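(* There is a RAM (random access machine) algorithm which, given as input a weakly $C(4)$ finite presentation $\langle \mathscr{A} \mid \mathscr{R} \rangle$ and two words $u, v \in \mathscr{A}^*$, decides whether $u$ and $v$ represent the same element of the semigroup (or monoid) presented in time $$O\left( |\mathscr{R}|^2 \min(|u|,|v|) \right).$$
   Context: A finite presentation $\langle \mathscr{A} \mid \mathscr{R} \rangle$ consists of a finite alphabet $\mathscr{A}$ and a finite set $\mathscr{R}$ of relations, which are pairs of words over $\mathscr{A}$. A relation word is a word which occurs as one side of a relation in the presentation. A piece is a word which occurs as a factor of two distinct relation words, or in two different (possibly overlapping) places within one relation word; by convention the empty word is always a piece. The presentation is weakly $C(n)$, for a positive integer $n$, if no relation word can be written as a product of strictly fewer than $n$ pieces. Here $|u|$ is the length of the word $u$, and $|\mathscr{R}|$ denotes the sum of the lengths of the relation words. The RAM has unit-cost operations, with each generator stored in a single register. The constant in the $O(\cdot)$ is absolute (the presentation is part of the input); as usual the bound is understood for non-degenerate input sizes, i.e. $|\mathscr{R}|, |u|, |v| \geq 1$. *)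

theory Defs
  imports Main
begin

section \<open>Finite presentations, pieces and weak small overlap conditions\<close>

definition finite_presentation :: "'a set \<Rightarrow> ('a list \<times> 'a list) set \<Rightarrow> bool" where
  "finite_presentation A R \<longleftrightarrow> finite A \<and> finite R \<and> R \<subseteq> lists A \<times> lists A"

definition relation_words :: "('a list \<times> 'a list) set \<Rightarrow> 'a list set" where
  "relation_words R = fst ` R \<union> snd ` R"

text \<open>Each relation word is counted once, even if it is a side of several relations.\<close>

definition relation_size :: "('a list \<times> 'a list) set \<Rightarrow> nat" where
  "relation_size R = (\<Sum>w\<in>relation_words R. length w)"

definition occurs_at :: "'a list \<Rightarrow> 'a list \<Rightarrow> nat \<Rightarrow> bool" where
  "occurs_at p w i \<longleftrightarrow> (\<exists>x y. w = x @ p @ y \<and> length x = i)"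

definition piece :: "('a list \<times> 'a list) set \<Rightarrow> 'a list \<Rightarrow> bool" where
  "piece R p \<longleftrightarrow> p = [] \<or>
     (\<exists>w1\<in>relation_words R. \<exists>w2\<in>relation_words R. w1 \<noteq> w2 \<and>
        (\<exists>i. occurs_at p w1 i) \<and> (\<exists>j. occurs_at p w2 j)) \<or>
     (\<exists>w\<in>relation_words R. \<exists>i j. i \<noteq> j \<and> occurs_at p w i \<and> occurs_at p w j)"

definition weakly_C :: "nat \<Rightarrow> ('a list \<times> 'a list) set \<Rightarrow> bool" where
  "weakly_C n R \<longleftrightarrow>
     (\<forall>w\<in>relation_words R. \<nexists>ps. length ps < n \<and> (\<forall>p\<in>set ps. piece R p) \<and> w = concat ps)"


section \<open>The presented monoid and semigroup\<close>

text \<open>The least congruence containing \<open>R\<close> on a set \<open>W\<close> of words closed under concatenation.\<close>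

inductive_set generated_congruence ::
    "'a list set \<Rightarrow> ('a list \<times> 'a list) set \<Rightarrow> ('a list \<times> 'a list) set"
  for W :: "'a list set" and R :: "('a list \<times> 'a list) set" where
  base: "(r, s) \<in> R \<Longrightarrow> (r, s) \<in> generated_congruence W R"
| refl: "w \<in> W \<Longrightarrow> (w, w) \<in> generated_congruence W R"
| sym: "(w, x) \<in> generated_congruence W R \<Longrightarrow> (x, w) \<in> generated_congruence W R"
| trans: "(w, x) \<in> generated_congruence W R \<Longrightarrow> (x, y) \<in> generated_congruence W R
    \<Longrightarrow> (w, y) \<in> generated_congruence W R"
| mult: "(w, x) \<in> generated_congruence W R \<Longrightarrow> (y, z) \<in> generated_congruence W R
    \<Longrightarrow> (w @ y, x @ z) \<in> generated_congruence W R"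

text \<open>The element represented by a word is its congruence class.\<close>

definition monoid_element :: "'a set \<Rightarrow> ('a list \<times> 'a list) set \<Rightarrow> 'a list \<Rightarrow> 'a list set" where
  "monoid_element A R w = generated_congruence (lists A) R `` {w}"

definition semigroup_element :: "'a set \<Rightarrow> ('a list \<times> 'a list) set \<Rightarrow> 'a list \<Rightarrow> 'a list set" where
  "semigroup_element A R w = generated_congruence (lists A - {[]}) R `` {w}"


section \<open>Unit-cost random access machines\<close>

text \<open>
  Registers are indexed by, and hold, natural numbers. The only arithmetic is addition and
  (truncated) subtraction; there is no unit-cost multiplication.
\<close>

datatype instr =
    Const nat nat
  | Add nat nat nat
  | Sub nat nat nat
  | Load nat nat
  | Store nat nat
  | Jump nat
  | JumpZero nat nat

type_synonym ram_state = "nat \<times> (nat \<Rightarrow> nat)"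

fun exec :: "instr \<Rightarrow> ram_state \<Rightarrow> ram_state" where
  "exec (Const i n) (pc, m) = (Suc pc, m(i := n))"
| "exec (Add i j k) (pc, m) = (Suc pc, m(i := m j + m k))"
| "exec (Sub i j k) (pc, m) = (Suc pc, m(i := m j - m k))"
| "exec (Load i j) (pc, m) = (Suc pc, m(i := m (m j)))"
| "exec (Store i j) (pc, m) = (Suc pc, m(m i := m j))"
| "exec (Jump l) (pc, m) = (l, m)"
| "exec (JumpZero i l) (pc, m) = (if m i = 0 then l else Suc pc, m)"

text \<open>A program halts when the program counter leaves the code; a halted state is a fixed point.\<close>

definition ram_step :: "instr list \<Rightarrow> ram_state \<Rightarrow> ram_state" where
  "ram_step P s = (if fst s < length P then exec (P ! fst s) s else s)"

text \<open>
  A machine consists of its code and the number of registers it reserves as working registers.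
  The input is stored in the registers directly after the reserved ones; all other registers
  are initially zero.
\<close>

record ram =
  reserved :: nat
  code :: "instr list"

definition initial_memory :: "nat \<Rightarrow> nat list \<Rightarrow> nat \<Rightarrow> nat" where
  "initial_memory b xs i = (if b \<le> i \<and> i < b + length xs then xs ! (i - b) else 0)"

text \<open>On input \<open>xs\<close>, after at most \<open>t\<close> instructions, \<open>M\<close> has halted with \<open>out\<close> in register 0.\<close>

definition ram_outputs_within :: "ram \<Rightarrow> nat list \<Rightarrow> nat \<Rightarrow> nat \<Rightarrow> bool" where
  "ram_outputs_within M xs t out \<longleftrightarrow>
     (let s = (ram_step (code M) ^^ t) (0, initial_memory (reserved M) xs)
      in length (code M) \<le> fst s \<and> snd s 0 = out)"


section \<open>Input format\<close>

text \<open>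
  Generators are natural numbers, each occupying one register. The alphabet and the set of
  relations are given by repetition-free lists \<open>gs\<close> and \<open>rs\<close>.
  All lengths, hence the addresses of \<open>u\<close>, \<open>v\<close> and the relations, are available from a header
  of four registers, so that a machine need not read either word in full.
\<close>

definition encode_word :: "nat list \<Rightarrow> nat list" where
  "encode_word w = length w # w"

definition encode_input ::
    "nat list \<Rightarrow> (nat list \<times> nat list) list \<Rightarrow> nat list \<Rightarrow> nat list \<Rightarrow> nat list" where
  "encode_input gs rs u v =
     [length gs, length rs, length u, length v] @ u @ v @
     concat (map (\<lambda>(r, s). encode_word r @ encode_word s) rs) @ gs"

end

(*
A relation word w factors as B w @ Z w, where Z w is its longest suffix that is a piece. By C(4),
B w is not a product of two pieces, so an occurrence of B w in a word (a head) determines w. A site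
is a head that no later head overlaps. Rewriting never changes the letters before the first site and
never destroys it: every word equivalent to w @ B S @ t is of the form w @ B Q @ t', where Q lies in the
class of S under the relations, and the pairs (S, t) and (Q, t') are linked by rewriting t and by exchanging
Z P for Z P' together with P for P'. Such an exchange influences the word behind it only through
a piece z, a suffix of some Z P, which may complete a new head. This reduces the equivalence of two words
with a common first site to that of two shorter words, each an unread part of an input word preceded
by at most one piece, together with a piece that has to be a possible prefix of both.

Let L be the size of the presentation. Away from sites the comparison costs O(L) per letter. At a site it
costs O(L^2), which is paid for by a letter of each input word read for the first time, since a piece is
shorter than a head. As both words are consumed simultaneously, the length of the shorter one counts.
Beforehand the relation words are collected without repetition in a trie, their classes are found by
relabelling, and the numbers |B w| by comparing all pairs of relation words; all this takes O(L^2).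
*)

theory Submission
  imports Defs "HOL-Library.Sublist"
begin

section \<open>Pieces, heads and sites\<close>

text \<open>The obstacle is that the tails at a site are compared up to \<open>apx\<close>, a
  transitive closure that ranges over all words of a class. It collapses because of
  \<open>act_unique\<close>: the piece that completes a head in front of a given tail is determined
  by that tail, since otherwise the head would be a product of two pieces. Consecutive links of a
  chain therefore use the same piece, and the closure amounts to one equivalence of words. A piece
  can also be hidden in both words at once; hence the loop decides \<open>WP\<close>, equivalence
  together with a possible prefix, and not equivalence alone.

  The size of the presentation counts every relation word once, whereas relations are pairs of
  relation words. The input may thus be quadratically long in L, and comparing each side of each
  relation with all collected words would be too slow; a trie finds a word in time proportional to
  its own length. Likewise classes are relabelled only if their labels differ, which happens at most
  as often as there are relation words.\<close>

definition occ :: "'a list \<Rightarrow> 'a list \<Rightarrow> nat \<Rightarrow> bool" where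
  "occ p u k \<longleftrightarrow> k + length p \<le> length u \<and> (\<forall>x<length p. u ! (k + x) = p ! x)"

lemma occ_append: "occ p (a @ p @ b) (length a)"
  by (auto simp: occ_def nth_append)

lemma occD: assumes "occ p u k" shows "u = take k u @ p @ drop (k + length p) u"
proof -
  have "take (length p) (drop k u) = p"
    using assms by (auto simp: occ_def intro!: nth_equalityI)
  then show ?thesis
    by (metis append_take_drop_id drop_drop add.commute)
qed

text \<open>The notion is that of \<open>occurs_at\<close>; the pointwise form turns overlaps of
  occurrences into index arithmetic.\<close>

lemma occ_iff: "occ p u k \<longleftrightarrow> (\<exists>a b. u = a @ p @ b \<and> length a = k)"
proof
  assume o: "occ p u k"
  then have "length (take k u) = k" by (auto simp: occ_def)
  with occD[OF o] show "\<exists>a b. u = a @ p @ b \<and> length a = k" by blast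
qed (auto simp: occ_append)

lemma occ_drop: "occ p (drop j u) k \<Longrightarrow> j \<le> length u \<Longrightarrow> occ p u (j + k)"
  by (auto simp: occ_def add.assoc)

lemma occ_drop': "occ p u (j + k) \<Longrightarrow> occ p (drop j u) k"
  by (auto simp: occ_def add.assoc)

lemma occ_0: "occ p u 0 \<longleftrightarrow> prefix p u"
  by (auto simp: occ_iff prefix_def)

locale C4_presentation =
  fixes R :: "('a list \<times> 'a list) set"
  assumes C4: "weakly_C 4 R"
begin

abbreviation "RW \<equiv> relation_words R"

definition zlen :: "'a list \<Rightarrow> nat" where
  "zlen w = Max {n. n \<le> length w \<and> piece R (drop (length w - n) w)}"

definition bl :: "'a list \<Rightarrow> nat" where "bl w = length w - zlen w"
definition B :: "'a list \<Rightarrow> 'a list" where "B w = take (bl w) w"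
definition Z :: "'a list \<Rightarrow> 'a list" where "Z w = drop (bl w) w"

lemma B_Z: "B w @ Z w = w" by (simp add: B_def Z_def)
lemma bl_le: "bl w \<le> length w" by (simp add: bl_def)
lemma length_B [simp]: "length (B w) = bl w" by (simp add: B_def bl_le)
lemma B_nth [simp]: "x < bl w \<Longrightarrow> B w ! x = w ! x" by (simp add: B_def)

lemma piece_Nil [simp]: "piece R []" by (simp add: piece_def)

lemma zlen_in: "zlen w \<le> length w \<and> piece R (drop (length w - zlen w) w)"
proof -
  have "0 \<in> {n. n \<le> length w \<and> piece R (drop (length w - n) w)}" by simp
  moreover have "finite {n. n \<le> length w \<and> piece R (drop (length w - n) w)}" by simp
  ultimately show ?thesis unfolding zlen_def using Max_in[of "{n. n \<le> length w \<and> piece R (drop (length w - n) w)}"] by blast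
qed


lemma piece_Z: "piece R (Z w)" using zlen_in[of w] by (simp add: Z_def bl_def)

lemma length_Z: "length (Z w) = zlen w" using zlen_in[of w] by (simp add: Z_def bl_def)

text \<open>Maximality of \<open>Z w\<close> as a lower bound on starting positions, the shape in
  which overlap arguments contradict it.\<close>

lemma suffix_piece:
  assumes "i \<le> length w" "piece R (drop i w)" shows "bl w \<le> i"
proof -
  have "length w - i \<le> zlen w"
    unfolding zlen_def using assms by (intro Max_ge) auto
  then show ?thesis by (simp add: bl_def)
qed

lemma occurs_at_factor: "occurs_at p w i \<Longrightarrow> p = a @ q @ b \<Longrightarrow> occurs_at q w (i + length a)"
  unfolding occurs_at_def by (elim exE conjE, rule_tac x = "x @ a" in exI) auto

lemma piece_factor: assumes "piece R p" "p = a @ q @ b" shows "piece R q"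
  using assms(1) unfolding piece_def
proof (elim disjE)
  assume "p = []" then show "q = [] \<or> (\<exists>w1\<in>RW. \<exists>w2\<in>RW. w1 \<noteq> w2 \<and> (\<exists>i. occurs_at q w1 i) \<and> (\<exists>j. occurs_at q w2 j)) \<or>
     (\<exists>w\<in>RW. \<exists>i j. i \<noteq> j \<and> occurs_at q w i \<and> occurs_at q w j)" using assms by simp
next
  assume "\<exists>w1\<in>RW. \<exists>w2\<in>RW. w1 \<noteq> w2 \<and> (\<exists>i. occurs_at p w1 i) \<and> (\<exists>j. occurs_at p w2 j)"
  then show "q = [] \<or> (\<exists>w1\<in>RW. \<exists>w2\<in>RW. w1 \<noteq> w2 \<and> (\<exists>i. occurs_at q w1 i) \<and> (\<exists>j. occurs_at q w2 j)) \<or>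
     (\<exists>w\<in>RW. \<exists>i j. i \<noteq> j \<and> occurs_at q w i \<and> occurs_at q w j)" using occurs_at_factor[OF _ assms(2)] by meson
next
  assume "\<exists>w\<in>RW. \<exists>i j. i \<noteq> j \<and> occurs_at p w i \<and> occurs_at p w j"
  then obtain w i j where w: "w \<in> RW" and "i \<noteq> j" "occurs_at p w i" "occurs_at p w j" by blast
  then have "i + length a \<noteq> j + length a" "occurs_at q w (i + length a)" "occurs_at q w (j + length a)"
    using occurs_at_factor[OF _ assms(2)] by auto
  with w show "q = [] \<or> (\<exists>w1\<in>RW. \<exists>w2\<in>RW. w1 \<noteq> w2 \<and> (\<exists>i. occurs_at q w1 i) \<and> (\<exists>j. occurs_at q w2 j)) \<or>
     (\<exists>w\<in>RW. \<exists>i j. i \<noteq> j \<and> occurs_at q w i \<and> occurs_at q w j)" by blast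
qed

lemma piece_prefix: "piece R p \<Longrightarrow> prefix q p \<Longrightarrow> piece R q"
  using piece_factor[of p "[]" q] by (auto simp: prefix_def)

lemma piece_suffix: "piece R p \<Longrightarrow> suffix q p \<Longrightarrow> piece R q"
  using piece_factor[of p _ q "[]"] by (auto simp: suffix_def)

text \<open>The source of all pieces in overlap arguments: an interval of one relation word is read
  again elsewhere.\<close>

lemma piece_if_two_occurrences:
  assumes "S \<in> RW" "S' \<in> RW" "i + l \<le> length S" "j + l \<le> length S'" "S \<noteq> S' \<or> i \<noteq> j"
    and eq: "\<And>x. x < l \<Longrightarrow> S ! (i + x) = S' ! (j + x)"
  shows "piece R (take l (drop i S))"
proof -
  have "take l (drop i S) = take l (drop j S')"
    using assms by (auto intro!: nth_equalityI)
  moreover have "occurs_at (take l (drop i S)) S i"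
    unfolding occurs_at_def using assms(3)
    by (intro exI[of _ "take i S"] exI[of _ "drop l (drop i S)"]) (simp del: drop_drop)
  moreover have "occurs_at (take l (drop j S')) S' j"
    unfolding occurs_at_def using assms(4)
    by (intro exI[of _ "take j S'"] exI[of _ "drop l (drop j S')"]) (simp del: drop_drop)
  ultimately show ?thesis unfolding piece_def using assms(1,2,5) by metis
qed

text \<open>Followed by the piece \<open>Z S\<close>, two pieces for \<open>B S\<close> would write
  \<open>S\<close> as a product of three. This is the only place where C(4) itself is used.\<close>

lemma B_not_two_pieces:
  assumes "S \<in> RW" "k \<le> bl S" "piece R (take k S)" "piece R (take (bl S - k) (drop k S))"
  shows False
proof -
  have "S = concat [take k S, take (bl S - k) (drop k S), Z S]"
    using assms(2) take_add[of k "bl S - k" S] append_take_drop_id[of "bl S" S] by (simp add: Z_def del: append_take_drop_id)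
  moreover have "\<forall>p\<in>set [take k S, take (bl S - k) (drop k S), Z S]. piece R p"
    using assms piece_Z by simp
  moreover have "length [take k S, take (bl S - k) (drop k S), Z S] < 4" by simp
  ultimately show False using C4 assms(1) unfolding weakly_C_def by metis
qed

lemma B_not_piece: "S \<in> RW \<Longrightarrow> \<not> piece R (B S)"
  using B_not_two_pieces[of S "bl S"] by (auto simp: B_def)

lemma bl_pos: "S \<in> RW \<Longrightarrow> 0 < bl S"
  using B_not_piece[of S] by (cases "bl S") (auto simp: B_def)

text \<open>An end of \<open>S\<close> that is read again elsewhere is a piece, so it cannot start
  inside \<open>B S\<close>. Together with \<open>B_two_occurrences\<close> this settles most
  overlaps; only a head covered by two pieces needs \<open>B_not_two_pieces\<close>.\<close>

lemma suffix_two_occurrences: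
  assumes "S \<in> RW" "S' \<in> RW" "i + l = length S" "j + l \<le> length S'" "S \<noteq> S' \<or> i \<noteq> j"
    and eq: "\<And>x. x < l \<Longrightarrow> S ! (i + x) = S' ! (j + x)"
  shows "bl S \<le> i"
proof -
  have "piece R (take l (drop i S))"
    by (rule piece_if_two_occurrences[of _ S' i l j]) (use assms in auto)
  then show ?thesis using assms(3) by (intro suffix_piece) auto
qed

lemma B_two_occurrences:
  assumes "S \<in> RW" "S' \<in> RW" "j + bl S \<le> length S'" "S \<noteq> S' \<or> j \<noteq> 0"
    and eq: "\<And>x. x < bl S \<Longrightarrow> S ! x = S' ! (j + x)"
  shows False
proof -
  have "piece R (take (bl S) (drop 0 S))"
    by (rule piece_if_two_occurrences[of _ S' 0 _ j]) (use assms bl_le in auto)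
  then show ?thesis using B_not_piece[OF assms(1)] by (simp add: B_def)
qed

section \<open>Heads and sites\<close>

definition head :: "'a list \<Rightarrow> 'a list \<Rightarrow> nat \<Rightarrow> bool" where
  "head S u k \<longleftrightarrow> S \<in> RW \<and> occ (B S) u k"

lemma headD: "head S u k \<Longrightarrow> S \<in> RW" "head S u k \<Longrightarrow> k + bl S \<le> length u"
  "head S u k \<Longrightarrow> x < bl S \<Longrightarrow> u ! (k + x) = S ! x"
  by (auto simp: head_def occ_def)

lemma headI: "S \<in> RW \<Longrightarrow> k + bl S \<le> length u \<Longrightarrow> (\<And>x. x < bl S \<Longrightarrow> u ! (k + x) = S ! x) \<Longrightarrow> head S u k"
  by (auto simp: head_def occ_def)

lemma head_less: assumes "head S u k" shows "k < length u"
  using headD(2)[OF assms] bl_pos[OF headD(1)[OF assms]] by linarith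

text \<open>The shorter of two heads at the same position would occur a second time, at the
  beginning of the other relation word.\<close>

lemma head_unique: assumes "head S u k" "head S' u k" shows "S = S'"
proof -
  have "S = S'" if h: "head S u k" "head S' u k" "bl S \<le> bl S'" for S S'
  proof (rule ccontr)
    assume n: "S \<noteq> S'"
    show False
    proof (rule B_two_occurrences[of S S' 0])
      fix x assume x: "x < bl S"
      show "S ! x = S' ! (0 + x)"
        using headD(3)[OF h(1) x] headD(3)[OF h(2), of x] x h(3) by simp
    qed (use n headD(1)[OF h(1)] headD(1)[OF h(2)] h(3) bl_le[of S'] in auto)
  qed
  then show ?thesis using assms by (metis nat_le_linear)
qed

text \<open>For \<open>Q\<close> in \<open>RW\<close> this says that position 0 of
  \<open>B Q @ t\<close> is a site.\<close>

definition clean :: "'a list \<Rightarrow> 'a list \<Rightarrow> bool" where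
  "clean Q t \<longleftrightarrow> (\<forall>k S. 0 < k \<and> k < bl Q \<longrightarrow> \<not> head S (B Q @ t) k)"

definition site :: "'a list \<Rightarrow> nat \<Rightarrow> bool" where
  "site u k \<longleftrightarrow> (\<exists>S. head S u k \<and> \<not> (\<exists>k' S'. k < k' \<and> k' < k + bl S \<and> head S' u k'))"

definition first_site :: "'a list \<Rightarrow> 'a list \<Rightarrow> 'a list \<Rightarrow> 'a list \<Rightarrow> bool" where
  "first_site u w S t \<longleftrightarrow> S \<in> RW \<and> u = w @ B S @ t \<and> clean S t \<and> (\<forall>k<length w. \<not> site u k)"

text \<open>The last head of a word is overlapped by no later one, so a word with a head has a
  site.\<close>

lemma first_site_exists:
  assumes "head S u k" shows "\<exists>w S t. first_site u w S t"
proof -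
  define H where "H = {k. \<exists>S. head S u k}"
  have fin: "finite H" unfolding H_def by (rule finite_subset[of _ "{..<length u}"]) (auto dest: head_less)
  have "Max H \<in> H" using assms fin by (intro Max_in) (auto simp: H_def)
  then obtain T where T: "head T u (Max H)" unfolding H_def by blast
  have "k' \<le> Max H" if "head S' u k'" for k' S'
    by (rule Max_ge[OF fin]) (use that in \<open>auto simp: H_def\<close>)
  then have ex: "site u (Max H)" unfolding site_def using T leD by blast
  define l where "l = (LEAST l. site u l)"
  have l: "site u l" using ex unfolding l_def by (rule LeastI)
  have least: "\<And>k. k < l \<Longrightarrow> \<not> site u k" unfolding l_def by (rule not_less_Least)
  obtain S where S: "head S u l" and cl: "\<And>k' S'. l < k' \<Longrightarrow> k' < l + bl S \<Longrightarrow> \<not> head S' u k'"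
    using l unfolding site_def by auto
  define w t where "w = take l u" and "t = drop (l + bl S) u"
  have u: "u = w @ B S @ t" using occD S unfolding head_def w_def t_def by fastforce
  have lw: "length w = l" using head_less[OF S] by (simp add: w_def)
  have "clean S t" unfolding clean_def
  proof (intro allI impI notI)
    fix k S' assume k: "0 < k \<and> k < bl S" and h: "head S' (B S @ t) k"
    have "drop l u = B S @ t" using u lw by auto
    then have "head S' u (l + k)" using h head_less[OF S] occ_drop[of _ l u k] unfolding head_def by simp
    then show False using cl k by simp
  qed
  then have "first_site u w S t" using u lw least headD(1)[OF S] unfolding first_site_def by auto
  then show ?thesis by blast
qed

text \<open>A full relation word may reach into a later head with its part \<open>Z S\<close> only.
  If \<open>B S\<close> reached into \<open>B Q\<close>, then either \<open>B Q\<close> would lie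
  inside \<open>S\<close>, or an end of \<open>S\<close> starting inside \<open>B S\<close> would
  also begin \<open>Q\<close> and be a piece longer than \<open>Z S\<close>.\<close>

lemma overlap_to_right:
  assumes "S \<in> RW" "Q \<in> RW" "occ S (x @ B Q @ y) k" "k < length x"
  shows "k + bl S \<le> length x"
proof (rule ccontr)
  assume n: "\<not> k + bl S \<le> length x"
  let ?u = "x @ B Q @ y"
  have S: "\<And>i. i < length S \<Longrightarrow> ?u ! (k + i) = S ! i" "k + length S \<le> length ?u"
    using assms(3) unfolding occ_def by auto
  have Q: "\<And>i. i < bl Q \<Longrightarrow> ?u ! (length x + i) = Q ! i" by (simp add: nth_append)
  have eq: "Q ! i = S ! (length x - k + i)" if "i < bl Q" "length x - k + i < length S" for i
    using S(1)[OF that(2)] Q[OF that(1)] assms(4) by simp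
  show False
  proof (cases "length x + bl Q \<le> k + length S")
    case True
    then show False
      using assms eq by (intro B_two_occurrences[of Q S "length x - k"]) auto
  next
    case False
    have "bl S \<le> length x - k"
      by (rule suffix_two_occurrences[of S Q _ "k + length S - length x" 0])
        (use assms n False eq bl_le[of S] bl_le[of Q] in auto)
    then show False using n assms(4) by linarith
  qed
qed

text \<open>No rewriting takes place before the first site. By \<open>overlap_to_right\<close> the
  head of \<open>S\<close> lies in the unchanged part \<open>w\<close>, so it is a head of
  \<open>u\<close> as well; as it is no site of \<open>u\<close>, some head \<open>B S'\<close> of
  \<open>u\<close> overlaps it, and there is no room for \<open>B S'\<close> between
  \<open>S\<close> and \<open>P\<close>.\<close>

lemma no_word_before_first_site:
  assumes fs: "first_site u w P t" and S: "S \<in> RW" and Q: "Q \<in> RW"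
    and o: "occ S (w @ B Q @ t') k" and k: "k < length w"
  shows False
proof -
  let ?v = "w @ B Q @ t'"
  have P: "P \<in> RW" and u: "u = w @ B P @ t" and ns: "\<And>k. k < length w \<Longrightarrow> \<not> site u k"
    using fs unfolding first_site_def by auto
  have kb: "k + bl S \<le> length w" using overlap_to_right[OF S Q o k] .
  have Sv: "\<And>i. i < length S \<Longrightarrow> ?v ! (k + i) = S ! i" using o unfolding occ_def by auto
  have Su: "u ! (k + i) = S ! i" if "i < length S" "k + i < length w" for i
    using Sv[OF that(1)] that(2) u by (simp add: nth_append)
  have "head S u k" by (rule headI) (use S kb u Su bl_le[of S] in auto)
  then obtain k' S' where k': "k < k'" "k' < k + bl S" and h': "head S' u k'"
    using ns[OF k] unfolding site_def by blast
  note S' = headD(1)[OF h'] and u' = headD(3)[OF h']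
  have eq: "S' ! x = S ! (k' - k + x)" if "x < bl S'" "k' - k + x < length S" "k' + x < length w" for x
    using u'[OF that(1)] Su[of "k' - k + x"] that k' by simp
  show False
  proof (cases "k' + bl S' \<le> k + length S \<and> k' + bl S' \<le> length w")
    case True
    then show False using S S' eq k' by (intro B_two_occurrences[of S' S "k' - k"]) auto
  next
    case F: False
    show False
    proof (cases "k + length S \<le> length w")
      case True
      then have "bl S \<le> k' - k"
        using F k' S S' eq bl_le[of S] bl_le[of S']
        by (intro suffix_two_occurrences[of S S' _ "k + length S - k'" 0]) auto
      then show False using k' by linarith
    next
      case False
      then have e: "length w < k' + bl S'" using F by linarith
      \<comment> \<open>Here \<open>B S'\<close> crosses the end of \<open>w\<close>: its letters
        before that point are shared with \<open>S\<close>, those behind it with \<open>P\<close>.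
        Unless \<open>B P\<close> lies inside \<open>S'\<close>, this makes \<open>B S'\<close> a
        product of two pieces.\<close>
      have p1: "piece R (take (length w - k') (drop 0 S'))"
        by (rule piece_if_two_occurrences[of _ S _ _ "k' - k"])
          (use S S' e False eq k' kb bl_le[of S'] in auto)
      have eq2: "P ! x = S' ! (length w - k' + x)" if "x < bl P" "length w - k' + x < bl S'" for x
        using u'[OF that(2)] that k' kb u by (simp add: nth_append)
      show False
      proof (cases "k' + bl S' \<le> length w + bl P")
        case True
        have "piece R (take (bl S' - (length w - k')) (drop (length w - k') S'))"
          by (rule piece_if_two_occurrences[of _ P _ _ 0])
            (use S' P e eq2 k' kb True bl_le[of S'] bl_le[of P] in auto)
        then show False using p1 e k' kb by (intro B_not_two_pieces[OF S', of "length w - k'"]) auto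
      next
        case False
        show False
          by (rule B_two_occurrences[of P S' "length w - k'"])
            (use S' P e eq2 k' kb False bl_le[of S'] in auto)
      qed
    qed
  qed
qed

section \<open>Rewriting steps and their effect on the first site\<close>

definition rel :: "'a list \<Rightarrow> 'a list \<Rightarrow> bool" where
  "rel r s \<longleftrightarrow> (r, s) \<in> R \<or> (s, r) \<in> R"

definition step :: "'a list \<Rightarrow> 'a list \<Rightarrow> bool" where
  "step u v \<longleftrightarrow> (\<exists>a r s b. rel r s \<and> u = a @ r @ b \<and> v = a @ s @ b)"

abbreviation "eqv \<equiv> step\<^sup>*\<^sup>*"
abbreviation "cls \<equiv> rel\<^sup>*\<^sup>*"

lemma rel_RW: "rel r s \<Longrightarrow> r \<in> RW \<and> s \<in> RW"
  by (force simp: rel_def relation_words_def image_iff)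

text \<open>
  In a pair \<open>(Q, t)\<close> the first site of a word is filled by \<open>B Q\<close> and followed by \<open>t\<close>. It can only be
  rewritten as a full relation word.
\<close>

inductive sys :: "'a list \<times> 'a list \<Rightarrow> 'a list \<times> 'a list \<Rightarrow> bool" where
  tail: "step t t' \<Longrightarrow> sys (Q, t) (Q, t')"
| switch: "rel Q Q' \<Longrightarrow> sys (Q, Z Q @ t) (Q', Z Q' @ t)"

text \<open>A full relation word turns its head into a site: a head starting inside
  \<open>B Q\<close> would either lie in \<open>Q\<close>, or share with \<open>Q\<close> an end
  longer than \<open>Z Q\<close>.\<close>

lemma clean_full: assumes "Q \<in> RW" shows "clean Q (Z Q @ t)"
  unfolding clean_def
proof (intro allI impI notI)
  fix k S assume k: "0 < k \<and> k < bl Q" and h: "head S (B Q @ Z Q @ t) k"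
  have u: "B Q @ Z Q @ t = Q @ t" using B_Z[of Q] by (metis append.assoc)
  note S = headD(1)[OF h]
  have eq: "S ! x = Q ! (k + x)" if "x < bl S" "k + x < length Q" for x
    using headD(3)[OF h that(1)] that u by (simp add: nth_append)
  show False
  proof (cases "k + bl S \<le> length Q")
    case True
    then show False using S assms eq k by (intro B_two_occurrences[of S Q k]) auto
  next
    case False
    have "bl Q \<le> k"
      by (rule suffix_two_occurrences[of Q S _ "length Q - k" 0])
        (use S assms eq k False bl_le[of Q] bl_le[of S] in auto)
    then show False using k by simp
  qed
qed

lemma step_head: assumes "step u v" shows "\<exists>S k. head S u k"
proof -
  obtain a r s b where r: "rel r s" "u = a @ r @ b" using assms unfolding step_def by blast
  have "r \<in> RW" using rel_RW r by blast
  then have "head r u (length a)" unfolding r(2)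
    by (intro headI) (use bl_le[of r] in \<open>auto simp: nth_append\<close>)
  then show ?thesis by blast
qed

text \<open>Rewriting the tail may spoil \<open>clean\<close> by creating heads, but it creates no
  full relation word that starts inside \<open>B Q\<close>. The letters of the tail before its first
  site stay fixed, and \<open>B S\<close> ends before that site by \<open>overlap_to_right\<close>;
  so \<open>B S\<close> would have been a head already in \<open>B Q @ t1\<close>. The assumption
  \<open>IH\<close> is what the strong induction of \<open>first_site_steps\<close> supplies for the
  m steps in the tail.\<close>

lemma no_word_after_clean:
  assumes IH: "\<And>u w S t v. first_site u w S t \<Longrightarrow> (step ^^ m) u v \<Longrightarrow> \<exists>Q t'. Q \<in> RW \<and> v = w @ B Q @ t'"
    and cl: "clean Q t1" and Q: "Q \<in> RW" and st: "(step ^^ m) t1 t'" and S: "S \<in> RW"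
    and o: "occ S (B Q @ t') k" and k: "0 < k" "k < bl Q"
  shows False
proof -
  have Sv: "\<And>i. i < length S \<Longrightarrow> (B Q @ t') ! (k + i) = S ! i" "k + length S \<le> bl Q + length t'"
    using o unfolding occ_def by auto
  show False
  proof (cases "\<exists>S k. head S t1 k")
    case False
    then have "t' = t1" using st step_head by (metis relpowp_E2)
    then have "head S (B Q @ t1) k" by (intro headI) (use S Sv bl_le[of S] in auto)
    then show False using cl k unfolding clean_def by blast
  next
    case True
    then obtain w S' t where fs: "first_site t1 w S' t" using first_site_exists by blast
    then obtain P t2 where P: "P \<in> RW" "t' = w @ B P @ t2" using IH st by blast
    have t1: "t1 = w @ B S' @ t" using fs unfolding first_site_def by simp
    have "occ S ((B Q @ w) @ B P @ t2) k" using o P by simp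
    then have kb: "k + bl S \<le> bl Q + length w"
      using overlap_to_right[OF S P(1), of "B Q @ w" t2 k] k by simp
    have "head S (B Q @ t1) k"
    proof (rule headI)
      fix x assume x: "x < bl S"
      then have "((B Q @ w) @ B S' @ t) ! (k + x) = ((B Q @ w) @ B P @ t2) ! (k + x)"
        using kb nth_append_left[of "k + x" "B Q @ w"] by simp
      then have "(B Q @ t1) ! (k + x) = (B Q @ t') ! (k + x)" using t1 P(2) by simp
      then show "(B Q @ t1) ! (k + x) = S ! x" using Sv(1)[of x] x bl_le[of S] by simp
    qed (use S kb t1 in auto)
    then show False using cl k unfolding clean_def by blast
  qed
qed

text \<open>The current tail \<open>t'\<close> need not be clean, since rewriting may create heads
  that overlap \<open>B Q\<close>. The invariant therefore remembers a clean tail \<open>t1\<close>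
  from which \<open>t'\<close> has been reached, and bounds the number m of these steps by n, so
  that the induction hypothesis is available for \<open>t1\<close>.\<close>

lemma first_site_steps:
  "(step ^^ n) u v \<Longrightarrow> first_site u w S t \<Longrightarrow>
    \<exists>Q t' t1 m. Q \<in> RW \<and> v = w @ B Q @ t' \<and> sys\<^sup>*\<^sup>* (S, t) (Q, t') \<and> clean Q t1 \<and> m \<le> n \<and> (step ^^ m) t1 t'"
proof (induction n arbitrary: u v w S t rule: less_induct)
  case (less n)
  show ?case
  proof (cases n)
    case 0
    then have "u = v" using less.prems by simp
    with less.prems(2) 0 show ?thesis unfolding first_site_def
      by (intro exI[of _ S] exI[of _ t] exI[of _ t] exI[of _ 0]) auto
  next
    case (Suc n')
    then obtain x where x: "(step ^^ n') u x" "step x v" using less.prems(1) by auto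
    obtain Q t' t1 m where Q: "Q \<in> RW" and xe: "x = w @ B Q @ t'" and s: "sys\<^sup>*\<^sup>* (S, t) (Q, t')"
      and cl: "clean Q t1" and m: "m \<le> n'" "(step ^^ m) t1 t'"
      using less.IH[OF _ x(1) less.prems(2)] Suc by auto
    obtain a p q b where pq: "rel p q" and xa: "x = a @ p @ b" and va: "v = a @ q @ b"
      using x(2) unfolding step_def by blast
    have p: "p \<in> RW" and q: "q \<in> RW" using rel_RW[OF pq] by auto
    have o: "occ p (w @ B Q @ t') (length a)" using xa xe occ_append by metis
    have a1: "length w \<le> length a"
      using no_word_before_first_site[OF less.prems(2) p Q o] by (meson not_le)
    define k where "k = length a - length w"
    have ok: "occ p (B Q @ t') k" using o a1 unfolding k_def occ_def by (auto simp: nth_append)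
    have "\<not> (0 < k \<and> k < bl Q)"
      using no_word_after_clean[of m, OF _ cl Q m(2) p ok] less.IH[of m] m(1) Suc by (metis le_imp_less_Suc)
    then consider "k = 0" | "bl Q \<le> k" by linarith
    then show ?thesis
    proof cases
      case 1
      have "head p (B Q @ t') 0" "head Q (B Q @ t') 0"
        using ok 1 p Q bl_le[of p] by (auto intro!: headI simp: occ_def nth_append)
      then have pQ: "p = Q" using head_unique by blast
      have "a = w" using 1 a1 xa xe unfolding k_def by (metis append_eq_append_conv diff_is_0_eq le_antisym)
      then have "t' = Z Q @ b" using xa xe pQ B_Z[of Q] by (metis append.assoc append_same_eq same_append_eq)
      then have "sys (Q, t') (q, Z q @ b)" using switch[of Q q b] pq pQ by simp
      moreover have "v = w @ B q @ Z q @ b" using va \<open>a = w\<close> B_Z[of q] by (metis append.assoc)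
      \<comment> \<open>After a switch the tail starts with \<open>Z q\<close>. It is then its own
        clean witness, and the count of tail steps starts again at 0.\<close>
      ultimately show ?thesis using s clean_full[OF q] q
        by (intro exI[of _ q] exI[of _ "Z q @ b"] exI[of _ "Z q @ b"] exI[of _ 0]) auto
    next
      case 2
      have "length (w @ B Q) \<le> length a" using 2 a1 unfolding k_def by simp
      moreover have "(w @ B Q) @ t' = a @ p @ b" using xa xe by simp
      ultimately obtain c where c: "a = (w @ B Q) @ c" "t' = c @ p @ b"
        using prefix_length_prefix[of "w @ B Q" "(w @ B Q) @ t'" a]
        by (metis append.assoc prefixI prefixE same_append_eq)
      have st: "step t' (c @ q @ b)" using c pq unfolding step_def by blast
      then have "(step ^^ Suc m) t1 (c @ q @ b)" using m(2) by auto
      moreover have "sys\<^sup>*\<^sup>* (S, t) (Q, c @ q @ b)" using s tail[OF st] by (rule rtranclp.rtrancl_into_rtrancl)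
      ultimately show ?thesis using Q va c cl m(1) Suc
        by (intro exI[of _ Q] exI[of _ "c @ q @ b"] exI[of _ t1] exI[of _ "Suc m"]) auto
    qed
  qed
qed

end

section \<open>Equivalence of words in terms of their first site\<close>

text \<open>Letters are counted from the end, the direction in which \<open>CSUF\<close>
  compares.\<close>

definition common_suffix :: "nat \<Rightarrow> 'b list \<Rightarrow> 'b list \<Rightarrow> bool" where
  "common_suffix c xs ys \<longleftrightarrow> c \<le> length xs \<and> c \<le> length ys \<and>
    (\<forall>x<c. xs ! (length xs - Suc x) = ys ! (length ys - Suc x))"

lemma common_suffix_drop:
  assumes "common_suffix c xs ys"
  shows "drop (length xs - c) xs = drop (length ys - c) ys"
proof (rule nth_equalityI)
  show "length (drop (length xs - c) xs) = length (drop (length ys - c) ys)"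
    using assms by (simp add: common_suffix_def)
  fix i assume i: "i < length (drop (length xs - c) xs)"
  have c: "c \<le> length xs" "c \<le> length ys" using assms by (auto simp: common_suffix_def)
  then have i': "i < c" using i by simp
  have "xs ! (length xs - Suc (c - Suc i)) = ys ! (length ys - Suc (c - Suc i))"
    using assms i' c unfolding common_suffix_def by (metis diff_Suc_less gr_implies_not0 neq0_conv)
  moreover have "length xs - Suc (c - Suc i) = length xs - c + i" "length ys - Suc (c - Suc i) = length ys - c + i"
    using c i' by auto
  ultimately show "drop (length xs - c) xs ! i = drop (length ys - c) ys ! i" using c by simp
qed

lemma common_suffixI:
  assumes "suffix p xs" "suffix p ys" shows "common_suffix (length p) xs ys"
  using assms by (auto simp: common_suffix_def suffix_def nth_append)

context C4_presentation begin

section \<open>Equivalence of words and the letters before the first site\<close>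

lemma rel_sym: "rel r s \<Longrightarrow> rel s r" by (auto simp: rel_def)

lemma cls_sym: "cls r s \<Longrightarrow> cls s r"
  by (induction rule: rtranclp_induct) (auto intro: converse_rtranclp_into_rtranclp rel_sym)

lemma cls_RW: "cls r s \<Longrightarrow> r \<in> RW \<Longrightarrow> s \<in> RW"
  by (induction rule: rtranclp_induct) (auto dest: rel_RW)

lemma step_context: assumes "step u v" shows "step (a @ u @ b) (a @ v @ b)"
proof -
  obtain c r s d where "rel r s" "u = c @ r @ d" "v = c @ s @ d" using assms unfolding step_def by blast
  then show ?thesis unfolding step_def
    by (intro exI[of _ "a @ c"] exI[of _ r] exI[of _ s] exI[of _ "d @ b"]) simp
qed

lemma step_sym: "step u v \<Longrightarrow> step v u" unfolding step_def using rel_sym by blast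

lemma eqv_sym: "eqv u v \<Longrightarrow> eqv v u"
  by (induction rule: rtranclp_induct) (auto intro: converse_rtranclp_into_rtranclp step_sym)

lemma eqv_trans: "eqv u v \<Longrightarrow> eqv v w \<Longrightarrow> eqv u w" by (rule rtranclp_trans)

lemma eqv_context: "eqv u v \<Longrightarrow> eqv (a @ u @ b) (a @ v @ b)"
  by (induction rule: rtranclp_induct) (auto intro: rtranclp.rtrancl_into_rtrancl step_context)

lemma eqv_left: "eqv u v \<Longrightarrow> eqv (a @ u) (a @ v)" using eqv_context[of u v a "[]"] by simp

lemma cls_eqv: "cls r s \<Longrightarrow> eqv (r @ b) (s @ b)"
proof (induction rule: rtranclp_induct)
  case (step y z)
  then have "step (y @ b) (z @ b)" unfolding step_def by (metis append_Nil)
  then show ?case using step.IH by auto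
qed simp

lemma sys_sym: "sys x y \<Longrightarrow> sys y x"
  by (induction rule: sys.induct) (auto intro: sys.intros step_sym rel_sym)

lemma sys_rtrancl_sym: "sys\<^sup>*\<^sup>* x y \<Longrightarrow> sys\<^sup>*\<^sup>* y x"
  by (induction rule: rtranclp_induct) (auto intro: converse_rtranclp_into_rtranclp sys_sym)

lemma sys_step: assumes "sys x y"
  shows "eqv (B (fst x) @ snd x) (B (fst y) @ snd y) \<and> cls (fst x) (fst y)"
  using assms
proof (cases rule: sys.cases)
  case (tail t t' Q)
  then show ?thesis using eqv_left[of t t' "B Q"] by auto
next
  case (switch Q Q' t)
  have "eqv ((B Q @ Z Q) @ t) ((B Q' @ Z Q') @ t)" unfolding B_Z using switch cls_eqv by blast
  then show ?thesis using switch by auto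
qed

lemma sys_eqv: "sys\<^sup>*\<^sup>* x y \<Longrightarrow> eqv (B (fst x) @ snd x) (B (fst y) @ snd y) \<and> cls (fst x) (fst y)"
  by (induction rule: rtranclp_induct) (use sys_step in \<open>auto intro: eqv_trans rtranclp_trans\<close>)

lemma first_site_eqv:
  assumes "first_site u w S t" "eqv u v"
  obtains Q t' where "Q \<in> RW" "v = w @ B Q @ t'" "sys\<^sup>*\<^sup>* (S, t) (Q, t')" "eqv (B S @ t) (B Q @ t')"
proof -
  obtain n where "(step ^^ n) u v" using assms(2) rtranclp_imp_relpowp by fast
  from first_site_steps[OF this assms(1)] obtain Q t' where
    *: "Q \<in> RW" "v = w @ B Q @ t'" "sys\<^sup>*\<^sup>* (S, t) (Q, t')" by blast
  show ?thesis by (rule that[OF *]) (use sys_eqv[OF *(3)] in simp)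
qed

lemma no_head_eqv: "\<nexists>S k. head S u k \<Longrightarrow> eqv u v \<Longrightarrow> v = u"
  using step_head by (metis converse_rtranclpE)

text \<open>The k letters precede the first site, and rewriting leaves those alone; a word without
  heads allows no step at all.\<close>

lemma eqv_drop:
  assumes ns: "\<And>j. j < k \<Longrightarrow> \<not> site u j" and k: "k \<le> length u" and e: "eqv u v"
  shows "k \<le> length v \<and> take k v = take k u \<and> eqv (drop k u) (drop k v)"
proof (cases "\<exists>S k. head S u k")
  case False
  then have "v = u" using no_head_eqv e by blast
  then show ?thesis using k by simp
next
  case True
  then obtain w S t where fs: "first_site u w S t" using first_site_exists by blast
  then obtain Q t' where v: "v = w @ B Q @ t'" and q: "eqv (B S @ t) (B Q @ t')"
    using first_site_eqv e by metis
  have u: "u = w @ B S @ t" using fs unfolding first_site_def by simp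
  \<comment> \<open>The position of a \<open>first_site\<close> is indeed a site in the sense of
    \<open>site\<close>, so it is not among the first k positions.\<close>
  have "site u (length w)"
    unfolding site_def
  proof (intro exI conjI notI)
    show "head S u (length w)" using fs unfolding first_site_def head_def using occ_append by blast
    assume "\<exists>k' S'. length w < k' \<and> k' < length w + bl S \<and> head S' u k'"
    then obtain k' S' where k': "length w < k'" "k' < length w + bl S" "head S' u k'" by blast
    then have "head S' (B S @ t) (k' - length w)"
      using occ_drop'[of _ u "length w" "k' - length w"] u unfolding head_def by simp
    moreover have "clean S t" using fs unfolding first_site_def by simp
    ultimately show False using k' unfolding clean_def by (metis less_diff_conv2 add.commute less_imp_le zero_less_diff)
  qed
  then have kw: "k \<le> length w" using ns by (meson not_le)
  have "eqv (drop k w @ B S @ t) (drop k w @ B Q @ t')" using q by (rule eqv_left)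
  then show ?thesis using kw u v by simp
qed

text \<open>
  Replacing \<open>B S\<close> by \<open>B Q\<close> at a site may presuppose that the remaining word can be rewritten so as to
  expose a piece \<open>p\<close>; this obligation is carried along to the following letters.
\<close>

definition WP :: "'a list \<Rightarrow> 'a list \<Rightarrow> 'a list \<Rightarrow> bool" where
  "WP u v p \<longleftrightarrow> eqv u v \<and> (\<exists>x. eqv u (p @ x))"

text \<open>Both \<open>v\<close> and \<open>p @ x\<close> are equivalent to \<open>u\<close>, so
  \<open>eqv_drop\<close> applies to either. If \<open>p\<close> has fewer than k letters, it is
  visible in \<open>u\<close> and no obligation remains.\<close>

lemma WP_nonsite:
  assumes ns: "\<And>j. j < k \<Longrightarrow> \<not> site u j" and k: "k \<le> length u"
  shows "WP u v p \<longleftrightarrow> k \<le> length v \<and> take k u = take k v \<and> prefix (take k p) u \<and>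
    WP (drop k u) (drop k v) (drop k p)"
proof
  assume w: "WP u v p"
  then obtain x where x: "eqv u (p @ x)" unfolding WP_def by blast
  note 1 = eqv_drop[OF ns k, of v] and 2 = eqv_drop[OF ns k x]
  have "prefix (take k (p @ x)) u" using 2 by (metis take_is_prefix)
  then have "prefix (take k p) u" by (metis prefix_order.trans take_append prefixI)
  moreover have "\<exists>y. drop k (p @ x) = drop k p @ y" by simp
  ultimately show "k \<le> length v \<and> take k u = take k v \<and> prefix (take k p) u \<and>
    WP (drop k u) (drop k v) (drop k p)" using 1 2 w unfolding WP_def by metis
next
  assume a: "k \<le> length v \<and> take k u = take k v \<and> prefix (take k p) u \<and>
    WP (drop k u) (drop k v) (drop k p)"
  then have "eqv (take k u @ drop k u) (take k v @ drop k v)" unfolding WP_def by (metis eqv_left)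
  then have e: "eqv u v" by simp
  obtain x where x: "eqv (drop k u) (drop k p @ x)" using a unfolding WP_def by blast
  have "\<exists>x. eqv u (p @ x)"
  proof (cases "k \<le> length p")
    case True
    then have "take k u = take k p" using a by (auto simp: prefix_def)
    then have "eqv (take k u @ drop k u) (take k p @ drop k p @ x)" using x by (metis eqv_left)
    then show ?thesis by (metis append.assoc append_take_drop_id)
  next
    case False
    then show ?thesis using a by (auto simp: prefix_def)
  qed
  with e show "WP u v p" unfolding WP_def by blast
qed

lemma Nil_eqv: "eqv [] v \<longleftrightarrow> v = []"
  using no_head_eqv[of "[]" v] head_less by fastforce

lemma WP_Nil: "u = [] \<or> v = [] \<Longrightarrow> WP u v p \<longleftrightarrow> u = [] \<and> v = [] \<and> p = []"
  unfolding WP_def using Nil_eqv eqv_sym by (metis append_is_Nil_conv rtranclp.rtrancl_refl)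

text \<open>
  The relation induced on the words behind \<open>Z S\<close> when the relation word at a site runs through the class of \<open>S\<close>.
\<close>

definition apx :: "'a list \<Rightarrow> 'a list \<Rightarrow> 'a list \<Rightarrow> bool" where
  "apx S = (\<lambda>t1 t2. \<exists>P. cls S P \<and> eqv (Z P @ t1) (Z P @ t2))\<^sup>*\<^sup>*"

lemma apx_refl: "apx S t t" and apx_trans: "apx S a b \<Longrightarrow> apx S b c \<Longrightarrow> apx S a c"
  and apx_step: "cls S P \<Longrightarrow> eqv (Z P @ t1) (Z P @ t2) \<Longrightarrow> apx S t1 t2"
  unfolding apx_def by (auto intro: r_into_rtranclp)

lemma apx_eqv: "eqv t1 t2 \<Longrightarrow> apx S t1 t2"
  by (rule apx_step[of S S]) (auto intro: eqv_left)

lemma apx_sym: "apx S a b \<Longrightarrow> apx S b a"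
  unfolding apx_def
  by (induction rule: rtranclp_induct) (auto intro: converse_rtranclp_into_rtranclp eqv_sym)

text \<open>Between two switches only the tail is rewritten, so the tail left by one switch and the
  tail used by the next are equivalent behind the same \<open>Z Q\<close>. Each such passage is one
  link of \<open>apx\<close>.\<close>

lemma sys_cases:
  "sys\<^sup>*\<^sup>* x y \<Longrightarrow> (fst x = fst y \<and> eqv (snd x) (snd y)) \<or>
    (\<exists>t1 t2. eqv (snd x) (Z (fst x) @ t1) \<and> eqv (snd y) (Z (fst y) @ t2) \<and> apx (fst x) t1 t2)"
proof (induction rule: rtranclp_induct)
  case (step y z)
  from step.hyps(2) show ?case
  proof (cases rule: sys.cases)
    case (tail t t' Q)
    then have "eqv t' t" using step_sym by auto
    then show ?thesis using step.IH tail
      by (auto intro: eqv_trans eqv_sym)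
  next
    case (switch Q Q' t)
    from step.IH show ?thesis
    proof
      assume "fst x = fst y \<and> eqv (snd x) (snd y)"
      then show ?thesis using switch apx_refl by auto
    next
      assume "\<exists>t1 t2. eqv (snd x) (Z (fst x) @ t1) \<and> eqv (snd y) (Z (fst y) @ t2) \<and> apx (fst x) t1 t2"
      then obtain t1 t2 where t: "eqv (snd x) (Z (fst x) @ t1)" "eqv (Z Q @ t) (Z Q @ t2)" "apx (fst x) t1 t2"
        using switch by auto
      have "cls (fst x) Q" using sys_eqv[OF step.hyps(1)] switch by simp
      then have "apx (fst x) t1 t" using t apx_step[of "fst x" Q t2 t] eqv_sym apx_trans by blast
      then show ?thesis using t(1) switch by auto
    qed
  qed
qed simp

lemma sys_switch: "cls S Q \<Longrightarrow> sys\<^sup>*\<^sup>* (S, Z S @ t) (Q, Z Q @ t)"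
  by (induction rule: rtranclp_induct) (auto intro: rtranclp.rtrancl_into_rtrancl switch)

lemma sys_tails: "eqv t t' \<Longrightarrow> sys\<^sup>*\<^sup>* (S, t) (S, t')"
  by (induction rule: rtranclp_induct) (auto intro: rtranclp.rtrancl_into_rtrancl tail)

lemma apx_sys: "apx S t1 t2 \<Longrightarrow> sys\<^sup>*\<^sup>* (S, Z S @ t1) (S, Z S @ t2)"
  unfolding apx_def
proof (induction rule: rtranclp_induct)
  case (step t2 t3)
  then obtain P where P: "cls S P" "eqv (Z P @ t2) (Z P @ t3)" by blast
  show ?case
    using rtranclp_trans[OF step.IH rtranclp_trans[OF sys_switch[OF P(1)] rtranclp_trans[OF sys_tails[OF P(2)] sys_switch[OF cls_sym[OF P(1)]]]]] .
qed simp

text \<open>The piece \<open>z\<close> in front of \<open>t\<close> creates a head that is not present in \<open>t\<close>.\<close>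

definition act :: "'a list \<Rightarrow> 'a list \<Rightarrow> 'a list \<Rightarrow> bool" where
  "act z S t \<longleftrightarrow> S \<in> RW \<and> piece R z \<and> z \<noteq> [] \<and> prefix (B S) (z @ t)"

lemma act_length: assumes "act z S t" shows "length z < bl S"
proof (rule ccontr)
  assume "\<not> length z < bl S"
  then have "prefix (B S) z" using assms unfolding act_def
    by (metis prefix_length_prefix prefixI length_B not_le)
  then show False using assms piece_prefix B_not_piece unfolding act_def by blast
qed

lemma act_nth: assumes "act z S t"
  shows "bl S \<le> length z + length t" "i < length z \<Longrightarrow> z ! i = S ! i"
    "length z + i < bl S \<Longrightarrow> t ! i = S ! (length z + i)"
proof -
  obtain y where y: "z @ t = B S @ y" using assms unfolding act_def prefix_def by auto
  then have "length z + length t = bl S + length y" by (metis length_append length_B)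
  then show "bl S \<le> length z + length t" by simp
  have n: "(z @ t) ! j = S ! j" if "j < bl S" for j using y that by (simp add: nth_append)
  show "z ! i = S ! i" if "i < length z" using n[of i] that act_length[OF assms] by (simp add: nth_append)
  show "t ! i = S ! (length z + i)" if "length z + i < bl S" using n[OF that] by (simp add: nth_append)
qed

text \<open>Let the part of \<open>B S\<close> behind \<open>z\<close> be the shorter of the two
  remainders at the beginning of \<open>t\<close>. It is also read in \<open>S'\<close> behind
  \<open>z'\<close>; were this a different place, it would be a piece, and so would \<open>z\<close>
  be, so that \<open>B S\<close> would be a product of two pieces.\<close>

lemma act_unique: assumes "act z S t" "act z' S' t" shows "z = z'"
proof -
  have "z = z'" if h: "act z S t" "act z' S' t" "bl S - length z \<le> bl S' - length z'" for z S z' S'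
  proof -
    have S: "S \<in> RW" "S' \<in> RW" and pz: "piece R z" using h unfolding act_def by auto
    note l = act_length[OF h(1)] act_length[OF h(2)]
    have tz: "take (length z) S = z"
      using act_nth(2)[OF h(1)] l(1) bl_le[of S] by (intro nth_equalityI) auto
    have tz': "take (length z') S' = z'"
      using act_nth(2)[OF h(2)] l(2) bl_le[of S'] by (intro nth_equalityI) auto
    have "S = S' \<and> length z = length z'"
    proof (rule ccontr)
      assume n: "\<not> (S = S' \<and> length z = length z')"
      have "piece R (take (bl S - length z) (drop (length z) S))"
      proof (rule piece_if_two_occurrences[of _ S' _ _ "length z'"])
        fix x assume "x < bl S - length z"
        then show "S ! (length z + x) = S' ! (length z' + x)"
          using act_nth(3)[OF h(1), of x] act_nth(3)[OF h(2), of x] h(3) l by simp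
      qed (use S n h(3) l bl_le[of S] bl_le[of S'] in auto)
      then show False using B_not_two_pieces[OF S(1), of "length z"] l pz tz by simp
    qed
    then show ?thesis using tz tz' by metis
  qed
  then show ?thesis using assms by (metis nat_le_linear)
qed

section \<open>Cancelling a common piece in front of two tails\<close>

lemma site_inside_tail:
  assumes Q: "Q \<in> RW" and e: "w @ B Q @ t = Z P @ t1" and less: "length w < length (Z P)"
  obtains z where "Z P = w @ z" "act z Q t1" "z @ t1 = B Q @ t"
proof -
  have "take (length w) (Z P @ t1) = w" using arg_cong[OF e, of "take (length w)"] by simp
  then have "Z P = w @ drop (length w) (Z P)" using less append_take_drop_id[of "length w" "Z P"] by simp
  then obtain z where z: "Z P = w @ z" by blast
  then have zt: "z @ t1 = B Q @ t" using e by simp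
  have "act z Q t1" unfolding act_def
    using z less zt Q piece_suffix[OF piece_Z[of P], of z]
    by (auto simp: prefix_def suffix_def)
  then show ?thesis using that z zt by blast
qed

lemma eqv_tail_cancel:
  assumes e: "eqv (Z P @ t1) (Z P @ t2)"
  shows "eqv t1 t2 \<or> (\<exists>z S S'. suffix z (Z P) \<and> act z S t1 \<and> act z S' t2 \<and> eqv (z @ t1) (z @ t2))"
proof (cases "\<exists>S k. head S (Z P @ t1) k")
  case False
  then show ?thesis using no_head_eqv[OF _ e] by auto
next
  case True
  then obtain w S t where fs: "first_site (Z P @ t1) w S t" using first_site_exists by blast
  from fs e obtain Q t' where Q: "Q \<in> RW" "Z P @ t2 = w @ B Q @ t'" "eqv (B S @ t) (B Q @ t')"
    by (metis first_site_eqv)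
  show ?thesis
  proof (cases "length w < length (Z P)")
    case True
    obtain z where z: "Z P = w @ z" "act z S t1" "z @ t1 = B S @ t"
      using site_inside_tail[OF _ _ True] fs unfolding first_site_def by metis
    obtain z' where z': "Z P = w @ z'" "act z' Q t2" "z' @ t2 = B Q @ t'"
      using site_inside_tail[OF Q(1) Q(2)[symmetric] True] .
    have "z' = z" using z z' by simp
    then show ?thesis using z z' Q(3) by (intro disjI2) (metis suffixI)
  next
    case False
    have ns: "\<not> site (Z P @ t1) j" if "j < length (Z P)" for j
      using fs False that unfolding first_site_def by (meson less_le_trans not_le)
    have "length (Z P) \<le> length (Z P @ t2) \<and> take (length (Z P)) (Z P @ t2) = take (length (Z P)) (Z P @ t1) \<and>
      eqv (drop (length (Z P)) (Z P @ t1)) (drop (length (Z P)) (Z P @ t2))"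
      by (rule eqv_drop[OF ns _ e]) simp_all
    then show ?thesis by simp
  qed
qed

text \<open>Consecutive links of a chain meet in a tail, and by \<open>act_unique\<close> this tail
  admits only one active piece. So all links that cannot be cancelled concern the same
  \<open>z\<close> and compose to one equivalence.\<close>

lemma apx_cases:
  "apx S t1 t2 \<Longrightarrow> eqv t1 t2 \<or> (\<exists>z T T' P. cls S P \<and> suffix z (Z P) \<and> act z T t1 \<and> act z T' t2 \<and> eqv (z @ t1) (z @ t2))"
  unfolding apx_def
proof (induction rule: rtranclp_induct)
  case (step t2 t3)
  obtain P where P: "cls S P" "eqv (Z P @ t2) (Z P @ t3)" using step.hyps(2) by blast
  from step.IH show ?case
  proof
    assume "eqv t1 t2"
    then have "eqv (Z P @ t1) (Z P @ t3)" using P(2) eqv_left eqv_trans by blast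
    from eqv_tail_cancel[OF this] show ?thesis using P(1) by blast
  next
    assume "\<exists>z T T' P. cls S P \<and> suffix z (Z P) \<and> act z T t1 \<and> act z T' t2 \<and> eqv (z @ t1) (z @ t2)"
    then obtain z T T' P' where z: "cls S P'" "suffix z (Z P')" "act z T t1" "act z T' t2" "eqv (z @ t1) (z @ t2)" by blast
    from eqv_tail_cancel[OF P(2)] show ?thesis
    proof
      assume e: "eqv t2 t3"
      then have "eqv (z @ t1) (z @ t3)" using z(5) eqv_left eqv_trans by blast
      moreover obtain y where "Z P' = y @ z" using z(2) unfolding suffix_def by blast
      ultimately have "eqv (Z P' @ t1) (Z P' @ t3)" using eqv_left[of "z @ t1" "z @ t3" y] by simp
      from eqv_tail_cancel[OF this] show ?thesis using z(1) by blast
    next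
      assume "\<exists>z S S'. suffix z (Z P) \<and> act z S t2 \<and> act z S' t3 \<and> eqv (z @ t2) (z @ t3)"
      then obtain z' S1 S2 where z': "act z' S1 t2" "act z' S2 t3" "eqv (z' @ t2) (z' @ t3)" by blast
      have "z' = z" using act_unique[OF z'(1) z(4)] .
      then show ?thesis using z z' eqv_trans by blast
    qed
  qed
qed simp

text \<open>Which of this lemma and \<open>apx_no_act\<close> applies depends on \<open>t1\<close>
  and the class of \<open>S\<close> only; the program \<open>ACTIVE\<close> finds out.\<close>

lemma apx_act:
  assumes "act z T t1" "cls S P" "suffix z (Z P)"
  shows "apx S t1 t2 \<longleftrightarrow> eqv (z @ t1) (z @ t2)"
proof
  assume "apx S t1 t2"
  from apx_cases[OF this] show "eqv (z @ t1) (z @ t2)"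
    using act_unique[OF assms(1)] eqv_left by blast
next
  assume e: "eqv (z @ t1) (z @ t2)"
  obtain y where "Z P = y @ z" using assms(3) unfolding suffix_def by blast
  then have "eqv (Z P @ t1) (Z P @ t2)" using eqv_left[OF e, of y] by simp
  then show "apx S t1 t2" using assms(2) apx_step by blast
qed

lemma apx_no_act:
  assumes "\<And>z T P. act z T t1 \<Longrightarrow> cls S P \<Longrightarrow> \<not> suffix z (Z P)"
  shows "apx S t1 t2 \<longleftrightarrow> eqv t1 t2"
  using apx_cases[of S t1 t2] assms apx_eqv by blast

text \<open>If the first site of \<open>t\<close> came after \<open>Z P\<close>, the letters of
  \<open>Z P\<close> would be unaffected by rewriting and visible in \<open>t\<close>. So it lies
  inside \<open>Z P\<close>, and what follows in \<open>Z P\<close> is active on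
  \<open>t1\<close>.\<close>

lemma hidden_tail:
  assumes e: "eqv t (Z P @ t1)" and np: "\<not> prefix (Z P) t"
  obtains w z T b where "Z P = w @ z" "t = w @ b" "act z T t1" "eqv b (z @ t1)"
proof -
  have "\<exists>S k. head S t k" using no_head_eqv[OF _ e] np by (auto simp: prefix_def)
  then obtain w S t3 where fs: "first_site t w S t3" using first_site_exists by blast
  from fs e obtain Q t' where Q: "Q \<in> RW" "Z P @ t1 = w @ B Q @ t'" "eqv (B S @ t3) (B Q @ t')"
    by (metis first_site_eqv)
  have t: "t = w @ B S @ t3" using fs unfolding first_site_def by simp
  have less: "length w < length (Z P)"
  proof (rule ccontr)
    assume "\<not> length w < length (Z P)"
    then have "prefix (Z P) w" using Q(2) by (metis not_le prefix_length_prefix prefixI)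
    then show False using np t prefix_append by blast
  qed
  obtain z where z: "Z P = w @ z" "act z Q t1" "z @ t1 = B Q @ t'"
    using site_inside_tail[OF Q(1) Q(2)[symmetric] less] .
  show ?thesis using that[OF z(1) t z(2)] Q(3) z(3) by simp
qed

text \<open>A hidden \<open>Z P\<close> provides an active piece, and then \<open>apx_act\<close>
  turns the link between the tails into an equivalence.\<close>

lemma hidden_tail_apx:
  assumes e: "eqv t (Z P @ t1)" and np: "\<not> prefix (Z P) t" and a: "apx S t1 t2" and c: "cls S P"
  shows "eqv t (Z P @ t2)"
proof -
  obtain w z T b where z: "Z P = w @ z" "t = w @ b" "act z T t1" "eqv b (z @ t1)"
    using hidden_tail[OF e np] .
  have "eqv (z @ t1) (z @ t2)" using apx_act[OF z(3) c] a z(1) by (simp add: suffix_def)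
  then have "eqv (w @ z @ t1) (w @ z @ t2)" by (rule eqv_left)
  then have "eqv (Z P @ t1) (Z P @ t2)" unfolding z(1) by simp
  with e show ?thesis by (rule eqv_trans)
qed

lemma sys_both_tails:
  assumes "cls S Q"
  shows "sys\<^sup>*\<^sup>* (S, Z S @ t1) (Q, Z Q @ t2) \<longleftrightarrow> apx S t1 t2"
proof
  assume "sys\<^sup>*\<^sup>* (S, Z S @ t1) (Q, Z Q @ t2)"
  from sys_cases[OF this] show "apx S t1 t2"
  proof
    assume "fst (S, Z S @ t1) = fst (Q, Z Q @ t2) \<and> eqv (snd (S, Z S @ t1)) (snd (Q, Z Q @ t2))"
    then have "eqv (Z S @ t1) (Z S @ t2)" by auto
    then show ?thesis by (rule apx_step[OF rtranclp.rtrancl_refl])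
  next
    assume "\<exists>a b. eqv (snd (S, Z S @ t1)) (Z (fst (S, Z S @ t1)) @ a) \<and>
      eqv (snd (Q, Z Q @ t2)) (Z (fst (Q, Z Q @ t2)) @ b) \<and> apx (fst (S, Z S @ t1)) a b"
    then obtain a b where ab: "eqv (Z S @ t1) (Z S @ a)" "eqv (Z Q @ t2) (Z Q @ b)" "apx S a b" by auto
    have "apx S t1 a" "apx S b t2"
      using apx_step[of S S t1 a] apx_step[OF assms eqv_sym[OF ab(2)]] ab(1) by auto
    with ab(3) show ?thesis using apx_trans by blast
  qed
next
  assume "apx S t1 t2"
  then show "sys\<^sup>*\<^sup>* (S, Z S @ t1) (Q, Z Q @ t2)"
    by (rule rtranclp_trans[OF apx_sys sys_switch[OF assms]])
qed

text \<open>A detour through other relation words gains nothing unless both tails show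
  \<open>Z S\<close>: a tail that hides \<open>Z S\<close> can follow every link by plain
  rewriting.\<close>

lemma sys_same_word:
  assumes "\<not> (prefix (Z S) t \<and> prefix (Z S) t')"
  shows "sys\<^sup>*\<^sup>* (S, t) (S, t') \<longleftrightarrow> eqv t t'"
proof
  assume "sys\<^sup>*\<^sup>* (S, t) (S, t')"
  from sys_cases[OF this] show "eqv t t'"
  proof
    assume "\<exists>t1 t2. eqv (snd (S, t)) (Z (fst (S, t)) @ t1) \<and>
      eqv (snd (S, t')) (Z (fst (S, t')) @ t2) \<and> apx (fst (S, t)) t1 t2"
    then obtain a b where ab: "eqv t (Z S @ a)" "eqv t' (Z S @ b)" "apx S a b" by auto
    then show ?thesis using assms hidden_tail_apx[OF ab(1) _ ab(3)] hidden_tail_apx[OF ab(2) _ apx_sym[OF ab(3)]]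
      by (metis eqv_sym eqv_trans rtranclp.rtrancl_refl)
  qed simp
qed (rule sys_tails)

lemma sys_left_hidden:
  assumes "S \<noteq> Q" "cls S Q" "\<not> prefix (Z S) t"
  shows "sys\<^sup>*\<^sup>* (S, t) (Q, Z Q @ t2) \<longleftrightarrow> eqv t (Z S @ t2)"
proof
  assume "sys\<^sup>*\<^sup>* (S, t) (Q, Z Q @ t2)"
  from sys_cases[OF this] assms(1) obtain a b where
    ab: "eqv t (Z S @ a)" "eqv (Z Q @ t2) (Z Q @ b)" "apx S a b" by auto
  have "apx S a t2" using ab(3) apx_step[OF assms(2) eqv_sym[OF ab(2)]] apx_trans by blast
  then show "eqv t (Z S @ t2)" using hidden_tail_apx[OF ab(1) assms(3)] by blast
next
  assume "eqv t (Z S @ t2)"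
  then show "sys\<^sup>*\<^sup>* (S, t) (Q, Z Q @ t2)" using sys_tails sys_switch[OF assms(2)] rtranclp_trans by fast
qed

lemma sys_right_hidden:
  assumes "S \<noteq> Q" "cls S Q" "\<not> prefix (Z Q) t'"
  shows "sys\<^sup>*\<^sup>* (S, Z S @ t1) (Q, t') \<longleftrightarrow> eqv (Z Q @ t1) t'"
  using sys_left_hidden[of Q S t' t1] assms sys_rtrancl_sym cls_sym eqv_sym by metis

text \<open>Both tails lead to the same \<open>t2\<close>, whose active piece \<open>z\<close> is
  unique. Hence \<open>z\<close> is a common suffix of \<open>Z S\<close> and \<open>Z Q\<close>,
  therefore a suffix of the longest one \<open>z0\<close>, and \<open>r\<close> and
  \<open>r'\<close> must be visible. Conversely a switch requires that \<open>z0\<close> can be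
  exposed; this is the origin of the prefix in \<open>WP\<close>.\<close>

lemma sys_both_hidden:
  assumes "S \<noteq> Q" "cls S Q" "\<not> prefix (Z S) t" "\<not> prefix (Z Q) t'"
    and r: "Z S = r @ z0" "Z Q = r' @ z0"
    and max: "\<And>z. suffix z (Z S) \<Longrightarrow> suffix z (Z Q) \<Longrightarrow> suffix z z0"
  shows "sys\<^sup>*\<^sup>* (S, t) (Q, t') \<longleftrightarrow> (\<exists>b b'. t = r @ b \<and> t' = r' @ b' \<and> WP b b' z0)"
proof
  assume "sys\<^sup>*\<^sup>* (S, t) (Q, t')"
  from sys_cases[OF this] assms(1) obtain t1 t2 where
    ab: "eqv t (Z S @ t1)" "eqv t' (Z Q @ t2)" "apx S t1 t2" by auto
  have t2: "eqv t (Z S @ t2)" using hidden_tail_apx[OF ab(1) assms(3) ab(3)] by blast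
  obtain w z T b where z: "Z S = w @ z" "t = w @ b" "act z T t2" "eqv b (z @ t2)"
    using hidden_tail[OF t2 assms(3)] .
  obtain w' z' T' b' where z': "Z Q = w' @ z'" "t' = w' @ b'" "act z' T' t2" "eqv b' (z' @ t2)"
    using hidden_tail[OF ab(2) assms(4)] .
  have zz: "z' = z" using act_unique z z' by blast
  then have "suffix z z0" using max z(1) z'(1) by (auto simp: suffix_def)
  then obtain y where y: "z0 = y @ z" by (auto simp: suffix_def)
  have w: "w = r @ y" "w' = r' @ y" using z(1) z'(1) r y zz by auto
  have 1: "eqv (y @ b) (z0 @ t2)" using eqv_left[OF z(4), of y] y by simp
  have 2: "eqv (y @ b') (z0 @ t2)" using eqv_left[OF z'(4), of y] y zz by simp
  have "WP (y @ b) (y @ b') z0" unfolding WP_def using 1 2 eqv_sym eqv_trans by blast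
  then show "\<exists>b b'. t = r @ b \<and> t' = r' @ b' \<and> WP b b' z0" using w z(2) z'(2) by auto
next
  assume "\<exists>b b'. t = r @ b \<and> t' = r' @ b' \<and> WP b b' z0"
  then obtain b b' x where b: "t = r @ b" "t' = r' @ b'" "eqv b b'" "eqv b (z0 @ x)" unfolding WP_def by blast
  have 1: "eqv t (Z S @ x)" using eqv_left[OF b(4), of r] b(1) r by simp
  have "eqv (z0 @ x) b'" using b(3,4) eqv_sym eqv_trans by blast
  then have 2: "eqv (Z Q @ x) t'" using eqv_left[of _ _ r'] b(2) r by fastforce
  show "sys\<^sup>*\<^sup>* (S, t) (Q, t')"
    using sys_tails[OF 1] sys_switch[OF assms(2)] sys_tails[OF 2] by (meson rtranclp_trans)
qed

section \<open>The reduction at a site in terms of \<open>WP\<close>\<close>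

lemma site_at_0:
  assumes h: "head S u 0" and cl: "\<And>k T. 0 < k \<Longrightarrow> k < bl S \<Longrightarrow> \<not> head T u k"
  obtains t where "u = B S @ t" "first_site u [] S t"
proof -
  obtain t where u: "u = B S @ t" using h unfolding head_def occ_0 prefix_def by auto
  then have "first_site u [] S t"
    unfolding first_site_def clean_def using headD(1)[OF h] cl by simp
  with u that show ?thesis by blast
qed

lemma site_eqv:
  assumes fs: "first_site (B S @ t) [] S t" and Q: "Q \<in> RW"
  shows "eqv (B S @ t) (B Q @ t') \<longleftrightarrow> sys\<^sup>*\<^sup>* (S, t) (Q, t')"
proof
  assume "eqv (B S @ t) (B Q @ t')"
  from first_site_eqv[OF fs this] obtain Q' t'' where
    q: "Q' \<in> RW" "B Q @ t' = B Q' @ t''" "sys\<^sup>*\<^sup>* (S, t) (Q', t'')" by (metis append_Nil)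
  have "head Q (B Q @ t') 0" using Q by (simp add: head_def occ_0)
  moreover have "head Q' (B Q @ t') 0" unfolding q(2) using q(1) by (simp add: head_def occ_0)
  ultimately have "Q = Q'" using head_unique by blast
  with q show "sys\<^sup>*\<^sup>* (S, t) (Q, t')" by simp
qed (use sys_eqv in fastforce)

text \<open>Justifies the answer no when the second word does not start with a head from the class
  of \<open>S\<close>.\<close>

lemma WP_site_heads:
  assumes fs: "first_site (B S @ t) [] S t" and w: "WP (B S @ t) v p"
  shows "\<exists>Q. head Q v 0 \<and> cls S Q"
proof -
  have "eqv (B S @ t) v" using w unfolding WP_def by simp
  from first_site_eqv[OF fs this] obtain Q t'' where
    q: "Q \<in> RW" "v = B Q @ t''" "sys\<^sup>*\<^sup>* (S, t) (Q, t'')" by (metis append_Nil)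
  then have "head Q v 0" by (auto simp: head_def occ_0)
  moreover have "cls S Q" using sys_eqv[OF q(3)] by simp
  ultimately show ?thesis by blast
qed

text \<open>A piece contains no head, so \<open>p\<close> has to fit into \<open>B P\<close> for the
  word \<open>P\<close> standing at the site. As \<open>P\<close> differs from \<open>S\<close>, a
  switch is needed, and this requires that the tail can expose \<open>Z S\<close>.\<close>

lemma possible_prefix_site:
  assumes fs: "first_site (B S @ t) [] S t" and p: "piece R p" and np: "\<not> prefix p S"
  shows "(\<exists>x. eqv (B S @ t) (p @ x)) \<longleftrightarrow> (\<exists>P. cls S P \<and> prefix p P) \<and> (\<exists>x. eqv t (Z S @ x))"
proof
  assume "\<exists>x. eqv (B S @ t) (p @ x)"
  then obtain x where x: "eqv (B S @ t) (p @ x)" by blast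
  from first_site_eqv[OF fs x] obtain P t' where
    q: "P \<in> RW" "p @ x = B P @ t'" "sys\<^sup>*\<^sup>* (S, t) (P, t')" by (metis append_Nil)
  have "prefix p (B P)"
  proof (rule ccontr)
    assume "\<not> prefix p (B P)"
    then have "prefix (B P) p" using q(2) by (metis prefixI prefix_same_cases)
    then show False using piece_prefix[OF p] B_not_piece q(1) by blast
  qed
  then have pp: "prefix p P" using B_Z[of P] by (metis prefix_prefix)
  then have "S \<noteq> P" using np by blast
  with sys_cases[OF q(3)] have "\<exists>x. eqv t (Z S @ x)" by auto
  with pp show "(\<exists>P. cls S P \<and> prefix p P) \<and> (\<exists>x. eqv t (Z S @ x))" using sys_eqv[OF q(3)] by auto
next
  assume "(\<exists>P. cls S P \<and> prefix p P) \<and> (\<exists>x. eqv t (Z S @ x))"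
  then obtain P x y where P: "cls S P" "P = p @ y" "eqv t (Z S @ x)" by (auto simp: prefix_def)
  have "eqv (B S @ t) ((B S @ Z S) @ x)" using eqv_left[OF P(3), of "B S"] by simp
  then have "eqv (B S @ t) (P @ x)" unfolding B_Z using cls_eqv[OF P(1)] eqv_trans by blast
  then show "\<exists>x. eqv (B S @ t) (p @ x)" using P(2) by auto
qed

lemma prefix_of_word_possible:
  assumes "S \<in> RW" "piece R p" "prefix p S" shows "prefix p (B S @ t)"
proof -
  have "prefix (B S) S" using B_Z[of S] by (metis prefixI)
  then have "prefix p (B S) \<or> prefix (B S) p" using assms(3) prefix_same_cases by blast
  then show ?thesis using piece_prefix[OF assms(2)] B_not_piece[OF assms(1)] by (auto intro: prefix_prefix)
qed

lemma WP_site: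
  assumes fs: "first_site (B S @ t) [] S t" and Q: "Q \<in> RW" and p: "piece R p"
  shows "WP (B S @ t) (B Q @ t') p \<longleftrightarrow> sys\<^sup>*\<^sup>* (S, t) (Q, t') \<and>
    (prefix p S \<or> (\<exists>P. cls S P \<and> prefix p P) \<and> (\<exists>x. eqv t (Z S @ x)))"
proof (cases "prefix p S")
  case True
  have "S \<in> RW" using fs unfolding first_site_def by simp
  from prefix_of_word_possible[OF this p True, of t] obtain x where "B S @ t = p @ x" by (auto simp: prefix_def)
  then have "\<exists>x. eqv (B S @ t) (p @ x)" by auto
  then show ?thesis unfolding WP_def site_eqv[OF fs Q] using True by simp
next
  case False
  then show ?thesis unfolding WP_def site_eqv[OF fs Q] possible_prefix_site[OF fs p False] by simp
qed

text \<open>With \<open>zlen_attained\<close> this expresses \<open>zlen\<close> as a maximum over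
  prefixes of relation words, which can be computed without a search for pieces; e is the position
  where the second occurrence ends.\<close>

lemma common_suffix_take_le_zlen:
  assumes S: "S \<in> RW" "S' \<in> RW" and e: "e \<le> length S'" and ne: "S \<noteq> S' \<or> e \<noteq> length S"
    and c: "common_suffix c S (take e S')"
  shows "c \<le> zlen S"
proof -
  have cl: "c \<le> length S" "c \<le> e" using c e by (auto simp: common_suffix_def)
  have d: "drop (length S - c) S = drop (e - c) (take e S')" using common_suffix_drop[OF c] e by simp
  have "bl S \<le> length S - c"
  proof (rule suffix_two_occurrences[of S S' _ c "e - c"])
    fix x assume x: "x < c"
    then have "drop (length S - c) S ! x = drop (e - c) (take e S') ! x" using d by simp
    then show "S ! (length S - c + x) = S' ! (e - c + x)" using x cl e by simp
  qed (use S ne cl e in auto)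
  then show ?thesis using cl zlen_in[of S] unfolding bl_def by linarith
qed

text \<open>A nonempty \<open>Z S\<close> is a piece, so it has an occurrence other than the one
  ending \<open>S\<close>. If the piece is due to two places in one word, they cannot both be
  final.\<close>

lemma zlen_attained:
  assumes S: "S \<in> RW" and z: "0 < zlen S"
  shows "\<exists>S' e. S' \<in> RW \<and> e \<le> length S' \<and> (S \<noteq> S' \<or> e \<noteq> length S) \<and> common_suffix (zlen S) S (take e S')"
proof -
  have suf: "suffix (Z S) S" using B_Z[of S] by (metis suffixI)
  have fin: "\<exists>S' e. S' \<in> RW \<and> e \<le> length S' \<and> (S \<noteq> S' \<or> e \<noteq> length S) \<and> common_suffix (zlen S) S (take e S')"
    if o: "S' \<in> RW" "occurs_at (Z S) S' i" "S \<noteq> S' \<or> i + zlen S \<noteq> length S" for S' i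
  proof -
    obtain x y where xy: "S' = x @ Z S @ y" "length x = i" using o(2) unfolding occurs_at_def by blast
    then have "take (i + zlen S) S' = x @ Z S" using length_Z[of S] by simp
    then have "suffix (Z S) (take (i + zlen S) S')" by (simp add: suffix_def)
    from common_suffixI[OF suf this] show ?thesis using o xy length_Z[of S]
      by (intro exI[of _ S'] exI[of _ "i + zlen S"]) auto
  qed
  have "Z S \<noteq> []" using z length_Z[of S] by auto
  then have "(\<exists>w1\<in>RW. \<exists>w2\<in>RW. w1 \<noteq> w2 \<and> (\<exists>i. occurs_at (Z S) w1 i) \<and> (\<exists>j. occurs_at (Z S) w2 j)) \<or>
     (\<exists>w\<in>RW. \<exists>i j. i \<noteq> j \<and> occurs_at (Z S) w i \<and> occurs_at (Z S) w j)"
    using piece_Z[of S] unfolding piece_def by blast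
  then show ?thesis
  proof
    assume "\<exists>w1\<in>RW. \<exists>w2\<in>RW. w1 \<noteq> w2 \<and> (\<exists>i. occurs_at (Z S) w1 i) \<and> (\<exists>j. occurs_at (Z S) w2 j)"
    then show ?thesis using fin by metis
  next
    assume "\<exists>w\<in>RW. \<exists>i j. i \<noteq> j \<and> occurs_at (Z S) w i \<and> occurs_at (Z S) w j"
    then obtain w i j where w: "w \<in> RW" "i \<noteq> j" "occurs_at (Z S) w i" "occurs_at (Z S) w j" by blast
    have "i + zlen S \<noteq> length S \<or> j + zlen S \<noteq> length S" using w(2) by linarith
    then show ?thesis using fin[OF w(1) w(3)] fin[OF w(1) w(4)] by blast
  qed
qed

section \<open>Rewriting and the congruences of the monoid and the semigroup\<close>

lemma congruence_imp_eqv: "(u, v) \<in> generated_congruence W R \<Longrightarrow> eqv u v"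
proof (induction rule: generated_congruence.induct)
  case (base r s)
  then have "step ([] @ r @ []) ([] @ s @ [])" unfolding step_def rel_def by blast
  then show ?case by auto
next
  case (mult w x y z)
  have "eqv (w @ y) (x @ y)" using eqv_context[OF mult.IH(1), of "[]" y] by simp
  then show ?case using eqv_left[OF mult.IH(2), of x] eqv_trans by blast
qed (auto intro: eqv_sym eqv_trans)

lemma eqv_imp_congruence:
  assumes "eqv u v" "u \<in> W" "W = lists A \<or> W = lists A - {[]}" "R \<subseteq> lists A \<times> lists A" "[] \<notin> RW"
  shows "(u, v) \<in> generated_congruence W R \<and> v \<in> W"
  using assms(1)
proof (induction rule: rtranclp_induct)
  case base
  show ?case using assms(2) generated_congruence.refl by blast
next
  case (step y z)
  then obtain a r s b where rs: "rel r s" "y = a @ r @ b" "z = a @ s @ b" unfolding step_def by blast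
  let ?G = "generated_congruence W R"
  have sA: "s \<in> lists A" "s \<noteq> []" using rs(1) assms(4,5) rel_RW[OF rs(1)] unfolding rel_def by auto
  have y: "y \<in> W" using step.IH by blast
  then have abA: "a \<in> lists A" "b \<in> lists A" using rs(2) assms(3) by auto
  have r: "(r, s) \<in> ?G" using rs(1) unfolding rel_def
    by (auto intro: generated_congruence.base generated_congruence.sym)
  \<comment> \<open>In the semigroup the empty word is outside \<open>W\<close> and has no
    reflexivity rule, so empty contexts are split off below.\<close>
  have ref: "(c, c) \<in> ?G" if "c \<in> lists A" "c \<noteq> []" for c
    using that assms(3) generated_congruence.refl by blast
  have rb: "(r @ b, s @ b) \<in> ?G"
    using r generated_congruence.mult[OF r ref[OF abA(2)]] by (cases "b = []") simp_all
  have "(a @ r @ b, a @ s @ b) \<in> ?G"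
    using rb generated_congruence.mult[OF ref[OF abA(1)] rb] by (cases "a = []") simp_all
  then have "(y, z) \<in> ?G" unfolding rs .
  from generated_congruence.trans[OF conjunct1[OF step.IH] this] have "(u, z) \<in> ?G" .
  moreover have "z \<in> W" using rs(3) abA sA assms(3) by auto
  ultimately show ?case by blast
qed

lemma class_eq_iff_eqv:
  assumes "u \<in> W" "v \<in> W" "W = lists A \<or> W = lists A - {[]}" "R \<subseteq> lists A \<times> lists A" "[] \<notin> RW"
  shows "generated_congruence W R `` {u} = generated_congruence W R `` {v} \<longleftrightarrow> eqv u v"
proof
  assume "generated_congruence W R `` {u} = generated_congruence W R `` {v}"
  then have "(u, v) \<in> generated_congruence W R" using generated_congruence.refl[OF assms(2)] by auto
  then show "eqv u v" by (rule congruence_imp_eqv)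
next
  assume "eqv u v"
  then have "(u, v) \<in> generated_congruence W R" using eqv_imp_congruence[OF _ assms(1,3,4,5)] by blast
  then show "generated_congruence W R `` {u} = generated_congruence W R `` {v}"
    by (blast intro: generated_congruence.trans generated_congruence.sym)
qed

text \<open>Nonempty relation words make \<open>eqv\<close> decide the monoid and the semigroup
  alike, and they bound \<open>L\<close> by twice the size of the presentation.\<close>

lemma Nil_notin_RW: "[] \<notin> RW"
  using bl_pos[of "[]"] bl_le[of "[]"] by auto

end

section \<open>A programming language for the RAM\<close>

text \<open>
  Programs act on variables and on a separate heap; heap cell \<open>a\<close> is stored in the register
  \<open>res + a\<close> behind the reserved ones, so no program can overwrite a working register by accident.
  The running time counts iterations of loops only: every other instruction is executed at most
  once between two iterations, so the RAM time is at most the code length times this count plus one.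
\<close>

datatype exp = N nat | V nat | Plus exp exp | Minus exp exp | H exp

datatype com = Asg nat exp | Put exp exp | Seq com com (infixr \<open>;;\<close> 60)
  | Cond exp com com | Loop exp com

type_synonym mem = "nat \<Rightarrow> nat"

fun ev :: "exp \<Rightarrow> mem \<Rightarrow> mem \<Rightarrow> nat" where
  "ev (N n) s h = n"
| "ev (V v) s h = s v"
| "ev (Plus a b) s h = ev a s h + ev b s h"
| "ev (Minus a b) s h = ev a s h - ev b s h"
| "ev (H a) s h = h (ev a s h)"

inductive bs :: "com \<Rightarrow> mem \<Rightarrow> mem \<Rightarrow> nat \<Rightarrow> mem \<Rightarrow> mem \<Rightarrow> bool" where
  bs_Asg: "bs (Asg x e) s h 0 (s(x := ev e s h)) h"
| bs_Put: "bs (Put a e) s h 0 s (h(ev a s h := ev e s h))"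
| bs_Seq: "bs c1 s h n1 s1 h1 \<Longrightarrow> bs c2 s1 h1 n2 s2 h2 \<Longrightarrow> bs (c1 ;; c2) s h (n1 + n2) s2 h2"
| bs_True: "ev b s h \<noteq> 0 \<Longrightarrow> bs c1 s h n s1 h1 \<Longrightarrow> bs (Cond b c1 c2) s h n s1 h1"
| bs_False: "ev b s h = 0 \<Longrightarrow> bs c2 s h n s1 h1 \<Longrightarrow> bs (Cond b c1 c2) s h n s1 h1"
| bs_Exit: "ev b s h = 0 \<Longrightarrow> bs (Loop b c) s h 0 s h"
| bs_Loop: "ev b s h \<noteq> 0 \<Longrightarrow> bs c s h n1 s1 h1 \<Longrightarrow> bs (Loop b c) s1 h1 n2 s2 h2 \<Longrightarrow>
    bs (Loop b c) s h (Suc (n1 + n2)) s2 h2"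

subsection \<open>Compilation to RAM code\<close>

fun max_var_exp :: "exp \<Rightarrow> nat" where
  "max_var_exp (N n) = 0"
| "max_var_exp (V v) = Suc v"
| "max_var_exp (Plus a b) = max (max_var_exp a) (max_var_exp b)"
| "max_var_exp (Minus a b) = max (max_var_exp a) (max_var_exp b)"
| "max_var_exp (H a) = max_var_exp a"

text \<open>Bounds how far the scratch registers extend above the target register.\<close>

fun depth_exp :: "exp \<Rightarrow> nat" where
  "depth_exp (N n) = 0"
| "depth_exp (V v) = 0"
| "depth_exp (Plus a b) = depth_exp a + Suc (depth_exp b)"
| "depth_exp (Minus a b) = depth_exp a + Suc (depth_exp b)"
| "depth_exp (H a) = Suc (depth_exp a)"

fun max_var :: "com \<Rightarrow> nat" where
  "max_var (Asg x e) = max (Suc x) (max_var_exp e)"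
| "max_var (Put a e) = max (max_var_exp a) (max_var_exp e)"
| "max_var (c1 ;; c2) = max (max_var c1) (max_var c2)"
| "max_var (Cond b c1 c2) = max (max_var_exp b) (max (max_var c1) (max_var c2))"
| "max_var (Loop b c) = max (max_var_exp b) (max_var c)"

fun depth :: "com \<Rightarrow> nat" where
  "depth (Asg x e) = Suc (depth_exp e)"
| "depth (Put a e) = Suc (depth_exp a + depth_exp e)"
| "depth (c1 ;; c2) = depth c1 + depth c2"
| "depth (Cond b c1 c2) = depth_exp b + depth c1 + depth c2"
| "depth (Loop b c) = depth_exp b + depth c"

text \<open>There is no move instruction, so a variable is copied by adding it to 0. A heap address
  is shifted by \<open>res\<close> at run time before it is used.\<close>

fun comp_exp :: "nat \<Rightarrow> exp \<Rightarrow> nat \<Rightarrow> instr list" where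
  "comp_exp res (N n) d = [Const d n]"
| "comp_exp res (V v) d = [Const d 0, Add d v d]"
| "comp_exp res (Plus a b) d = comp_exp res a d @ comp_exp res b (Suc d) @ [Add d d (Suc d)]"
| "comp_exp res (Minus a b) d = comp_exp res a d @ comp_exp res b (Suc d) @ [Sub d d (Suc d)]"
| "comp_exp res (H a) d = comp_exp res a d @ [Const (Suc d) res, Add d d (Suc d), Load d d]"

text \<open>Code lengths do not depend on addresses, so that jump targets can be computed while
  compiling.\<close>

fun code_length_exp :: "exp \<Rightarrow> nat" where
  "code_length_exp (N n) = 1"
| "code_length_exp (V v) = 2"
| "code_length_exp (Plus a b) = code_length_exp a + code_length_exp b + 1"
| "code_length_exp (Minus a b) = code_length_exp a + code_length_exp b + 1"
| "code_length_exp (H a) = code_length_exp a + 3"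

fun code_length :: "com \<Rightarrow> nat" where
  "code_length (Asg x e) = code_length_exp e + 2"
| "code_length (Put a e) = code_length_exp a + 2 + code_length_exp e + 1"
| "code_length (c1 ;; c2) = code_length c1 + code_length c2"
| "code_length (Cond b c1 c2) = code_length_exp b + 1 + code_length c1 + 1 + code_length c2"
| "code_length (Loop b c) = code_length_exp b + 1 + code_length c + 1"

fun compile :: "nat \<Rightarrow> nat \<Rightarrow> nat \<Rightarrow> com \<Rightarrow> instr list" where
  "compile t res a (Asg x e) = comp_exp res e t @ [Const (Suc t) 0, Add x t (Suc t)]"
| "compile t res a (Put p e) = comp_exp res p t @ [Const (Suc t) res, Add t t (Suc t)] @
     comp_exp res e (Suc t) @ [Store t (Suc t)]"
| "compile t res a (c1 ;; c2) = compile t res a c1 @ compile t res (a + code_length c1) c2"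
| "compile t res a (Cond b c1 c2) =
    (let a1 = a + code_length_exp b + 1; a2 = a1 + code_length c1 + 1 in
     comp_exp res b t @ [JumpZero t a2] @ compile t res a1 c1 @ [Jump (a2 + code_length c2)] @
     compile t res a2 c2)"
| "compile t res a (Loop b c) =
    (let a1 = a + code_length_exp b + 1; a2 = a1 + code_length c + 1 in
     comp_exp res b t @ [JumpZero t a2] @ compile t res a1 c @ [Jump a])"

lemma length_comp_exp: "length (comp_exp res e d) = code_length_exp e"
  by (induction e arbitrary: d) auto

lemma length_compile: "length (compile t res a c) = code_length c"
  by (induction c arbitrary: a) (simp_all add: Let_def length_comp_exp)

definition straight :: "instr \<Rightarrow> bool" where
  "straight i = (case i of Jump _ \<Rightarrow> False | JumpZero _ _ \<Rightarrow> False | _ \<Rightarrow> True)"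

definition effect :: "instr \<Rightarrow> mem \<Rightarrow> mem" where
  "effect i m = snd (exec i (0, m))"

lemma effect_simps [simp]:
  "effect (Const i n) m = m(i := n)"
  "effect (Add i j k) m = m(i := m j + m k)"
  "effect (Sub i j k) m = m(i := m j - m k)"
  "effect (Load i j) m = m(i := m (m j))"
  "effect (Store i j) m = m(m i := m j)"
  by (simp_all add: effect_def)

lemma straight_simps [simp]:
  "straight (Const i n)" "straight (Add i j k)" "straight (Sub i j k)"
  "straight (Load i j)" "straight (Store i j)"
  by (simp_all add: straight_def)

lemma exec_straight: "straight i \<Longrightarrow> exec i (pc, m) = (Suc pc, effect i m)"
  by (cases i) (auto simp: straight_def)

definition code_at :: "instr list \<Rightarrow> nat \<Rightarrow> instr list \<Rightarrow> bool" where
  "code_at P a is \<longleftrightarrow> (\<exists>x y. P = x @ is @ y \<and> length x = a)"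

lemma code_at_append:
  assumes "code_at P a (xs @ ys)"
  shows "code_at P a xs \<and> code_at P (a + length xs) ys"
proof -
  obtain x y where xy: "P = x @ xs @ ys @ y" "length x = a" using assms unfolding code_at_def by auto
  then show ?thesis unfolding code_at_def
    by (intro conjI exI[of _ x] exI[of _ "ys @ y"] exI[of _ "x @ xs"] exI[of _ y]) auto
qed

lemma code_at_Cons:
  assumes "code_at P a (i # ys)"
  shows "a < length P \<and> P ! a = i \<and> code_at P (Suc a) ys"
proof -
  have 1: "code_at P a [i]" "code_at P (Suc a) ys" using code_at_append[of P a "[i]" ys] assms by simp_all
  then obtain x y where "P = x @ i # y" "length x = a" unfolding code_at_def by auto
  then show ?thesis using 1(2) by auto
qed

lemma steps_straight:
  "code_at P a is \<Longrightarrow> \<forall>i\<in>set is. straight i \<Longrightarrow>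
    (ram_step P ^^ length is) (a, m) = (a + length is, fold effect is m)"
proof (induction "is" arbitrary: a m)
  case (Cons i "is")
  have "ram_step P (a, m) = (Suc a, effect i m)"
    using code_at_Cons[OF Cons.prems(1)] Cons.prems(2) exec_straight by (simp add: ram_step_def)
  then show ?case using Cons.IH[of "Suc a"] code_at_Cons[OF Cons.prems(1)] Cons.prems(2)
    by (simp add: funpow_swap1)
qed simp

text \<open>The registers from \<open>t\<close> up to \<open>res\<close> are scratch space and left
  unspecified.\<close>

definition represents :: "nat \<Rightarrow> nat \<Rightarrow> mem \<Rightarrow> mem \<Rightarrow> mem \<Rightarrow> bool" where
  "represents t res s h m \<longleftrightarrow> (\<forall>v<t. m v = s v) \<and> (\<forall>a. m (res + a) = h a)"

lemma straight_comp_exp: "\<forall>i\<in>set (comp_exp res e d). straight i"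
  by (induction e arbitrary: d) auto

lemma comp_exp_correct:
  "represents t res s h m \<Longrightarrow> max_var_exp e \<le> t \<Longrightarrow> t \<le> d \<Longrightarrow> d + depth_exp e < res \<Longrightarrow>
    fold effect (comp_exp res e d) m d = ev e s h \<and>
    (\<forall>i. i < d \<or> res \<le> i \<longrightarrow> fold effect (comp_exp res e d) m i = m i)"
proof (induction e arbitrary: d m)
  case (Plus a b)
  let ?m = "fold effect (comp_exp res a d) m"
  have 1: "?m d = ev a s h \<and> (\<forall>i. i < d \<or> res \<le> i \<longrightarrow> ?m i = m i)"
    using Plus.IH(1)[OF Plus.prems(1), of d] Plus.prems by simp
  then have r: "represents t res s h ?m" using Plus.prems by (auto simp: represents_def)
  show ?case using Plus.IH(2)[OF r, of "Suc d"] 1 Plus.prems by auto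
next
  case (Minus a b)
  let ?m = "fold effect (comp_exp res a d) m"
  have 1: "?m d = ev a s h \<and> (\<forall>i. i < d \<or> res \<le> i \<longrightarrow> ?m i = m i)"
    using Minus.IH(1)[OF Minus.prems(1), of d] Minus.prems by simp
  then have r: "represents t res s h ?m" using Minus.prems by (auto simp: represents_def)
  show ?case using Minus.IH(2)[OF r, of "Suc d"] 1 Minus.prems by auto
next
  case (H a)
  let ?m = "fold effect (comp_exp res a d) m"
  have 1: "?m d = ev a s h \<and> (\<forall>i. i < d \<or> res \<le> i \<longrightarrow> ?m i = m i)"
    using H.IH[OF H.prems(1), of d] H.prems by simp
  moreover have "m (res + ev a s h) = h (ev a s h)" using H.prems(1) by (simp add: represents_def)
  ultimately show ?case using H.prems by (auto simp: add.commute)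
qed (auto simp: represents_def)

lemma steps_comp_exp:
  assumes "code_at P a (comp_exp res e t)" "represents t res s h m" "max_var_exp e \<le> t" "t + depth_exp e < res"
  obtains m' where "(ram_step P ^^ code_length_exp e) (a, m) = (a + code_length_exp e, m')"
    "represents t res s h m'" "m' t = ev e s h"
proof
  let ?m = "fold effect (comp_exp res e t) m"
  note c = comp_exp_correct[OF assms(2,3) order_refl assms(4)]
  show "(ram_step P ^^ code_length_exp e) (a, m) = (a + code_length_exp e, ?m)"
    using steps_straight[OF assms(1) straight_comp_exp] by (simp add: length_comp_exp)
  show "represents t res s h ?m" "?m t = ev e s h" using c assms(2,4) by (auto simp: represents_def)
qed

lemma steps_trans: "(f ^^ n1) x = y \<Longrightarrow> (f ^^ n2) y = z \<Longrightarrow> (f ^^ (n1 + n2)) x = z"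
  by (metis add.commute comp_apply funpow_add)

theorem compile_correct:
  "bs c s h n s' h' \<Longrightarrow> code_at P a (compile t res a c) \<Longrightarrow> max_var c \<le> t \<Longrightarrow> t + depth c < res \<Longrightarrow>
    represents t res s h m \<Longrightarrow>
    \<exists>k m'. k \<le> code_length c * Suc n \<and> (ram_step P ^^ k) (a, m) = (a + code_length c, m') \<and>
      represents t res s' h' m'"
proof (induction arbitrary: a m rule: bs.induct)
  case (bs_Asg x e s h)
  let ?c = "compile t res a (Asg x e)"
  have "t + depth_exp e < res" using bs_Asg.prems by simp
  note c = comp_exp_correct[OF bs_Asg.prems(4) _ order_refl this]
  have "\<forall>i\<in>set ?c. straight i" using straight_comp_exp by auto
  from steps_straight[OF bs_Asg.prems(1) this, of m]
  have "(ram_step P ^^ code_length (Asg x e)) (a, m) = (a + code_length (Asg x e), fold effect ?c m)"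
    by (simp only: length_compile)
  moreover have "represents t res (s(x := ev e s h)) h (fold effect ?c m)"
    using c bs_Asg.prems by (auto simp: represents_def)
  ultimately show ?case by (metis le_refl mult.right_neutral One_nat_def)
next
  case (bs_Put p e s h)
  let ?c = "compile t res a (Put p e)"
  let ?m1 = "fold effect (comp_exp res p t) m"
  let ?m2 = "?m1(Suc t := res, t := ?m1 t + res)"
  have d: "t + depth_exp p < res" "Suc t + depth_exp e < res" using bs_Put.prems by auto
  note c = comp_exp_correct[OF bs_Put.prems(4) _ order_refl d(1)]
  have r: "represents t res s h ?m2" using c bs_Put.prems by (auto simp: represents_def)
  note c2 = comp_exp_correct[OF r _ _ d(2)]
  have "\<forall>i\<in>set ?c. straight i" using straight_comp_exp by auto
  from steps_straight[OF bs_Put.prems(1) this, of m]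
  have "(ram_step P ^^ code_length (Put p e)) (a, m) = (a + code_length (Put p e), fold effect ?c m)"
    by (simp only: length_compile)
  moreover have "represents t res s (h(ev p s h := ev e s h)) (fold effect ?c m)"
    using c c2 r bs_Put.prems by (auto simp: represents_def add.commute)
  ultimately show ?case by (metis le_refl mult.right_neutral One_nat_def)
next
  case (bs_Seq c1 s h n1 s1 h1 c2 n2 s2 h2)
  have at: "code_at P a (compile t res a c1)" "code_at P (a + code_length c1) (compile t res (a + code_length c1) c2)"
    using code_at_append[of P a "compile t res a c1"] bs_Seq.prems(1) by (auto simp: length_compile)
  obtain k1 m1 where 1: "k1 \<le> code_length c1 * Suc n1" "(ram_step P ^^ k1) (a, m) = (a + code_length c1, m1)"
    "represents t res s1 h1 m1"
    using bs_Seq.IH(1)[OF at(1) _ _ bs_Seq.prems(4)] bs_Seq.prems by auto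
  obtain k2 m2 where 2: "k2 \<le> code_length c2 * Suc n2"
    "(ram_step P ^^ k2) (a + code_length c1, m1) = (a + code_length c1 + code_length c2, m2)"
    "represents t res s2 h2 m2"
    using bs_Seq.IH(2)[OF at(2) _ _ 1(3)] bs_Seq.prems by auto
  have "k1 + k2 \<le> code_length (c1 ;; c2) * Suc (n1 + n2)"
    using 1(1) 2(1) by (simp add: algebra_simps)
  then show ?case using steps_trans[OF 1(2) 2(2)] 2(3) by (auto simp: add.assoc)
next
  case (bs_True b s h c1 n s1 h1 c2)
  let ?l = "code_length_exp b"
  let ?a1 = "a + ?l + 1" let ?a2 = "?a1 + code_length c1 + 1"
  have at: "code_at P a (comp_exp res b t)" "?a1 - 1 < length P" "P ! (?a1 - 1) = JumpZero t ?a2"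
    "code_at P ?a1 (compile t res ?a1 c1)" "?a2 - 1 < length P" "P ! (?a2 - 1) = Jump (?a2 + code_length c2)"
    using bs_True.prems(1)
    by (auto simp: Let_def length_compile length_comp_exp dest!: code_at_append code_at_Cons)
  obtain m0 where 0: "(ram_step P ^^ ?l) (a, m) = (a + ?l, m0)"
    "represents t res s h m0" "m0 t = ev b s h"
    using steps_comp_exp[OF at(1) bs_True.prems(4)] bs_True.prems by auto
  have 1: "(ram_step P ^^ 1) (a + ?l, m0) = (?a1, m0)"
    using at(2,3) 0(3) bs_True.hyps(1) by (simp add: ram_step_def)
  obtain k m1 where 2: "k \<le> code_length c1 * Suc n" "(ram_step P ^^ k) (?a1, m0) = (?a1 + code_length c1, m1)"
    "represents t res s1 h1 m1"
    using bs_True.IH[OF at(4) _ _ 0(2)] bs_True.prems by auto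
  have 3: "(ram_step P ^^ 1) (?a1 + code_length c1, m1) = (?a2 + code_length c2, m1)"
    using at(5,6) by (simp add: ram_step_def)
  have "?l + 1 + k + 1 \<le> code_length (Cond b c1 c2) * Suc n" using 2(1) by (simp add: algebra_simps)
  then show ?case using steps_trans[OF steps_trans[OF steps_trans[OF 0(1) 1] 2(2)] 3] 2(3)
    by (intro exI[of _ "?l + 1 + k + 1"] exI[of _ m1]) (auto simp: algebra_simps)
next
  case (bs_False b s h c2 n s1 h1 c1)
  let ?l = "code_length_exp b"
  let ?a1 = "a + ?l + 1" let ?a2 = "?a1 + code_length c1 + 1"
  have at: "code_at P a (comp_exp res b t)" "?a1 - 1 < length P" "P ! (?a1 - 1) = JumpZero t ?a2"
    "code_at P ?a2 (compile t res ?a2 c2)"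
    using bs_False.prems(1)
    by (auto simp: Let_def length_compile length_comp_exp dest!: code_at_append code_at_Cons)
  obtain m0 where 0: "(ram_step P ^^ ?l) (a, m) = (a + ?l, m0)"
    "represents t res s h m0" "m0 t = ev b s h"
    using steps_comp_exp[OF at(1) bs_False.prems(4)] bs_False.prems by auto
  have 1: "(ram_step P ^^ 1) (a + ?l, m0) = (?a2, m0)"
    using at(2,3) 0(3) bs_False.hyps(1) by (simp add: ram_step_def)
  obtain k m1 where 2: "k \<le> code_length c2 * Suc n" "(ram_step P ^^ k) (?a2, m0) = (?a2 + code_length c2, m1)"
    "represents t res s1 h1 m1"
    using bs_False.IH[OF at(4) _ _ 0(2)] bs_False.prems by auto
  have "?l + 1 + k \<le> code_length (Cond b c1 c2) * Suc n" using 2(1) by (simp add: algebra_simps)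
  then show ?case using steps_trans[OF steps_trans[OF 0(1) 1] 2(2)] 2(3)
    by (intro exI[of _ "?l + 1 + k"] exI[of _ m1]) (auto simp: algebra_simps)
next
  case (bs_Exit b s h c)
  let ?l = "code_length_exp b"
  let ?a1 = "a + ?l + 1" let ?a2 = "?a1 + code_length c + 1"
  have at: "code_at P a (comp_exp res b t)" "?a1 - 1 < length P" "P ! (?a1 - 1) = JumpZero t ?a2"
    using bs_Exit.prems(1)
    by (auto simp: Let_def length_compile length_comp_exp dest!: code_at_append code_at_Cons)
  obtain m0 where 0: "(ram_step P ^^ ?l) (a, m) = (a + ?l, m0)"
    "represents t res s h m0" "m0 t = ev b s h"
    using steps_comp_exp[OF at(1) bs_Exit.prems(4)] bs_Exit.prems by auto
  have 1: "(ram_step P ^^ 1) (a + ?l, m0) = (?a2, m0)"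
    using at(2,3) 0(3) bs_Exit.hyps(1) by (simp add: ram_step_def)
  show ?case using steps_trans[OF 0(1) 1] 0(2)
    by (intro exI[of _ "?l + 1"] exI[of _ m0]) (auto simp: algebra_simps)
next
  case (bs_Loop b s h c n1 s1 h1 n2 s2 h2)
  let ?l = "code_length_exp b"
  let ?a1 = "a + ?l + 1" let ?a2 = "?a1 + code_length c + 1"
  have at: "code_at P a (comp_exp res b t)" "?a1 - 1 < length P" "P ! (?a1 - 1) = JumpZero t ?a2"
    "code_at P ?a1 (compile t res ?a1 c)" "?a2 - 1 < length P" "P ! (?a2 - 1) = Jump a"
    using bs_Loop.prems(1)
    by (auto simp: Let_def length_compile length_comp_exp dest!: code_at_append code_at_Cons)
  obtain m0 where 0: "(ram_step P ^^ ?l) (a, m) = (a + ?l, m0)"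
    "represents t res s h m0" "m0 t = ev b s h"
    using steps_comp_exp[OF at(1) bs_Loop.prems(4)] bs_Loop.prems by auto
  have 1: "(ram_step P ^^ 1) (a + ?l, m0) = (?a1, m0)"
    using at(2,3) 0(3) bs_Loop.hyps(1) by (simp add: ram_step_def)
  obtain k m1 where 2: "k \<le> code_length c * Suc n1" "(ram_step P ^^ k) (?a1, m0) = (?a1 + code_length c, m1)"
    "represents t res s1 h1 m1"
    using bs_Loop.IH(1)[OF at(4) _ _ 0(2)] bs_Loop.prems by auto
  have 3: "(ram_step P ^^ 1) (?a1 + code_length c, m1) = (a, m1)"
    using at(5,6) by (simp add: ram_step_def)
  obtain k' m2 where 4: "k' \<le> code_length (Loop b c) * Suc n2"
    "(ram_step P ^^ k') (a, m1) = (a + code_length (Loop b c), m2)" "represents t res s2 h2 m2"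
    using bs_Loop.IH(2)[OF bs_Loop.prems(1,2,3) 2(3)] by auto
  \<comment> \<open>The \<open>Suc n1\<close> units pay for the test, the body and the jump back,
    the other \<open>Suc n2\<close> for the remaining iterations.\<close>
  have "?l + 1 + k + 1 + k' \<le> code_length (Loop b c) * Suc (Suc (n1 + n2))"
    using 2(1) 4(1) by (simp add: algebra_simps)
  then show ?case using steps_trans[OF steps_trans[OF steps_trans[OF steps_trans[OF 0(1) 1] 2(2)] 3] 4(2)] 4(3)
    by (intro exI[of _ "?l + 1 + k + 1 + k'"] exI[of _ m2]) auto
qed

text \<open>The successor in \<open>t\<close> keeps register 0, which holds the output, among the
  variables for every program.\<close>

definition machine :: "com \<Rightarrow> ram" where
  "machine c = (let t = Suc (max_var c); res = Suc (t + depth c) in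
    \<lparr>reserved = res, code = compile t res 0 c\<rparr>)"

theorem machine_correct:
  assumes "bs c (\<lambda>_. 0) (\<lambda>a. if a < length xs then xs ! a else 0) n s' h'"
  shows "\<exists>k \<le> code_length c * Suc n. ram_outputs_within (machine c) xs k (s' 0)"
proof -
  define t where "t = Suc (max_var c)"
  define res where "res = Suc (t + depth c)"
  have m: "machine c = \<lparr>reserved = res, code = compile t res 0 c\<rparr>"
    by (simp add: machine_def t_def res_def)
  have "code_at (compile t res 0 c) 0 (compile t res 0 c)" unfolding code_at_def
    by (intro exI[of _ "[]"]) simp
  moreover have "represents t res (\<lambda>_. 0) (\<lambda>a. if a < length xs then xs ! a else 0) (initial_memory res xs)"
    by (auto simp: represents_def initial_memory_def res_def)
  ultimately obtain k m' where "k \<le> code_length c * Suc n"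
    "(ram_step (compile t res 0 c) ^^ k) (0, initial_memory res xs) = (0 + code_length c, m')"
    "represents t res s' h' m'"
    using compile_correct[OF assms, of "compile t res 0 c" 0 t res "initial_memory res xs"]
    by (auto simp: t_def res_def)
  moreover from this(3) have "m' 0 = s' 0" by (simp add: represents_def t_def)
  ultimately show ?thesis unfolding ram_outputs_within_def m
    by (intro exI[of _ k]) (auto simp: length_compile)
qed

subsection \<open>Reasoning about programs\<close>

text \<open>Total correctness with a bound on loop iterations. One execution is enough, as
  \<open>machine_correct\<close> starts from a single derivation.\<close>

definition run :: "com \<Rightarrow> mem \<Rightarrow> mem \<Rightarrow> nat \<Rightarrow> (mem \<Rightarrow> mem \<Rightarrow> bool) \<Rightarrow> bool" where
  "run c s h n Q \<longleftrightarrow> (\<exists>s' h' k. bs c s h k s' h' \<and> k \<le> n \<and> Q s' h')"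

inductive_cases bs_AsgE: "bs (Asg x e) s h n s' h'"
inductive_cases bs_PutE: "bs (Put a e) s h n s' h'"
inductive_cases bs_SeqE: "bs (c1 ;; c2) s h n s' h'"
inductive_cases bs_CondE: "bs (Cond b c1 c2) s h n s' h'"

lemma run_Asg [simp]: "run (Asg x e) s h n Q \<longleftrightarrow> Q (s(x := ev e s h)) h"
  unfolding run_def by (auto intro: bs.intros elim: bs_AsgE)

lemma run_Put [simp]: "run (Put a e) s h n Q \<longleftrightarrow> Q s (h(ev a s h := ev e s h))"
  unfolding run_def by (auto intro: bs.intros elim: bs_PutE)

lemma run_Cond [simp]:
  "run (Cond b c1 c2) s h n Q \<longleftrightarrow> (if ev b s h \<noteq> 0 then run c1 s h n Q else run c2 s h n Q)"
proof -
  have "bs (Cond b c1 c2) s h k s' h' \<longleftrightarrow> (if ev b s h \<noteq> 0 then bs c1 s h k s' h' else bs c2 s h k s' h')" for k s' h'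
    by (auto intro: bs_True bs_False elim: bs_CondE)
  then show ?thesis unfolding run_def by simp
qed

lemma run_Seq:
  assumes "run c1 s h n1 (\<lambda>s' h'. run c2 s' h' n2 Q)" "n1 + n2 \<le> n"
  shows "run (c1 ;; c2) s h n Q"
proof -
  obtain s1 h1 k1 s2 h2 k2 where "bs c1 s h k1 s1 h1" "k1 \<le> n1" "bs c2 s1 h1 k2 s2 h2" "k2 \<le> n2" "Q s2 h2"
    using assms(1) unfolding run_def by blast
  then show ?thesis unfolding run_def using assms(2) bs_Seq[of c1 s h k1 s1 h1 c2 k2 s2 h2]
    by (meson add_mono dual_order.trans)
qed

lemma run_Seq_Asg [simp]: "run (Asg x e ;; c) s h n Q \<longleftrightarrow> run c (s(x := ev e s h)) h n Q"
proof
  assume "run (Asg x e ;; c) s h n Q"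
  then show "run c (s(x := ev e s h)) h n Q" unfolding run_def
    by (elim exE conjE bs_SeqE bs_AsgE) auto
next
  assume "run c (s(x := ev e s h)) h n Q"
  then show "run (Asg x e ;; c) s h n Q" by (intro run_Seq[of _ _ _ 0 _ n]) auto
qed

lemma run_Seq_Put [simp]: "run (Put a e ;; c) s h n Q \<longleftrightarrow> run c s (h(ev a s h := ev e s h)) n Q"
proof
  assume "run (Put a e ;; c) s h n Q"
  then show "run c s (h(ev a s h := ev e s h)) n Q" unfolding run_def
    by (elim exE conjE bs_SeqE bs_PutE) auto
next
  assume "run c s (h(ev a s h := ev e s h)) n Q"
  then show "run (Put a e ;; c) s h n Q" by (intro run_Seq[of _ _ _ 0 _ n]) auto
qed

lemma run_Seq_Seq [simp]: "run ((c1 ;; c2) ;; c3) s h n Q \<longleftrightarrow> run (c1 ;; c2 ;; c3) s h n Q"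
proof
  assume "run ((c1 ;; c2) ;; c3) s h n Q"
  then show "run (c1 ;; c2 ;; c3) s h n Q" unfolding run_def
    by (elim exE conjE bs_SeqE) (metis bs_Seq add.assoc)
next
  assume "run (c1 ;; c2 ;; c3) s h n Q"
  then show "run ((c1 ;; c2) ;; c3) s h n Q" unfolding run_def
    by (elim exE conjE bs_SeqE) (metis bs_Seq add.assoc)
qed

lemma run_Seq_Cond [simp]:
  "run (Cond b c1 c2 ;; c) s h n Q \<longleftrightarrow> (if ev b s h \<noteq> 0 then run (c1 ;; c) s h n Q else run (c2 ;; c) s h n Q)"
proof -
  have "bs (Cond b c1 c2 ;; c) s h k s' h' \<longleftrightarrow> (if ev b s h \<noteq> 0 then bs (c1 ;; c) s h k s' h' else bs (c2 ;; c) s h k s' h')"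
    for k s' h'
    by (auto intro: bs_Seq bs_True bs_False elim!: bs_SeqE elim: bs_CondE)
  then show ?thesis unfolding run_def by simp
qed

lemma run_mono: "run c s h n Q \<Longrightarrow> n \<le> n' \<Longrightarrow> (\<And>s' h'. Q s' h' \<Longrightarrow> Q' s' h') \<Longrightarrow> run c s h n' Q'"
  unfolding run_def using dual_order.trans by blast

lemma run_Seq':
  assumes "run c1 s h n1 P" "\<And>s' h'. P s' h' \<Longrightarrow> run c2 s' h' n2 Q" "n1 + n2 \<le> n"
  shows "run (c1 ;; c2) s h n Q"
  using run_Seq run_mono[OF assms(1) order_refl, of "\<lambda>s' h'. run c2 s' h' n2 Q"] assms(2,3) by blast

text \<open>Amortised counting: every iteration may have its own bound k, provided that the
  potential falls by k and one more unit for the iteration itself.\<close>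

lemma run_Loop:
  assumes "I s h" "\<phi> s h \<le> n"
    and body: "\<And>s h. I s h \<Longrightarrow> ev b s h \<noteq> 0 \<Longrightarrow> \<exists>k. run c s h k (\<lambda>s' h'. I s' h' \<and> \<phi> s' h' + k + 1 \<le> \<phi> s h)"
    and exit: "\<And>s h. I s h \<Longrightarrow> ev b s h = 0 \<Longrightarrow> Q s h"
  shows "run (Loop b c) s h n Q"
proof -
  have "\<exists>s' h' k. bs (Loop b c) s h k s' h' \<and> k \<le> \<phi> s h \<and> Q s' h'" if "I s h" for s h
    using that
  proof (induction "\<phi> s h" arbitrary: s h rule: less_induct)
    case less
    show ?case
    proof (cases "ev b s h = 0")
      case True
      then show ?thesis using bs_Exit[OF True, of c] exit[OF less.prems True] by blast
    next
      case False
      obtain k s1 h1 k1 where 1: "bs c s h k1 s1 h1" "k1 \<le> k" "I s1 h1" "\<phi> s1 h1 + k + 1 \<le> \<phi> s h"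
        using body[OF less.prems False] unfolding run_def by blast
      then obtain s2 h2 k2 where 2: "bs (Loop b c) s1 h1 k2 s2 h2" "k2 \<le> \<phi> s1 h1" "Q s2 h2"
        using less.hyps[of s1 h1] by auto
      have "Suc (k1 + k2) \<le> \<phi> s h" using 1 2 by simp
      then show ?thesis using bs_Loop[OF False 1(1) 2(1)] 2(3) by blast
    qed
  qed
  from this[OF assms(1)] show ?thesis unfolding run_def using assms(2) dual_order.trans by blast
qed

text \<open>Boolean tests by truncated subtraction: 1 - n is 1 for n = 0 and 0 otherwise, so a
  double one normalises a truth value.\<close>

definition "Lt a b = Minus (N 1) (Minus (N 1) (Minus b a))"
definition "Eq a b = Minus (N 1) (Plus (Minus a b) (Minus b a))"
definition "And a b = Minus (N 1) (Plus (Minus (N 1) a) (Minus (N 1) b))"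
definition "Nt a = Minus (N 1) a"

lemma ev_bool [simp]:
  "ev (Lt a b) s h = of_bool (ev a s h < ev b s h)"
  "ev (Eq a b) s h = of_bool (ev a s h = ev b s h)"
  "ev (And a b) s h = of_bool (ev a s h \<noteq> 0 \<and> ev b s h \<noteq> 0)"
  "ev (Nt a) s h = of_bool (ev a s h = 0)"
  by (auto simp: Lt_def Eq_def And_def Nt_def)

section \<open>Comparing words and searching relation words\<close>

definition seg :: "mem \<Rightarrow> nat \<Rightarrow> nat \<Rightarrow> nat list" where
  "seg h a n = map h [a..<a + n]"

lemma length_seg [simp]: "length (seg h a n) = n" by (simp add: seg_def)
lemma seg_nth [simp]: "i < n \<Longrightarrow> seg h a n ! i = h (a + i)" by (simp add: seg_def)
lemma seg_0 [simp]: "seg h a 0 = []" by (simp add: seg_def)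
lemma drop_seg: "drop k (seg h a n) = seg h (a + k) (n - k)"
  by (rule nth_equalityI) (auto simp: add.assoc)
lemma take_seg: "take k (seg h a n) = seg h a (min k n)" by (rule nth_equalityI) auto
lemma seg_cong: "(\<And>i. a \<le> i \<Longrightarrow> i < a + n \<Longrightarrow> h i = h' i) \<Longrightarrow> seg h a n = seg h' a n"
  by (simp add: seg_def)

text \<open>
  A stream is the concatenation of two memory segments, given by four consecutive variables
  (address and length of either segment). The current words of the main loop have this shape:
  a segment of a relation word, followed by the unread part of an input word.

  The variables 5 to 8 and 61 to 64 describe streams to be compared, 9 the number of letters to compare;
  11, 15 and 20 return results of subprograms. The current words are in 24 to 27 and 28 to 31, the piece
  that remains to be exposed in 32 and 33; 34 is zero after the decision, which is left in 0.
  The variables 35 and 37 point to the relation words whose heads start the current words.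
\<close>

definition str :: "mem \<Rightarrow> nat \<Rightarrow> nat \<Rightarrow> nat \<Rightarrow> nat \<Rightarrow> nat list" where
  "str h p1 l1 p2 l2 = seg h p1 l1 @ seg h p2 l2"

lemma length_str [simp]: "length (str h p1 l1 p2 l2) = l1 + l2" by (simp add: str_def)

lemma drop_str: "drop k (str h p1 l1 p2 l2) = str h (p1 + k) (l1 - k) (p2 + (k - l1)) (l2 - (k - l1))"
  by (simp add: str_def drop_seg)

lemma str_0 [simp]: "str h p1 l1 p2 0 = seg h p1 l1" "str h p1 0 p2 l2 = seg h p2 l2"
  by (simp_all add: str_def)

definition agree :: "nat set \<Rightarrow> mem \<Rightarrow> mem \<Rightarrow> bool" where
  "agree W s s' \<longleftrightarrow> (\<forall>z. z \<notin> W \<longrightarrow> s' z = s z)"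

lemma agreeD: "agree W s s' \<Longrightarrow> z \<notin> W \<Longrightarrow> s' z = s z"
  by (simp add: agree_def)

lemma agree_refl [simp]: "agree W s s"
  by (simp add: agree_def)

lemma agree_upd [simp]:
  "x \<in> W \<Longrightarrow> agree W s (s'(x := v)) \<longleftrightarrow> agree W s s'"
  "x \<in> W \<Longrightarrow> agree W (s(x := v)) s' \<longleftrightarrow> agree W s s'"
  by (auto simp: agree_def)

lemma agree_via: "agree U t s'' \<Longrightarrow> U \<subseteq> W \<Longrightarrow> agree W s t \<Longrightarrow> agree W s s''"
  by (auto simp: agree_def subset_iff)

text \<open>Letters are read shifted by one, so that 0 can signal the end of the stream.\<close>

definition GET :: "nat \<Rightarrow> nat \<Rightarrow> com" where
  "GET g b = Cond (Lt (V 10) (V (b + 1))) (Asg g (Plus (N 1) (H (Plus (V b) (V 10)))))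
    (Cond (Lt (V 10) (Plus (V (b + 1)) (V (b + 3))))
      (Asg g (Plus (N 1) (H (Plus (V (b + 2)) (Minus (V 10) (V (b + 1)))))))
      (Asg g (N 0)))"

lemmas exec_simps = run_Seq_Asg run_Seq_Seq ev.simps fun_upd_apply numeral_eq_iff num.distinct num.inject
  zero_neq_numeral numeral_neq_zero simp_thms if_True if_False

lemma run_GET:
  "run (GET g b ;; c) s h n Q \<longleftrightarrow> run c (s(g :=
    let w = str h (s b) (s (b + 1)) (s (b + 2)) (s (b + 3)) in
    if s 10 < length w then Suc (w ! s 10) else 0)) h n Q"
  by (simp add: GET_def str_def nth_append)

definition MATCH :: com where
  "MATCH = Asg 10 (N 0) ;; Asg 11 (N 1) ;;
    Loop (And (V 11) (Lt (V 10) (V 9)))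
      (GET 12 61 ;; GET 13 5 ;;
       Cond (And (V 12) (Eq (V 12) (V 13))) (Asg 10 (Plus (V 10) (N 1))) (Asg 11 (N 0)))"

definition match :: "nat \<Rightarrow> nat list \<Rightarrow> nat list \<Rightarrow> bool" where
  "match n xs ys \<longleftrightarrow> n \<le> length xs \<and> n \<le> length ys \<and> take n xs = take n ys"

lemma match_prefix: "length xs = n \<Longrightarrow> match n xs ys \<longleftrightarrow> prefix xs ys"
  by (auto simp: match_def prefix_def) (metis append_take_drop_id)

lemma match_prefix_take: "n \<le> length xs \<Longrightarrow> match n xs ys \<longleftrightarrow> prefix (take n xs) ys"
  using match_prefix[of "take n xs" n ys] by (simp add: match_def)

lemma match_Suc: "match (Suc i) xs ys \<longleftrightarrow> match i xs ys \<and> i < length xs \<and> i < length ys \<and> xs ! i = ys ! i"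
  by (auto simp: match_def take_Suc_conv_app_nth)

lemma match_less: "match n xs ys \<Longrightarrow> m \<le> n \<Longrightarrow> match m xs ys"
  by (auto simp: match_def) (metis min.absorb1 take_take)

lemma run_MATCH:
  assumes xs: "xs = str h (s 61) (s 62) (s 63) (s 64)" and ys: "ys = str h (s 5) (s 6) (s 7) (s 8)" and n: "s 9 \<le> n"
  shows "run MATCH s h n (\<lambda>s' h'. h' = h \<and> s' 11 = of_bool (match (s 9) xs ys) \<and>
    (\<forall>z. z \<notin> {10, 11, 12, 13} \<longrightarrow> s' z = s z))"
  unfolding MATCH_def run_Seq_Asg
proof (rule run_Loop[where I = "\<lambda>s' h'. h' = h \<and> (\<forall>z. z \<notin> {10, 11, 12, 13} \<longrightarrow> s' z = s z) \<and> s' 10 \<le> s 9 \<and>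
      match (s' 10) xs ys \<and> (s' 11 = 1 \<or> s' 11 = 0 \<and> \<not> match (s 9) xs ys)"
      and \<phi> = "\<lambda>s' h'. if s' 11 = 0 then 0 else s 9 - s' 10"], goal_cases)
  case (3 s' h')
  note I = 3(1) and b = 3(2)
  have s': "s' 61 = s 61" "s' 62 = s 62" "s' 63 = s 63" "s' 64 = s 64" "s' 5 = s 5" "s' 6 = s 6" "s' 7 = s 7" "s' 8 = s 8" "s' 9 = s 9"
    using I by auto
  have c: "s' 10 < s 9" "s' 11 = 1" using b I s' by (auto split: if_splits)
  have nm: "\<not> match (s 9) xs ys" if "\<not> match (Suc (s' 10)) xs ys"
    using that c(1) match_less by (metis Suc_leI)
  have l: "s 62 + s 64 = length xs" "s 6 + s 8 = length ys" using xs ys by simp_all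
  show ?case
  proof (cases "match (Suc (s' 10)) xs ys")
    case True
    then show ?thesis using I c
      by (intro exI[of _ 0]) (simp add: run_GET s' xs[symmetric] ys[symmetric] l Let_def match_Suc)
  next
    case False
    then show ?thesis using I c nm
      by (intro exI[of _ 0]) (auto simp: run_GET s' xs[symmetric] ys[symmetric] l Let_def match_Suc)
  qed
qed (use n in \<open>auto simp: match_def split: if_splits\<close>)

lemma run_MATCH_agree:
  assumes "xs = str h (s 61) (s 62) (s 63) (s 64)" "ys = str h (s 5) (s 6) (s 7) (s 8)" "s 9 \<le> n"
  shows "run MATCH s h n (\<lambda>s' h'. h' = h \<and> s' 11 = of_bool (match (s 9) xs ys) \<and> agree {10, 11, 12, 13} s s')"
  using run_MATCH[OF assms] unfolding agree_def .

lemma run_MATCH_Seq: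
  assumes "\<And>s'. agree {10, 11, 12, 13} s s' \<Longrightarrow>
      s' 11 = of_bool (match (s 9) (str h (s 61) (s 62) (s 63) (s 64)) (str h (s 5) (s 6) (s 7) (s 8))) \<Longrightarrow>
      run c s' h m Q"
    and "s 9 + m \<le> n"
  shows "run (MATCH ;; c) s h n Q"
proof (rule run_Seq')
  show "run MATCH s h (s 9) (\<lambda>s' h'. h' = h \<and>
    s' 11 = of_bool (match (s 9) (str h (s 61) (s 62) (s 63) (s 64)) (str h (s 5) (s 6) (s 7) (s 8))) \<and>
    agree {10, 11, 12, 13} s s')"
    by (rule run_MATCH_agree) simp_all
qed (use assms in auto)

text \<open>The variables 16 and 18 hold the addresses just behind the two words, 17 and 19 their
  lengths.\<close>

definition CSUF :: com where
  "CSUF = Asg 20 (N 0) ;; Loop (And (Lt (V 20) (V 17)) (And (Lt (V 20) (V 19))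
    (Eq (H (Minus (V 16) (Plus (V 20) (N 1)))) (H (Minus (V 18) (Plus (V 20) (N 1)))))))
    (Asg 20 (Plus (V 20) (N 1)))"

lemma run_CSUF:
  assumes xs: "xs = seg h (s 16 - s 17) (s 17)" "s 17 \<le> s 16" and ys: "ys = seg h (s 18 - s 19) (s 19)" "s 19 \<le> s 18"
    and n: "s 17 \<le> n"
  shows "run CSUF s h n (\<lambda>s' h'. h' = h \<and> common_suffix (s' 20) xs ys \<and>
    (\<forall>c. common_suffix c xs ys \<longrightarrow> c \<le> s' 20) \<and> (\<forall>z. z \<noteq> 20 \<longrightarrow> s' z = s z))"
  unfolding CSUF_def run_Seq_Asg
proof (rule run_Loop[where I = "\<lambda>s' h'. h' = h \<and> (\<forall>z. z \<noteq> 20 \<longrightarrow> s' z = s z) \<and> common_suffix (s' 20) xs ys"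
      and \<phi> = "\<lambda>s' h'. s 17 - s' 20"], goal_cases)
  case (3 s' h')
  then show ?case
    using xs ys by (intro exI[of _ 0]) (auto simp: common_suffix_def less_Suc_eq split: if_splits)
next
  case (4 s' h')
  have "c \<le> s' 20" if c: "common_suffix c xs ys" for c
  proof (rule ccontr)
    assume n: "\<not> c \<le> s' 20"
    then have "s' 20 < s 17" "s' 20 < s 19" "xs ! (length xs - Suc (s' 20)) = ys ! (length ys - Suc (s' 20))"
      using c xs ys by (auto simp: common_suffix_def)
    then show False using 4 xs ys by (auto split: if_splits)
  qed
  then show ?case using 4(1) by blast
qed (use n in \<open>auto simp: common_suffix_def\<close>)

text \<open>
  The record at \<open>x\<close> consists of four cells: address and length of a relation word \<open>w\<close>, the number
  \<open>bl w\<close>, and a label that identifies the class of \<open>w\<close> under the relations. The variables 22 and 23 delimit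
  the table of records.
\<close>

definition recs :: "nat \<Rightarrow> nat \<Rightarrow> nat set" where
  "recs t k = (\<lambda>i. t + 4 * i) ` {..<k}"

definition wd :: "mem \<Rightarrow> nat \<Rightarrow> nat list" where
  "wd h x = seg h (h x) (h (x + 1))"

text \<open>Visits the records until \<open>bd\<close> leaves a nonzero value in 11. The result 0
  means failure: the table does not start at address 0.\<close>

definition FINDR :: "nat \<Rightarrow> nat \<Rightarrow> com \<Rightarrow> com" where
  "FINDR y r bd = Asg y (V 22) ;; Asg r (N 0) ;; Loop (And (Lt (V y) (V 23)) (Nt (V r)))
    (bd ;; Cond (V 11) (Asg r (V y)) (Asg r (N 0)) ;; Asg y (Plus (V y) (N 4)))"

lemma run_FINDR:
  assumes T: "s 22 = t" "s 23 = t + 4 * k" "0 < t"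
    and W: "11 \<in> W" "y \<notin> W" "r \<notin> W" "y \<noteq> r" "{y, r} \<inter> {22, 23} = {}" "22 \<notin> W" "23 \<notin> W"
    and bd: "\<And>s' x. x \<in> recs t k \<Longrightarrow> s' y = x \<Longrightarrow> (\<And>z. z \<notin> W \<union> {y, r} \<Longrightarrow> s' z = s z) \<Longrightarrow>
      run bd s' h (c x) (\<lambda>s'' h''. h'' = h \<and> s'' 11 = of_bool (P x) \<and> (\<forall>z. z \<notin> W \<longrightarrow> s'' z = s' z))"
    and n: "(\<Sum>x\<in>recs t k. 1 + c x) \<le> n"
  shows "run (FINDR y r bd) s h n (\<lambda>s' h'. h' = h \<and>
    (s' r = 0 \<and> (\<forall>x\<in>recs t k. \<not> P x) \<or> s' r \<in> recs t k \<and> P (s' r)) \<and> (\<forall>z. z \<notin> W \<union> {y, r} \<longrightarrow> s' z = s z))"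
  unfolding FINDR_def run_Seq_Asg
proof (rule run_Loop[where I = "\<lambda>s' h'. h' = h \<and> (\<forall>z. z \<notin> W \<union> {y, r} \<longrightarrow> s' z = s z) \<and>
      (\<exists>j\<le>k. s' y = t + 4 * j \<and> (s' r = 0 \<and> (\<forall>i<j. \<not> P (t + 4 * i)) \<or> s' r \<in> recs t k \<and> P (s' r)))"
      and \<phi> = "\<lambda>s' h'. \<Sum>i = (s' y - t) div 4..<k. 1 + c (t + 4 * i)"])
  have "(\<Sum>i = 0..<k. 1 + c (t + 4 * i)) = (\<Sum>x\<in>recs t k. 1 + c x)"
    unfolding recs_def by (subst sum.reindex) (auto simp: inj_on_def lessThan_atLeast0)
  then show "(\<Sum>i = (((s(y := ev (V 22) s h))(r := ev (N 0) (s(y := ev (V 22) s h)) h)) y - t) div 4..<k. 1 + c (t + 4 * i)) \<le> n"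
    using n T by simp
next
  fix s' h' assume I: "h' = h \<and> (\<forall>z. z \<notin> W \<union> {y, r} \<longrightarrow> s' z = s z) \<and>
      (\<exists>j\<le>k. s' y = t + 4 * j \<and> (s' r = 0 \<and> (\<forall>i<j. \<not> P (t + 4 * i)) \<or> s' r \<in> recs t k \<and> P (s' r)))"
    and b: "ev (And (Lt (V y) (V 23)) (Nt (V r))) s' h' \<noteq> 0"
  then obtain j where j: "s' y = t + 4 * j" "j \<le> k"
    "s' r = 0 \<and> (\<forall>i<j. \<not> P (t + 4 * i)) \<or> s' r \<in> recs t k \<and> P (s' r)" by auto
  have s23: "s' 23 = t + 4 * k" using I W T by auto
  have jk: "j < k" "s' r = 0" using b j s23 by (auto split: if_splits)
  have j0: "\<forall>i<j. \<not> P (t + 4 * i)" using j(3) jk T(3) by (auto simp: recs_def)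
  have x: "t + 4 * j \<in> recs t k" using jk by (auto simp: recs_def)
  have sm: "(\<Sum>i = j..<k. 1 + c (t + 4 * i)) = 1 + c (t + 4 * j) + (\<Sum>i = Suc j..<k. 1 + c (t + 4 * i))"
    using jk by (simp add: sum.atLeast_Suc_lessThan)
  have rn: "run bd s' h (c (t + 4 * j)) (\<lambda>s'' h''. h'' = h \<and> s'' 11 = of_bool (P (t + 4 * j)) \<and> (\<forall>z. z \<notin> W \<longrightarrow> s'' z = s' z))"
    by (rule bd[where x = "t + 4 * j"]) (use x j(1) I in auto)
  show "\<exists>n. run (bd ;; Cond (V 11) (Asg r (V y)) (Asg r (N 0)) ;; Asg y (Plus (V y) (N 4))) s' h' n
    (\<lambda>s'' h'. (h' = h \<and> (\<forall>z. z \<notin> W \<union> {y, r} \<longrightarrow> s'' z = s z) \<and>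
      (\<exists>j\<le>k. s'' y = t + 4 * j \<and> (s'' r = 0 \<and> (\<forall>i<j. \<not> P (t + 4 * i)) \<or> s'' r \<in> recs t k \<and> P (s'' r)))) \<and>
      (\<Sum>i = (s'' y - t) div 4..<k. 1 + c (t + 4 * i)) + n + 1 \<le> (\<Sum>i = (s' y - t) div 4..<k. 1 + c (t + 4 * i)))"
  proof (intro exI, rule run_Seq')
    show "run bd s' h' (c (t + 4 * j)) (\<lambda>s'' h''. h'' = h \<and> s'' 11 = of_bool (P (t + 4 * j)) \<and> (\<forall>z. z \<notin> W \<longrightarrow> s'' z = s' z))"
      using rn I by simp
    show "c (t + 4 * j) + 0 \<le> c (t + 4 * j)" by simp
    fix s'' h'' assume q: "h'' = h \<and> s'' 11 = of_bool (P (t + 4 * j)) \<and> (\<forall>z. z \<notin> W \<longrightarrow> s'' z = s' z)"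
    then have sy: "s'' y = t + 4 * j" using W j by auto
    have "\<exists>l\<le>k. s'' y + 4 = t + 4 * l \<and> l = Suc j" using sy jk by (intro exI[of _ "Suc j"]) auto
    then show "run (Cond (V 11) (Asg r (V y)) (Asg r (N 0)) ;; Asg y (Plus (V y) (N 4))) s'' h'' 0
     (\<lambda>s'' h'. (h' = h \<and> (\<forall>z. z \<notin> W \<union> {y, r} \<longrightarrow> s'' z = s z) \<and>
      (\<exists>j\<le>k. s'' y = t + 4 * j \<and> (s'' r = 0 \<and> (\<forall>i<j. \<not> P (t + 4 * i)) \<or> s'' r \<in> recs t k \<and> P (s'' r)))) \<and>
      (\<Sum>i = (s'' y - t) div 4..<k. 1 + c (t + 4 * i)) + c (t + 4 * j) + 1 \<le> (\<Sum>i = (s' y - t) div 4..<k. 1 + c (t + 4 * i)))"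
      using q I j j0 x sy sm W by (cases "P (t + 4 * j)") (auto simp: less_Suc_eq intro!: exI[of _ "Suc j"])
  qed
next
  fix s' h' assume I: "h' = h \<and> (\<forall>z. z \<notin> W \<union> {y, r} \<longrightarrow> s' z = s z) \<and>
      (\<exists>j\<le>k. s' y = t + 4 * j \<and> (s' r = 0 \<and> (\<forall>i<j. \<not> P (t + 4 * i)) \<or> s' r \<in> recs t k \<and> P (s' r)))"
    and b: "ev (And (Lt (V y) (V 23)) (Nt (V r))) s' h' = 0"
  have s23: "s' 23 = t + 4 * k" using I W T by auto
  show "h' = h \<and> (s' r = 0 \<and> (\<forall>x\<in>recs t k. \<not> P x) \<or> s' r \<in> recs t k \<and> P (s' r)) \<and> (\<forall>z. z \<notin> W \<union> {y, r} \<longrightarrow> s' z = s z)"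
    using I b s23 by (auto simp: recs_def)
qed (use T W in auto)

lemma run_FINDR_agree:
  assumes T: "s 22 = t" "s 23 = t + 4 * k" "0 < t"
    and W: "11 \<in> W" "y \<notin> W" "r \<notin> W" "y \<noteq> r" "{y, r} \<inter> {22, 23} = {}" "22 \<notin> W" "23 \<notin> W"
    and bd: "\<And>s' x. x \<in> recs t k \<Longrightarrow> s' y = x \<Longrightarrow> agree (W \<union> {y, r}) s s' \<Longrightarrow>
      run bd s' h (c x) (\<lambda>s'' h''. h'' = h \<and> s'' 11 = of_bool (P x) \<and> agree W s' s'')"
    and n: "(\<Sum>x\<in>recs t k. 1 + c x) \<le> n"
  shows "run (FINDR y r bd) s h n (\<lambda>s' h'. h' = h \<and>
    (s' r = 0 \<and> (\<forall>x\<in>recs t k. \<not> P x) \<or> s' r \<in> recs t k \<and> P (s' r)) \<and> agree (W \<union> {y, r}) s s')"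
  unfolding agree_def
  by (rule run_FINDR[OF T W _ n]) (use bd in \<open>auto simp: agree_def\<close>)

definition HEAD :: com where
  "HEAD = FINDR 14 15 (Asg 61 (H (V 14)) ;; Asg 62 (H (Plus (V 14) (N 2))) ;; Asg 64 (N 0) ;; Asg 9 (V 62) ;; MATCH)"

definition PREFIX_CLASS :: com where
  "PREFIX_CLASS = FINDR 14 15 (Cond (Eq (H (Plus (V 14) (N 3))) (H (Plus (V 35) (N 3))))
     (Asg 61 (V 32) ;; Asg 62 (V 33) ;; Asg 64 (N 0) ;; Asg 5 (H (V 14)) ;; Asg 6 (H (Plus (V 14) (N 1))) ;;
      Asg 8 (N 0) ;; Asg 9 (V 33) ;; MATCH)
     (Asg 11 (N 0)))"

text \<open>The length is tested first: letters taken from a relation word beyond its part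
  \<open>Z\<close> would come from the head, where a match means nothing.\<close>

definition SUFFIX_CLASS :: com where
  "SUFFIX_CLASS = FINDR 14 15 (
     Cond (And (Eq (H (Plus (V 14) (N 3))) (H (Plus (V 35) (N 3))))
            (Nt (Lt (Minus (H (Plus (V 14) (N 1))) (H (Plus (V 14) (N 2)))) (V 43))))
     (Asg 61 (Minus (Plus (H (V 14)) (H (Plus (V 14) (N 1)))) (V 43)) ;; Asg 62 (V 43) ;; Asg 64 (N 0) ;;
      Asg 5 (H (V 42)) ;; Asg 6 (V 43) ;; Asg 8 (N 0) ;; Asg 9 (V 43) ;; MATCH)
     (Asg 11 (N 0)))"

text \<open>By \<open>act_length\<close> an active piece is a proper prefix of the head it
  completes, so the nonempty prefixes of heads are the only candidates. There are fewer than L of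
  them over all relation words when there are any relation words, and each is tested in
  O(L).\<close>

definition ACTIVE_WORD :: com where
  "ACTIVE_WORD = Asg 43 (N 1) ;; Asg 44 (N 0) ;;
    Loop (And (Lt (V 43) (H (Plus (V 42) (N 2)))) (Nt (V 44)))
     (Asg 61 (Plus (H (V 42)) (V 43)) ;; Asg 62 (Minus (H (Plus (V 42) (N 2))) (V 43)) ;; Asg 64 (N 0) ;;
      Asg 5 (V 24) ;; Asg 6 (V 25) ;; Asg 7 (V 26) ;; Asg 8 (V 27) ;; Asg 9 (V 62) ;; MATCH ;;
      Cond (V 11) SUFFIX_CLASS (Asg 15 (N 0)) ;;
      Cond (V 15) (Asg 44 (N 1)) (Asg 43 (Plus (V 43) (N 1))))"

text \<open>The second run of \<open>ACTIVE_WORD\<close> recovers the length in 43, about which the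
  specification of \<open>FINDR\<close> says nothing; it doubles the cost bound.\<close>

definition ACTIVE :: com where
  "ACTIVE = FINDR 42 41 (ACTIVE_WORD ;; Asg 11 (V 44)) ;;
    Cond (V 41) (Asg 42 (V 41) ;; ACTIVE_WORD) (Asg 43 (N 0))"

section \<open>Correctness and cost of the searches\<close>

locale word_problem = C4_presentation R for R :: "(nat list \<times> nat list) set" +
  assumes finite_R: "finite R"
begin

lemma finite_RW: "finite RW" using finite_R by (simp add: relation_words_def)

text \<open>The extra unit per word makes \<open>L\<close> a bound for the number of records as
  well.\<close>

definition L :: nat where "L = (\<Sum>w\<in>RW. Suc (length w))"

lemma length_le_L: "w \<in> RW \<Longrightarrow> Suc (length w) \<le> L"
  unfolding L_def by (rule member_le_sum[OF _ _ finite_RW]) auto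

lemma piece_length_le_L: assumes "piece R p" shows "length p \<le> L"
proof -
  have "p = [] \<or> (\<exists>w\<in>RW. \<exists>i. occurs_at p w i)" using assms unfolding piece_def by blast
  then show ?thesis
  proof
    assume "\<exists>w\<in>RW. \<exists>i. occurs_at p w i"
    then obtain w where w: "w \<in> RW" "length p \<le> length w" unfolding occurs_at_def by auto
    then show ?thesis using length_le_L[OF w(1)] by simp
  qed simp
qed

definition table :: "mem \<Rightarrow> nat \<Rightarrow> nat \<Rightarrow> bool" where
  "table h t k \<longleftrightarrow> 0 < t \<and> bij_betw (wd h) (recs t k) RW \<and> (\<forall>x\<in>recs t k. h (x + 2) = bl (wd h x)) \<and>
    (\<forall>x\<in>recs t k. \<forall>y\<in>recs t k. h (x + 3) = h (y + 3) \<longleftrightarrow> cls (wd h x) (wd h y))"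

lemma tableD:
  assumes "table h t k"
  shows "x \<in> recs t k \<Longrightarrow> wd h x \<in> RW" "S \<in> RW \<Longrightarrow> \<exists>x\<in>recs t k. wd h x = S"
    "x \<in> recs t k \<Longrightarrow> h (x + 2) = bl (wd h x)"
    "x \<in> recs t k \<Longrightarrow> y \<in> recs t k \<Longrightarrow> h (x + 3) = h (y + 3) \<longleftrightarrow> cls (wd h x) (wd h y)"
    "x \<in> recs t k \<Longrightarrow> y \<in> recs t k \<Longrightarrow> wd h x = wd h y \<longleftrightarrow> x = y"
    "(\<Sum>x\<in>recs t k. Suc (length (wd h x))) = L" "0 < t"
proof -
  have b: "bij_betw (wd h) (recs t k) RW" using assms by (simp add: table_def)
  show "x \<in> recs t k \<Longrightarrow> wd h x \<in> RW" using b by (auto simp: bij_betw_def)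
  show "S \<in> RW \<Longrightarrow> \<exists>x\<in>recs t k. wd h x = S" using b unfolding bij_betw_def by (metis imageE)
  show "x \<in> recs t k \<Longrightarrow> y \<in> recs t k \<Longrightarrow> wd h x = wd h y \<longleftrightarrow> x = y"
    using b unfolding bij_betw_def inj_on_def by blast
  show "(\<Sum>x\<in>recs t k. Suc (length (wd h x))) = L"
    unfolding L_def using sum.reindex_bij_betw[OF b, of "\<lambda>w. Suc (length w)"] .
qed (use assms in \<open>auto simp: table_def\<close>)

lemma length_wd: "length (wd h x) = h (x + 1)" by (simp add: wd_def)

lemma B_wd: "table h t k \<Longrightarrow> x \<in> recs t k \<Longrightarrow> seg h (h x) (h (x + 2)) = B (wd h x)"
  using tableD(3) bl_le[of "wd h x"] by (simp add: B_def wd_def take_seg min_def)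

lemma Z_wd: "table h t k \<Longrightarrow> x \<in> recs t k \<Longrightarrow> seg h (h x + h (x + 2)) (h (x + 1) - h (x + 2)) = Z (wd h x)"
  using tableD(3) by (simp add: Z_def wd_def drop_seg)

lemma run_HEAD:
  assumes T: "table h t k" "s 22 = t" "s 23 = t + 4 * k"
    and w: "w = str h (s 5) (s 6) (s 7) (s 8)" and n: "L \<le> n"
  shows "run HEAD s h n (\<lambda>s' h'. h' = h \<and>
    (s' 15 = 0 \<and> (\<forall>S. \<not> head S w 0) \<or> s' 15 \<in> recs t k \<and> head (wd h (s' 15)) w 0) \<and>
    agree {9, 10, 11, 12, 13, 14, 15, 61, 62, 64} s s')"
proof (rule run_mono)
  show "run HEAD s h n (\<lambda>s' h'. h' = h \<and>
    (s' 15 = 0 \<and> (\<forall>x\<in>recs t k. \<not> head (wd h x) w 0) \<or> s' 15 \<in> recs t k \<and> head (wd h (s' 15)) w 0) \<and>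
    agree ({9, 10, 11, 12, 13, 61, 62, 64} \<union> {14, 15}) s s')"
    unfolding HEAD_def
  proof (rule run_FINDR_agree[where c = "\<lambda>x. bl (wd h x)"], goal_cases)
    case (11 s' x)
    have fr: "s' z = s z" if "z \<notin> {9, 10, 11, 12, 13, 61, 62, 64, 14, 15}" for z using agreeD[OF 11(3)] that by simp
    have b: "h (x + 2) = bl (wd h x)" using tableD(3)[OF T(1) 11(1)] .
    let ?s = "s'(61 := h x, 62 := h (x + 2), 64 := 0, 9 := h (x + 2))"
    have "run MATCH ?s h (bl (wd h x)) (\<lambda>s'' h'. h' = h \<and> s'' 11 = of_bool (match (?s 9) (B (wd h x)) w) \<and>
      agree {10, 11, 12, 13} ?s s'')"
      by (rule run_MATCH_agree) (use 11 b B_wd[OF T(1) 11(1)] w fr in simp_all)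
    then have "run MATCH ?s h (bl (wd h x)) (\<lambda>s'' h'. h' = h \<and> s'' 11 = of_bool (head (wd h x) w 0) \<and>
      agree {9, 10, 11, 12, 13, 61, 62, 64} s' s'')"
      by (elim run_mono) (use tableD(1)[OF T(1) 11(1)] b in \<open>auto simp: match_prefix head_def occ_0 intro: agree_via\<close>)
    then show ?case using 11(2) by simp
  next
    case 12
    have "(\<Sum>x\<in>recs t k. 1 + bl (wd h x)) \<le> (\<Sum>x\<in>recs t k. Suc (length (wd h x)))"
      by (rule sum_mono) (simp add: bl_le)
    then show ?case using tableD(6)[OF T(1)] n by simp
  qed (use T tableD(7)[OF T(1)] in auto)
qed (use tableD(2)[OF T(1)] in \<open>auto dest: headD(1) intro: agree_via\<close>)

lemma run_PREFIX_CLASS: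
  assumes T: "table h t k" "s 22 = t" "s 23 = t + 4 * k" and r: "s 35 \<in> recs t k"
    and n: "L * Suc (s 33) \<le> n"
  shows "run PREFIX_CLASS s h n (\<lambda>s' h'. h' = h \<and>
    (s' 15 \<noteq> 0 \<longleftrightarrow> (\<exists>P. cls (wd h (s 35)) P \<and> prefix (seg h (s 32) (s 33)) P)) \<and>
    agree {5, 6, 8, 9, 10, 11, 12, 13, 14, 15, 61, 62, 64} s s')"
proof (rule run_mono)
  let ?p = "seg h (s 32) (s 33)"
  let ?P = "\<lambda>x. cls (wd h (s 35)) (wd h x) \<and> prefix ?p (wd h x)"
  show "run PREFIX_CLASS s h n (\<lambda>s' h'. h' = h \<and>
    (s' 15 = 0 \<and> (\<forall>x\<in>recs t k. \<not> ?P x) \<or> s' 15 \<in> recs t k \<and> ?P (s' 15)) \<and>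
    agree ({5, 6, 8, 9, 10, 11, 12, 13, 61, 62, 64} \<union> {14, 15}) s s')"
    unfolding PREFIX_CLASS_def
  proof (rule run_FINDR_agree[where c = "\<lambda>x. s 33"], goal_cases)
    case (11 s' x)
    have fr: "s' z = s z" if "z \<notin> {5, 6, 8, 9, 10, 11, 12, 13, 61, 62, 64, 14, 15}" for z using agreeD[OF 11(3)] that by simp
    have c: "h (x + 3) = h (s 35 + 3) \<longleftrightarrow> cls (wd h (s 35)) (wd h x)"
      using tableD(4)[OF T(1) r 11(1)] by metis
    let ?s = "s'(61 := s 32, 62 := s 33, 64 := 0, 5 := h x, 6 := h (x + 1), 8 := 0, 9 := s 33)"
    have "run MATCH ?s h (s 33) (\<lambda>s'' h'. h' = h \<and> s'' 11 = of_bool (match (?s 9) ?p (wd h x)) \<and>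
      agree {10, 11, 12, 13} ?s s'')"
      by (rule run_MATCH_agree) (use 11 fr in \<open>simp_all add: wd_def\<close>)
    then have "run MATCH ?s h (s 33) (\<lambda>s'' h'. h' = h \<and> s'' 11 = of_bool (prefix ?p (wd h x)) \<and>
      agree {5, 6, 8, 9, 10, 11, 12, 13, 61, 62, 64} s' s'')"
      by (elim run_mono) (auto simp: match_prefix intro: agree_via)
    then show ?case using 11(2) fr c by simp
  next
    case 12
    have "card (recs t k) \<le> (\<Sum>x\<in>recs t k. Suc (length (wd h x)))"
      unfolding card_eq_sum by (rule sum_mono) simp
    then have "card (recs t k) * Suc (s 33) \<le> L * Suc (s 33)" using tableD(6)[OF T(1)] by (intro mult_le_mono1) simp
    then show ?case using n by simp
  qed (use T tableD(7)[OF T(1)] in auto)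
  fix s' h'
  assume a: "h' = h \<and> (s' 15 = 0 \<and> (\<forall>x\<in>recs t k. \<not> ?P x) \<or> s' 15 \<in> recs t k \<and> ?P (s' 15)) \<and>
    agree ({5, 6, 8, 9, 10, 11, 12, 13, 61, 62, 64} \<union> {14, 15}) s s'"
  have "0 \<notin> recs t k" using tableD(7)[OF T(1)] by (auto simp: recs_def)
  moreover have "(\<exists>P. cls (wd h (s 35)) P \<and> prefix ?p P) \<longleftrightarrow> (\<exists>x\<in>recs t k. ?P x)"
    using tableD(2)[OF T(1)] cls_RW tableD(1)[OF T(1) r] by metis
  ultimately show "h' = h \<and> (s' 15 \<noteq> 0 \<longleftrightarrow> (\<exists>P. cls (wd h (s 35)) P \<and> prefix ?p P)) \<and>
    agree {5, 6, 8, 9, 10, 11, 12, 13, 14, 15, 61, 62, 64} s s'"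
    using a by (cases "s' 15 = 0") (auto intro: agree_via)
qed simp

lemma run_SUFFIX_CLASS:
  assumes T: "table h t k" "s 22 = t" "s 23 = t + 4 * k" and r: "s 35 \<in> recs t k"
    and x: "s 42 \<in> recs t k" "s 43 \<le> bl (wd h (s 42))" and n: "L \<le> n"
  shows "run SUFFIX_CLASS s h n (\<lambda>s' h'. h' = h \<and>
    (s' 15 \<noteq> 0 \<longleftrightarrow> (\<exists>P. cls (wd h (s 35)) P \<and> suffix (take (s 43) (wd h (s 42))) (Z P))) \<and>
    agree {5, 6, 8, 9, 10, 11, 12, 13, 14, 15, 61, 62, 64} s s')"
proof (rule run_mono)
  let ?p = "take (s 43) (wd h (s 42))"
  have lp: "length ?p = s 43" using x(2) bl_le[of "wd h (s 42)"] by simp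
  have p: "?p = seg h (h (s 42)) (s 43)" using x(2) bl_le[of "wd h (s 42)"] by (simp add: wd_def take_seg min_def)
  let ?P = "\<lambda>x. cls (wd h (s 35)) (wd h x) \<and> suffix ?p (Z (wd h x))"
  show "run SUFFIX_CLASS s h n (\<lambda>s' h'. h' = h \<and>
    (s' 15 = 0 \<and> (\<forall>x\<in>recs t k. \<not> ?P x) \<or> s' 15 \<in> recs t k \<and> ?P (s' 15)) \<and>
    agree ({5, 6, 8, 9, 10, 11, 12, 13, 61, 62, 64} \<union> {14, 15}) s s')"
    unfolding SUFFIX_CLASS_def
  proof (rule run_FINDR_agree[where c = "\<lambda>x. length (wd h x)"], goal_cases)
    case (11 s' x)
    have fr: "s' z = s z" if "z \<notin> {5, 6, 8, 9, 10, 11, 12, 13, 61, 62, 64, 14, 15}" for z using agreeD[OF 11(3)] that by simp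
    have c: "h (x + 3) = h (s 35 + 3) \<longleftrightarrow> cls (wd h (s 35)) (wd h x)"
      using tableD(4)[OF T(1) r 11(1)] by metis
    have b: "h (x + 2) = bl (wd h x)" and lx: "h (x + 1) = length (wd h x)"
      using tableD(3)[OF T(1) 11(1)] by (simp_all add: length_wd)
    have zl: "length (Z (wd h x)) = h (x + 1) - h (x + 2)" using b lx by (simp add: Z_def)
    let ?s = "s'(61 := h x + h (x + 1) - s 43, 62 := s 43, 64 := 0, 5 := h (s 42), 6 := s 43, 8 := 0, 9 := s 43)"
    have m: "run MATCH ?s h (length (wd h x)) (\<lambda>s'' h'. h' = h \<and> s'' 11 = of_bool (suffix ?p (Z (wd h x))) \<and>
      agree {5, 6, 8, 9, 10, 11, 12, 13, 61, 62, 64} s' s'')"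
      if le: "s 43 \<le> h (x + 1) - h (x + 2)"
    proof -
      let ?q = "seg h (h x + h (x + 1) - s 43) (s 43)"
      have "?q = drop (h (x + 1) - h (x + 2) - s 43) (Z (wd h x))"
        using le bl_le[of "wd h x"] b lx unfolding Z_wd[OF T(1) 11(1), symmetric] drop_seg
        by (intro arg_cong2[where f = "seg h"]) auto
      then have q: "suffix ?q (Z (wd h x))" by (metis suffix_drop)
      have "run MATCH ?s h (length (wd h x)) (\<lambda>s'' h'. h' = h \<and> s'' 11 = of_bool (match (?s 9) ?q ?p) \<and>
        agree {10, 11, 12, 13} ?s s'')"
        by (rule run_MATCH_agree) (use 11 fr p le lx in simp_all)
      moreover have "match (s 43) ?q ?p \<longleftrightarrow> suffix ?p (Z (wd h x))"
      proof -
        have "match (s 43) ?q ?p \<longleftrightarrow> ?q = ?p" using lp by (simp add: match_def)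
        also have "\<dots> \<longleftrightarrow> suffix ?p (Z (wd h x))"
        proof
          assume "suffix ?p (Z (wd h x))"
          then have "suffix ?q ?p" by (rule suffix_length_suffix[OF q]) (simp only: lp length_seg)
          then obtain y where "?p = y @ ?q" unfolding suffix_def by blast
          moreover from arg_cong[OF this, of length] have "y = []" unfolding length_append lp length_seg by simp
          ultimately show "?q = ?p" by simp
        qed (use q in simp)
        finally show ?thesis .
      qed
      ultimately show ?thesis by (elim run_mono) (auto intro: agree_via)
    qed
    have "\<not> suffix ?p (Z (wd h x))" if "\<not> s 43 \<le> h (x + 1) - h (x + 2)"
      using that lp zl suffix_length_le by metis
    then show ?case using 11(2) fr c m by (auto simp: not_less)
  next
    case 12
    show ?case using tableD(6)[OF T(1)] n by simp
  qed (use T tableD(7)[OF T(1)] in auto)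
  fix s' h'
  assume a: "h' = h \<and> (s' 15 = 0 \<and> (\<forall>x\<in>recs t k. \<not> ?P x) \<or> s' 15 \<in> recs t k \<and> ?P (s' 15)) \<and>
    agree ({5, 6, 8, 9, 10, 11, 12, 13, 61, 62, 64} \<union> {14, 15}) s s'"
  have "0 \<notin> recs t k" using tableD(7)[OF T(1)] by (auto simp: recs_def)
  moreover have "(\<exists>P. cls (wd h (s 35)) P \<and> suffix ?p (Z P)) \<longleftrightarrow> (\<exists>x\<in>recs t k. ?P x)"
    using tableD(2)[OF T(1)] cls_RW tableD(1)[OF T(1) r] by metis
  ultimately show "h' = h \<and> (s' 15 \<noteq> 0 \<longleftrightarrow> (\<exists>P. cls (wd h (s 35)) P \<and> suffix ?p (Z P))) \<and>
    agree {5, 6, 8, 9, 10, 11, 12, 13, 14, 15, 61, 62, 64} s s'"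
    using a by (cases "s' 15 = 0") (auto intro: agree_via)
qed simp

text \<open>The record form of \<open>act\<close>: the candidate consists of the first l letters of
  the word at x. Being a suffix of some \<open>Z P\<close> makes it a piece.\<close>

definition active_at :: "mem \<Rightarrow> nat list \<Rightarrow> nat \<Rightarrow> nat \<Rightarrow> nat \<Rightarrow> bool" where
  "active_at h w r x l \<longleftrightarrow> 0 < l \<and> l < bl (wd h x) \<and> prefix (drop l (B (wd h x))) w \<and>
    (\<exists>P. cls (wd h r) P \<and> suffix (take l (wd h x)) (Z P))"

lemma run_ACTIVE_WORD:
  assumes T: "table h t k" "s 22 = t" "s 23 = t + 4 * k" and r: "s 35 \<in> recs t k"
    and x: "s 42 \<in> recs t k" and w: "w = str h (s 24) (s 25) (s 26) (s 27)"
    and n: "bl (wd h (s 42)) * Suc (2 * L) \<le> n"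
  shows "run ACTIVE_WORD s h n (\<lambda>s' h'. h' = h \<and>
    (s' 44 = 0 \<and> (\<forall>l. \<not> active_at h w (s 35) (s 42) l) \<or> s' 44 = 1 \<and> active_at h w (s 35) (s 42) (s' 43)) \<and>
    agree {5, 6, 7, 8, 9, 10, 11, 12, 13, 14, 15, 43, 44, 61, 62, 64} s s')"
proof -
  \<comment> \<open>The price of one candidate: L for comparing the rest of the head, L for the
    search in the class, 1 for the iteration.\<close>
  define K where "K = Suc (2 * L)"
  show ?thesis
    unfolding ACTIVE_WORD_def run_Seq_Asg
proof (rule run_Loop[where I = "\<lambda>s' h'. h' = h \<and> 0 < s' 43 \<and>
    (s' 44 = 0 \<and> (\<forall>l < s' 43. \<not> active_at h w (s 35) (s 42) l) \<or> s' 44 = 1 \<and> active_at h w (s 35) (s 42) (s' 43)) \<and>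
    agree {5, 6, 7, 8, 9, 10, 11, 12, 13, 14, 15, 43, 44, 61, 62, 64} s s'"
    and \<phi> = "\<lambda>s' h'. if s' 44 = 0 then (bl (wd h (s 42)) - s' 43) * K else 0"], goal_cases)
  case 2
  have "(bl (wd h (s 42)) - 1) * K \<le> n"
    using n unfolding K_def[symmetric] by (rule dual_order.trans) (rule mult_le_mono1, simp)
  then show ?case by simp
next
  case (3 s' h')
  let ?x = "wd h (s 42)"
  note b = tableD(3)[OF T(1) x] and xR = tableD(1)[OF T(1) x]
  have fr: "s' z = s z" if "z \<notin> {5, 6, 7, 8, 9, 10, 11, 12, 13, 14, 15, 43, 44, 61, 62, 64}" for z
    using agreeD[of _ s s'] 3(1) that by blast
  have ag: "agree {5, 6, 7, 8, 9, 10, 11, 12, 13, 14, 15, 43, 44, 61, 62, 64} s s'" using 3(1) by simp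
  have h: "h' = h" using 3(1) by simp
  have c: "s' 44 = 0" "s' 43 < bl ?x" "0 < s' 43" "\<And>l. l < s' 43 \<Longrightarrow> \<not> active_at h w (s 35) (s 42) l"
    using 3 b fr by (auto split: if_splits)
  let ?l = "s' 43"
  have pd: "(bl ?x - ?l) * K = K + (bl ?x - Suc ?l) * K"
    using c(2) by (metis Suc_diff_Suc mult_Suc)
  have blL: "bl ?x - ?l \<le> L" using length_le_L[OF xR] bl_le[of ?x] by linarith
  have sB: "seg h (h (s 42) + ?l) (bl ?x - ?l) = drop ?l (B ?x)"
    using B_wd[OF T(1) x] b by (metis drop_seg)
  show ?case
  proof (intro exI[of _ "2 * L"], simp only: exec_simps h, rule run_MATCH_Seq[where m = L], goal_cases)
    case (1 s1)
    have "s1 11 = of_bool (match (bl ?x - ?l) (seg h (h (s 42) + ?l) (bl ?x - ?l)) (str h (s 24) (s 25) (s 26) (s 27)))"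
      using 1(2) by (simp add: fr b[simplified])
    moreover have "match (bl ?x - ?l) (drop ?l (B ?x)) w \<longleftrightarrow> prefix (drop ?l (B ?x)) w"
      by (rule match_prefix) simp
    ultimately have m: "s1 11 = of_bool (prefix (drop ?l (B ?x)) w)"
      unfolding sB w[symmetric] by simp
    have f1: "s1 z = s' z" if "z \<notin> {5, 6, 7, 8, 9, 10, 11, 12, 13, 61, 62, 64}" for z using agreeD[OF 1(1)] that by simp
    have rest: "run (Cond (V 15) (Asg 44 (N 1)) (Asg 43 (Plus (V 43) (N 1)))) s2 h 0 (\<lambda>s' h'.
        (h' = h \<and> 0 < s' 43 \<and> (s' 44 = 0 \<and> (\<forall>l < s' 43. \<not> active_at h w (s 35) (s 42) l) \<or>
          s' 44 = 1 \<and> active_at h w (s 35) (s 42) (s' 43)) \<and>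
        agree {5, 6, 7, 8, 9, 10, 11, 12, 13, 14, 15, 43, 44, 61, 62, 64} s s') \<and>
        (if s' 44 = 0 then (bl ?x - s' 43) * K else 0) + 2 * L + 1
          \<le> (if c44 = 0 then (bl ?x - c43) * K else 0))"
      if s2: "agree {5, 6, 7, 8, 9, 10, 11, 12, 13, 14, 15, 61, 62, 64} s' s2"
        "s2 15 \<noteq> 0 \<longleftrightarrow> active_at h w (s 35) (s 42) ?l" "c44 = 0" "c43 = ?l" for s2 c44 c43
    proof -
      have fz: "agree {5, 6, 7, 8, 9, 10, 11, 12, 13, 14, 15, 43, 44, 61, 62, 64} s s2"
        by (rule agree_via[OF s2(1) _ ag]) auto
      have KL: "2 * L + 1 = K" "K \<le> (bl ?x - ?l) * K" using pd by (simp_all add: K_def)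
      have s44: "s2 43 = ?l" "s2 44 = 0" using agreeD[OF s2(1)] c(1) by simp_all
      show ?thesis
      proof (cases "s2 15 = 0")
        case True
        then show ?thesis using s2(2) c(3,4) s44 pd KL(1)
          by (simp add: s2(3,4) fz less_Suc_eq)
      next
        case False
        then show ?thesis using s2(2) c(3) s44 KL
          by (simp add: s2(3,4) fz)
      qed
    qed
    have acl: "active_at h w (s 35) (s 42) ?l \<longleftrightarrow> prefix (drop ?l (B ?x)) w \<and>
        (\<exists>P. cls (wd h (s 35)) P \<and> suffix (take ?l ?x) (Z P))"
      using c unfolding active_at_def by simp
    have ag1: "agree {5, 6, 7, 8, 9, 10, 11, 12, 13, 14, 15, 61, 62, 64} s' s1"
      by (rule agree_via[OF 1(1)]) simp_all
    show ?case
    proof (cases "s1 11 = 0")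
      case True
      then have "(s1(15 := 0)) 15 \<noteq> 0 \<longleftrightarrow> active_at h w (s 35) (s 42) ?l" using m acl by simp
      from rest[of "s1(15 := 0)" "s' 44" "s' 43", OF _ this c(1) HOL.refl] ag1 True show ?thesis by simp
    next
      case False
      then have pf: "prefix (drop ?l (B ?x)) w" using m by (auto split: if_splits)
      show ?thesis
        unfolding run_Seq_Cond ev.simps if_P[OF False]
      proof (rule run_Seq')
        show "run SUFFIX_CLASS s1 h L (\<lambda>s' h'. h' = h \<and>
          (s' 15 \<noteq> 0 \<longleftrightarrow> (\<exists>P. cls (wd h (s1 35)) P \<and> suffix (take (s1 43) (wd h (s1 42))) (Z P))) \<and>
          agree {5, 6, 8, 9, 10, 11, 12, 13, 14, 15, 61, 62, 64} s1 s')"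
          by (rule run_SUFFIX_CLASS[OF T(1)]) (simp_all add: f1 fr T r x less_imp_le[OF c(2)])
        fix s2 h2
        assume q: "h2 = h \<and> (s2 15 \<noteq> 0 \<longleftrightarrow> (\<exists>P. cls (wd h (s1 35)) P \<and> suffix (take (s1 43) (wd h (s1 42))) (Z P))) \<and>
          agree {5, 6, 8, 9, 10, 11, 12, 13, 14, 15, 61, 62, 64} s1 s2"
        have ag2: "agree {5, 6, 7, 8, 9, 10, 11, 12, 13, 14, 15, 61, 62, 64} s' s2"
          by (rule agree_via[OF _ _ ag1]) (use q in auto)
        have "s2 15 \<noteq> 0 \<longleftrightarrow> active_at h w (s 35) (s 42) ?l" using q acl pf by (simp add: f1 fr)
        from rest[of s2 "s' 44" "s' 43", OF ag2 this c(1) HOL.refl] q show "run (Cond (V 15) (Asg 44 (N 1)) (Asg 43 (Plus (V 43) (N 1)))) s2 h2 0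
          (\<lambda>s'a h'. (h' = h \<and> 0 < s'a 43 \<and> (s'a 44 = 0 \<and> (\<forall>l<s'a 43. \<not> active_at h w (s 35) (s 42) l) \<or>
            s'a 44 = 1 \<and> active_at h w (s 35) (s 42) (s'a 43)) \<and>
            agree {5, 6, 7, 8, 9, 10, 11, 12, 13, 14, 15, 43, 44, 61, 62, 64} s s'a) \<and>
            (if s'a 44 = 0 then (bl ?x - s'a 43) * K else 0) + 2 * L + 1 \<le> (if s' 44 = 0 then (bl ?x - s' 43) * K else 0))"
          by simp
      qed simp
    qed
  qed (use blL b fr in simp)
next
  case (4 s' h')
  have s42: "s' 42 = s 42"
    using agreeD[of "{5, 6, 7, 8, 9, 10, 11, 12, 13, 14, 15, 43, 44, 61, 62, 64}" s s' 42] 4(1) by simp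
  show ?case
  proof (cases "s' 44 = 0")
    case True
    then have ge: "bl (wd h (s 42)) \<le> s' 43" using 4 s42 tableD(3)[OF T(1) x] by auto
    have "\<not> active_at h w (s 35) (s 42) l" for l
    proof (cases "l < s' 43")
      case False
      then show ?thesis using ge by (simp add: active_at_def)
    qed (use 4(1) True in auto)
    then show ?thesis using 4(1) True by simp
  qed (use 4(1) in auto)
qed (auto simp: active_at_def)
qed

lemma run_ACTIVE:
  assumes T: "table h t k" "s 22 = t" "s 23 = t + 4 * k" and r: "s 35 \<in> recs t k"
    and w: "w = str h (s 24) (s 25) (s 26) (s 27)" and n: "2 * (L * Suc (2 * L)) \<le> n"
  shows "run ACTIVE s h n (\<lambda>s' h'. h' = h \<and>
    (s' 43 = 0 \<and> (\<forall>x\<in>recs t k. \<forall>l. \<not> active_at h w (s 35) x l) \<or>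
      s' 42 \<in> recs t k \<and> active_at h w (s 35) (s' 42) (s' 43)) \<and>
    agree {5, 6, 7, 8, 9, 10, 11, 12, 13, 14, 15, 41, 42, 43, 44, 61, 62, 64} s s')"
  unfolding ACTIVE_def
proof (rule run_Seq')
  let ?W = "{5, 6, 7, 8, 9, 10, 11, 12, 13, 14, 15, 43, 44, 61, 62, 64} :: nat set"
  let ?P = "\<lambda>x. \<exists>l. active_at h w (s 35) x l"
  have bL: "bl (wd h x) * Suc (2 * L) \<le> length (wd h x) * Suc (2 * L)" for x
    by (rule mult_le_mono1) (rule bl_le)
  show "run (FINDR 42 41 (ACTIVE_WORD ;; Asg 11 (V 44))) s h (L * Suc (2 * L)) (\<lambda>s' h'. h' = h \<and>
    (s' 41 = 0 \<and> (\<forall>x\<in>recs t k. \<not> ?P x) \<or> s' 41 \<in> recs t k \<and> ?P (s' 41)) \<and>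
    agree (?W \<union> {42, 41}) s s')"
  proof (rule run_FINDR_agree[where c = "\<lambda>x. bl (wd h x) * Suc (2 * L)"], goal_cases)
    case (11 s' x)
    have fr: "s' z = s z" if "z \<notin> ?W \<union> {42, 41}" for z using agreeD[OF 11(3)] that by simp
    show ?case
    proof (rule run_Seq')
      show "run ACTIVE_WORD s' h (bl (wd h x) * Suc (2 * L)) (\<lambda>s'' h'. h' = h \<and>
        (s'' 44 = 0 \<and> (\<forall>l. \<not> active_at h w (s' 35) (s' 42) l) \<or> s'' 44 = 1 \<and> active_at h w (s' 35) (s' 42) (s'' 43)) \<and>
        agree ?W s' s'')"
        by (rule run_ACTIVE_WORD[OF T(1)]) (use 11 fr T r w in auto)
      show "bl (wd h x) * Suc (2 * L) + 0 \<le> bl (wd h x) * Suc (2 * L)" by simp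
      fix s2 h2
      assume "h2 = h \<and> (s2 44 = 0 \<and> (\<forall>l. \<not> active_at h w (s' 35) (s' 42) l) \<or> s2 44 = 1 \<and> active_at h w (s' 35) (s' 42) (s2 43)) \<and>
        agree ?W s' s2"
      then show "run (Asg 11 (V 44)) s2 h2 0 (\<lambda>s'' h''. h'' = h \<and> s'' 11 = of_bool (?P x) \<and> agree ?W s' s'')"
        using 11(2) fr[of 35] by auto
    qed
  next
    case 12
    have "(\<Sum>x\<in>recs t k. 1 + bl (wd h x) * Suc (2 * L)) \<le> (\<Sum>x\<in>recs t k. Suc (length (wd h x)) * Suc (2 * L))"
    proof (rule sum_mono)
      fix x show "1 + bl (wd h x) * Suc (2 * L) \<le> Suc (length (wd h x)) * Suc (2 * L)"
        using bL[of x] unfolding mult_Suc[of "length (wd h x)"] by (intro add_mono) simp_all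
    qed
    also have "\<dots> = L * Suc (2 * L)" unfolding tableD(6)[OF T(1), symmetric] sum_distrib_right by simp
    finally show ?case .
  qed (use T tableD(7)[OF T(1)] in auto)
  show "L * Suc (2 * L) + L * Suc (2 * L) \<le> n" using n by simp
  fix s1 h1 assume a: "h1 = h \<and>
    (s1 41 = 0 \<and> (\<forall>x\<in>recs t k. \<not> ?P x) \<or> s1 41 \<in> recs t k \<and> ?P (s1 41)) \<and>
    agree (?W \<union> {42, 41}) s s1"
  have fr: "s1 z = s z" if "z \<notin> ?W \<union> {42, 41}" for z using agreeD[of _ s s1] a that by blast
  have ag: "agree {5, 6, 7, 8, 9, 10, 11, 12, 13, 14, 15, 41, 42, 43, 44, 61, 62, 64} s s1"
    by (rule agree_via[of "?W \<union> {42, 41}" s]) (use a in auto)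
  show "run (Cond (V 41) (Asg 42 (V 41) ;; ACTIVE_WORD) (Asg 43 (N 0))) s1 h1 (L * Suc (2 * L)) (\<lambda>s' h'. h' = h \<and>
    (s' 43 = 0 \<and> (\<forall>x\<in>recs t k. \<forall>l. \<not> active_at h w (s 35) x l) \<or>
      s' 42 \<in> recs t k \<and> active_at h w (s 35) (s' 42) (s' 43)) \<and>
    agree {5, 6, 7, 8, 9, 10, 11, 12, 13, 14, 15, 41, 42, 43, 44, 61, 62, 64} s s')"
  proof (cases "s1 41 = 0")
    case True
    have "0 \<notin> recs t k" using tableD(7)[OF T(1)] by (auto simp: recs_def)
    then show ?thesis using True a ag by auto
  next
    case False
    then have x: "s1 41 \<in> recs t k" "?P (s1 41)" using a by auto
    let ?s = "s1(42 := s1 41)"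
    have "run ACTIVE_WORD ?s h (L * Suc (2 * L)) (\<lambda>s' h'. h' = h \<and>
      (s' 44 = 0 \<and> (\<forall>l. \<not> active_at h w (?s 35) (?s 42) l) \<or> s' 44 = 1 \<and> active_at h w (?s 35) (?s 42) (s' 43)) \<and>
      agree ?W ?s s')"
    proof (rule run_ACTIVE_WORD[OF T(1)])
      have "bl (wd h (s1 41)) \<le> L" using length_le_L[OF tableD(1)[OF T(1) x(1)]] bl_le[of "wd h (s1 41)"] by linarith
      then show "bl (wd h (?s 42)) * Suc (2 * L) \<le> L * Suc (2 * L)" unfolding fun_upd_same by (rule mult_le_mono1)
    qed (use fr T r w x in auto)
    then have "run ACTIVE_WORD ?s h (L * Suc (2 * L)) (\<lambda>s' h'. h' = h \<and>
      (s' 43 = 0 \<and> (\<forall>x\<in>recs t k. \<forall>l. \<not> active_at h w (s 35) x l) \<or>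
        s' 42 \<in> recs t k \<and> active_at h w (s 35) (s' 42) (s' 43)) \<and>
      agree {5, 6, 7, 8, 9, 10, 11, 12, 13, 14, 15, 41, 42, 43, 44, 61, 62, 64} s s')"
    proof (rule run_mono[OF _ order_refl], goal_cases)
      case (1 s2 h2)
      have s2: "s2 42 = s1 41" using agreeD[of ?W ?s s2 42] 1 by simp
      have "agree {5, 6, 7, 8, 9, 10, 11, 12, 13, 14, 15, 41, 42, 43, 44, 61, 62, 64} s s2"
        by (rule agree_via[of ?W ?s]) (use 1 ag in auto)
      then show ?case using 1 s2 x fr[of 35] by auto
    qed
    then show ?thesis using False a by simp
  qed
qed

end

section \<open>The main loop\<close>

declare One_nat_def [simp del] add_2_eq_Suc [simp del] add_2_eq_Suc' [simp del]

text \<open>The truncated difference of 36 and 25 is the number of letters taken from the second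
  segment. The length in 25 is changed last because the other assignments read it.\<close>

definition DROP_U :: com where
  "DROP_U = Asg 24 (Plus (V 24) (V 36)) ;; Asg 26 (Plus (V 26) (Minus (V 36) (V 25))) ;;
    Asg 27 (Minus (V 27) (Minus (V 36) (V 25))) ;; Asg 25 (Minus (V 25) (V 36))"

definition DROP_V :: com where
  "DROP_V = Asg 28 (Plus (V 28) (V 36)) ;; Asg 30 (Plus (V 30) (Minus (V 36) (V 29))) ;;
    Asg 31 (Minus (V 31) (Minus (V 36) (V 29))) ;; Asg 29 (Minus (V 29) (V 36))"

definition drop_u :: "mem \<Rightarrow> mem" where
  "drop_u s = s(24 := s 24 + s 36, 26 := s 26 + (s 36 - s 25), 27 := s 27 - (s 36 - s 25), 25 := s 25 - s 36)"

definition drop_v :: "mem \<Rightarrow> mem" where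
  "drop_v s = s(28 := s 28 + s 36, 30 := s 30 + (s 36 - s 29), 31 := s 31 - (s 36 - s 29), 29 := s 29 - s 36)"

lemma run_DROP [simp]:
  "run (DROP_U ;; c) s h n Q \<longleftrightarrow> run c (drop_u s) h n Q"
  "run (DROP_V ;; c) s h n Q \<longleftrightarrow> run c (drop_v s) h n Q"
  "run DROP_U s h n Q \<longleftrightarrow> Q (drop_u s) h"
  "run DROP_V s h n Q \<longleftrightarrow> Q (drop_v s) h"
  by (simp_all add: DROP_U_def DROP_V_def drop_u_def drop_v_def)

text \<open>The current words are \<open>AU @ UU\<close> and \<open>AV @ VV\<close>; the word \<open>PW\<close> is a prefix still to be exposed.\<close>

definition "AU h s = seg h (s (24 :: nat)) (s 25)"
definition "UU h s = seg h (s (26 :: nat)) (s 27)"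
definition "AV h s = seg h (s (28 :: nat)) (s 29)"
definition "VV h s = seg h (s (30 :: nat)) (s 31)"
definition "PW h s = seg h (s (32 :: nat)) (s 33)"

lemmas state_defs = AU_def UU_def AV_def VV_def PW_def

lemma drop_u_simps [simp]:
  "AU h (drop_u s) = drop (s 36) (AU h s)"
  "UU h (drop_u s) = drop (s 36 - s 25) (UU h s)"
  "AV h (drop_u s) = AV h s" "VV h (drop_u s) = VV h s" "PW h (drop_u s) = PW h s"
  "z \<notin> {24, 25, 26, 27} \<Longrightarrow> drop_u s z = s z"
  "drop_u s 25 = s 25 - s 36" "drop_u s 27 = s 27 - (s 36 - s 25)"
  by (auto simp: state_defs drop_u_def drop_seg)

lemma drop_v_simps [simp]:
  "AV h (drop_v s) = drop (s 36) (AV h s)"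
  "VV h (drop_v s) = drop (s 36 - s 29) (VV h s)"
  "AU h (drop_v s) = AU h s" "UU h (drop_v s) = UU h s" "PW h (drop_v s) = PW h s"
  "z \<notin> {28, 29, 30, 31} \<Longrightarrow> drop_v s z = s z"
  "drop_v s 29 = s 29 - s 36" "drop_v s 31 = s 31 - (s 36 - s 29)"
  by (auto simp: state_defs drop_v_def drop_seg)

lemma state_upd [simp]:
  "z \<notin> {24, 25} \<Longrightarrow> AU h (s(z := a)) = AU h s"
  "z \<notin> {26, 27} \<Longrightarrow> UU h (s(z := a)) = UU h s"
  "z \<notin> {28, 29} \<Longrightarrow> AV h (s(z := a)) = AV h s"
  "z \<notin> {30, 31} \<Longrightarrow> VV h (s(z := a)) = VV h s"
  "z \<notin> {32, 33} \<Longrightarrow> PW h (s(z := a)) = PW h s"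
  by (auto simp: state_defs)

lemma state_agree:
  assumes "agree W s s'"
  shows "W \<inter> {24, 25} = {} \<Longrightarrow> AU h s' = AU h s" "W \<inter> {26, 27} = {} \<Longrightarrow> UU h s' = UU h s"
    "W \<inter> {28, 29} = {} \<Longrightarrow> AV h s' = AV h s" "W \<inter> {30, 31} = {} \<Longrightarrow> VV h s' = VV h s"
    "W \<inter> {32, 33} = {} \<Longrightarrow> PW h s' = PW h s"
  using agreeD[OF assms] by (auto simp: state_defs)

lemma length_state: "length (AU h s) = s 25" "length (UU h s) = s 27" "length (AV h s) = s 29"
  "length (VV h s) = s 31" "length (PW h s) = s 33"
  by (simp_all add: state_defs)

lemma str_state: "str h (s 24) (s 25) (s 26) (s 27) = AU h s @ UU h s"
  "str h (s 28) (s 29) (s 30) (s 31) = AV h s @ VV h s"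
  by (simp_all add: state_defs str_def)

text \<open>The nested difference assigned to 9 is the minimum of 36 and 33: only the part of the
  piece that falls on the letters read is compared.\<close>

definition STEP :: com where
  "STEP = Asg 61 (V 24) ;; Asg 62 (V 25) ;; Asg 63 (V 26) ;; Asg 64 (V 27) ;;
    Asg 5 (V 28) ;; Asg 6 (V 29) ;; Asg 7 (V 30) ;; Asg 8 (V 31) ;; Asg 9 (V 36) ;; MATCH ;; Asg 40 (V 11) ;;
    Asg 61 (V 32) ;; Asg 62 (V 33) ;; Asg 64 (N 0) ;;
    Asg 5 (V 24) ;; Asg 6 (V 25) ;; Asg 7 (V 26) ;; Asg 8 (V 27) ;;
    Asg 9 (Minus (V 36) (Minus (V 36) (V 33))) ;; MATCH ;;
    Cond (And (V 40) (V 11)) (DROP_U ;; DROP_V ;; Asg 32 (Plus (V 32) (V 36)) ;; Asg 33 (Minus (V 33) (V 36)))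
      (Asg 34 (N 0))"

lemma run_STEP:
  assumes n: "2 * s 36 \<le> n"
  shows "run STEP s h n (\<lambda>s' h'. h' = h \<and> s' 0 = s 0 \<and> s' 22 = s 22 \<and> s' 23 = s 23 \<and>
    (if match (s 36) (AU h s @ UU h s) (AV h s @ VV h s) \<and> prefix (take (s 36) (PW h s)) (AU h s @ UU h s)
     then s' 34 = s 34 \<and> AU h s' = drop (s 36) (AU h s) \<and> UU h s' = drop (s 36 - s 25) (UU h s) \<and>
       AV h s' = drop (s 36) (AV h s) \<and> VV h s' = drop (s 36 - s 29) (VV h s) \<and> PW h s' = drop (s 36) (PW h s)
     else s' 34 = 0))"
  unfolding STEP_def
proof (simp only: exec_simps, rule run_MATCH_Seq[where m = "s 36"], goal_cases)
  case (1 s1)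
  have f1: "s1 z = s z" if "z \<notin> {5, 6, 7, 8, 9, 10, 11, 12, 13, 61, 62, 63, 64}" for z
    using agreeD[OF 1(1)] that by simp
  have m1: "s1 11 = of_bool (match (s 36) (AU h s @ UU h s) (AV h s @ VV h s))"
    using 1(2) by (simp add: str_state)
  have min: "s 36 - (s 36 - s 33) = min (s 36) (s 33)" by simp
  show ?case
  proof (simp only: exec_simps, rule run_MATCH_Seq[where m = 0], goal_cases)
    case (1 s2)
    have f2: "s2 z = s z" if "z \<notin> {5, 6, 7, 8, 9, 10, 11, 12, 13, 40, 61, 62, 63, 64}" for z
      using agreeD[OF 1(1), of z] that f1 by simp
    have s40: "s2 40 = s1 11" using agreeD[OF 1(1), of 40] by simp
    have "s2 11 = of_bool (match (min (s 36) (s 33)) (PW h s) (AU h s @ UU h s))"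
      using 1(2) by (simp add: f1 str_state min PW_def)
    then have m2: "s2 11 = of_bool (prefix (take (s 36) (PW h s)) (AU h s @ UU h s))"
      by (subst (asm) match_prefix_take) (auto simp: length_state min_def)
    have st: "AU h s2 = AU h s" "UU h s2 = UU h s" "AV h s2 = AV h s" "VV h s2 = VV h s" "PW h s2 = PW h s"
      by (simp_all add: state_defs f2)
    have pw: "PW h (x(32 := s 32 + s 36, 33 := s 33 - s 36)) = drop (s 36) (PW h s)" for x
      by (simp add: PW_def drop_seg)
    show ?case
      using m1 m2 s40 by (simp add: f2 st pw)
  qed (auto simp: f1)
qed (use n in auto)

definition SCAN :: com where
  "SCAN = Asg 36 (N 1) ;; Asg 37 (N 0) ;;
    Loop (And (Lt (V 36) (H (Plus (V 35) (N 2)))) (Nt (V 37)))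
     (Asg 5 (Plus (V 24) (V 36)) ;; Asg 6 (Minus (V 25) (V 36)) ;;
      Asg 7 (Plus (V 26) (Minus (V 36) (V 25))) ;; Asg 8 (Minus (V 27) (Minus (V 36) (V 25))) ;; HEAD ;;
      Cond (V 15) (Asg 37 (N 1)) (Asg 36 (Plus (V 36) (N 1))))"

text \<open>The prefix condition of \<open>WP_site\<close>. The flag 39 tells whether the piece
  starts some word of the class; 38 tells that it does not start the word at hand, so that the tail
  must be able to expose its \<open>Z\<close>.\<close>

definition NEED :: com where
  "NEED = Asg 39 (N 1) ;; Asg 61 (V 32) ;; Asg 62 (V 33) ;; Asg 64 (N 0) ;;
    Asg 5 (H (V 35)) ;; Asg 6 (H (Plus (V 35) (N 1))) ;; Asg 8 (N 0) ;; Asg 9 (V 33) ;; MATCH ;;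
    Cond (V 11) (Asg 38 (N 0)) (Asg 38 (N 1) ;; PREFIX_CLASS ;; Asg 39 (V 15))"

abbreviation "ZL r \<equiv> Minus (H (Plus (V r) (N 1))) (H (Plus (V r) (N 2)))"

text \<open>The five programs from here to \<open>HIDDEN\<close> belong to the cases of the
  comparison at a site: \<open>sys_both_tails\<close>, \<open>sys_same_word\<close>,
  \<open>sys_left_hidden\<close>, \<open>sys_right_hidden\<close> and
  \<open>sys_both_hidden\<close>. Only \<open>SAME\<close> has to keep the obligation recorded in
  38; in the other cases the tail can expose \<open>Z S\<close> as soon as the two pairs are
  linked.\<close>

definition BOTH :: com where
  "BOTH = Asg 36 (ZL 35) ;; DROP_U ;; Asg 36 (ZL 37) ;; DROP_V ;; Asg 33 (N 0) ;; ACTIVE ;;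
    Cond (V 43) (Asg 24 (H (V 42)) ;; Asg 25 (V 43) ;; Asg 28 (H (V 42)) ;; Asg 29 (V 43)) (Asg 33 (N 0))"

definition SAME :: com where
  "SAME = Cond (V 38) (Asg 32 (Plus (H (V 35)) (H (Plus (V 35) (N 2)))) ;; Asg 33 (ZL 35)) (Asg 33 (N 0))"

definition RIGHT :: com where
  "RIGHT = Asg 36 (ZL 37) ;; DROP_V ;; Asg 28 (Plus (H (V 35)) (H (Plus (V 35) (N 2)))) ;;
    Asg 29 (ZL 35) ;; Asg 33 (N 0)"

definition LEFT :: com where
  "LEFT = Asg 36 (ZL 35) ;; DROP_U ;; Asg 24 (Plus (H (V 37)) (H (Plus (V 37) (N 2)))) ;;
    Asg 25 (ZL 37) ;; Asg 33 (N 0)"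

definition HIDDEN :: com where
  "HIDDEN = Asg 16 (Plus (H (V 35)) (H (Plus (V 35) (N 1)))) ;; Asg 17 (ZL 35) ;;
    Asg 18 (Plus (H (V 37)) (H (Plus (V 37) (N 1)))) ;; Asg 19 (ZL 37) ;; CSUF ;;
    Asg 61 (Plus (H (V 35)) (H (Plus (V 35) (N 2)))) ;; Asg 62 (Minus (ZL 35) (V 20)) ;; Asg 64 (N 0) ;;
    Asg 5 (V 24) ;; Asg 6 (V 25) ;; Asg 7 (V 26) ;; Asg 8 (V 27) ;; Asg 9 (V 62) ;; MATCH ;; Asg 40 (V 11) ;;
    Asg 61 (Plus (H (V 37)) (H (Plus (V 37) (N 2)))) ;; Asg 62 (Minus (ZL 37) (V 20)) ;; Asg 64 (N 0) ;;
    Asg 5 (V 28) ;; Asg 6 (V 29) ;; Asg 7 (V 30) ;; Asg 8 (V 31) ;; Asg 9 (V 62) ;; MATCH ;;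
    Cond (And (V 40) (V 11))
      (Asg 36 (Minus (ZL 35) (V 20)) ;; DROP_U ;; Asg 36 (Minus (ZL 37) (V 20)) ;; DROP_V ;;
       Asg 32 (Minus (Plus (H (V 35)) (H (Plus (V 35) (N 1)))) (V 20)) ;; Asg 33 (V 20))
      (Asg 34 (N 0))"

definition TAIL :: com where
  "TAIL = Asg 36 (H (Plus (V 35) (N 2))) ;; DROP_U ;; Asg 36 (H (Plus (V 37) (N 2))) ;; DROP_V ;;
    Asg 61 (Plus (H (V 35)) (H (Plus (V 35) (N 2)))) ;; Asg 62 (ZL 35) ;; Asg 64 (N 0) ;;
    Asg 5 (V 24) ;; Asg 6 (V 25) ;; Asg 7 (V 26) ;; Asg 8 (V 27) ;; Asg 9 (V 62) ;; MATCH ;; Asg 40 (V 11) ;;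
    Asg 61 (Plus (H (V 37)) (H (Plus (V 37) (N 2)))) ;; Asg 62 (ZL 37) ;; Asg 64 (N 0) ;;
    Asg 5 (V 28) ;; Asg 6 (V 29) ;; Asg 7 (V 30) ;; Asg 8 (V 31) ;; Asg 9 (V 62) ;; MATCH ;; Asg 41 (V 11) ;;
    Cond (And (V 40) (V 41)) BOTH
      (Cond (Eq (V 35) (V 37)) SAME (Cond (V 41) RIGHT (Cond (V 40) LEFT HIDDEN)))"

definition SITE :: com where
  "SITE = Asg 5 (V 28) ;; Asg 6 (V 29) ;; Asg 7 (V 30) ;; Asg 8 (V 31) ;; HEAD ;; Asg 37 (V 15) ;;
    Cond (And (V 37) (Eq (H (Plus (V 35) (N 3))) (H (Plus (V 37) (N 3)))))
      (NEED ;; Cond (V 39) TAIL (Asg 34 (N 0)))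
      (Asg 34 (N 0))"

text \<open>If the head at 0 is overlapped, all letters before the overlapping head are read at
  once: fewer of them might all belong to prepended pieces and would not pay for
  \<open>SCAN\<close>.\<close>

definition BODY :: com where
  "BODY = Cond (And (Plus (V 25) (V 27)) (Plus (V 29) (V 31)))
    (Asg 5 (V 24) ;; Asg 6 (V 25) ;; Asg 7 (V 26) ;; Asg 8 (V 27) ;; HEAD ;; Asg 35 (V 15) ;;
     Cond (V 35) (SCAN ;; Cond (V 37) STEP SITE) (Asg 36 (N 1) ;; STEP))
    (Asg 0 (And (Nt (Plus (V 25) (V 27))) (And (Nt (Plus (V 29) (V 31))) (Nt (V 33)))) ;; Asg 34 (N 0))"

section \<open>Correctness and cost of one iteration\<close>

context word_problem begin

lemma head_drop: "j \<le> length u \<Longrightarrow> head S (drop j u) 0 \<longleftrightarrow> head S u j"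
  unfolding head_def using occ_drop[of "B S" j u 0] occ_drop'[of "B S" u j 0] by auto

lemma run_SCAN:
  assumes T: "table h t k" "s 22 = t" "s 23 = t + 4 * k" and r: "s 35 \<in> recs t k"
    and u: "u = AU h s @ UU h s" "head (wd h (s 35)) u 0" and n: "L * Suc L \<le> n"
  shows "run SCAN s h n (\<lambda>s' h'. h' = h \<and> 0 < s' 36 \<and> s' 36 \<le> bl (wd h (s 35)) \<and>
    (\<forall>j S. 0 < j \<and> j < s' 36 \<longrightarrow> \<not> head S u j) \<and>
    (s' 37 = 0 \<and> s' 36 = bl (wd h (s 35)) \<or> s' 37 = 1 \<and> s' 36 < bl (wd h (s 35)) \<and> (\<exists>S. head S u (s' 36))) \<and>
    agree {5, 6, 7, 8, 9, 10, 11, 12, 13, 14, 15, 36, 37, 61, 62, 64} s s')"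
proof -
  let ?b = "bl (wd h (s 35))"
  let ?W = "{5, 6, 7, 8, 9, 10, 11, 12, 13, 14, 15, 36, 37, 61, 62, 64} :: nat set"
  note b = tableD(3)[OF T(1) r] and rR = tableD(1)[OF T(1) r]
  have bu: "?b \<le> length u" using headD(2)[OF u(2)] by simp
  show ?thesis
    unfolding SCAN_def run_Seq_Asg
  proof (rule run_Loop[where I = "\<lambda>s' h'. h' = h \<and> 0 < s' 36 \<and> s' 36 \<le> ?b \<and>
    (\<forall>j S. 0 < j \<and> j < s' 36 \<longrightarrow> \<not> head S u j) \<and>
    (s' 37 = 0 \<or> s' 37 = 1 \<and> s' 36 < ?b \<and> (\<exists>S. head S u (s' 36))) \<and> agree ?W s s'"
    and \<phi> = "\<lambda>s' h'. if s' 37 = 0 then (?b - s' 36) * Suc L else 0"], goal_cases)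
    case 1
    then show ?case using bl_pos[OF rR] by auto
  next
    case 2
    have "(?b - 1) * Suc L \<le> L * Suc L"
      using length_le_L[OF rR] bl_le[of "wd h (s 35)"] by (intro mult_le_mono1) linarith
    then show ?case using n by simp
  next
    case (3 s' h')
    then have ag: "agree ?W s s'" and h: "h' = h" by auto
    have fr: "s' z = s z" if "z \<notin> ?W" for z using agreeD[OF ag that] .
    have c: "s' 37 = 0" "s' 36 < ?b" "0 < s' 36" "\<And>j S. 0 < j \<Longrightarrow> j < s' 36 \<Longrightarrow> \<not> head S u j"
      using 3 b fr by (auto split: if_splits)
    define l where "l = s' 36"
    have pd: "(?b - l) * Suc L = Suc L + (?b - (l + 1)) * Suc L"
      using c(2) unfolding l_def by (metis Suc_diff_Suc mult_Suc Suc_eq_plus1)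
    let ?s = "s'(5 := s 24 + l, 6 := s 25 - l, 7 := s 26 + (l - s 25), 8 := s 27 - (l - s 25))"
    have dr: "drop l u = str h (?s 5) (?s 6) (?s 7) (?s 8)"
      unfolding u(1) str_state[symmetric] drop_str by simp
    show ?case
    proof (rule exI[of _ L], simp only: exec_simps h, rule run_Seq')
      have "run HEAD ?s h L (\<lambda>s'' h'. h' = h \<and>
        (s'' 15 = 0 \<and> (\<forall>S. \<not> head S (drop l u) 0) \<or> s'' 15 \<in> recs t k \<and> head (wd h (s'' 15)) (drop l u) 0) \<and>
        agree {9, 10, 11, 12, 13, 14, 15, 61, 62, 64} ?s s'')"
        by (rule run_HEAD[OF T(1) _ _ dr]) (simp_all add: T fr)
      then show "run HEAD (s'(5 := s' 24 + s' 36, 6 := s' 25 - s' 36, 7 := s' 26 + (s' 36 - s' 25), 8 := s' 27 - (s' 36 - s' 25)))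
        h L (\<lambda>s'' h'. h' = h \<and>
        (s'' 15 = 0 \<and> (\<forall>S. \<not> head S (drop l u) 0) \<or> s'' 15 \<in> recs t k \<and> head (wd h (s'' 15)) (drop l u) 0) \<and>
        agree {9, 10, 11, 12, 13, 14, 15, 61, 62, 64} ?s s'')"
        by (simp add: fr l_def)
    next
      fix s2 h2
      assume q: "h2 = h \<and>
        (s2 15 = 0 \<and> (\<forall>S. \<not> head S (drop l u) 0) \<or> s2 15 \<in> recs t k \<and> head (wd h (s2 15)) (drop l u) 0) \<and>
        agree {9, 10, 11, 12, 13, 14, 15, 61, 62, 64} ?s s2"
      have ag2: "agree ?W s s2"
        by (rule agree_via[of "{9, 10, 11, 12, 13, 14, 15, 61, 62, 64}" ?s]) (use q ag in auto)
      have s2: "s2 36 = l" "s2 37 = 0"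
        using agreeD[of "{9, 10, 11, 12, 13, 14, 15, 61, 62, 64}" ?s s2] q c(1) l_def by auto
      have 0: "0 \<notin> recs t k" using tableD(7)[OF T(1)] by (auto simp: recs_def)
      have hd: "head S (drop l u) 0 \<longleftrightarrow> head S u l" for S using c(2) bu l_def by (intro head_drop) simp
      have le: "L + 1 \<le> (?b - l) * Suc L" unfolding pd by simp
      show "run (Cond (V 15) (Asg 37 (N 1)) (Asg 36 (Plus (V 36) (N 1)))) s2 h2 0
        (\<lambda>s'a h'. (h' = h \<and> 0 < s'a 36 \<and> s'a 36 \<le> ?b \<and>
          (\<forall>j S. 0 < j \<and> j < s'a 36 \<longrightarrow> \<not> head S u j) \<and>
          (s'a 37 = 0 \<or> s'a 37 = 1 \<and> s'a 36 < ?b \<and> (\<exists>S. head S u (s'a 36))) \<and> agree ?W s s'a) \<and>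
          (if s'a 37 = 0 then (?b - s'a 36) * Suc L else 0) + L + 1 \<le> (if s' 37 = 0 then (?b - s' 36) * Suc L else 0))"
      proof (cases "s2 15 = 0")
        case True
        then have "\<not> head S u l" for S using q hd 0 by auto
        then have "\<forall>j S. 0 < j \<and> j < l + 1 \<longrightarrow> \<not> head S u j" using c(4) l_def by (metis less_Suc_eq Suc_eq_plus1)
        then show ?thesis using True q ag2 s2 c pd l_def by simp
      next
        case False
        then have "\<exists>S. head S u l" using q hd by auto
        then show ?thesis using False q ag2 s2 c le l_def by simp
      qed
    qed simp
  next
    case (4 s' h')
    have s35: "s' 35 = s 35" using agreeD[of ?W s s' 35] 4(1) by simp
    have "s' 37 = 0 \<Longrightarrow> s' 36 = ?b" using 4 b s35 by auto
    then show ?case using 4(1) by auto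
  qed
qed

lemma run_NEED:
  assumes T: "table h t k" "s 22 = t" "s 23 = t + 4 * k" and r: "s 35 \<in> recs t k"
    and n: "s 33 + L * Suc (s 33) \<le> n"
  shows "run NEED s h n (\<lambda>s' h'. h' = h \<and> (s' 38 = 0 \<longleftrightarrow> prefix (PW h s) (wd h (s 35))) \<and>
    (s' 39 \<noteq> 0 \<longleftrightarrow> prefix (PW h s) (wd h (s 35)) \<or> (\<exists>P. cls (wd h (s 35)) P \<and> prefix (PW h s) P)) \<and>
    agree {5, 6, 8, 9, 10, 11, 12, 13, 14, 15, 38, 39, 61, 62, 64} s s')"
  unfolding NEED_def
proof (simp only: exec_simps, rule run_MATCH_Seq[where m = "L * Suc (s 33)"], goal_cases)
  case (1 s1)
  let ?W = "{5, 6, 8, 9, 10, 11, 12, 13, 14, 15, 38, 39, 61, 62, 64} :: nat set"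
  have ag: "agree ?W s s1" by (rule agree_via[OF 1(1)]) simp_all
  have fr: "s1 z = s z" if "z \<notin> ?W" for z using agreeD[OF ag that] .
  have s39: "s1 39 = 1" using agreeD[OF 1(1), of 39] by simp
  have pw: "PW h s1 = PW h s" by (simp add: PW_def fr)
  have "s1 11 = of_bool (match (s 33) (PW h s) (wd h (s 35)))"
    using 1(2) by (simp add: PW_def wd_def)
  then have m: "s1 11 = of_bool (prefix (PW h s) (wd h (s 35)))"
    by (subst (asm) match_prefix) (auto simp: length_state)
  show ?case
  proof (cases "s1 11 = 0")
    case False
    then show ?thesis using m ag s39 by (auto split: if_splits)
  next
    case True
    then have np: "\<not> prefix (PW h s) (wd h (s 35))" using m by (auto split: if_splits)
    have nz: "\<not> s1 11 \<noteq> 0" using True by simp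
    show ?thesis
      unfolding run_Cond run_Seq_Asg ev.simps if_not_P[OF nz]
    proof (rule run_Seq')
      let ?s = "s1(38 := 1)"
      show "run PREFIX_CLASS ?s h (L * Suc (s 33)) (\<lambda>s' h'. h' = h \<and>
        (s' 15 \<noteq> 0 \<longleftrightarrow> (\<exists>P. cls (wd h (?s 35)) P \<and> prefix (seg h (?s 32) (?s 33)) P)) \<and>
        agree {5, 6, 8, 9, 10, 11, 12, 13, 14, 15, 61, 62, 64} ?s s')"
        by (rule run_PREFIX_CLASS[OF T(1)]) (simp_all add: T r fr)
      fix s2 h2
      assume q: "h2 = h \<and> (s2 15 \<noteq> 0 \<longleftrightarrow> (\<exists>P. cls (wd h (?s 35)) P \<and> prefix (seg h (?s 32) (?s 33)) P)) \<and>
        agree {5, 6, 8, 9, 10, 11, 12, 13, 14, 15, 61, 62, 64} ?s s2"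
      have ag2: "agree ?W s s2"
        by (rule agree_via[of "{5, 6, 8, 9, 10, 11, 12, 13, 14, 15, 61, 62, 64}" ?s]) (use q ag in auto)
      have s38: "s2 38 = 1" using agreeD[of "{5, 6, 8, 9, 10, 11, 12, 13, 14, 15, 61, 62, 64}" ?s s2 38] q by simp
      have "s2 15 \<noteq> 0 \<longleftrightarrow> (\<exists>P. cls (wd h (s 35)) P \<and> prefix (PW h s) P)"
        using q by (simp add: fr PW_def)
      then show "run (Asg 39 (V 15)) s2 h2 0 (\<lambda>s' h'. h' = h \<and> (s' 38 = 0 \<longleftrightarrow> prefix (PW h s) (wd h (s 35))) \<and>
        (s' 39 \<noteq> 0 \<longleftrightarrow> prefix (PW h s) (wd h (s 35)) \<or> (\<exists>P. cls (wd h (s 35)) P \<and> prefix (PW h s) P)) \<and>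
        agree ?W s s')"
        using np q ag2 s38 by simp
    qed simp
  qed
qed (use n in auto)

text \<open>At a site the loop can only stop with the answer no, which is the value already in 0.
  The strict inequalities say that a letter of either input word has been read for the first
  time.\<close>

definition outcome :: "mem \<Rightarrow> nat \<Rightarrow> nat \<Rightarrow> bool \<Rightarrow> nat \<Rightarrow> nat \<Rightarrow> mem \<Rightarrow> bool" where
  "outcome h t k W0 lu lv s \<longleftrightarrow> s 0 = 0 \<and> s 22 = t \<and> s 23 = t + 4 * k \<and>
    (s 34 = 0 \<and> \<not> W0 \<or> s 34 \<noteq> 0 \<and> (WP (AU h s @ UU h s) (AV h s @ VV h s) (PW h s) \<longleftrightarrow> W0) \<and>
      piece R (AU h s) \<and> piece R (AV h s) \<and> piece R (PW h s) \<and>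
      length (UU h s) < lu \<and> length (VV h s) < lv)"

lemma WP_no_prefix: "WP u v [] \<longleftrightarrow> eqv u v" unfolding WP_def by auto

lemma zl: "table h t k \<Longrightarrow> x \<in> recs t k \<Longrightarrow> h (x + 1) - h (x + 2) = length (Z (wd h x))"
  using tableD(3) length_wd[of h x] by (simp add: Z_def)

text \<open>The situation after both heads have been removed. A piece is shorter than a head, so
  both prepended segments are used up; this is \<open>e\<close>. \<open>W0\<close> is the criterion
  of \<open>WP_site\<close>, with the prefix condition reduced to the flag 38.\<close>

context
  fixes h s t k lu lv W0
  assumes T: "table h t k" "s 22 = t" "s 23 = t + 4 * k" and s0: "s 0 = 0" "s 34 \<noteq> 0"
    and r: "s 35 \<in> recs t k" and q: "s 37 \<in> recs t k" and c: "cls (wd h (s 35)) (wd h (s 37))"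
    and e: "s 25 = 0" "s 29 = 0"
    and lt: "length (UU h s) < lu" "length (VV h s) < lv"
    and W0: "W0 \<longleftrightarrow> sys\<^sup>*\<^sup>* (wd h (s 35), UU h s) (wd h (s 37), VV h s) \<and>
      (s 38 \<noteq> 0 \<longrightarrow> (\<exists>x. eqv (UU h s) (Z (wd h (s 35)) @ x)))"
begin

lemma empty_state: "AU h s = []" "AV h s = []"
  using e by (simp_all add: state_defs)

lemma zl_state: "h (s 35 + 1) - h (s 35 + 2) = length (Z (wd h (s 35)))"
  "h (s 37 + 1) - h (s 37 + 2) = length (Z (wd h (s 37)))"
  using zl[OF T(1)] r q by auto

lemma seg_Z_state: "seg h (h (s 35) + h (s 35 + 2)) (length (Z (wd h (s 35)))) = Z (wd h (s 35))"
  "seg h (h (s 37) + h (s 37 + 2)) (length (Z (wd h (s 37)))) = Z (wd h (s 37))"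
  using Z_wd[OF T(1)] r q by (simp_all flip: zl_state)

lemma run_BOTH:
  assumes t1: "UU h s = Z (wd h (s 35)) @ t1" and t2: "VV h s = Z (wd h (s 37)) @ t2"
    and n: "2 * (L * Suc (2 * L)) \<le> n"
  shows "run BOTH s h n (\<lambda>s' h'. h' = h \<and> outcome h t k W0 lu lv s')"
proof -
  let ?S = "wd h (s 35)" let ?Q = "wd h (s 37)"
  define s1 where "s1 = (drop_v ((drop_u (s(36 := length (Z ?S))))(36 := length (Z ?Q))))(33 := 0)"
  have f1: "s1 z = s z" if "z \<notin> {24, 25, 26, 27, 28, 29, 30, 31, 33, 36}" for z using that by (simp add: s1_def)
  have st1: "AU h s1 = []" "UU h s1 = t1" "AV h s1 = []" "VV h s1 = t2"
    using t1 t2 e by (simp_all add: s1_def empty_state)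
  have pw0: "PW h s' = []" if "s' 33 = 0" for s' :: mem using that by (simp add: PW_def)
  have W: "W0 \<longleftrightarrow> apx ?S t1 t2"
    unfolding W0 t1 t2 sys_both_tails[OF c] by auto
  have lt': "length t1 < lu" "length t2 < lv" using lt t1 t2 by simp_all
  let ?A = "{5, 6, 7, 8, 9, 10, 11, 12, 13, 14, 15, 41, 42, 43, 44, 61, 62, 64} :: nat set"
  have "run (ACTIVE ;; Cond (V 43) (Asg 24 (H (V 42)) ;; Asg 25 (V 43) ;; Asg 28 (H (V 42)) ;; Asg 29 (V 43)) (Asg 33 (N 0)))
    s1 h n (\<lambda>s' h'. h' = h \<and> outcome h t k W0 lu lv s')"
  proof (rule run_Seq')
    show "run ACTIVE s1 h (2 * (L * Suc (2 * L))) (\<lambda>s' h'. h' = h \<and>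
      (s' 43 = 0 \<and> (\<forall>x\<in>recs t k. \<forall>l. \<not> active_at h t1 (s1 35) x l) \<or>
        s' 42 \<in> recs t k \<and> active_at h t1 (s1 35) (s' 42) (s' 43)) \<and> agree ?A s1 s')"
      by (rule run_ACTIVE[OF T(1)]) (simp_all add: f1 T r str_state st1)
    show "2 * (L * Suc (2 * L)) + 0 \<le> n" using n by simp
    fix s2 h2
    assume a: "h2 = h \<and> (s2 43 = 0 \<and> (\<forall>x\<in>recs t k. \<forall>l. \<not> active_at h t1 (s1 35) x l) \<or>
        s2 42 \<in> recs t k \<and> active_at h t1 (s1 35) (s2 42) (s2 43)) \<and> agree ?A s1 s2"
    then have ag: "agree ?A s1 s2" by simp
    have f2: "s2 z = s1 z" if "z \<notin> ?A" for z using agreeD[OF ag that] .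
    have st2: "AU h s2 = []" "UU h s2 = t1" "AV h s2 = []" "VV h s2 = t2"
      using st1 state_agree[OF ag, of h] by simp_all
    have s33: "s2 33 = 0" by (simp add: f2) (simp add: s1_def)
    show "run (Cond (V 43) (Asg 24 (H (V 42)) ;; Asg 25 (V 43) ;; Asg 28 (H (V 42)) ;; Asg 29 (V 43)) (Asg 33 (N 0)))
      s2 h2 0 (\<lambda>s' h'. h' = h \<and> outcome h t k W0 lu lv s')"
    proof (cases "s2 43 = 0")
      case True
      \<comment> \<open>An active piece would be a proper prefix of its head, hence one of the
        candidates that \<open>ACTIVE\<close> has rejected.\<close>
      have na: "\<not> suffix z (Z P)" if ac: "act z U t1" and cP: "cls ?S P" for z U P
      proof
        assume sf: "suffix z (Z P)"
        have U: "U \<in> RW" using ac unfolding act_def by simp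
        then obtain x where x: "x \<in> recs t k" "wd h x = U" using tableD(2)[OF T(1)] by blast
        have lz: "length z < bl U" using act_length[OF ac] .
        have tz: "take (length z) U = z"
          using act_nth(2)[OF ac] lz bl_le[of U] by (intro nth_equalityI) auto
        have "take (length z) (B U) = z" using tz lz by (simp add: B_def min_def)
        then have "B U = z @ drop (length z) (B U)" by (metis append_take_drop_id)
        then have "prefix (drop (length z) (B U)) t1"
          using ac unfolding act_def by (metis same_prefix_prefix)
        then have "active_at h t1 (s1 35) x (length z)"
          using ac lz tz cP sf x unfolding active_at_def act_def by (auto simp: f1)
        moreover have "\<not> active_at h t1 (s1 35) x (length z)"
          using a True x(1) by (auto simp: active_at_def)
        ultimately show False by simp
      qed
      have "W0 \<longleftrightarrow> WP t1 t2 []" unfolding W WP_no_prefix by (rule apx_no_act) (use na in blast)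
      then show ?thesis using True a st2 s33 lt' s0
        by (simp add: outcome_def pw0 f2 f1 T)
    next
      case False
      then have x: "s2 42 \<in> recs t k" and ac: "active_at h t1 (s1 35) (s2 42) (s2 43)" using a by auto
      let ?U = "wd h (s2 42)" let ?l = "s2 43" let ?z = "take ?l ?U"
      obtain P where P: "cls ?S P" "suffix ?z (Z P)" and l: "0 < ?l" "?l < bl ?U" "prefix (drop ?l (B ?U)) t1"
        using ac unfolding active_at_def by (auto simp: f1)
      have pz: "piece R ?z" using piece_suffix[OF piece_Z P(2)] .
      have tB: "?z = take ?l (B ?U)" using l(2) by (simp add: B_def min_def)
      have "prefix (B ?U) (?z @ t1)" unfolding tB using l(3)
        by (metis append_take_drop_id same_prefix_prefix)
      then have act: "act ?z ?U t1" unfolding act_def using pz l tableD(1)[OF T(1) x] bl_le[of ?U] by auto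
      have W': "W0 \<longleftrightarrow> WP (?z @ t1) (?z @ t2) []" unfolding W WP_no_prefix by (rule apx_act[OF act P])
      have sz: "seg h (h (s2 42)) ?l = ?z" using l(2) bl_le[of ?U] by (simp add: wd_def take_seg length_wd min_def)
      show ?thesis using False a st2 s33 lt' s0 pz W'
        by (simp add: outcome_def pw0 f2 f1 T AU_def AV_def sz)
    qed
  qed
  then show ?thesis by (simp add: BOTH_def zl_state s1_def)
qed

lemma run_SAME:
  assumes eq: "s 35 = s 37" and np: "\<not> (prefix (Z (wd h (s 35))) (UU h s) \<and> prefix (Z (wd h (s 37))) (VV h s))"
  shows "run SAME s h n (\<lambda>s' h'. h' = h \<and> outcome h t k W0 lu lv s')"
proof -
  let ?S = "wd h (s 35)"
  have "W0 \<longleftrightarrow> eqv (UU h s) (VV h s) \<and> (s 38 \<noteq> 0 \<longrightarrow> (\<exists>x. eqv (UU h s) (Z ?S @ x)))"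
    unfolding W0 using sys_same_word[of ?S "UU h s" "VV h s"] np eq by simp
  then have W: "W0 \<longleftrightarrow> WP (UU h s) (VV h s) (if s 38 \<noteq> 0 then Z ?S else [])"
    unfolding WP_def by auto
  show ?thesis
  proof (cases "s 38 = 0")
    case True
    then show ?thesis using W lt s0
      by (simp add: SAME_def outcome_def T empty_state) (simp add: PW_def)
  next
    case False
    then show ?thesis using W lt s0 piece_Z[of ?S]
      by (simp add: SAME_def outcome_def T empty_state zl_state) (simp add: PW_def UU_def VV_def seg_Z_state empty_state e AU_def AV_def)
  qed
qed

lemma run_RIGHT:
  assumes ne: "wd h (s 35) \<noteq> wd h (s 37)" and np: "\<not> prefix (Z (wd h (s 35))) (UU h s)"
    and t2: "VV h s = Z (wd h (s 37)) @ t2"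
  shows "run RIGHT s h n (\<lambda>s' h'. h' = h \<and> outcome h t k W0 lu lv s')"
proof -
  let ?S = "wd h (s 35)" let ?Q = "wd h (s 37)"
  have "W0 \<longleftrightarrow> eqv (UU h s) (Z ?S @ t2)"
    unfolding W0 t2 sys_left_hidden[OF ne c np] by auto
  then have W: "W0 \<longleftrightarrow> WP (UU h s) (Z ?S @ t2) []" by (simp add: WP_no_prefix)
  let ?s1 = "drop_v (s(36 := length (Z ?Q)))"
  let ?s2 = "?s1(28 := h (s 35) + h (s 35 + 2), 29 := length (Z ?S), 33 := 0)"
  have st: "AU h ?s2 = []" "UU h ?s2 = UU h s" "AV h ?s2 = Z ?S" "VV h ?s2 = t2" "PW h ?s2 = []"
    using e t2 empty_state
    by (simp_all add: AV_def[of h "_(28 := _, 29 := _, 33 := _)"] PW_def[of h "_(33 := _)"] seg_Z_state)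
  have "outcome h t k W0 lu lv ?s2"
    unfolding outcome_def st using W lt t2 s0 piece_Z[of ?S] by (simp add: T)
  then show ?thesis by (simp add: RIGHT_def zl_state)
qed

lemma run_LEFT:
  assumes ne: "wd h (s 35) \<noteq> wd h (s 37)" and np: "\<not> prefix (Z (wd h (s 37))) (VV h s)"
    and t1: "UU h s = Z (wd h (s 35)) @ t1"
  shows "run LEFT s h n (\<lambda>s' h'. h' = h \<and> outcome h t k W0 lu lv s')"
proof -
  let ?S = "wd h (s 35)" let ?Q = "wd h (s 37)"
  have "W0 \<longleftrightarrow> eqv (Z ?Q @ t1) (VV h s)"
    unfolding W0 t1 sys_right_hidden[OF ne c np] by auto
  then have W: "W0 \<longleftrightarrow> WP (Z ?Q @ t1) (VV h s) []" by (simp add: WP_no_prefix)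
  let ?s1 = "drop_u (s(36 := length (Z ?S)))"
  let ?s2 = "?s1(24 := h (s 37) + h (s 37 + 2), 25 := length (Z ?Q), 33 := 0)"
  have st: "AV h ?s2 = []" "VV h ?s2 = VV h s" "AU h ?s2 = Z ?Q" "UU h ?s2 = t1" "PW h ?s2 = []"
    using e t1 empty_state
    by (simp_all add: AU_def[of h "_(24 := _, 25 := _, 33 := _)"] PW_def[of h "_(33 := _)"] seg_Z_state)
  have "outcome h t k W0 lu lv ?s2"
    unfolding outcome_def st using W lt t1 s0 piece_Z[of ?Q] by (simp add: T)
  then show ?thesis by (simp add: LEFT_def zl_state)
qed

lemma run_HIDDEN:
  assumes ne: "wd h (s 35) \<noteq> wd h (s 37)" and np: "\<not> prefix (Z (wd h (s 35))) (UU h s)"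
    "\<not> prefix (Z (wd h (s 37))) (VV h s)" and n: "3 * L \<le> n"
  shows "run HIDDEN s h n (\<lambda>s' h'. h' = h \<and> outcome h t k W0 lu lv s')"
proof -
  let ?S = "wd h (s 35)" let ?Q = "wd h (s 37)"
  \<comment> \<open>Pairs with different relation words are linked only through a switch, which
    already exposes \<open>Z S\<close>; the obligation in 38 holds automatically.\<close>
  have "sys\<^sup>*\<^sup>* (?S, UU h s) (?Q, VV h s) \<Longrightarrow> \<exists>x. eqv (UU h s) (Z ?S @ x)"
    using sys_cases[of "(?S, UU h s)" "(?Q, VV h s)"] ne by auto
  then have W1: "W0 \<longleftrightarrow> sys\<^sup>*\<^sup>* (?S, UU h s) (?Q, VV h s)" unfolding W0 by blast
  have lZ: "length (Z ?S) \<le> L" "length (Z ?Q) \<le> L"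
    using length_le_L[OF tableD(1)[OF T(1) r]] length_le_L[OF tableD(1)[OF T(1) q]] by (auto simp: Z_def)
  have adr: "h (s 35) + h (s 35 + 1) - length (Z ?S) = h (s 35) + h (s 35 + 2)"
    "length (Z ?S) \<le> h (s 35) + h (s 35 + 1)"
    "h (s 37) + h (s 37 + 1) - length (Z ?Q) = h (s 37) + h (s 37 + 2)"
    "length (Z ?Q) \<le> h (s 37) + h (s 37 + 1)"
    using zl_state bl_le[of ?S] bl_le[of ?Q] tableD(3)[OF T(1) r] tableD(3)[OF T(1) q] length_wd[of h "s 35"] length_wd[of h "s 37"]
    by simp_all
  let ?s = "s(16 := h (s 35) + h (s 35 + 1), 17 := length (Z ?S), 18 := h (s 37) + h (s 37 + 1), 19 := length (Z ?Q))"
  have 1: "run CSUF ?s h L (\<lambda>s' h'. h' = h \<and> common_suffix (s' 20) (Z ?S) (Z ?Q) \<and>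
    (\<forall>c. common_suffix c (Z ?S) (Z ?Q) \<longrightarrow> c \<le> s' 20) \<and> (\<forall>z. z \<noteq> 20 \<longrightarrow> s' z = ?s z))"
    by (rule run_CSUF) (use adr lZ seg_Z_state in simp_all)
  show ?thesis
    unfolding HIDDEN_def
  proof (simp only: exec_simps zl_state, rule run_Seq'[OF 1, where ?n2.0 = "2 * L"], goal_cases)
    case (1 s1 h1)
    have h1: "h1 = h" using 1 by simp
    have f1: "s1 z = s z" if "z \<notin> {16, 17, 18, 19, 20}" for z using 1 that by auto
    define d where "d = s1 20"
    have cs: "common_suffix d (Z ?S) (Z ?Q)" and mx: "\<And>c. common_suffix c (Z ?S) (Z ?Q) \<Longrightarrow> c \<le> d"
      using 1 unfolding d_def by auto
    define z0 rr rq where "z0 = drop (length (Z ?S) - d) (Z ?S)" and "rr = take (length (Z ?S) - d) (Z ?S)"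
      and "rq = take (length (Z ?Q) - d) (Z ?Q)"
    have dl: "d \<le> length (Z ?S)" "d \<le> length (Z ?Q)" using cs by (auto simp: common_suffix_def)
    have zS: "Z ?S = rr @ z0" unfolding rr_def z0_def by simp
    have zQ: "Z ?Q = rq @ z0" unfolding rq_def z0_def common_suffix_drop[OF cs] by simp
    have lz0: "length z0 = d" unfolding z0_def using dl by simp
    have mx': "suffix z z0" if sf: "suffix z (Z ?S)" "suffix z (Z ?Q)" for z
    proof -
      have "length z \<le> length z0" using mx[OF common_suffixI[OF sf]] lz0 by simp
      moreover have "suffix z0 (Z ?S)" unfolding zS by (simp add: suffix_def)
      ultimately show ?thesis using sf(1) suffix_length_suffix by blast
    qed
    have W2: "W0 \<longleftrightarrow> (\<exists>b b'. UU h s = rr @ b \<and> VV h s = rq @ b' \<and> WP b b' z0)"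
      unfolding W1
    proof (rule sys_both_hidden[OF ne c np zS zQ])
      fix z assume "suffix z (Z ?S)" "suffix z (Z ?Q)"
      then show "suffix z z0" by (rule mx')
    qed
    have srr: "seg h (h (s 35) + h (s 35 + 2)) (length (Z ?S) - d) = rr"
      using arg_cong[OF seg_Z_state(1), of "take (length (Z ?S) - d)"] by (simp add: rr_def take_seg min_def)
    have srq: "seg h (h (s 37) + h (s 37 + 2)) (length (Z ?Q) - d) = rq"
      using arg_cong[OF seg_Z_state(2), of "take (length (Z ?Q) - d)"] by (simp add: rq_def take_seg min_def)
    have "seg h (h (s 35) + h (s 35 + 2) + (length (Z ?S) - d)) (length (Z ?S) - (length (Z ?S) - d)) = z0"
      unfolding z0_def drop_seg[symmetric] seg_Z_state ..
    moreover have "h (s 35) + h (s 35 + 2) + (length (Z ?S) - d) = h (s 35) + h (s 35 + 1) - d"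
      "length (Z ?S) - (length (Z ?S) - d) = d" using adr dl by simp_all
    ultimately have sz0: "seg h (h (s 35) + h (s 35 + 1) - d) d = z0" by simp
    have lr: "length rr = length (Z ?S) - d" "length rq = length (Z ?Q) - d" unfolding rr_def rq_def by simp_all
    show ?case
      unfolding h1
    proof (simp only: exec_simps f1 insert_iff empty_iff zl_state d_def[symmetric], rule run_MATCH_Seq[where m = L], goal_cases)
      case (1 s2)
      have f2: "s2 z = s z" if "z \<notin> {5, 6, 7, 8, 9, 10, 11, 12, 13, 16, 17, 18, 19, 20, 61, 62, 64}" for z
        using agreeD[OF 1(1), of z] that f1 by simp
      have d2: "s2 20 = d" using agreeD[OF 1(1), of 20] by (simp add: d_def)
      have "s2 11 = of_bool (match (length (Z ?S) - d) rr (UU h s))"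
        using 1(2) by (simp add: srr str_state empty_state)
      then have m2: "s2 11 = of_bool (prefix rr (UU h s))"
        by (subst (asm) match_prefix) (auto simp: lr)
      show ?case
      proof (simp only: exec_simps f2 insert_iff empty_iff zl_state d2, rule run_MATCH_Seq[where m = 0], goal_cases)
        case (1 s3)
        have f3: "s3 z = s z" if "z \<notin> {5, 6, 7, 8, 9, 10, 11, 12, 13, 16, 17, 18, 19, 20, 40, 61, 62, 64}" for z
          using agreeD[OF 1(1), of z] that f2 by simp
        have d3: "s3 20 = d" using agreeD[OF 1(1), of 20] by (simp add: d2)
        have s40: "s3 40 = s2 11" using agreeD[OF 1(1), of 40] by simp
        have "s3 11 = of_bool (match (length (Z ?Q) - d) rq (VV h s))"
          using 1(2) by (simp add: srq str_state empty_state)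
        then have m3: "s3 11 = of_bool (prefix rq (VV h s))"
          by (subst (asm) match_prefix) (auto simp: lr)
        have st: "AU h s3 = []" "UU h s3 = UU h s" "AV h s3 = []" "VV h s3 = VV h s"
          using empty_state by (simp_all add: state_defs f3)
        show ?case
        proof (cases "prefix rr (UU h s) \<and> prefix rq (VV h s)")
          case False
          then have "\<not> W0" unfolding W2 by (auto simp: prefix_def)
          then show ?thesis using False m2 m3 s40 s0
            by (auto simp: outcome_def f3 T)
        next
          case True
          then obtain b b' where b: "UU h s = rr @ b" "VV h s = rq @ b'" by (auto simp: prefix_def)
          have W3: "W0 \<longleftrightarrow> WP b b' z0" unfolding W2 b by simp
          let ?s4 = "drop_u (s3(36 := length rr))"
          let ?s5 = "drop_v (?s4(36 := length rq))"
          let ?s6 = "?s5(32 := h (s 35) + h (s 35 + 1) - d, 33 := d)"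
          have "AU h ?s6 = []" "UU h ?s6 = b" "AV h ?s6 = []" "VV h ?s6 = b'" "PW h ?s6 = z0"
            using st b e by (simp_all add: f3 PW_def[of h "_(33 := _)"] sz0)
          moreover have "piece R z0" unfolding z0_def using piece_suffix[OF piece_Z] suffix_drop by blast
          ultimately have "outcome h t k W0 lu lv ?s6"
            using W3 lt b s0 by (simp add: outcome_def f3 T)
          then show ?thesis using True m2 m3 s40
            by (simp add: f3 d3 zl_state lr)
        qed
      qed (use lZ in simp_all)
    qed (use lZ in simp_all)
  qed (use n in simp)
qed

end

text \<open>Looking for the two parts \<open>Z\<close> costs at most 2 L; the other 3 L are for
  \<open>HIDDEN\<close>, the quadratic term is for \<open>BOTH\<close>.\<close>

lemma run_TAIL:
  assumes T: "table h t k" "s 22 = t" "s 23 = t + 4 * k" and s0: "s 0 = 0" "s 34 \<noteq> 0"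
    and r: "s 35 \<in> recs t k" and q: "s 37 \<in> recs t k" and c: "cls (wd h (s 35)) (wd h (s 37))"
    and u: "AU h s @ UU h s = B (wd h (s 35)) @ x" "length (AU h s) < bl (wd h (s 35))"
    and v: "AV h s @ VV h s = B (wd h (s 37)) @ y" "length (AV h s) < bl (wd h (s 37))"
    and W0: "W0 \<longleftrightarrow> sys\<^sup>*\<^sup>* (wd h (s 35), x) (wd h (s 37), y) \<and>
      (s 38 \<noteq> 0 \<longrightarrow> (\<exists>w. eqv x (Z (wd h (s 35)) @ w)))"
    and n: "5 * L + 2 * (L * Suc (2 * L)) \<le> n"
  shows "run TAIL s h n (\<lambda>s' h'. h' = h \<and> outcome h t k W0 (length (UU h s)) (length (VV h s)) s')"
proof -
  let ?S = "wd h (s 35)" let ?Q = "wd h (s 37)"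
  have bS: "h (s 35 + 2) = bl ?S" and bQ: "h (s 37 + 2) = bl ?Q" using tableD(3)[OF T(1)] r q by auto
  have zl': "h (s 35 + 1) - bl ?S = length (Z ?S)" "h (s 37 + 1) - bl ?Q = length (Z ?Q)"
    using zl[OF T(1) r] zl[OF T(1) q] bS bQ by auto
  have sZ: "seg h (h (s 35) + bl ?S) (length (Z ?S)) = Z ?S" "seg h (h (s 37) + bl ?Q) (length (Z ?Q)) = Z ?Q"
    using Z_wd[OF T(1) r] Z_wd[OF T(1) q] zl' bS bQ by auto
  have lZ: "length (Z ?S) \<le> L" "length (Z ?Q) \<le> L"
    using length_le_L[OF tableD(1)[OF T(1) r]] length_le_L[OF tableD(1)[OF T(1) q]] by (auto simp: Z_def)
  define s1 where "s1 = drop_v ((drop_u (s(36 := bl ?S)))(36 := bl ?Q))"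
  have l: "length (AU h s) = s 25" "length (AV h s) = s 29" by (simp_all add: length_state)
  have "drop (bl ?S) (AU h s @ UU h s) = x" "drop (bl ?Q) (AV h s @ VV h s) = y" unfolding u(1) v(1) by simp_all
  then have dr: "drop (bl ?S - s 25) (UU h s) = x" "drop (bl ?Q - s 29) (VV h s) = y"
    using u(2) v(2) l by simp_all
  have "length (AU h s) + length (UU h s) = bl ?S + length x" "length (AV h s) + length (VV h s) = bl ?Q + length y"
    using arg_cong[OF u(1), of length] arg_cong[OF v(1), of length] by simp_all
  then have lt: "length x < length (UU h s)" "length y < length (VV h s)" using u(2) v(2) by linarith+
  have f1: "s1 z = s z" if "z \<notin> {24, 25, 26, 27, 28, 29, 30, 31, 36}" for z using that by (simp add: s1_def)
  have e1: "s1 25 = 0" "s1 29 = 0" using u(2) v(2) l by (simp_all add: s1_def)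
  have st1: "AU h s1 = []" "UU h s1 = x" "AV h s1 = []" "VV h s1 = y"
    using dr u(2) v(2) l by (simp_all add: s1_def)
  show ?thesis
    unfolding TAIL_def
  proof (simp only: exec_simps run_DROP bS, simp only: drop_u_simps drop_v_simps exec_simps insert_iff empty_iff bS bQ s1_def[symmetric] f1 zl',
      rule run_MATCH_Seq[where m = "4 * L + 2 * (L * Suc (2 * L))"], goal_cases)
    case (1 s2)
    have f2: "s2 z = s1 z" if "z \<notin> {5, 6, 7, 8, 9, 10, 11, 12, 13, 61, 62, 64}" for z
      using agreeD[OF 1(1), of z] that by simp
    have "s2 11 = of_bool (match (length (Z ?S)) (Z ?S) x)"
      using 1(2) by (simp add: sZ str_state st1)
    then have m2: "s2 11 = of_bool (prefix (Z ?S) x)" by (simp add: match_prefix)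
    show ?case
    proof (simp only: exec_simps insert_iff empty_iff bS bQ f2 f1 zl',
        rule run_MATCH_Seq[where m = "3 * L + 2 * (L * Suc (2 * L))"], goal_cases)
      case (1 s3)
      have f3: "s3 z = s1 z" if "z \<notin> {5, 6, 7, 8, 9, 10, 11, 12, 13, 40, 61, 62, 64}" for z
        using agreeD[OF 1(1), of z] that f2 by simp
      have s40: "s3 40 = of_bool (prefix (Z ?S) x)" using agreeD[OF 1(1), of 40] m2 by simp
      have "s3 11 = of_bool (match (length (Z ?Q)) (Z ?Q) y)"
        using 1(2) by (simp add: sZ str_state st1)
      then have m3: "s3 11 = of_bool (prefix (Z ?Q) y)" by (simp add: match_prefix)
      let ?s = "s3(41 := s3 11)"
      have st: "UU h ?s = x" "VV h ?s = y" using st1 by (simp_all add: state_defs f3)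
      have W0': "W0 \<longleftrightarrow> sys\<^sup>*\<^sup>* (wd h (?s 35), UU h ?s) (wd h (?s 37), VV h ?s) \<and>
        (?s 38 \<noteq> 0 \<longrightarrow> (\<exists>w. eqv (UU h ?s) (Z (wd h (?s 35)) @ w)))"
        unfolding st using W0 by (simp add: f3 f1)
      have lt': "length (UU h ?s) < length (UU h s)" "length (VV h ?s) < length (VV h s)" using lt st by simp_all
      have pre: "?s 22 = t" "?s 23 = t + 4 * k" "?s 0 = 0" "?s 34 \<noteq> 0" "?s 35 \<in> recs t k" "?s 37 \<in> recs t k"
        "cls (wd h (?s 35)) (wd h (?s 37))" "?s 25 = 0" "?s 29 = 0"
        using T s0 r q c by (simp_all add: f3 f1 e1)
      have inj: "?S = ?Q \<longleftrightarrow> s 35 = s 37" using tableD(5)[OF T(1) r q] .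
      have s5: "?s 35 = s 35" "?s 37 = s 37" by (simp_all add: f3 f1)
      show ?case
      proof (cases "prefix (Z ?S) x \<and> prefix (Z ?Q) y")
        case True
        then obtain t1 t2 where t: "x = Z ?S @ t1" "y = Z ?Q @ t2" by (auto simp: prefix_def)
        have "run BOTH ?s h (3 * L + 2 * (L * Suc (2 * L))) (\<lambda>s' h'. h' = h \<and> outcome h t k W0 (length (UU h s)) (length (VV h s)) s')"
          by (rule run_BOTH[OF T(1) pre lt' W0', of t1 t2]) (use t in \<open>simp_all only: st s5\<close>)
        then show ?thesis using True m3 s40 by simp
      next
        case F: False
        show ?thesis
        proof (cases "s 35 = s 37")
          case True
          have "run SAME ?s h (3 * L + 2 * (L * Suc (2 * L))) (\<lambda>s' h'. h' = h \<and> outcome h t k W0 (length (UU h s)) (length (VV h s)) s')"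
            by (rule run_SAME[OF T(1) pre lt' W0']) (simp_all only: st s5 True F, use F True in simp)
          then show ?thesis using F True m3 s40 by (simp add: f3 f1)
        next
          case ne: False
          then have ne': "wd h (?s 35) \<noteq> wd h (?s 37)" using inj by (simp add: f3 f1)
          consider "prefix (Z ?Q) y" "\<not> prefix (Z ?S) x" | "prefix (Z ?S) x" "\<not> prefix (Z ?Q) y"
            | "\<not> prefix (Z ?S) x" "\<not> prefix (Z ?Q) y" using F by blast
          then show ?thesis
          proof cases
            case 1
            then obtain t2 where t2: "y = Z ?Q @ t2" by (auto simp: prefix_def)
            have "run RIGHT ?s h (3 * L + 2 * (L * Suc (2 * L))) (\<lambda>s' h'. h' = h \<and> outcome h t k W0 (length (UU h s)) (length (VV h s)) s')"
              by (rule run_RIGHT[OF T(1) pre lt' W0' ne', of t2]) (use 1 t2 in \<open>simp_all only: st s5\<close>, simp)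
            then show ?thesis using 1 ne m3 s40 by (simp add: f3 f1)
          next
            case 2
            then obtain t1 where t1: "x = Z ?S @ t1" by (auto simp: prefix_def)
            have "run LEFT ?s h (3 * L + 2 * (L * Suc (2 * L))) (\<lambda>s' h'. h' = h \<and> outcome h t k W0 (length (UU h s)) (length (VV h s)) s')"
              by (rule run_LEFT[OF T(1) pre lt' W0' ne', of t1]) (use 2 t1 in \<open>simp_all only: st s5\<close>, simp)
            then show ?thesis using 2 ne m3 s40 by (simp add: f3 f1)
          next
            case 3
            have "run HIDDEN ?s h (3 * L + 2 * (L * Suc (2 * L))) (\<lambda>s' h'. h' = h \<and> outcome h t k W0 (length (UU h s)) (length (VV h s)) s')"
              by (rule run_HIDDEN[OF T(1) pre lt' W0' ne']) (use 3 in \<open>simp_all only: st s5\<close>, simp_all)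
            then show ?thesis using 3 ne m3 s40 by (simp add: f3 f1)
          qed
        qed
      qed
    qed (use lZ in simp_all)
  qed (use lZ n in simp_all)
qed

text \<open>The reason for progress at a site: removing the head reaches beyond the prepended
  piece.\<close>

lemma piece_shorter_than_head:
  assumes p: "piece R a" and h: "head S (a @ b) 0" shows "length a < bl S"
proof (rule ccontr)
  assume "\<not> length a < bl S"
  moreover have "prefix (B S) (a @ b)" using h by (simp add: head_def occ_0)
  ultimately have "prefix (B S) a" by (metis length_B not_less prefix_length_prefix prefixI)
  then show False using piece_prefix[OF p] B_not_piece headD(1)[OF h] by blast
qed

lemma run_SITE:
  assumes T: "table h t k" "s 22 = t" "s 23 = t + 4 * k" and s0: "s 0 = 0" "s 34 \<noteq> 0"
    and r: "s 35 \<in> recs t k" and u: "AU h s @ UU h s = B (wd h (s 35)) @ x"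
    and fs: "first_site (B (wd h (s 35)) @ x) [] (wd h (s 35)) x"
    and p: "piece R (AU h s)" "piece R (AV h s)" "piece R (PW h s)"
    and n: "5 * (L * L) + 10 * L \<le> n"
  shows "run SITE s h n (\<lambda>s' h'. h' = h \<and>
    outcome h t k (WP (AU h s @ UU h s) (AV h s @ VV h s) (PW h s)) (length (UU h s)) (length (VV h s)) s')"
proof -
  let ?S = "wd h (s 35)" let ?v = "AV h s @ VV h s"
  define W where "W = WP (AU h s @ UU h s) ?v (PW h s)"
  have s33: "s 33 \<le> L" using piece_length_le_L[OF p(3)] by (simp add: length_state)
  let ?s = "s(5 := s 28, 6 := s 29, 7 := s 30, 8 := s 31)"
  let ?N = "5 * L + 2 * (L * Suc (2 * L)) + (L + L * Suc L)"
  show ?thesis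
    unfolding W_def[symmetric] SITE_def
  proof (simp only: exec_simps, rule run_Seq'[where ?n2.0 = ?N and ?n1.0 = L])
    show "run HEAD ?s h L (\<lambda>s' h'. h' = h \<and>
      (s' 15 = 0 \<and> (\<forall>S. \<not> head S ?v 0) \<or> s' 15 \<in> recs t k \<and> head (wd h (s' 15)) ?v 0) \<and>
      agree {9, 10, 11, 12, 13, 14, 15, 61, 62, 64} ?s s')"
      by (rule run_HEAD[OF T(1)]) (simp_all add: T str_state)
    show "L + ?N \<le> n" using n by (simp add: algebra_simps)
    fix s1 h1
    assume a: "h1 = h \<and>
      (s1 15 = 0 \<and> (\<forall>S. \<not> head S ?v 0) \<or> s1 15 \<in> recs t k \<and> head (wd h (s1 15)) ?v 0) \<and>
      agree {9, 10, 11, 12, 13, 14, 15, 61, 62, 64} ?s s1"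
    define s2 where "s2 = s1(37 := s1 15)"
    have f2: "s2 z = s z" if "z \<notin> {5, 6, 7, 8, 9, 10, 11, 12, 13, 14, 15, 37, 61, 62, 64}" for z
      using agreeD[of "{9, 10, 11, 12, 13, 14, 15, 61, 62, 64}" ?s s1 z] a that by (simp add: s2_def)
    have s37: "s2 37 = s1 15" by (simp add: s2_def)
    have st2: "AU h s2 = AU h s" "UU h s2 = UU h s" "AV h s2 = AV h s" "VV h s2 = VV h s" "PW h s2 = PW h s"
      by (simp_all add: state_defs f2)
    have z0: "0 \<notin> recs t k" using tableD(7)[OF T(1)] by (auto simp: recs_def)
    have noW: "\<not> W" if "\<And>Q. head Q ?v 0 \<Longrightarrow> \<not> cls ?S Q"
      using WP_site_heads[OF fs, of ?v "PW h s"] that unfolding W_def u by blast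
    have fail: "outcome h t k W (length (UU h s)) (length (VV h s)) (s'(34 := 0))"
      if "\<not> W" "s' 0 = 0" "s' 22 = t" "s' 23 = t + 4 * k" for s'
      using that by (simp add: outcome_def)
    have "run (Cond (And (V 37) (Eq (H (Plus (V 35) (N 3))) (H (Plus (V 37) (N 3)))))
      (NEED ;; Cond (V 39) TAIL (Asg 34 (N 0))) (Asg 34 (N 0))) s2 h ?N
      (\<lambda>s' h'. h' = h \<and> outcome h t k W (length (UU h s)) (length (VV h s)) s')"
    proof (cases "s1 15 \<noteq> 0 \<and> h (s 35 + 3) = h (s1 15 + 3)")
      case False
      have "\<not> W"
      proof (rule noW, rule notI)
        fix Q assume Q: "head Q ?v 0" "cls ?S Q"
        then have q: "s1 15 \<in> recs t k" "head (wd h (s1 15)) ?v 0" using a by auto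
        then have "wd h (s1 15) = Q" using head_unique Q(1) by blast
        then have "h (s 35 + 3) = h (s1 15 + 3)" using Q(2) tableD(4)[OF T(1) r q(1)] by simp
        then show False using False q(1) z0 by auto
      qed
      from fail[OF this, of s2] False show ?thesis by (auto simp: s37 f2 s0 T)
    next
      case True
      then have q: "s1 15 \<in> recs t k" "head (wd h (s1 15)) ?v 0" using a by auto
      let ?Q = "wd h (s1 15)"
      have cl: "cls ?S ?Q" using True tableD(4)[OF T(1) r q(1)] by simp
      obtain y where y: "?v = B ?Q @ y" using q(2) unfolding head_def occ_0 prefix_def by blast
      have hu: "head ?S (AU h s @ UU h s) 0" unfolding u using tableD(1)[OF T(1) r] by (simp add: head_def occ_0)
      have lA: "length (AU h s) < bl ?S" "length (AV h s) < bl ?Q"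
        using piece_shorter_than_head[OF p(1) hu] piece_shorter_than_head[OF p(2) q(2)] by auto
      have W2: "W \<longleftrightarrow> sys\<^sup>*\<^sup>* (?S, x) (?Q, y) \<and>
        (prefix (PW h s) ?S \<or> (\<exists>P. cls ?S P \<and> prefix (PW h s) P) \<and> (\<exists>w. eqv x (Z ?S @ w)))"
        unfolding W_def u y by (rule WP_site[OF fs tableD(1)[OF T(1) q(1)] p(3)])
      have "run (NEED ;; Cond (V 39) TAIL (Asg 34 (N 0))) s2 h ?N
        (\<lambda>s' h'. h' = h \<and> outcome h t k W (length (UU h s)) (length (VV h s)) s')"
      proof (rule run_Seq'[where ?n2.0 = "5 * L + 2 * (L * Suc (2 * L))" and ?n1.0 = "L + L * Suc L"])
        have "s 33 + L * Suc (s 33) \<le> L + L * Suc L" using s33 by (intro add_mono mult_le_mono) simp_all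
        then show "run NEED s2 h (L + L * Suc L) (\<lambda>s' h'. h' = h \<and> (s' 38 = 0 \<longleftrightarrow> prefix (PW h s2) (wd h (s2 35))) \<and>
          (s' 39 \<noteq> 0 \<longleftrightarrow> prefix (PW h s2) (wd h (s2 35)) \<or> (\<exists>P. cls (wd h (s2 35)) P \<and> prefix (PW h s2) P)) \<and>
          agree {5, 6, 8, 9, 10, 11, 12, 13, 14, 15, 38, 39, 61, 62, 64} s2 s')"
          by (intro run_NEED[OF T(1)]) (simp_all add: T f2 r)
        fix s3 h3
        assume b: "h3 = h \<and> (s3 38 = 0 \<longleftrightarrow> prefix (PW h s2) (wd h (s2 35))) \<and>
          (s3 39 \<noteq> 0 \<longleftrightarrow> prefix (PW h s2) (wd h (s2 35)) \<or> (\<exists>P. cls (wd h (s2 35)) P \<and> prefix (PW h s2) P)) \<and>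
          agree {5, 6, 8, 9, 10, 11, 12, 13, 14, 15, 38, 39, 61, 62, 64} s2 s3"
        then have ag: "agree {5, 6, 8, 9, 10, 11, 12, 13, 14, 15, 38, 39, 61, 62, 64} s2 s3" by simp
        have f3: "s3 z = s2 z" if "z \<notin> {5, 6, 8, 9, 10, 11, 12, 13, 14, 15, 38, 39, 61, 62, 64}" for z
          using agreeD[OF ag that] .
        have st3: "AU h s3 = AU h s" "UU h s3 = UU h s" "AV h s3 = AV h s" "VV h s3 = VV h s"
          using state_agree[OF ag, of h] st2 by simp_all
        have s3: "s3 35 = s 35" "s3 37 = s1 15" by (simp_all add: f3 f2 s37)
        have n38: "s3 38 = 0 \<longleftrightarrow> prefix (PW h s) ?S" using b by (simp add: st2 f2)
        have n39: "s3 39 \<noteq> 0 \<longleftrightarrow> prefix (PW h s) ?S \<or> (\<exists>P. cls ?S P \<and> prefix (PW h s) P)" using b by (simp add: st2 f2)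
        show "run (Cond (V 39) TAIL (Asg 34 (N 0))) s3 h3 (5 * L + 2 * (L * Suc (2 * L)))
          (\<lambda>s' h'. h' = h \<and> outcome h t k W (length (UU h s)) (length (VV h s)) s')"
        proof (cases "s3 39 = 0")
          case True
          then have "\<not> W" using n39 W2 by blast
          from fail[OF this, of s3] True b show ?thesis by (simp add: f3 f2 s0 T)
        next
          case False
          have W3: "W \<longleftrightarrow> sys\<^sup>*\<^sup>* (wd h (s3 35), x) (wd h (s3 37), y) \<and>
            (s3 38 \<noteq> 0 \<longrightarrow> (\<exists>w. eqv x (Z (wd h (s3 35)) @ w)))"
            using W2 n38 n39 False unfolding s3 by (cases "prefix (PW h s) ?S") simp_all
          have "run TAIL s3 h (5 * L + 2 * (L * Suc (2 * L)))
            (\<lambda>s' h'. h' = h \<and> outcome h t k W (length (UU h s3)) (length (VV h s3)) s')"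
            by (rule run_TAIL[OF T(1) _ _ _ _ _ _ _ _ _ _ _ W3])
              (use r q cl u y lA s0 T in \<open>simp_all add: s3 st3\<close>, simp_all add: f3 f2 s0 T)
          then show ?thesis using False b st3 by simp
        qed
      qed simp
      then show ?thesis using True by (simp add: s37 f2)
    qed
    then show "run (Asg 37 (V 15) ;; Cond (And (V 37) (Eq (H (Plus (V 35) (N 3))) (H (Plus (V 37) (N 3)))))
      (NEED ;; Cond (V 39) TAIL (Asg 34 (N 0))) (Asg 34 (N 0))) s1 h1 ?N
      (\<lambda>s' h'. h' = h \<and> outcome h t k W (length (UU h s)) (length (VV h s)) s')"
      using a by (simp only: exec_simps s2_def)
  qed
qed

section \<open>Invariant and potential of the main loop\<close>

definition good :: "mem \<Rightarrow> nat \<Rightarrow> nat \<Rightarrow> bool \<Rightarrow> mem \<Rightarrow> bool" where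
  "good h t k W s \<longleftrightarrow> s 22 = t \<and> s 23 = t + 4 * k \<and>
    (s 34 = 0 \<and> s 0 = of_bool W \<or> s 34 \<noteq> 0 \<and> s 0 = 0 \<and>
      (WP (AU h s @ UU h s) (AV h s @ VV h s) (PW h s) \<longleftrightarrow> W) \<and>
      piece R (AU h s) \<and> piece R (AV h s) \<and> piece R (PW h s))"

text \<open>
  An iteration that starts at a head costs \<open>O(L\<^sup>2)\<close> and reads a fresh letter of either input word,
  since a piece is shorter than a head; any other iteration costs \<open>O(L)\<close>. The potential
  pays for the at most \<open>L\<close> letters of the piece \<open>AU\<close> at the lower price.
\<close>

definition pot :: "mem \<Rightarrow> nat" where
  "pot s = (let M = L + 2; E = 20 * (M * M) in
    if s 34 = 0 then 0 else E + min (2 * E * s 27 + 3 * M * s 25) (2 * E * s 31 + 3 * M * s 29))"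

text \<open>L for \<open>HEAD\<close>, 2 for \<open>STEP\<close> on a single letter and 1 for the
  iteration stay below 3 M, which every letter releases at least, whether prepended or
  fresh.\<close>

lemma pot_step:
  assumes "s 34 \<noteq> 0" "0 < s 25 + s 27" "0 < s 29 + s 31"
    and "s' 25 = s 25 - 1" "s' 27 = s 27 - (1 - s 25)" "s' 29 = s 29 - 1" "s' 31 = s 31 - (1 - s 29)"
  shows "pot s' + (L + 2) + 1 \<le> pot s"
proof -
  define M where "M = L + 2"
  define E where "E = 20 * (M * M)"
  have E: "3 * M \<le> 2 * E" "L + 3 \<le> 3 * M" unfolding E_def M_def by (simp_all add: algebra_simps)
  have *: "2 * E * (b - (1 - a)) + 3 * M * (a - 1) + 3 * M \<le> 2 * E * b + 3 * M * a" if ab: "0 < a + b" for a b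
  proof (cases a)
    case 0
    then obtain b' where "b = Suc b'" using ab by (cases b) auto
    then show ?thesis using 0 E by simp
  next
    case (Suc a')
    then show ?thesis by simp
  qed
  show ?thesis
    using *[OF assms(2)] *[OF assms(3)] E(2) assms(1,4-7) unfolding pot_def M_def[symmetric] Let_def E_def[symmetric]
    by (auto simp: min_def)
qed

text \<open>A fresh letter releases 2 E. This covers the cost of the iteration and provides 3 M for
  each of the at most L letters of a newly prepended piece; the factor 20 in E is generous.\<close>

lemma pot_fresh:
  assumes "s 34 \<noteq> 0" "s' 25 \<le> L" "s' 27 < s 27" "s' 29 \<le> L" "s' 31 < s 31"
  shows "pot s' + (6 * (L * L) + 12 * L) + 1 \<le> pot s"
proof -
  define M where "M = L + 2"
  define E where "E = 20 * (M * M)"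
  define N where "N = 6 * (L * L) + 12 * L"
  have E: "3 * M * L + N + 1 \<le> 2 * E" unfolding E_def M_def N_def by (simp add: algebra_simps)
  have *: "2 * E * b' + 3 * M * a' + N + 1 \<le> 2 * E * b + 3 * M * a" if "a' \<le> L" "b' < b" for a a' b b'
  proof -
    have "2 * E * Suc b' \<le> 2 * E * b" using that(2) by (intro mult_le_mono2) simp
    moreover have "3 * M * a' \<le> 3 * M * L" using that(1) by (intro mult_le_mono2)
    moreover have "2 * E * Suc b' = 2 * E * b' + 2 * E" by simp
    ultimately show ?thesis using E by linarith
  qed
  show ?thesis
    using *[OF assms(2,3), of "s 25"] *[OF assms(4,5), of "s 29"] assms(1)
    unfolding pot_def M_def[symmetric] Let_def E_def[symmetric] N_def[symmetric]
    by (auto simp: min_def)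
qed

text \<open>The constant summand E of the potential is reserved for the iteration that stops the
  loop.\<close>

lemma pot_stop:
  assumes "s 34 \<noteq> 0" "s' 34 = 0"
  shows "pot s' + (6 * (L * L) + 12 * L + 2) + 1 \<le> pot s"
  using assms unfolding pot_def Let_def by (simp add: algebra_simps)

lemma run_STEP_good:
  assumes g: "good h t k W s" "s 34 \<noteq> 0" and ns: "\<And>j. j < s 36 \<Longrightarrow> \<not> site (AU h s @ UU h s) j"
    and le: "s 36 \<le> s 25 + s 27" and n: "2 * s 36 \<le> n"
  shows "run STEP s h n (\<lambda>s' h'. h' = h \<and> good h t k W s' \<and>
    (s' 34 = 0 \<or> s' 34 \<noteq> 0 \<and> match (s 36) (AU h s @ UU h s) (AV h s @ VV h s) \<and>
      s' 25 = s 25 - s 36 \<and> s' 27 = s 27 - (s 36 - s 25) \<and> s' 29 = s 29 - s 36 \<and> s' 31 = s 31 - (s 36 - s 29)))"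
proof (rule run_mono[OF run_STEP[where s = s, OF n] order_refl])
  let ?u = "AU h s @ UU h s" let ?v = "AV h s @ VV h s" let ?l = "s 36"
  have lu: "?l \<le> length ?u" using le by (simp add: length_state)
  have W: "W \<longleftrightarrow> match ?l ?u ?v \<and> prefix (take ?l (PW h s)) ?u \<and> WP (drop ?l ?u) (drop ?l ?v) (drop ?l (PW h s))"
    using g WP_nonsite[of ?l ?u ?v "PW h s", OF ns lu] lu unfolding good_def match_def by blast
  have pc: "piece R (drop ?l (AU h s))" "piece R (drop ?l (AV h s))" "piece R (drop ?l (PW h s))"
    using g piece_suffix suffix_drop unfolding good_def by blast+
  fix s' h'
  assume a: "h' = h \<and> s' 0 = s 0 \<and> s' 22 = s 22 \<and> s' 23 = s 23 \<and>
    (if match ?l ?u ?v \<and> prefix (take ?l (PW h s)) ?u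
     then s' 34 = s 34 \<and> AU h s' = drop ?l (AU h s) \<and> UU h s' = drop (?l - s 25) (UU h s) \<and>
       AV h s' = drop ?l (AV h s) \<and> VV h s' = drop (?l - s 29) (VV h s) \<and> PW h s' = drop ?l (PW h s)
     else s' 34 = 0)"
  show "h' = h \<and> good h t k W s' \<and>
    (s' 34 = 0 \<or> s' 34 \<noteq> 0 \<and> match ?l ?u ?v \<and>
      s' 25 = s 25 - ?l \<and> s' 27 = s 27 - (?l - s 25) \<and> s' 29 = s 29 - ?l \<and> s' 31 = s 31 - (?l - s 29))"
  proof (cases "match ?l ?u ?v \<and> prefix (take ?l (PW h s)) ?u")
    case False
    then have "\<not> W" "s' 34 = 0" using W a by auto
    then show ?thesis using a g by (simp add: good_def)
  next
    case True
    then have st: "s' 34 = s 34" "AU h s' = drop ?l (AU h s)" "UU h s' = drop (?l - s 25) (UU h s)"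
       "AV h s' = drop ?l (AV h s)" "VV h s' = drop (?l - s 29) (VV h s)" "PW h s' = drop ?l (PW h s)"
      using a by auto
    have "AU h s' @ UU h s' = drop ?l ?u" "AV h s' @ VV h s' = drop ?l ?v"
      unfolding st by (simp_all add: length_state)
    then have "good h t k W s'" using a g W True st pc by (simp add: good_def)
    moreover have "s' 25 = s 25 - ?l" "s' 27 = s 27 - (?l - s 25)" "s' 29 = s 29 - ?l" "s' 31 = s 31 - (?l - s 29)"
      using arg_cong[OF st(2), of length] arg_cong[OF st(3), of length] arg_cong[OF st(4), of length]
        arg_cong[OF st(5), of length] by (simp_all add: length_state)
    ultimately show ?thesis using a True st(1) g(2) by simp
  qed
qed

text \<open>Otherwise the first l letters of \<open>B S\<close> would be a piece as part of
  \<open>a\<close>, and the others would be one as the overlap with \<open>S'\<close>. The piece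
  \<open>a\<close> may belong to the second word, which agrees with \<open>u\<close> on the letters
  concerned.\<close>

lemma piece_shorter_than_overlap:
  assumes p: "piece R a" and S: "head S u 0" and S': "head S' u l" and l: "0 < l" "l < bl S"
    and a: "take l (a @ b) = take l u"
  shows "length a < l"
proof (rule ccontr)
  assume "\<not> length a < l"
  then have la: "take l a = take l u" using a by simp
  have lS: "l + bl S' \<le> length u" "bl S \<le> length u" using headD(2)[OF S] headD(2)[OF S'] by simp_all
  have "take l u = take l S" using headD(3)[OF S] lS l bl_le[of S] by (intro nth_equalityI) auto
  then have 1: "piece R (take l S)" using la piece_prefix[OF p take_is_prefix, of l] by simp
  have over: "bl S < l + bl S'"
  proof (rule ccontr)
    assume "\<not> bl S < l + bl S'"
    then show False
      using headD(3)[OF S] headD(3)[OF S'] headD(1)[OF S] headD(1)[OF S'] l bl_le[of S]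
      by (intro B_two_occurrences[of S' S l]) auto
  qed
  have "piece R (take (bl S - l) (drop l S))"
    by (rule piece_if_two_occurrences[of _ S' _ _ 0])
      (use headD(3)[OF S] headD(3)[OF S'] headD(1)[OF S] headD(1)[OF S'] l over bl_le[of S] bl_le[of S'] in \<open>auto simp flip: headD(3)[OF S]\<close>)
  then show False using B_not_two_pieces[OF headD(1)[OF S] _ 1] l by simp
qed

lemma run_BODY:
  assumes T: "table h t k" and g: "good h t k W s" "s 34 \<noteq> 0"
  shows "\<exists>n. run BODY s h n (\<lambda>s' h'. h' = h \<and> good h t k W s' \<and> pot s' + n + 1 \<le> pot s)"
proof -
  let ?u = "AU h s @ UU h s" let ?v = "AV h s @ VV h s"
  have T2: "s 22 = t" "s 23 = t + 4 * k" and s0: "s 0 = 0" and W: "WP ?u ?v (PW h s) \<longleftrightarrow> W"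
    and p: "piece R (AU h s)" "piece R (AV h s)" "piece R (PW h s)"
    using g unfolding good_def by auto
  show ?thesis
  proof (cases "s 25 + s 27 = 0 \<or> s 29 + s 31 = 0")
    case True
    then have "?u = [] \<or> ?v = []" using length_state[of h s] by auto
    then have "W \<longleftrightarrow> ?u = [] \<and> ?v = [] \<and> PW h s = []" using WP_Nil[of ?u ?v "PW h s"] W by simp
    also have "\<dots> \<longleftrightarrow> s 25 + s 27 = 0 \<and> s 29 + s 31 = 0 \<and> s 33 = 0"
      using length_state[of h s] by (auto simp flip: length_0_conv)
    finally have W': "W \<longleftrightarrow> s 25 + s 27 = 0 \<and> s 29 + s 31 = 0 \<and> s 33 = 0" .
    let ?s = "s(0 := of_bool W, 34 := 0)"
    have "pot ?s + 0 + 1 \<le> pot s" using pot_stop[of s ?s] g(2) by simp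
    moreover have "good h t k W ?s" by (simp add: good_def T2)
    ultimately show ?thesis using True W' by (intro exI[of _ 0]) (auto simp: BODY_def)
  next
    case ne: False
    let ?s = "s(5 := s 24, 6 := s 25, 7 := s 26, 8 := s 27)"
    let ?H = "\<lambda>s' h'. h' = h \<and>
        (s' 15 = 0 \<and> (\<forall>S. \<not> head S ?u 0) \<or> s' 15 \<in> recs t k \<and> head (wd h (s' 15)) ?u 0) \<and>
        agree {9, 10, 11, 12, 13, 14, 15, 61, 62, 64} ?s s'"
    have H: "run HEAD ?s h L ?H" by (rule run_HEAD[OF T]) (simp_all add: T2 str_state)
    have z0: "0 \<notin> recs t k" using tableD(7)[OF T] by (auto simp: recs_def)
    have good_frame: "good h t k W s'" if "\<And>z. z \<in> {0, 22, 23, 24, 25, 26, 27, 28, 29, 30, 31, 32, 33, 34} \<Longrightarrow> s' z = s z" for s'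
      using g that by (simp add: good_def state_defs)
    have cond: "ev (And (Plus (V 25) (V 27)) (Plus (V 29) (V 31))) s h \<noteq> 0" using ne by simp
    show ?thesis
    proof (cases "\<exists>S. head S ?u 0")
      case False
      show ?thesis
        unfolding BODY_def run_Cond if_P[OF cond]
      proof (rule exI[of _ "L + 2"], simp only: exec_simps, rule run_Seq'[OF H, where ?n2.0 = 2], goal_cases)
        case (1 s1 h1)
        then have h1: "h1 = h" and s15: "s1 15 = 0" using False by auto
        let ?s2 = "s1(35 := s1 15, 36 := 1)"
        have f: "?s2 z = s z" if "z \<notin> {5, 6, 7, 8, 9, 10, 11, 12, 13, 14, 15, 35, 36, 61, 62, 64}" for z
          using agreeD[of "{9, 10, 11, 12, 13, 14, 15, 61, 62, 64}" ?s s1 z] 1 that by simp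
        have st: "AU h ?s2 = AU h s" "UU h ?s2 = UU h s" "AV h ?s2 = AV h s" "VV h ?s2 = VV h s"
          by (simp_all only: state_defs f insert_iff empty_iff numeral_eq_iff num.distinct num.inject simp_thms)
        have "run STEP ?s2 h 2 (\<lambda>s' h'. h' = h \<and> good h t k W s' \<and>
          (s' 34 = 0 \<or> s' 34 \<noteq> 0 \<and> match (?s2 36) (AU h ?s2 @ UU h ?s2) (AV h ?s2 @ VV h ?s2) \<and>
            s' 25 = ?s2 25 - ?s2 36 \<and> s' 27 = ?s2 27 - (?s2 36 - ?s2 25) \<and> s' 29 = ?s2 29 - ?s2 36 \<and> s' 31 = ?s2 31 - (?s2 36 - ?s2 29)))"
        proof (rule run_STEP_good)
          show "good h t k W ?s2" by (rule good_frame, rule f) auto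
          show "?s2 34 \<noteq> 0" using f[of 34] g(2) by simp
          have "1 \<le> s 25 + s 27" using ne by linarith
          then show "?s2 36 \<le> ?s2 25 + ?s2 27" using f[of 25] f[of 27] by simp
          fix j assume "j < ?s2 36"
          then show "\<not> site (AU h ?s2 @ UU h ?s2) j" using False unfolding st by (auto simp: site_def)
        qed simp
        then have "run STEP ?s2 h 2 (\<lambda>s' h'. h' = h \<and> good h t k W s' \<and> pot s' + (L + 2) + 1 \<le> pot s)"
        proof (rule run_mono[OF _ order_refl], goal_cases)
          case (1 s3 h3)
          have fs: "s1 25 = s 25" "s1 27 = s 27" "s1 29 = s 29" "s1 31 = s 31"
            using f[of 25] f[of 27] f[of 29] f[of 31] by simp_all
          show ?case
          proof (cases "s3 34 = 0")
            case True
            from pot_stop[of s s3, OF g(2) this] 1 show ?thesis by simp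
          next
            case False
            have "pot s3 + (L + 2) + 1 \<le> pot s"
              by (rule pot_step) (use 1 False ne g(2) fs in auto)
            then show ?thesis using 1 by simp
          qed
        qed
        then show ?case using s15 h1 by simp
      qed simp
    next
      case True
      let ?n2 = "L * Suc L + (5 * (L * L) + 10 * L)"
      show ?thesis
        unfolding BODY_def run_Cond if_P[OF cond]
      proof (rule exI[of _ "6 * (L * L) + 12 * L"], simp only: exec_simps, rule run_Seq'[OF H, where ?n2.0 = ?n2], goal_cases)
        case (1 s1 h1)
        then have h1: "h1 = h" and r: "s1 15 \<in> recs t k" "head (wd h (s1 15)) ?u 0" using True by auto
        define s2 where "s2 = s1(35 := s1 15)"
        let ?S = "wd h (s1 15)"
        have f2: "s2 z = s z" if "z \<notin> {5, 6, 7, 8, 9, 10, 11, 12, 13, 14, 15, 35, 61, 62, 64}" for z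
          using agreeD[of "{9, 10, 11, 12, 13, 14, 15, 61, 62, 64}" ?s s1 z] 1 that by (simp add: s2_def)
        have s35: "s2 35 = s1 15" by (simp add: s2_def)
        have st2: "AU h s2 = AU h s" "UU h s2 = UU h s" by (simp_all add: state_defs f2)
        have bu: "bl ?S \<le> length ?u" using headD(2)[OF r(2)] by simp
        have blL: "bl ?S \<le> L" using length_le_L[OF headD(1)[OF r(2)]] bl_le[of ?S] by simp
        have "run (SCAN ;; Cond (V 37) STEP SITE) s2 h ?n2 (\<lambda>s' h'. h' = h \<and> good h t k W s' \<and>
          pot s' + (6 * (L * L) + 12 * L) + 1 \<le> pot s)"
        proof (rule run_Seq'[where ?n1.0 = "L * Suc L" and ?n2.0 = "5 * (L * L) + 10 * L"])
          show "run SCAN s2 h (L * Suc L) (\<lambda>s' h'. h' = h \<and> 0 < s' 36 \<and> s' 36 \<le> bl (wd h (s2 35)) \<and>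
            (\<forall>j S. 0 < j \<and> j < s' 36 \<longrightarrow> \<not> head S ?u j) \<and>
            (s' 37 = 0 \<and> s' 36 = bl (wd h (s2 35)) \<or> s' 37 = 1 \<and> s' 36 < bl (wd h (s2 35)) \<and> (\<exists>S. head S ?u (s' 36))) \<and>
            agree {5, 6, 7, 8, 9, 10, 11, 12, 13, 14, 15, 36, 37, 61, 62, 64} s2 s')"
            by (rule run_SCAN[OF T]) (simp_all add: T2 f2 s35 r st2)
          fix s3 h3
          assume a: "h3 = h \<and> 0 < s3 36 \<and> s3 36 \<le> bl (wd h (s2 35)) \<and>
            (\<forall>j S. 0 < j \<and> j < s3 36 \<longrightarrow> \<not> head S ?u j) \<and>
            (s3 37 = 0 \<and> s3 36 = bl (wd h (s2 35)) \<or> s3 37 = 1 \<and> s3 36 < bl (wd h (s2 35)) \<and> (\<exists>S. head S ?u (s3 36))) \<and>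
            agree {5, 6, 7, 8, 9, 10, 11, 12, 13, 14, 15, 36, 37, 61, 62, 64} s2 s3"
          have f3: "s3 z = s z" if "z \<notin> {5, 6, 7, 8, 9, 10, 11, 12, 13, 14, 15, 35, 36, 37, 61, 62, 64}" for z
            using agreeD[of "{5, 6, 7, 8, 9, 10, 11, 12, 13, 14, 15, 36, 37, 61, 62, 64}" s2 s3 z] a f2[of z] that by simp
          have s35': "s3 35 = s1 15"
            using agreeD[of "{5, 6, 7, 8, 9, 10, 11, 12, 13, 14, 15, 36, 37, 61, 62, 64}" s2 s3 35] a s35 by simp
          have st: "AU h s3 = AU h s" "UU h s3 = UU h s" "AV h s3 = AV h s" "VV h s3 = VV h s" "PW h s3 = PW h s"
            by (simp_all add: state_defs f3)
          have g3: "good h t k W s3" by (rule good_frame, rule f3) auto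
          show "run (Cond (V 37) STEP SITE) s3 h3 (5 * (L * L) + 10 * L) (\<lambda>s' h'. h' = h \<and> good h t k W s' \<and>
            pot s' + (6 * (L * L) + 12 * L) + 1 \<le> pot s)"
          proof (cases "s3 37 = 0")
            case False
            then have l: "0 < s3 36" "s3 36 < bl ?S" and h': "\<exists>S'. head S' ?u (s3 36)"
              and nh: "\<And>j S. 0 < j \<Longrightarrow> j < s3 36 \<Longrightarrow> \<not> head S ?u j" using a s35 by auto
            have "run STEP s3 h (5 * (L * L) + 10 * L) (\<lambda>s' h'. h' = h \<and> good h t k W s' \<and>
              (s' 34 = 0 \<or> s' 34 \<noteq> 0 \<and> match (s3 36) (AU h s3 @ UU h s3) (AV h s3 @ VV h s3) \<and>
                s' 25 = s3 25 - s3 36 \<and> s' 27 = s3 27 - (s3 36 - s3 25) \<and> s' 29 = s3 29 - s3 36 \<and> s' 31 = s3 31 - (s3 36 - s3 29)))"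
            proof (rule run_STEP_good[OF g3])
              fix j assume j: "j < s3 36"
              show "\<not> site (AU h s3 @ UU h s3) j"
              \<comment> \<open>Position 0 carries a head but is no site, since the head found by
                \<open>SCAN\<close> overlaps it; the positions in between carry no head.\<close>
              proof (cases "j = 0")
                case True
                then show ?thesis unfolding st site_def using h' l r(2) head_unique by (metis add_0)
              next
                case False
                then show ?thesis unfolding st site_def using nh j by blast
              qed
            qed (use l bu blL g(2) f3 in \<open>auto simp: length_state\<close>)
            then have "run STEP s3 h (5 * (L * L) + 10 * L) (\<lambda>s' h'. h' = h \<and> good h t k W s' \<and>
              pot s' + (6 * (L * L) + 12 * L) + 1 \<le> pot s)"
            proof (rule run_mono[OF _ order_refl], goal_cases)
              case (1 s4 h4)
              show ?case
              proof (cases "s4 34 = 0")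
                case True
                from pot_stop[of s s4, OF g(2) this] 1 show ?thesis by simp
              next
                case False
                then have m: "match (s3 36) ?u ?v" using 1 st by simp
                obtain S' where S': "head S' ?u (s3 36)" using h' by blast
                \<comment> \<open>Both prepended pieces end before the overlapping head, so a fresh
                  letter of either word is read.\<close>
                have "length (AU h s) < s3 36"
                  by (rule piece_shorter_than_overlap[OF p(1) r(2) S' l HOL.refl])
                moreover have "length (AV h s) < s3 36"
                  by (rule piece_shorter_than_overlap[OF p(2) r(2) S' l]) (use m in \<open>simp add: match_def\<close>)
                moreover have "s3 36 \<le> s 25 + s 27" "s3 36 \<le> s 29 + s 31"
                  using m by (simp_all add: match_def length_state)
                ultimately have "pot s4 + (6 * (L * L) + 12 * L) + 1 \<le> pot s"
                  by (intro pot_fresh) (use 1 False g(2) f3 in \<open>auto simp: length_state\<close>)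
                then show ?thesis using 1 by simp
              qed
            qed
            then show ?thesis using False a by simp
          next
            case True
            then have nh: "\<And>j S. 0 < j \<Longrightarrow> j < bl ?S \<Longrightarrow> \<not> head S ?u j" using a s35 by auto
            obtain x where x: "?u = B ?S @ x" "first_site ?u [] ?S x" using site_at_0[OF r(2) nh] by blast
            have "run SITE s3 h (5 * (L * L) + 10 * L) (\<lambda>s' h'. h' = h \<and>
              outcome h t k (WP (AU h s3 @ UU h s3) (AV h s3 @ VV h s3) (PW h s3)) (length (UU h s3)) (length (VV h s3)) s')"
              by (rule run_SITE[OF T, where x = x]) (use T2 s0 g(2) r x p in \<open>simp_all add: f3 s35' st\<close>)
            then have "run SITE s3 h (5 * (L * L) + 10 * L) (\<lambda>s' h'. h' = h \<and> good h t k W s' \<and>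
              pot s' + (6 * (L * L) + 12 * L) + 1 \<le> pot s)"
            proof (rule run_mono[OF _ order_refl], goal_cases)
              case (1 s4 h4)
              then have o: "outcome h t k W (length (UU h s)) (length (VV h s)) s4" and h4: "h4 = h" using st W by simp_all
              then have g4: "good h t k W s4" unfolding outcome_def good_def by auto
              show ?case
              proof (cases "s4 34 = 0")
                case True
                from pot_stop[of s s4, OF g(2) this] g4 h4 show ?thesis by simp
              next
                case False
                have "pot s4 + (6 * (L * L) + 12 * L) + 1 \<le> pot s"
                  by (rule pot_fresh) (use o False g(2) piece_length_le_L[of "AU h s4"] piece_length_le_L[of "AV h s4"]
                    length_state[of h s4] length_state[of h s] in \<open>simp_all add: outcome_def\<close>)
                then show ?thesis using g4 h4 by simp
              qed
            qed
            then show ?thesis using True a by simp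
          qed
        qed simp
        moreover have "s1 15 \<noteq> 0" using r(1) z0 by metis
        ultimately show ?case using h1 by (simp add: s2_def)
      qed (simp add: algebra_simps)
    qed
  qed
qed

lemma run_main_loop:
  assumes T: "table h t k" and g: "good h t k W s" and n: "pot s \<le> n"
  shows "run (Loop (V 34) BODY) s h n (\<lambda>s' h'. s' 0 = of_bool W)"
proof (rule run_Loop[where I = "\<lambda>s' h'. h' = h \<and> good h t k W s'" and \<phi> = "\<lambda>s' h'. pot s'"], goal_cases)
  case (3 s' h')
  then obtain m where "run BODY s' h m (\<lambda>s'' h'. h' = h \<and> good h t k W s'' \<and> pot s'' + m + 1 \<le> pot s')"
    using run_BODY[OF T, of W s'] by auto
  then show ?case using 3(1) by (intro exI[of _ m]) simp
qed (use g n in \<open>auto simp: good_def\<close>)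

end

section \<open>Collecting the relation words\<close>

definition holds :: "mem \<Rightarrow> nat \<Rightarrow> nat list \<Rightarrow> bool" where
  "holds h a xs \<longleftrightarrow> (\<forall>i<length xs. h (a + i) = xs ! i)"

lemma holds_Nil [simp]: "holds h a []" by (simp add: holds_def)

lemma holds_append [simp]: "holds h a (xs @ ys) \<longleftrightarrow> holds h a xs \<and> holds h (a + length xs) ys"
proof
  assume H: "holds h a (xs @ ys)"
  have "h (a + length xs + i) = ys ! i" if "i < length ys" for i
    using H that unfolding holds_def
    by (metis add.assoc add_less_cancel_left length_append nth_append_length_plus)
  moreover have "h (a + i) = xs ! i" if "i < length xs" for i
    using H that unfolding holds_def by (metis length_append nth_append trans_less_add1)
  ultimately show "holds h a xs \<and> holds h (a + length xs) ys" by (simp add: holds_def)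
next
  assume "holds h a xs \<and> holds h (a + length xs) ys"
  then show "holds h a (xs @ ys)"
    unfolding holds_def length_append nth_append
    by (metis add.assoc add_diff_inverse_nat add_less_cancel_left)
qed

lemma holds_Cons [simp]: "holds h a (x # xs) \<longleftrightarrow> h a = x \<and> holds h (a + 1) xs"
  using holds_append[of h a "[x]" xs] by (simp add: holds_def One_nat_def)

lemma holds_cong: "holds h a xs \<Longrightarrow> (\<And>b. a \<le> b \<Longrightarrow> b < a + length xs \<Longrightarrow> h' b = h b) \<Longrightarrow> holds h' a xs"
  by (simp add: holds_def)

lemma holds_seg: "holds h a xs \<Longrightarrow> seg h a (length xs) = xs"
  by (rule nth_equalityI) (auto simp: holds_def)

definition encs :: "nat list list \<Rightarrow> nat list" where
  "encs ws = concat (map encode_word ws)"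

lemma encs_simps [simp]: "encs [] = []" "encs (w # ws) = length w # w @ encs ws"
  by (simp_all add: encs_def encode_word_def)

text \<open>One pass over the relations finds their end, which the header does not give, and
  accumulates in 48 a bound for all letters occurring in them.\<close>

definition SIZE :: com where
  "SIZE = Loop (V 46) (Asg 47 (H (V 45)) ;; Asg 45 (Plus (V 45) (N 1)) ;;
    Loop (V 47) (Asg 48 (Plus (V 48) (H (V 45))) ;; Asg 45 (Plus (V 45) (N 1)) ;; Asg 47 (Minus (V 47) (N 1))) ;;
    Asg 46 (Minus (V 46) (N 1)))"

lemma run_SIZE_word:
  assumes w: "holds h (s 45) w" "s 47 = length w" and n: "length w \<le> n"
  shows "run (Loop (V 47) (Asg 48 (Plus (V 48) (H (V 45))) ;; Asg 45 (Plus (V 45) (N 1)) ;; Asg 47 (Minus (V 47) (N 1))))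
    s h n (\<lambda>s' h'. h' = h \<and> s' 45 = s 45 + length w \<and> s' 48 = s 48 + sum_list w \<and> agree {45, 47, 48} s s')"
proof (rule run_Loop[where I = "\<lambda>s' h'. h' = h \<and> agree {45, 47, 48} s s' \<and>
      (\<exists>v. holds h (s' 45) v \<and> s' 47 = length v \<and> s' 45 + length v = s 45 + length w \<and> s' 48 + sum_list v = s 48 + sum_list w)"
      and \<phi> = "\<lambda>s' h'. s' 47"], goal_cases)
  case (3 s' h')
  then obtain v where v: "holds h (s' 45) v" "s' 47 = length v" "s' 45 + length v = s 45 + length w"
    "s' 48 + sum_list v = s 48 + sum_list w" by blast
  then obtain c v' where "v = c # v'" using 3(2) by (cases v) auto
  then show ?case using 3(1) v
    by (intro exI[of _ 0]) (auto intro!: exI[of _ v'])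
qed (use assms in auto)

lemma run_SIZE:
  assumes w: "holds h (s 45) (encs ws)" "s 46 = length ws" and n: "length (encs ws) \<le> n"
  shows "run SIZE s h n (\<lambda>s' h'. h' = h \<and> s' 45 = s 45 + length (encs ws) \<and>
    s' 48 = s 48 + sum_list (concat ws) \<and> agree {45, 46, 47, 48} s s')"
  unfolding SIZE_def
proof (rule run_Loop[where I = "\<lambda>s' h'. h' = h \<and> agree {45, 46, 47, 48} s s' \<and>
      (\<exists>v. holds h (s' 45) (encs v) \<and> s' 46 = length v \<and> s' 45 + length (encs v) = s 45 + length (encs ws) \<and>
        s' 48 + sum_list (concat v) = s 48 + sum_list (concat ws))"
      and \<phi> = "\<lambda>s' h'. s 45 + length (encs ws) - s' 45"], goal_cases)
  case (3 s' h')
  then obtain v where v: "holds h (s' 45) (encs v)" "s' 46 = length v" "s' 45 + length (encs v) = s 45 + length (encs ws)"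
    "s' 48 + sum_list (concat v) = s 48 + sum_list (concat ws)" and h: "h' = h" and ag: "agree {45, 46, 47, 48} s s'" by blast
  then obtain x v' where x: "v = x # v'" using 3(2) by (cases v) auto
  let ?s = "s'(47 := length x, 45 := s' 45 + 1)"
  have hx: "h (s' 45) = length x" "holds h (s' 45 + 1) x" "holds h (s' 45 + 1 + length x) (encs v')"
    using v(1) unfolding x by auto
  have w: "run (Loop (V 47) (Asg 48 (Plus (V 48) (H (V 45))) ;; Asg 45 (Plus (V 45) (N 1)) ;; Asg 47 (Minus (V 47) (N 1))))
    ?s h (length x) (\<lambda>s'' h'. h' = h \<and> s'' 45 = ?s 45 + length x \<and> s'' 48 = ?s 48 + sum_list x \<and> agree {45, 47, 48} ?s s'')"
    by (rule run_SIZE_word) (use hx in auto)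
  show ?case
  proof (rule exI[of _ "length x"], simp only: exec_simps h hx(1), rule run_Seq'[OF w, where ?n2.0 = 0], goal_cases)
    case (1 s2 h2)
    have ag2: "agree {45, 46, 47, 48} s s2"
      by (rule agree_via[of "{45, 47, 48}" ?s]) (use 1 ag in auto)
    have "s2 46 = s' 46" using agreeD[of "{45, 47, 48}" ?s s2 46] 1 by simp
    then show ?case using 1 v x hx(3) ag2
      by (auto simp: intro!: exI[of _ v'])
  qed simp
next
  case (4 s' h')
  then show ?case by auto
qed (use assms in auto)

lemma block_address_inj:
  fixes S :: nat
  assumes "S * j + d = S * j' + d'" "d < S" "d' < S"
  shows "j = j'" "d = d'"
proof -
  have "(S * j + d) div S = j" "(S * j' + d') div S = j'" using assms(2,3) by simp_all
  then show j: "j = j'" using assms(1) by simp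
  then show "d = d'" using assms(1) by simp
qed

text \<open>
  Node \<open>j\<close> of the trie, representing the word \<open>nd j\<close>, occupies \<open>S\<close> cells from address \<open>A + S * j\<close>: the
  first one points to the record of the word \<open>nd j\<close> (or is 0), the cell at offset \<open>Suc c\<close> to the child for letter \<open>c\<close>.
\<close>

definition trie :: "mem \<Rightarrow> nat \<Rightarrow> nat \<Rightarrow> nat \<Rightarrow> (nat \<Rightarrow> nat list) \<Rightarrow> bool" where
  "trie h A S n nd \<longleftrightarrow> 0 < n \<and> nd 0 = [] \<and> inj_on nd {..<n} \<and>
    (\<forall>j<n. nd j \<noteq> [] \<longrightarrow> butlast (nd j) \<in> nd ` {..<n}) \<and>
    (\<forall>j<n. \<forall>c. Suc c < S \<longrightarrow> h (A + S * j + Suc c) = 0 \<and> nd j @ [c] \<notin> nd ` {..<n} \<or>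
      (\<exists>j'<n. h (A + S * j + Suc c) = A + S * j' \<and> nd j' = nd j @ [c])) \<and>
    (\<forall>a. A + S * n \<le> a \<longrightarrow> h a = 0)"

lemma trie_frame:
  assumes "trie h A S n nd"
    and "\<And>j c. j < n \<Longrightarrow> Suc c < S \<Longrightarrow> h' (A + S * j + Suc c) = h (A + S * j + Suc c)"
    and "\<And>a. A + S * n \<le> a \<Longrightarrow> h' a = h a"
  shows "trie h' A S n nd"
  using assms unfolding trie_def by auto

lemma trie_cell:
  assumes "trie h A S n nd" "j < n" "Suc c < S"
  shows "h (A + S * j + Suc c) = 0 \<and> nd j @ [c] \<notin> nd ` {..<n} \<or>
      (\<exists>j'<n. h (A + S * j + Suc c) = A + S * j' \<and> nd j' = nd j @ [c])"
  using assms unfolding trie_def by (elim conjE) (erule allE[of _ j], erule impE, assumption, erule allE[of _ c], simp)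

lemma trie_extend:
  assumes T: "trie h A S n nd" and j: "j < n" and c: "Suc c < S" and z: "h (A + S * j + Suc c) = 0" and A: "0 < A"
  shows "trie (h(A + S * j + Suc c := A + S * n)) A S (Suc n) (nd(n := nd j @ [c]))"
    and "nd j @ [c] \<notin> nd ` {..<n}"
proof -
  let ?h = "h(A + S * j + Suc c := A + S * n)" let ?nd = "nd(n := nd j @ [c])"
  have T': "0 < n" "nd 0 = []" "inj_on nd {..<n}" "\<And>j. j < n \<Longrightarrow> nd j \<noteq> [] \<Longrightarrow> butlast (nd j) \<in> nd ` {..<n}"
    "\<And>j c. j < n \<Longrightarrow> Suc c < S \<Longrightarrow> h (A + S * j + Suc c) = 0 \<and> nd j @ [c] \<notin> nd ` {..<n} \<or>
      (\<exists>j'<n. h (A + S * j + Suc c) = A + S * j' \<and> nd j' = nd j @ [c])"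
    "\<And>a. A + S * n \<le> a \<Longrightarrow> h a = 0" using T unfolding trie_def by auto
  show new: "nd j @ [c] \<notin> nd ` {..<n}" using T'(5)[OF j c] z A by auto
  have im: "?nd ` {..<Suc n} = insert (nd j @ [c]) (nd ` {..<n})"
    unfolding lessThan_Suc image_insert by auto
  have adr: "A + S * j1 + Suc c1 = A + S * j + Suc c \<longleftrightarrow> j1 = j \<and> c1 = c" if "Suc c1 < S" for j1 c1
    using block_address_inj[of S j1 "Suc c1" j "Suc c"] that c by auto
  have cell: "A + S * j + Suc c < A + S * n"
  proof -
    have "S * Suc j \<le> S * n" using j by (intro mult_le_mono2) simp
    then show ?thesis using c by simp
  qed
  show "trie ?h A S (Suc n) ?nd"
    unfolding trie_def
  proof (intro conjI allI impI)
    show "inj_on ?nd {..<Suc n}"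
    proof -
      have "nd x \<noteq> nd j @ [c]" if "x < n" for x using new that by (metis imageI lessThan_iff)
      then show ?thesis using T'(3) unfolding lessThan_Suc by (auto simp: inj_on_def) metis+
    qed
  next
    fix j1 assume j1: "j1 < Suc n" "?nd j1 \<noteq> []"
    then show "butlast (?nd j1) \<in> ?nd ` {..<Suc n}"
      unfolding im using T'(4)[of j1] j by (cases "j1 = n") auto
  next
    fix j1 c1 assume j1: "j1 < Suc n" and c1: "Suc c1 < S"
    show "?h (A + S * j1 + Suc c1) = 0 \<and> ?nd j1 @ [c1] \<notin> ?nd ` {..<Suc n} \<or>
      (\<exists>j'<Suc n. ?h (A + S * j1 + Suc c1) = A + S * j' \<and> ?nd j' = ?nd j1 @ [c1])"
    proof (cases "j1 = n")
      case True
      \<comment> \<open>The words of the nodes are closed under removing the last letter. A child of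
        the new node would thus have required the new node to exist before.\<close>
      have "nd j @ [c, c1] \<notin> nd ` {..<n}"
      proof
        assume "nd j @ [c, c1] \<in> nd ` {..<n}"
        then obtain j2 where j2: "j2 < n" "nd j2 = nd j @ [c, c1]" by auto
        have "butlast (nd j2) = nd j @ [c]" unfolding j2(2) by (simp add: butlast_append)
        then show False using T'(4)[OF j2(1)] j2(2) new by simp
      qed
      moreover have "?h (A + S * n + Suc c1) = 0" using adr[OF c1, of n] j T'(6) by auto
      ultimately show ?thesis unfolding im using True by simp
    next
      case False
      then have j1n: "j1 < n" using j1 by simp
      show ?thesis
      proof (cases "j1 = j \<and> c1 = c")
        case True
        then show ?thesis using j by (intro disjI2 exI[of _ n]) auto
      next
        case ne: False
        have same: "?h (A + S * j1 + Suc c1) = h (A + S * j1 + Suc c1)"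
          by (rule fun_upd_other) (use adr[OF c1, of j1] ne in blast)
        from T'(5)[OF j1n c1] show ?thesis
        proof
          assume a: "h (A + S * j1 + Suc c1) = 0 \<and> nd j1 @ [c1] \<notin> nd ` {..<n}"
          have "nd j1 @ [c1] \<noteq> nd j @ [c]" using ne T'(3) j1n j by (auto simp: inj_on_def)
          then show ?thesis unfolding im same using a j1n by simp
        next
          assume "\<exists>j'<n. h (A + S * j1 + Suc c1) = A + S * j' \<and> nd j' = nd j1 @ [c1]"
          then obtain j' where "j' < n" "h (A + S * j1 + Suc c1) = A + S * j'" "nd j' = nd j1 @ [c1]" by blast
          then show ?thesis unfolding same using j1n by (intro disjI2 exI[of _ j']) auto
        qed
      qed
    qed
  next
    fix a assume "A + S * Suc n \<le> a"
    then have "A + S * n \<le> a" by simp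
    then show "?h a = 0" using T'(6)[of a] cell by simp
  qed (use T' in auto)
qed

definition WALK :: com where
  "WALK = Loop (V 47) (Asg 53 (Plus (Plus (V 52) (N 1)) (H (V 45))) ;;
    Cond (H (V 53)) (Asg 52 (H (V 53))) (Put (V 53) (V 49) ;; Asg 52 (V 49) ;; Asg 49 (Plus (Plus (V 49) (V 48)) (N 1))) ;;
    Asg 45 (Plus (V 45) (N 1)) ;; Asg 47 (Minus (V 47) (N 1)))"

text \<open>What inserting a word has to know about a walk: old nodes keep their words and marks,
  new nodes carry new words and no mark, and nothing below the trie changes.\<close>

definition trie_grow :: "mem \<Rightarrow> mem \<Rightarrow> nat \<Rightarrow> nat \<Rightarrow> nat \<Rightarrow> (nat \<Rightarrow> nat list) \<Rightarrow> nat \<Rightarrow> (nat \<Rightarrow> nat list) \<Rightarrow> bool" where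
  "trie_grow h h' A S n nd n' nd' \<longleftrightarrow> trie h' A S n' nd' \<and> n \<le> n' \<and> (\<forall>a<A. h' a = h a) \<and>
    (\<forall>j<n. nd' j = nd j \<and> h' (A + S * j) = h (A + S * j)) \<and>
    (\<forall>j. n \<le> j \<and> j < n' \<longrightarrow> h' (A + S * j) = 0 \<and> nd' j \<notin> nd ` {..<n})"

lemma trie_grow_refl: "trie h A S n nd \<Longrightarrow> trie_grow h h A S n nd n nd"
  by (simp add: trie_grow_def)

lemma trie_grow_extend:
  assumes g: "trie_grow h h1 A S n nd n1 nd1" and j: "j < n1" and c: "Suc c < S"
    and z: "h1 (A + S * j + Suc c) = 0" and A: "0 < A"
  shows "trie_grow h (h1(A + S * j + Suc c := A + S * n1)) A S n nd (Suc n1) (nd1(n1 := nd1 j @ [c]))"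
proof -
  have T: "trie h1 A S n1 nd1" and le: "n \<le> n1" using g unfolding trie_grow_def by auto
  note e = trie_extend[OF T j c z A]
  have ne: "A + S * i \<noteq> A + S * j + Suc c" for i
    using block_address_inj[of S i 0 j "Suc c"] c by auto
  have sub: "nd ` {..<n} \<subseteq> nd1 ` {..<n1}" 
  proof
    fix x assume "x \<in> nd ` {..<n}"
    then obtain i where "i < n" "x = nd i" by blast
    then have "i < n1" "x = nd1 i" using g unfolding trie_grow_def by auto
    then show "x \<in> nd1 ` {..<n1}" by blast
  qed
  have "h1 (A + S * n1) = 0" using T unfolding trie_def by simp
  note h0 = this
  show ?thesis
    unfolding trie_grow_def
  proof (intro conjI allI impI)
    show "trie (h1(A + S * j + Suc c := A + S * n1)) A S (Suc n1) (nd1(n1 := nd1 j @ [c]))" by (rule e(1))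
    show "n \<le> Suc n1" using le by simp
    fix a assume "a < A" then show "(h1(A + S * j + Suc c := A + S * n1)) a = h a"
      using g unfolding trie_grow_def by simp
  next
    fix i assume "i < n"
    then show "(nd1(n1 := nd1 j @ [c])) i = nd i"
      "(h1(A + S * j + Suc c := A + S * n1)) (A + S * i) = h (A + S * i)"
      using g le ne[of i] unfolding trie_grow_def by auto
  next
    fix i assume i: "n \<le> i \<and> i < Suc n1"
    then show "(h1(A + S * j + Suc c := A + S * n1)) (A + S * i) = 0"
      using g ne[of i] h0 unfolding trie_grow_def by (cases "i = n1") auto
    show "(nd1(n1 := nd1 j @ [c])) i \<notin> nd ` {..<n}"
      using i g e(2) sub unfolding trie_grow_def by (cases "i = n1") auto
  qed
qed

lemma run_WALK:
  assumes T: "trie h A S n nd" and A: "0 < A" and S: "S = s 48 + 1" and w: "holds h (s 45) w" "s 47 = length w"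
    and small: "\<And>c. c \<in> set w \<Longrightarrow> Suc c < S" and low: "s 45 + length w \<le> A"
    and s: "s 52 = A" "s 49 = A + S * n" and m: "length w \<le> m"
  shows "run WALK s h m (\<lambda>s' h'. s' 45 = s 45 + length w \<and> agree {45, 47, 49, 52, 53} s s' \<and>
    (\<exists>n' nd' j. trie_grow h h' A S n nd n' nd' \<and> s' 49 = A + S * n' \<and> j < n' \<and> s' 52 = A + S * j \<and> nd' j = w))"
  unfolding WALK_def
proof (rule run_Loop[where I = "\<lambda>s' h'. agree {45, 47, 49, 52, 53} s s' \<and> s' 45 + s' 47 = s 45 + length w \<and> s' 47 \<le> length w \<and>
      (\<exists>n' nd' j. trie_grow h h' A S n nd n' nd' \<and> s' 49 = A + S * n' \<and> j < n' \<and> s' 52 = A + S * j \<and>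
        nd' j = take (length w - s' 47) w)"
      and \<phi> = "\<lambda>s' h'. s' 47"], goal_cases)
  case 1
  have "0 < n" "nd 0 = []" using T unfolding trie_def by auto
  then show ?case using trie_grow_refl[OF T] w s
    by (intro conjI exI[of _ n] exI[of _ nd] exI[of _ 0]) auto
next
  case (3 s' h')
  then have ag: "agree {45, 47, 49, 52, 53} s s'" and p: "s' 45 + s' 47 = s 45 + length w" "s' 47 \<le> length w" "s' 47 \<noteq> 0" by auto
  obtain n1 nd1 j where g: "trie_grow h h' A S n nd n1 nd1" and s49: "s' 49 = A + S * n1" and j: "j < n1"
    and s52: "s' 52 = A + S * j" and ndj: "nd1 j = take (length w - s' 47) w" using 3(1) by blast
  let ?q = "length w - s' 47"
  have q: "?q < length w" "s' 45 = s 45 + ?q" "length w - (s' 47 - 1) = Suc ?q" using p by auto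
  have lc: "h' (s' 45) = w ! ?q"
  proof -
    have "h' (s' 45) = h (s' 45)" using g q low unfolding trie_grow_def by auto
    moreover have "h (s 45 + ?q) = w ! ?q" using w(1) q(1) unfolding holds_def by blast
    ultimately show ?thesis by (simp only: q(2))
  qed
  have c: "Suc (w ! ?q) < S" using small q by simp
  have nx: "take ?q w @ [w ! ?q] = take (Suc ?q) w" using q by (simp add: take_Suc_conv_app_nth)
  have s48: "s' 48 = s 48" using agreeD[OF ag, of 48] by simp
  have T1: "trie h' A S n1 nd1" using g unfolding trie_grow_def by simp
  let ?a = "A + S * j + Suc (w ! ?q)"
  have ev53: "s' 52 + 1 + h' (s' 45) = ?a" using s52 lc by simp
  show ?case
  proof (cases "h' ?a = 0")
    case True
    note g2 = trie_grow_extend[OF g j c True A]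
    have "trie_grow h (h'(?a := A + S * n1)) A S n nd (Suc n1) (nd1(n1 := nd1 j @ [w ! ?q])) \<and> A + S * n1 + s 48 + 1 = A + S * Suc n1 \<and>
      n1 < Suc n1 \<and> A + S * n1 = A + S * n1 \<and> (nd1(n1 := nd1 j @ [w ! ?q])) n1 = take (Suc ?q) w"
      using g2 S ndj nx by simp
    then have "\<exists>n' nd' ja. trie_grow h (h'(?a := A + S * n1)) A S n nd n' nd' \<and> A + S * n1 + s 48 + 1 = A + S * n' \<and>
      ja < n' \<and> A + S * n1 = A + S * ja \<and> nd' ja = take (Suc ?q) w" by blast
    then show ?thesis using True ag p q(3)
      by (intro exI[of _ 0]) (simp add: ev53 s49 s48)
  next
    case False
    then have nz: "h' ?a \<noteq> 0" .
    obtain j' where j': "j' < n1" "h' ?a = A + S * j'" "nd1 j' = nd1 j @ [w ! ?q]"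
      using trie_cell[OF T1 j c] nz by (elim disjE conjE exE) simp_all
    have "\<exists>n' nd' ja. trie_grow h h' A S n nd n' nd' \<and> A + S * n1 = A + S * n' \<and>
      ja < n' \<and> A + S * j' = A + S * ja \<and> nd' ja = take (Suc ?q) w"
      by (intro exI[of _ n1] exI[of _ nd1] exI[of _ j']) (use g j' ndj nx in simp)
    then show ?thesis using False ag p q(3) j'(2)
      by (intro exI[of _ 0]) (simp add: ev53 s49)
  qed
next
  case (4 s' h')
  then show ?case by auto
qed (use w m in auto)

section \<open>The dictionary of relation words\<close>

lemma recs_Suc: "recs t (Suc k) = insert (t + 4 * k) (recs t k)"
  by (simp add: recs_def lessThan_Suc)

lemma finite_recs [simp]: "finite (recs t k)" by (simp add: recs_def)

lemma recs_bounds: "x \<in> recs t k \<Longrightarrow> t \<le> x \<and> x + 4 \<le> t + 4 * k" by (auto simp: recs_def)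

lemma recs_disjoint: "x \<in> recs t k \<Longrightarrow> y \<in> recs t k \<Longrightarrow> x + i = y + j \<Longrightarrow> i < 4 \<Longrightarrow> j < 4 \<Longrightarrow> x = y \<and> i = j"
  unfolding recs_def by clarsimp presburger

lemma card_recs: "card (recs t k) = k"
  unfolding recs_def by (subst card_image) (auto simp: inj_on_def)

lemma wd_cong: "h' x = h x \<Longrightarrow> h' (x + 1) = h (x + 1) \<Longrightarrow> (\<And>a. a < h x + h (x + 1) \<Longrightarrow> h' a = h a) \<Longrightarrow> wd h' x = wd h x"
  by (auto simp: wd_def intro!: seg_cong)

text \<open>Labels are addresses of existing records. A new record labelled with its own address is
  therefore in a class of its own. The records point to words inside the input, which is never
  overwritten.\<close>

definition dict :: "mem \<Rightarrow> mem \<Rightarrow> nat \<Rightarrow> nat \<Rightarrow> nat \<Rightarrow> nat \<Rightarrow> (nat \<Rightarrow> nat list) \<Rightarrow> nat \<Rightarrow> bool" where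
  "dict h s t A S n nd k \<longleftrightarrow> trie h A S n nd \<and> 0 < t \<and> s 22 = t \<and> s 23 = t + 4 * k \<and> s 50 = A \<and>
    S = s 48 + 1 \<and> s 49 = A + S * n \<and> t + 4 * k \<le> A \<and> inj_on (wd h) (recs t k) \<and>
    (\<forall>j<n. h (A + S * j) = 0 \<and> nd j \<notin> wd h ` recs t k \<or>
      h (A + S * j) \<in> recs t k \<and> wd h (h (A + S * j)) = nd j) \<and>
    wd h ` recs t k \<subseteq> nd ` {..<n} \<and> (\<forall>x\<in>recs t k. h x + h (x + 1) \<le> t \<and> h (x + 3) \<in> recs t k)"

definition INSERT :: com where
  "INSERT = Asg 47 (H (V 45)) ;; Asg 45 (Plus (V 45) (N 1)) ;; Asg 54 (V 45) ;; Asg 52 (V 50) ;; WALK ;;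
    Cond (H (V 52)) (Asg 47 (N 0)) (Put (V 52) (V 23) ;; Put (V 23) (V 54) ;;
      Put (Plus (V 23) (N 1)) (Minus (V 45) (V 54)) ;; Put (Plus (V 23) (N 3)) (V 23) ;; Asg 23 (Plus (V 23) (N 4))) ;;
    Asg 56 (H (V 52))"

lemma run_INSERT:
  assumes D: "dict h s t A S n nd k" and cap: "t + 4 * Suc k \<le> A"
    and w: "holds h (s 45) (length w # w)" and small: "\<And>c. c \<in> set w \<Longrightarrow> Suc c < S"
    and low: "s 45 + Suc (length w) \<le> t" and m: "length w \<le> m"
  shows "run INSERT s h m (\<lambda>s' h'. \<exists>n' nd' k'. dict h' s' t A S n' nd' k' \<and> s' 45 = s 45 + Suc (length w) \<and>
    s' 56 \<in> recs t k' \<and> wd h' (s' 56) = w \<and> (\<forall>a<t + 4 * k. h' a = h a) \<and>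
    (k' = k \<or> k' = Suc k \<and> w \<notin> wd h ` recs t k \<and> wd h' (t + 4 * k) = w \<and> h' (t + 4 * k + 3) = t + 4 * k) \<and>
    agree {23, 45, 47, 49, 52, 53, 54, 56} s s')"
proof -
  have D': "trie h A S n nd" "0 < t" "s 22 = t" "s 23 = t + 4 * k" "s 50 = A" "S = s 48 + 1" "s 49 = A + S * n"
    "inj_on (wd h) (recs t k)" "wd h ` recs t k \<subseteq> nd ` {..<n}"
    "\<And>j. j < n \<Longrightarrow> h (A + S * j) = 0 \<and> nd j \<notin> wd h ` recs t k \<or>
      h (A + S * j) \<in> recs t k \<and> wd h (h (A + S * j)) = nd j"
    "\<And>x. x \<in> recs t k \<Longrightarrow> h x + h (x + 1) \<le> t \<and> h (x + 3) \<in> recs t k" "t + 4 * k \<le> A"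
    using D unfolding dict_def by auto
  have hw: "h (s 45) = length w" "holds h (s 45 + 1) w" using w by auto
  let ?s = "s(47 := length w, 45 := s 45 + 1, 54 := s 45 + 1, 52 := A)"
  have W: "run WALK ?s h (length w) (\<lambda>s' h'. s' 45 = ?s 45 + length w \<and> agree {45, 47, 49, 52, 53} ?s s' \<and>
    (\<exists>n' nd' j. trie_grow h h' A S n nd n' nd' \<and> s' 49 = A + S * n' \<and> j < n' \<and> s' 52 = A + S * j \<and> nd' j = w))"
    by (rule run_WALK[OF D'(1)]) (use D' hw small low cap in auto)
  show ?thesis
    unfolding INSERT_def
  proof (simp only: exec_simps hw(1) D'(5), rule run_Seq'[OF W, where ?n2.0 = 0], goal_cases)
    case (1 s1 h1)
    then obtain n1 nd1 j where g: "trie_grow h h1 A S n nd n1 nd1" and s49: "s1 49 = A + S * n1" and j: "j < n1"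
      and s52: "s1 52 = A + S * j" and ndj: "nd1 j = w" by blast
    have ag: "agree {45, 47, 49, 52, 53} ?s s1" and s45: "s1 45 = s 45 + 1 + length w" using 1 by auto
    have f: "s1 z = s z" if "z \<notin> {45, 47, 49, 52, 53, 54}" for z using agreeD[OF ag, of z] that by simp
    have s54: "s1 54 = s 45 + 1" using agreeD[OF ag, of 54] by simp
    have T1: "trie h1 A S n1 nd1" and le: "n \<le> n1" and lowA: "\<And>a. a < A \<Longrightarrow> h1 a = h a"
      and old: "\<And>j. j < n \<Longrightarrow> nd1 j = nd j \<and> h1 (A + S * j) = h (A + S * j)"
      and new: "\<And>j. n \<le> j \<Longrightarrow> j < n1 \<Longrightarrow> h1 (A + S * j) = 0 \<and> nd1 j \<notin> nd ` {..<n}"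
      using g unfolding trie_grow_def by auto
    have lowk: "\<And>a. a < t + 4 * k \<Longrightarrow> h1 a = h a" using lowA D'(12) by simp
    have wd1: "wd h1 x = wd h x" if "x \<in> recs t k" for x
      by (rule wd_cong) (use that recs_bounds[OF that] D'(11)[OF that] D'(12) in \<open>auto intro!: lowA\<close>)
    have img: "wd h1 ` recs t k = wd h ` recs t k" using wd1 by auto
    have mark: "h1 (A + S * i) = 0 \<and> nd1 i \<notin> wd h ` recs t k \<or>
      h1 (A + S * i) \<in> recs t k \<and> wd h (h1 (A + S * i)) = nd1 i" if "i < n1" for i
    proof (cases "i < n")
      case True
      then show ?thesis using D'(10)[OF True] old[OF True] by simp
    next
      case False
      then show ?thesis using new[of i] that D'(9) by auto
    qed
    have sub: "wd h ` recs t k \<subseteq> nd1 ` {..<n1}"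
    proof
      fix x assume "x \<in> wd h ` recs t k"
      then obtain i where "i < n" "x = nd i" using D'(9) by blast
      then have "i < n1" "x = nd1 i" using old le by auto
      then show "x \<in> nd1 ` {..<n1}" by blast
    qed
    show ?case
    proof (cases "h1 (A + S * j) = 0")
      case False
      then have x: "h1 (A + S * j) \<in> recs t k" "wd h (h1 (A + S * j)) = w" using mark[OF j] ndj by auto
      let ?s1 = "s1(47 := 0, 56 := h1 (A + S * j))"
      have "inj_on (wd h1) (recs t k)" using D'(8) wd1 inj_on_cong[of "recs t k" "wd h1" "wd h"] by blast
      moreover have "h1 x + h1 (x + 1) \<le> t \<and> h1 (x + 3) \<in> recs t k" if "x \<in> recs t k" for x
        using D'(11)[OF that] recs_bounds[OF that] by (simp add: lowk)
      moreover have "h1 (A + S * i) = 0 \<and> nd1 i \<notin> wd h ` recs t k \<or>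
        h1 (A + S * i) \<in> recs t k \<and> wd h1 (h1 (A + S * i)) = nd1 i" if "i < n1" for i
        using mark[OF that] wd1 by auto
      moreover have "?s1 22 = t" "?s1 23 = t + 4 * k" "?s1 50 = A" "S = ?s1 48 + 1" "?s1 49 = A + S * n1"
        using f[of 22] f[of 23] f[of 50] f[of 48] D' s49 by simp_all
      ultimately have "dict h1 ?s1 t A S n1 nd1 k"
        unfolding dict_def img using T1 D'(2,12) sub by blast
      moreover have "agree {23, 45, 47, 49, 52, 53, 54, 56} s ?s1"
        using agree_via[OF ag, of "{23, 45, 47, 49, 52, 53, 54, 56}" s] by simp
      ultimately show ?thesis using False x s45 wd1[OF x(1)] lowk
        by (simp add: s52) blast
    next
      case True
      then have nw: "w \<notin> wd h ` recs t k" using mark[OF j] ndj D'(2) by (auto simp: recs_def)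
      let ?x = "t + 4 * k"
      define h2 where "h2 = h1(A + S * j := ?x, ?x := s 45 + 1, ?x + 1 := length w, ?x + 3 := ?x)"
      let ?s2 = "s1(23 := ?x + 4, 56 := ?x)"
      have xA: "?x + 4 \<le> A" using cap by simp
      have h2low: "h2 a = h a" if "a < ?x" for a using that xA lowk by (simp add: h2_def)
      have h2x: "h2 ?x = s 45 + 1" "h2 (?x + 1) = length w" "h2 (?x + 3) = ?x" "h2 (A + S * j) = ?x"
        using xA by (simp_all add: h2_def)
      have other: "h2 a = h1 a" if "A \<le> a" "a \<noteq> A + S * j" for a using that xA by (simp add: h2_def)
      have neq: "A + S * i + Suc c \<noteq> A + S * j" if "Suc c < S" for i c
        using block_address_inj[of S i "Suc c" j 0] that by auto
      have neq0: "A + S * i = A + S * j \<Longrightarrow> i = j" for i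
        using block_address_inj[of S i 0 j 0] D'(6) by auto
      have jn: "A + S * j < A + S * n1" using j D'(6) by simp
      have T2: "trie h2 A S n1 nd1"
      proof (rule trie_frame[OF T1])
        fix i c assume "i < n1" "Suc c < S"
        then show "h2 (A + S * i + Suc c) = h1 (A + S * i + Suc c)" using neq by (intro other) auto
      next
        fix a assume "A + S * n1 \<le> a"
        then have "A \<le> a" "a \<noteq> A + S * j" using jn by linarith+
        then show "h2 a = h1 a" by (rule other)
      qed
      have wd2: "wd h2 x = wd h x" if "x \<in> recs t k" for x
        by (rule wd_cong) (use that recs_bounds[OF that] D'(11)[OF that] in \<open>auto intro!: h2low\<close>)
      have wdx: "wd h2 ?x = w"
      proof -
        have "holds h2 (s 45 + 1) w" by (rule holds_cong[OF hw(2)]) (use low in \<open>auto intro!: h2low\<close>)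
        then show ?thesis unfolding wd_def h2x by (rule holds_seg)
      qed
      have img2: "wd h2 ` recs t (Suc k) = insert w (wd h ` recs t k)"
        unfolding recs_Suc image_insert wdx using wd2 by auto
      have nx: "?x \<notin> recs t k" using recs_bounds by fastforce
      have "inj_on (wd h2) (recs t (Suc k))"
        unfolding recs_Suc inj_on_insert wdx
        using D'(8) nw wd2 nx by (auto simp: inj_on_def image_iff)
      moreover have "h2 (A + S * i) = 0 \<and> nd1 i \<notin> insert w (wd h ` recs t k) \<or>
        h2 (A + S * i) \<in> recs t (Suc k) \<and> wd h2 (h2 (A + S * i)) = nd1 i" if i: "i < n1" for i
      proof (cases "i = j")
        case True
        then show ?thesis unfolding recs_Suc True h2x(4) wdx ndj by simp
      next
        case False
        then have e: "h2 (A + S * i) = h1 (A + S * i)" using neq0 by (intro other) auto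
        have "nd1 i \<noteq> w" using False T1 i j ndj unfolding trie_def inj_on_def by auto
        then show ?thesis unfolding e recs_Suc using mark[OF i] wd2 by auto
      qed
      moreover have "insert w (wd h ` recs t k) \<subseteq> nd1 ` {..<n1}" using sub j ndj by auto
      moreover have "h2 x + h2 (x + 1) \<le> t \<and> h2 (x + 3) \<in> recs t (Suc k)" if "x \<in> recs t (Suc k)" for x
      proof (cases "x = ?x")
        case True
        then show ?thesis unfolding True h2x recs_Suc using low by simp
      next
        case False
        then have x: "x \<in> recs t k" using that unfolding recs_Suc by simp
        have "h2 x = h x" "h2 (x + 1) = h (x + 1)" "h2 (x + 3) = h (x + 3)"
          using recs_bounds[OF x] by (auto intro!: h2low)
        then show ?thesis using D'(11)[OF x] unfolding recs_Suc by simp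
      qed
      moreover have "?s2 22 = t" "?s2 23 = t + 4 * Suc k" "?s2 50 = A" "S = ?s2 48 + 1" "?s2 49 = A + S * n1"
        using f[of 22] f[of 50] f[of 48] D' s49 by simp_all
      ultimately have "dict h2 ?s2 t A S n1 nd1 (Suc k)"
        unfolding dict_def img2 using T2 D'(2) cap by blast
      moreover have "agree {23, 45, 47, 49, 52, 53, 54, 56} s ?s2"
        using agree_via[OF ag, of "{23, 45, 47, 49, 52, 53, 54, 56}" s] by simp
      moreover have "?x \<in> recs t (Suc k)" unfolding recs_Suc by simp
      ultimately have "\<exists>n' nd' k'. dict h2 ?s2 t A S n' nd' k' \<and> ?s2 45 = s 45 + Suc (length w) \<and>
        ?s2 56 \<in> recs t k' \<and> wd h2 (?s2 56) = w \<and> (\<forall>a<t + 4 * k. h2 a = h a) \<and>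
        (k' = k \<or> k' = Suc k \<and> w \<notin> wd h ` recs t k \<and> wd h2 (t + 4 * k) = w \<and> h2 (t + 4 * k + 3) = t + 4 * k) \<and>
        agree {23, 45, 47, 49, 52, 53, 54, 56} s ?s2"
        using wdx h2x(3) h2low nw s45 by (intro exI[of _ n1] exI[of _ nd1] exI[of _ "Suc k"]) simp
      moreover have "s1 45 - s1 54 = length w" "s1 23 = ?x" "s1 54 = s 45 + 1" using s45 s54 f[of 23] D'(4) by simp_all
      moreover have "A + S * j \<noteq> ?x" "A + S * j \<noteq> ?x + 1" "A + S * j \<noteq> ?x + 3" using xA by simp_all
      ultimately show ?thesis using True by (simp add: s52 h2_def)
    qed
  qed (use m in simp)
qed

text \<open>Classes are merged by renaming the label found in record 56 to that of record 55
  throughout the table. The assignments of 0 to 65 and of 58 to itself merely fill branches in which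
  nothing is to be done.\<close>

definition UNION :: com where
  "UNION = Asg 57 (H (Plus (V 55) (N 3))) ;; Asg 58 (H (Plus (V 56) (N 3))) ;;
    Cond (Eq (V 57) (V 58)) (Asg 65 (N 0)) (Asg 65 (V 22) ;;
      Loop (Lt (V 65) (V 23)) (Cond (Eq (H (Plus (V 65) (N 3))) (V 58)) (Put (Plus (V 65) (N 3)) (V 57)) (Asg 58 (V 58)) ;;
        Asg 65 (Plus (V 65) (N 4))))"

definition relabelled :: "mem \<Rightarrow> mem \<Rightarrow> nat \<Rightarrow> nat \<Rightarrow> nat \<Rightarrow> nat \<Rightarrow> bool" where
  "relabelled h h' t k a b \<longleftrightarrow> (\<forall>x\<in>recs t k. h' (x + 3) = (if h (x + 3) = b then a else h (x + 3))) \<and>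
    (\<forall>z. (\<forall>x\<in>recs t k. z \<noteq> x + 3) \<longrightarrow> h' z = h z)"

lemma run_UNION:
  assumes T: "s 22 = t" "s 23 = t + 4 * k" and n: "h (s 55 + 3) \<noteq> h (s 56 + 3) \<Longrightarrow> k \<le> n"
  shows "run UNION s h n (\<lambda>s' h'. relabelled h h' t k (h (s 55 + 3)) (h (s 56 + 3)) \<and> agree {57, 58, 65} s s')"
proof (cases "h (s 55 + 3) = h (s 56 + 3)")
  case True
  then show ?thesis by (simp add: UNION_def relabelled_def)
next
  case False
  define la lb where "la = h (s 55 + 3)" and "lb = h (s 56 + 3)"
  let ?s = "s(57 := la, 58 := lb, 65 := t)"
  have "run (Loop (Lt (V 65) (V 23)) (Cond (Eq (H (Plus (V 65) (N 3))) (V 58)) (Put (Plus (V 65) (N 3)) (V 57)) (Asg 58 (V 58)) ;;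
        Asg 65 (Plus (V 65) (N 4)))) ?s h n (\<lambda>s' h'. relabelled h h' t k la lb \<and> agree {57, 58, 65} s s')"
  proof (rule run_Loop[where I = "\<lambda>s' h'. agree {65} ?s s' \<and>
      (\<exists>j\<le>k. s' 65 = t + 4 * j \<and> relabelled h h' t j la lb)" and \<phi> = "\<lambda>s' h'. k - (s' 65 - t) div 4"], goal_cases)
    case 1
    show ?case by (auto simp: relabelled_def recs_def intro!: exI[of _ 0])
  next
    case (3 s' h')
    then obtain j where ag: "agree {65} ?s s'" and j: "j \<le> k" "s' 65 = t + 4 * j" "relabelled h h' t j la lb" by blast
    have f: "s' 57 = la" "s' 58 = lb" "s' 23 = t + 4 * k" using agreeD[OF ag, of 57] agreeD[OF ag, of 58] agreeD[OF ag, of 23] T by simp_all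
    have jk: "j < k" using 3(2) j f by (auto split: if_splits)
    let ?x = "t + 4 * j"
    have nx: "\<forall>x\<in>recs t j. ?x + 3 \<noteq> x + 3" by (auto simp: recs_def)
    then have hx: "h' (?x + 3) = h (?x + 3)" using j(3) unfolding relabelled_def by blast
    have "relabelled h (if h (?x + 3) = lb then h'(?x + 3 := la) else h') t (Suc j) la lb"
      using j(3) nx hx unfolding relabelled_def recs_Suc by auto
    moreover have "agree {65} ?s (s'(65 := ?x + 4))" "agree {65} ?s (s'(58 := lb, 65 := ?x + 4))"
      using ag f by (auto simp: agree_def)
    moreover have "\<exists>i\<le>k. ?x + 4 = t + 4 * i \<and> relabelled h (if h (?x + 3) = lb then h'(?x + 3 := la) else h') t i la lb"
      using calculation(1) jk by (intro exI[of _ "Suc j"]) simp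
    ultimately show ?case using j f hx jk by (intro exI[of _ 0]) (auto split: if_splits)
  next
    case (4 s' h')
    then obtain j where ag: "agree {65} ?s s'" and j: "j \<le> k" "s' 65 = t + 4 * j" "relabelled h h' t j la lb" by blast
    have "s' 23 = t + 4 * k" using agreeD[OF ag, of 23] T by simp
    then have "j = k" using 4(2) j by (auto split: if_splits)
    moreover have "agree {57, 58, 65} s s'" by (rule agree_via[OF ag]) simp_all
    ultimately show ?case using j by simp
  qed (use n False in auto)
  then show ?thesis using False T(1) by (simp add: UNION_def la_def lb_def)
qed

lemma dict_relabelled:
  assumes D: "dict h s t A S n nd k" and r: "relabelled h h' t k a b" and a: "\<exists>x\<in>recs t k. a = h (x + 3)"
  shows "dict h' s t A S n nd k" "\<And>x. x \<in> recs t k \<Longrightarrow> wd h' x = wd h x" "\<And>z. z < t \<Longrightarrow> h' z = h z"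
proof -
  have D': "t + 4 * k \<le> A" "\<And>x. x \<in> recs t k \<Longrightarrow> h x + h (x + 1) \<le> t \<and> h (x + 3) \<in> recs t k"
    using D unfolding dict_def by auto
  have same: "h' z = h z" if "\<And>x. x \<in> recs t k \<Longrightarrow> z \<noteq> x + 3" for z using r that unfolding relabelled_def by blast
  show low: "h' z = h z" if "z < t" for z by (rule same) (use that recs_bounds in fastforce)
  have high: "h' z = h z" if "A \<le> z" for z by (rule same) (use that D'(1) recs_bounds in fastforce)
  have flds: "h' x = h x" "h' (x + 1) = h (x + 1)" if "x \<in> recs t k" for x
  proof -
    have "x \<noteq> y + 3" "x + 1 \<noteq> y + 3" if y: "y \<in> recs t k" for y
      using recs_disjoint[OF \<open>x \<in> recs t k\<close> y, of 0 3] recs_disjoint[OF \<open>x \<in> recs t k\<close> y, of 1 3] by auto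
    then show "h' x = h x" "h' (x + 1) = h (x + 1)" by (auto intro!: same simp del: add_eq_if)
  qed
  show wd: "wd h' x = wd h x" if "x \<in> recs t k" for x
    by (rule wd_cong) (use flds[OF that] D'(2)[OF that] low in auto)
  have img: "wd h' ` recs t k = wd h ` recs t k" using wd by auto
  have inj: "inj_on (wd h') (recs t k) = inj_on (wd h) (recs t k)" by (rule inj_on_cong) (rule wd)
  have "trie h' A S n nd" by (rule trie_frame[of h]) (use D high in \<open>auto simp: dict_def\<close>)
  moreover have "h' x + h' (x + 1) \<le> t \<and> h' (x + 3) \<in> recs t k" if "x \<in> recs t k" for x
    using D'(2)[OF that] D'(2) flds[OF that] r a that unfolding relabelled_def by auto
  moreover have "h' (A + S * j) = 0 \<and> nd j \<notin> wd h ` recs t k \<or>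
      h' (A + S * j) \<in> recs t k \<and> wd h' (h' (A + S * j)) = nd j" if "j < n" for j
    using D that wd high[of "A + S * j"] unfolding dict_def by auto
  ultimately show "dict h' s t A S n nd k"
    using D unfolding dict_def img inj by blast
qed

text \<open>For the full set of relations this is \<open>cls\<close>; during the collection
  \<open>D\<close> is the set of relations already processed.\<close>

definition closure :: "('a \<times> 'a) set \<Rightarrow> 'a \<Rightarrow> 'a \<Rightarrow> bool" where
  "closure D = (\<lambda>x y. (x, y) \<in> D \<or> (y, x) \<in> D)\<^sup>*\<^sup>*"

lemma closure_refl: "closure D x x" by (simp add: closure_def)
lemma closure_trans: "closure D x y \<Longrightarrow> closure D y z \<Longrightarrow> closure D x z" unfolding closure_def by (rule rtranclp_trans)
lemma closure_sym: "closure D x y \<Longrightarrow> closure D y x"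
  unfolding closure_def by (induction rule: rtranclp_induct) (auto intro: converse_rtranclp_into_rtranclp)
lemma closure_mono: "closure D x y \<Longrightarrow> D \<subseteq> D' \<Longrightarrow> closure D' x y"
  unfolding closure_def by (erule rtranclp_mono[THEN predicate2D, rotated]) auto
lemma closure_base: "(x, y) \<in> D \<Longrightarrow> closure D x y" unfolding closure_def by auto

text \<open>A path needs the new edge at most once, in one of the two directions. Hence adding a
  relation merges at most two classes, which is what relabelling does.\<close>

lemma closure_insert:
  "closure (insert (r, s) D) x y \<longleftrightarrow> closure D x y \<or> closure D x r \<and> closure D s y \<or> closure D x s \<and> closure D r y"
proof
  assume "closure (insert (r, s) D) x y"
  then show "closure D x y \<or> closure D x r \<and> closure D s y \<or> closure D x s \<and> closure D r y"
    unfolding closure_def[of "insert _ _"]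
  proof (induction rule: rtranclp_induct)
    case (step y z)
    from step.hyps(2) consider "(y, z) \<in> D \<or> (z, y) \<in> D" | "y = r" "z = s" | "y = s" "z = r" by auto
    then show ?case
    proof cases
      case 1
      then have yz: "closure D y z" using closure_base closure_sym by metis
      show ?thesis using step.IH closure_trans[OF _ yz] by blast
    next
      case 2
      then show ?thesis using step.IH closure_refl[of D s] by auto
    next
      case 3
      then show ?thesis using step.IH closure_refl[of D r] by auto
    qed
  qed (simp add: closure_refl)
next
  let ?D = "insert (r, s) D"
  have m: "closure D a b \<Longrightarrow> closure ?D a b" for a b by (rule closure_mono) auto
  have rs: "closure ?D r s" by (rule closure_base) simp
  assume "closure D x y \<or> closure D x r \<and> closure D s y \<or> closure D x s \<and> closure D r y"
  then show "closure ?D x y"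
  proof (elim disjE conjE)
    assume a: "closure D x r" and b: "closure D s y"
    show ?thesis by (rule closure_trans[OF closure_trans[OF m[OF a] rs] m[OF b]])
  next
    assume a: "closure D x s" and b: "closure D r y"
    show ?thesis by (rule closure_trans[OF closure_trans[OF m[OF a] closure_sym[OF rs]] m[OF b]])
  qed (rule m)
qed

lemma closure_outside: "closure D x y \<Longrightarrow> x \<notin> fst ` D \<union> snd ` D \<Longrightarrow> x = y"
  unfolding closure_def by (erule converse_rtranclpE) force+

section \<open>Labels of classes\<close>

definition labels_ok :: "mem \<Rightarrow> nat \<Rightarrow> nat \<Rightarrow> (nat list \<times> nat list) set \<Rightarrow> bool" where
  "labels_ok h t k D \<longleftrightarrow> (\<forall>x\<in>recs t k. \<forall>y\<in>recs t k. h (x + 3) = h (y + 3) \<longleftrightarrow> closure D (wd h x) (wd h y)) \<and>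
    fst ` D \<union> snd ` D \<subseteq> wd h ` recs t k"

definition label_count :: "mem \<Rightarrow> nat \<Rightarrow> nat \<Rightarrow> nat" where
  "label_count h t k = card ((\<lambda>x. h (x + 3)) ` recs t k)"

text \<open>The inequality says that a new record brings at most one new label; its symmetric form
  serves the two insertions of one relation at once by addition.\<close>

lemma insert_step:
  assumes D: "dict h s t A S n nd k" and D': "dict h' s' t A S n' nd' k'" and l: "labels_ok h t k Dn"
    and low: "\<forall>a<t + 4 * k. h' a = h a"
    and k': "k' = k \<or> k' = Suc k \<and> w \<notin> wd h ` recs t k \<and> wd h' (t + 4 * k) = w \<and> h' (t + 4 * k + 3) = t + 4 * k"
  shows "labels_ok h' t k' Dn" "\<And>x. x \<in> recs t k \<Longrightarrow> x \<in> recs t k' \<and> wd h' x = wd h x \<and> h' (x + 3) = h (x + 3)"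
    "label_count h' t k' + k \<le> label_count h t k + k'"
    "wd h' ` recs t k' \<subseteq> insert w (wd h ` recs t k)"
proof -
  have fl: "\<And>x. x \<in> recs t k \<Longrightarrow> h x + h (x + 1) \<le> t \<and> h (x + 3) \<in> recs t k" using D unfolding dict_def by auto
  have wd: "wd h' x = wd h x" if "x \<in> recs t k" for x
    by (rule wd_cong) (use fl[OF that] recs_bounds[OF that] low in auto)
  have lab: "h' (x + 3) = h (x + 3)" if "x \<in> recs t k" for x using recs_bounds[OF that] low by simp
  have sub: "recs t k \<subseteq> recs t k'" using k' by (auto simp: recs_def)
  show 2: "x \<in> recs t k' \<and> wd h' x = wd h x \<and> h' (x + 3) = h (x + 3)" if "x \<in> recs t k" for x
    using sub wd[OF that] lab[OF that] that by blast
  have img: "wd h' ` recs t k = wd h ` recs t k" "(\<lambda>x. h' (x + 3)) ` recs t k = (\<lambda>x. h (x + 3)) ` recs t k"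
    using wd lab by (auto simp: image_iff)
  show "wd h' ` recs t k' \<subseteq> insert w (wd h ` recs t k)"
    using k' img unfolding recs_Suc by (elim disjE conjE) (auto simp: recs_Suc)
  show "label_count h' t k' + k \<le> label_count h t k + k'"
    using k'
  proof
    assume "k' = Suc k \<and> w \<notin> wd h ` recs t k \<and> wd h' (t + 4 * k) = w \<and> h' (t + 4 * k + 3) = t + 4 * k"
    then show ?thesis unfolding label_count_def by (simp add: recs_Suc img(2) card_insert_if)
  qed (simp add: label_count_def img(2))
  show "labels_ok h' t k' Dn"
    using k'
  proof
    assume kk: "k' = k"
    show ?thesis using l unfolding labels_ok_def kk img(1) using wd lab by simp
  next
    assume kk: "k' = Suc k \<and> w \<notin> wd h ` recs t k \<and> wd h' (t + 4 * k) = w \<and> h' (t + 4 * k + 3) = t + 4 * k"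
    \<comment> \<open>A new word occurs in none of the relations processed so far, so it is alone in
      its class, like its label.\<close>
    have wout: "w \<notin> fst ` Dn \<union> snd ` Dn" using kk l unfolding labels_ok_def by blast
    have iso: "\<not> closure Dn w (wd h y)" "\<not> closure Dn (wd h y) w" if "y \<in> recs t k" for y
      using closure_outside[OF _ wout, of "wd h y"] closure_sym[of Dn "wd h y" w] kk that by auto
    have ne: "h (y + 3) \<noteq> t + 4 * k" if "y \<in> recs t k" for y using fl[OF that] recs_bounds by fastforce
    show ?thesis
      unfolding labels_ok_def
    proof (intro conjI ballI)
      have "fst ` Dn \<union> snd ` Dn \<subseteq> wd h' ` recs t k" using l unfolding labels_ok_def img(1) by blast
      also have "\<dots> \<subseteq> wd h' ` recs t k'" by (rule image_mono[OF sub])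
      finally show "fst ` Dn \<union> snd ` Dn \<subseteq> wd h' ` recs t k'" .
      fix x y assume x: "x \<in> recs t k'" and y: "y \<in> recs t k'"
      have x': "x = t + 4 * k \<or> x \<in> recs t k" and y': "y = t + 4 * k \<or> y \<in> recs t k" using x y kk by (auto simp: recs_Suc)
      show "h' (x + 3) = h' (y + 3) \<longleftrightarrow> closure Dn (wd h' x) (wd h' y)"
        using x' y'
      proof (elim disjE)
        assume "x \<in> recs t k" "y \<in> recs t k"
        then show ?thesis using l unfolding labels_ok_def by (simp add: wd lab)
      next
        assume e: "x = t + 4 * k" and y: "y \<in> recs t k"
        have "\<not> closure Dn (wd h' x) (wd h' y)" unfolding e wd[OF y] using kk iso(1)[OF y] by simp
        moreover have "h' (x + 3) \<noteq> h' (y + 3)" unfolding e lab[OF y] using kk ne[OF y] by metis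
        ultimately show ?thesis by simp
      next
        assume x: "x \<in> recs t k" and e: "y = t + 4 * k"
        have "\<not> closure Dn (wd h' x) (wd h' y)" unfolding e wd[OF x] using kk iso(2)[OF x] by simp
        moreover have "h' (x + 3) \<noteq> h' (y + 3)" unfolding e lab[OF x] using kk ne[OF x] by metis
        ultimately show ?thesis by simp
      qed (simp add: closure_refl)
    qed
  qed
qed

text \<open>After the renaming, equality of labels is just the case distinction of
  \<open>closure_insert\<close>. If the two labels differ, the second one is no longer in
  use.\<close>

lemma union_step:
  assumes D: "dict h s t A S n nd k" and l: "labels_ok h t k Dn" and x: "x1 \<in> recs t k" "x2 \<in> recs t k"
    and r: "relabelled h h' t k (h (x1 + 3)) (h (x2 + 3))"
  shows "labels_ok h' t k (insert (wd h x1, wd h x2) Dn)"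
    "label_count h' t k + of_bool (h (x1 + 3) \<noteq> h (x2 + 3)) \<le> label_count h t k"
proof -
  have wd: "wd h' x = wd h x" if "x \<in> recs t k" for x by (rule dict_relabelled(2)[OF D r _ that]) (use x in auto)
  have lab: "h' (x + 3) = (if h (x + 3) = h (x2 + 3) then h (x1 + 3) else h (x + 3))" if "x \<in> recs t k" for x
    using r that unfolding relabelled_def by simp
  have img: "wd h' ` recs t k = wd h ` recs t k" using wd by auto
  have c: "h (x + 3) = h (y + 3) \<longleftrightarrow> closure Dn (wd h x) (wd h y)" if "x \<in> recs t k" "y \<in> recs t k" for x y
    using l that unfolding labels_ok_def by simp
  show "labels_ok h' t k (insert (wd h x1, wd h x2) Dn)"
    unfolding labels_ok_def img
  proof (intro conjI ballI)
    show "fst ` insert (wd h x1, wd h x2) Dn \<union> snd ` insert (wd h x1, wd h x2) Dn \<subseteq> wd h ` recs t k"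
      using l x unfolding labels_ok_def by auto
    fix y z assume y: "y \<in> recs t k" and z: "z \<in> recs t k"
    show "h' (y + 3) = h' (z + 3) \<longleftrightarrow> closure (insert (wd h x1, wd h x2) Dn) (wd h' y) (wd h' z)"
      unfolding closure_insert wd[OF y] wd[OF z] lab[OF y] lab[OF z] c[OF y z, symmetric]
        c[OF y x(1), symmetric] c[OF y x(2), symmetric] c[OF x(1) z, symmetric] c[OF x(2) z, symmetric]
      by auto
  qed
  let ?L = "(\<lambda>x. h (x + 3)) ` recs t k"
  show "label_count h' t k + of_bool (h (x1 + 3) \<noteq> h (x2 + 3)) \<le> label_count h t k"
  proof (cases "h (x1 + 3) = h (x2 + 3)")
    case True
    then have "(\<lambda>x. h' (x + 3)) ` recs t k = ?L" by (intro image_cong) (simp_all add: lab)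
    then show ?thesis using True by (simp add: label_count_def)
  next
    case False
    have "(\<lambda>x. h' (x + 3)) ` recs t k \<subseteq> ?L - {h (x2 + 3)}"
      using lab x False by (auto simp: image_iff)
    then have "label_count h' t k \<le> card (?L - {h (x2 + 3)})"
      unfolding label_count_def by (intro card_mono) auto
    also have "\<dots> = card ?L - 1" using x(2) by (subst card_Diff_singleton) auto
    finally show ?thesis using False x(2) card_gt_0_iff[of ?L] unfolding label_count_def by force
  qed
qed

lemma dict_registers:
  assumes "dict h s t A S n nd k" and "\<And>z. z \<in> {22, 23, 48, 49, 50} \<Longrightarrow> s' z = s z"
  shows "dict h s' t A S n nd k"
proof -
  have e: "s' 22 = s 22" "s' 23 = s 23" "s' 48 = s 48" "s' 49 = s 49" "s' 50 = s 50" using assms(2) by auto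
  show ?thesis using assms(1) unfolding dict_def e .
qed

text \<open>For a bound \<open>n2\<close> that is known only after \<open>c1\<close> has been
  executed: the first part is given by one concrete execution.\<close>

lemma run_Seq_bs:
  assumes "bs c1 s h j s1 h1" "j \<le> n1" "run c2 s1 h1 n2 Q"
  shows "run (c1 ;; c2) s h (n1 + n2) Q"
  by (rule run_Seq[where ?n1.0 = n1 and ?n2.0 = n2]) (use assms in \<open>unfold run_def[of c1], blast\<close>, simp)

definition GATHER :: com where
  "GATHER = Loop (V 46) (INSERT ;; Asg 55 (V 56) ;; INSERT ;; UNION ;; Asg 46 (Minus (V 46) (N 1)))"

definition both_sides :: "(nat list \<times> nat list) list \<Rightarrow> nat list list" where
  "both_sides rs = concat (map (\<lambda>(r, s). [r, s]) rs)"

lemma both_sides_simps [simp]: "both_sides [] = []" "both_sides ((r, s) # rs) = r # s # both_sides rs"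
  by (simp_all add: both_sides_def)

lemma run_GATHER:
  assumes D: "dict h s t A S n nd 0" and w: "holds h (s 45) (encs (both_sides rs))" "s 46 = length rs"
    and low: "s 45 + length (encs (both_sides rs)) \<le> t" and cap: "t + 8 * length rs \<le> A"
    and small: "\<And>c. c \<in> set (concat (both_sides rs)) \<Longrightarrow> Suc c < S"
    and K: "K = card (fst ` set rs \<union> snd ` set rs)"
    and m: "length (encs (both_sides rs)) + K * K \<le> m"
  shows "run GATHER s h m (\<lambda>s' h'. (\<forall>a<t. h' a = h a) \<and>
    (\<exists>k. s' 22 = t \<and> s' 23 = t + 4 * k \<and> inj_on (wd h') (recs t k) \<and> wd h' ` recs t k = fst ` set rs \<union> snd ` set rs \<and>
      labels_ok h' t k (set rs) \<and> (\<forall>x\<in>recs t k. h' x + h' (x + 1) \<le> t)) \<and>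
    agree {23, 45, 46, 47, 49, 52, 53, 54, 55, 56, 57, 58, 65} s s')"
proof -
  let ?RW = "fst ` set rs \<union> snd ` set rs"
  let ?W = "{23, 45, 46, 47, 49, 52, 53, 54, 55, 56, 57, 58, 65} :: nat set"
  define e where "e = s 45 + length (encs (both_sides rs))"
  define I where "I = (\<lambda>s' h'. agree ?W s s' \<and> (\<forall>a<t. h' a = h a) \<and>
      (\<exists>dn rest n nd k. rs = dn @ rest \<and> dict h' s' t A S n nd k \<and> holds h (s' 45) (encs (both_sides rest)) \<and>
        s' 46 = length rest \<and> s' 45 + length (encs (both_sides rest)) = e \<and> t + 4 * k + 8 * length rest \<le> A \<and>
        wd h' ` recs t k = fst ` set dn \<union> snd ` set dn \<and> labels_ok h' t k (set dn)))"
  \<comment> \<open>Relabelling costs at most \<open>K\<close> and merges two labels, so the number of labels in use pays for it.\<close>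
  define pt where "pt = (\<lambda>(s' :: mem) h'. e - s' 45 + K * (label_count h' t ((s' 23 - t) div 4) + (K - (s' 23 - t) div 4)))"
  have finRW: "finite ?RW" by simp
  have kK: "k \<le> K" if "inj_on (wd h') (recs t k)" "wd h' ` recs t k \<subseteq> ?RW" for h' k
    using card_mono[OF finRW that(2)] card_image[OF that(1)] card_recs[of t k] K by simp
  show ?thesis
    unfolding GATHER_def
  proof (rule run_Loop[where I = I and \<phi> = pt], goal_cases)
    case 1
    show ?case unfolding I_def
      using D w cap by (intro conjI exI[of _ "[]"] exI[of _ rs] exI[of _ n] exI[of _ nd] exI[of _ 0])
        (auto simp: recs_def e_def labels_ok_def)
  next
    case 2
    have "s 23 = t" using D unfolding dict_def by simp
    then show ?case using m by (simp add: pt_def e_def label_count_def recs_def)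
  next
    case (3 s0 h0)
    obtain dn rest n0 nd0 k0 where ag0: "agree ?W s s0" and low0: "\<forall>a<t. h0 a = h a" and rs: "rs = dn @ rest"
      and D0: "dict h0 s0 t A S n0 nd0 k0" and w0: "holds h (s0 45) (encs (both_sides rest))" and l0: "s0 46 = length rest"
      and e0: "s0 45 + length (encs (both_sides rest)) = e" and cap0: "t + 4 * k0 + 8 * length rest \<le> A"
      and im0: "wd h0 ` recs t k0 = fst ` set dn \<union> snd ` set dn" and lab0: "labels_ok h0 t k0 (set dn)"
      using 3(1)[unfolded I_def] by (elim exE conjE) (rule that, assumption+)
    obtain r q rest' where rest: "rest = (r, q) # rest'" using 3(2) l0 by (cases rest) auto
    have et: "e \<le> t" using low by (simp add: e_def)
    have bnd: "s0 45 + Suc (length r) + Suc (length q) + length (encs (both_sides rest')) = e" using e0 rest by simp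
    have small': "c \<in> set r \<union> set q \<Longrightarrow> Suc c < S" for c using small unfolding rs rest both_sides_def by auto
    have wr: "holds h (s0 45) (length r # r)" "holds h (s0 45 + Suc (length r)) (length q # q)"
      "holds h (s0 45 + Suc (length r) + Suc (length q)) (encs (both_sides rest'))"
      using w0 unfolding rest by (simp_all add: ac_simps Suc_eq_plus1)
    have hr0: "holds h0 (s0 45) (length r # r)"
      by (rule holds_cong[OF wr(1)]) (use bnd et low0 in auto)
    define Q1 where "Q1 = (\<lambda>s1 h1. \<exists>n1 nd1 k1. dict h1 s1 t A S n1 nd1 k1 \<and> s1 45 = s0 45 + Suc (length r) \<and>
      s1 56 \<in> recs t k1 \<and> wd h1 (s1 56) = r \<and> (\<forall>a<t + 4 * k0. h1 a = h0 a) \<and>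
      (k1 = k0 \<or> k1 = Suc k0 \<and> r \<notin> wd h0 ` recs t k0 \<and> wd h1 (t + 4 * k0) = r \<and> h1 (t + 4 * k0 + 3) = t + 4 * k0) \<and>
      agree {23, 45, 47, 49, 52, 53, 54, 56} s0 s1)"
    have R1: "run INSERT s0 h0 (length r) Q1"
      unfolding Q1_def
      by (rule run_INSERT[OF D0 _ hr0]) (use cap0 rest small' bnd et in auto)
    show ?case
    proof -
      define C where "C = K * (label_count h0 t k0 + (K - k0))"
      have k0K: "k0 \<le> K" by (rule kK[of h0]) (use D0 im0 rs in \<open>auto simp: dict_def\<close>)
      have pt0: "pt s0 h0 = e - s0 45 + C" using D0 unfolding pt_def C_def dict_def by simp
      \<comment> \<open>The cost of \<open>UNION\<close> depends on whether the labels differ, which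
        shows only after both insertions; \<open>F\<close> takes this cost as its argument
        m.\<close>
      define F where "F = (\<lambda>s' h' m. I s' h' \<and> pt s' h' + (length r + (length q + m)) + 1 \<le> pt s0 h0)"
      have "\<exists>m. run (UNION ;; Asg 46 (Minus (V 46) (N 1))) s2 h2 m (\<lambda>s' h'. F s' h' m)"
        if q2: "dict h2 s2 t A S n2 nd2 k2" "s2 45 = s0 45 + Suc (length r) + Suc (length q)"
          "s2 56 \<in> recs t k2" "wd h2 (s2 56) = q" "s2 55 \<in> recs t k2" "wd h2 (s2 55) = r"
          "\<forall>a<t. h2 a = h a" "k2 \<le> Suc (Suc k0)" "labels_ok h2 t k2 (set dn)"
          "wd h2 ` recs t k2 = insert r (insert q (fst ` set dn \<union> snd ` set dn))"
          "label_count h2 t k2 + k0 \<le> label_count h0 t k0 + k2" "agree ?W s s2" "s2 46 = length rest" for s2 h2 n2 nd2 k2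
      proof -
        have k2K: "k2 \<le> K" by (rule kK[of h2]) (use q2 rs rest in \<open>auto simp: dict_def\<close>)
        define a b where "a = h2 (s2 55 + 3)" and "b = h2 (s2 56 + 3)"
        define m where "m = (if a = b then 0 else k2)"
        have s2T: "s2 22 = t" "s2 23 = t + 4 * k2" using q2(1) unfolding dict_def by auto
        have C2: "K * (label_count h2 t k2 + (K - k2)) \<le> C"
          unfolding C_def using q2(11) k2K k0K by (intro mult_le_mono2) linarith
        have "run (UNION ;; Asg 46 (Minus (V 46) (N 1))) s2 h2 m (\<lambda>s' h'. F s' h' m)"
        proof (rule run_Seq'[where ?n2.0 = 0])
          show "run UNION s2 h2 m (\<lambda>s' h'. relabelled h2 h' t k2 a b \<and> agree {57, 58, 65} s2 s')"
            unfolding a_def b_def by (rule run_UNION[OF s2T]) (simp add: m_def a_def b_def)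
          fix s3 h3 assume r3: "relabelled h2 h3 t k2 a b \<and> agree {57, 58, 65} s2 s3"
          have f3: "s3 z = s2 z" if "z \<notin> {57, 58, 65}" for z using agreeD[of "{57, 58, 65}" s2 s3 z] r3 that by simp
          have ex: "\<exists>x\<in>recs t k2. a = h2 (x + 3)" using q2(5) a_def by blast
          have rl: "relabelled h2 h3 t k2 a b" using r3 by simp
          have D3: "dict h3 s2 t A S n2 nd2 k2" by (rule dict_relabelled(1)[OF q2(1) rl ex])
          have wd3: "\<And>x. x \<in> recs t k2 \<Longrightarrow> wd h3 x = wd h2 x" by (rule dict_relabelled(2)[OF q2(1) rl ex])
          have low3: "\<And>z. z < t \<Longrightarrow> h3 z = h2 z" by (rule dict_relabelled(3)[OF q2(1) rl ex])
          note U = union_step[OF q2(1) q2(9) q2(5) q2(3) rl[unfolded a_def b_def]]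
          let ?s4 = "s3(46 := s3 46 - 1)"
          have D4: "dict h3 ?s4 t A S n2 nd2 k2" by (rule dict_registers[OF D3]) (auto simp: f3)
          have l4: "labels_ok h3 t k2 (set (dn @ [(r, q)]))" using U(1) unfolding q2(4,6) by simp
          have "wd h3 ` recs t k2 = wd h2 ` recs t k2" using wd3 by auto
          then have im4: "wd h3 ` recs t k2 = fst ` set (dn @ [(r, q)]) \<union> snd ` set (dn @ [(r, q)])" using q2(10) by auto
          have ag4: "agree ?W s ?s4"
            using agree_via[of "{57, 58, 65}" s2 s3 ?W s] r3 q2(12) by simp
          have I4: "I ?s4 h3"
            unfolding I_def
          proof (intro conjI exI)
            show "rs = (dn @ [(r, q)]) @ rest'" using rs rest by simp
            show "dict h3 ?s4 t A S n2 nd2 k2" by (rule D4)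
            show "holds h (?s4 45) (encs (both_sides rest'))" using wr(3) q2(2) by (simp add: f3)
            show "t + 4 * k2 + 8 * length rest' \<le> A" using cap0 q2(8) rest by simp
          qed (use ag4 low3 q2 rest bnd im4 l4 f3 in auto)
          have "pt ?s4 h3 = e - s2 45 + K * (label_count h3 t k2 + (K - k2))" using s2T by (simp add: pt_def f3)
          moreover have "K * (label_count h3 t k2 + (K - k2)) + m \<le> C"
          proof (cases "a = b")
            case True
            have "label_count h3 t k2 \<le> label_count h2 t k2" using U(2) by linarith
            then have "K * (label_count h3 t k2 + (K - k2)) \<le> K * (label_count h2 t k2 + (K - k2))"
              by (intro mult_le_mono2 add_le_mono1)
            from le_trans[OF this C2] show ?thesis unfolding m_def if_P[OF True] add_0_right .
          next
            case False
            have "K * (label_count h3 t k2 + (K - k2)) + K = K * (Suc (label_count h3 t k2) + (K - k2))" by simp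
            also have "\<dots> \<le> K * (label_count h2 t k2 + (K - k2))"
              using U(2) False unfolding a_def b_def by (intro mult_le_mono2) simp
            finally show ?thesis using C2 False k2K by (simp add: m_def)
          qed
          moreover have "s2 45 \<le> e" "s0 45 + length r + length q + 2 = s2 45" using q2(2) bnd by simp_all
          ultimately have "pt ?s4 h3 + (length r + (length q + m)) + 1 \<le> pt s0 h0" unfolding pt0 by linarith
          then show "run (Asg 46 (Minus (V 46) (N 1))) s3 h3 0 (\<lambda>s' h'. F s' h' m)" using I4 by (simp add: F_def)
        qed simp
        then show ?thesis by blast
      qed
      note fin = this
      have mid: "\<exists>m. run (INSERT ;; UNION ;; Asg 46 (Minus (V 46) (N 1))) (s1(55 := s1 56)) h1 (length q + m) (\<lambda>s' h'. F s' h' m)"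
        if "Q1 s1 h1" for s1 h1
      proof -
        obtain n1 nd1 k1 where D1: "dict h1 s1 t A S n1 nd1 k1" and s45: "s1 45 = s0 45 + Suc (length r)"
          and s56: "s1 56 \<in> recs t k1" "wd h1 (s1 56) = r" and low1: "\<forall>a<t + 4 * k0. h1 a = h0 a"
          and k1: "k1 = k0 \<or> k1 = Suc k0 \<and> r \<notin> wd h0 ` recs t k0 \<and> wd h1 (t + 4 * k0) = r \<and> h1 (t + 4 * k0 + 3) = t + 4 * k0"
          and ag1: "agree {23, 45, 47, 49, 52, 53, 54, 56} s0 s1" using \<open>Q1 s1 h1\<close> unfolding Q1_def by blast
        note S1 = insert_step[OF D0 D1 lab0 low1 k1]
        let ?s1 = "s1(55 := s1 56)"
        have D1': "dict h1 ?s1 t A S n1 nd1 k1" by (rule dict_registers[OF D1]) auto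
        have hq1: "holds h1 (?s1 45) (length q # q)"
          by (rule holds_cong[of h]) (use wr(2) s45 bnd et low0 low1 in auto)
        have "k1 \<le> Suc k0" using k1 by auto
        then have cap1: "t + 4 * Suc k1 \<le> A" using cap0 rest by simp
        define Q2 where "Q2 = (\<lambda>s2 h2. \<exists>n2 nd2 k2. dict h2 s2 t A S n2 nd2 k2 \<and> s2 45 = ?s1 45 + Suc (length q) \<and>
          s2 56 \<in> recs t k2 \<and> wd h2 (s2 56) = q \<and> (\<forall>a<t + 4 * k1. h2 a = h1 a) \<and>
          (k2 = k1 \<or> k2 = Suc k1 \<and> q \<notin> wd h1 ` recs t k1 \<and> wd h2 (t + 4 * k1) = q \<and> h2 (t + 4 * k1 + 3) = t + 4 * k1) \<and>
          agree {23, 45, 47, 49, 52, 53, 54, 56} ?s1 s2)"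
        have "run INSERT ?s1 h1 (length q) Q2"
          unfolding Q2_def
          by (rule run_INSERT[OF D1' cap1 hq1]) (use small' s45 bnd et in auto)
        then obtain s2 h2 j where b2: "bs INSERT ?s1 h1 j s2 h2" "j \<le> length q" "Q2 s2 h2" unfolding run_def by blast
        then obtain n2 nd2 k2 where D2: "dict h2 s2 t A S n2 nd2 k2" and s45': "s2 45 = ?s1 45 + Suc (length q)"
          and s56': "s2 56 \<in> recs t k2" "wd h2 (s2 56) = q" and low2: "\<forall>a<t + 4 * k1. h2 a = h1 a"
          and k2: "k2 = k1 \<or> k2 = Suc k1 \<and> q \<notin> wd h1 ` recs t k1 \<and> wd h2 (t + 4 * k1) = q \<and> h2 (t + 4 * k1 + 3) = t + 4 * k1"
          and ag2: "agree {23, 45, 47, 49, 52, 53, 54, 56} ?s1 s2" unfolding Q2_def by blast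
        note S2 = insert_step[OF D1 D2 S1(1) low2 k2]
        have s55: "s2 55 = s1 56" using agreeD[OF ag2, of 55] by simp
        have r2: "s2 55 \<in> recs t k2" "wd h2 (s2 55) = r" unfolding s55 using S2(2)[OF s56(1)] s56(2) by auto
        have "wd h0 ` recs t k0 \<subseteq> wd h1 ` recs t k1"
          using S1(2) by (force simp: image_iff)
        moreover have "wd h1 ` recs t k1 \<subseteq> wd h2 ` recs t k2"
          using S2(2) by (force simp: image_iff)
        moreover have "r \<in> wd h2 ` recs t k2" "q \<in> wd h2 ` recs t k2" using r2 s56' by (metis imageI)+
        ultimately have im2: "wd h2 ` recs t k2 = insert r (insert q (fst ` set dn \<union> snd ` set dn))"
        proof (intro equalityI)
          show "wd h2 ` recs t k2 \<subseteq> insert r (insert q (fst ` set dn \<union> snd ` set dn))"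
            using S2(4) S1(4) unfolding im0 by auto
        qed (use im0 in \<open>simp, blast\<close>)
        have a1: "agree ?W s s1" by (rule agree_via[OF ag1 _ ag0]) auto
        have a2: "agree ?W s s2" by (rule agree_via[OF ag2]) (use a1 in auto)
        have c45: "s2 45 = s0 45 + Suc (length r) + Suc (length q)" using s45 s45' by simp
        have clow: "\<forall>a<t. h2 a = h a" using low0 low1 low2 by simp
        have ck: "k2 \<le> Suc (Suc k0)" using k1 k2 by auto
        have clc: "label_count h2 t k2 + k0 \<le> label_count h0 t k0 + k2" using S1(3) S2(3) by linarith
        have c46: "s2 46 = length rest" using agreeD[OF ag2, of 46] agreeD[OF ag1, of 46] l0 by simp
        have "\<exists>m. run (UNION ;; Asg 46 (Minus (V 46) (N 1))) s2 h2 m (\<lambda>s' h'. F s' h' m)"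
          by (rule fin[OF D2 c45 s56' r2 clow ck S2(1) im2 clc a2 c46])
        then obtain m where "run (UNION ;; Asg 46 (Minus (V 46) (N 1))) s2 h2 m (\<lambda>s' h'. F s' h' m)" by blast
        then have "run (INSERT ;; UNION ;; Asg 46 (Minus (V 46) (N 1))) ?s1 h1 (length q + m) (\<lambda>s' h'. F s' h' m)"
          by (rule run_Seq_bs[OF b2(1,2)])
        then show ?thesis by blast
      qed
      obtain s1 h1 j where b1: "bs INSERT s0 h0 j s1 h1" "j \<le> length r" "Q1 s1 h1" using R1 unfolding run_def by blast
      obtain m where m: "run (INSERT ;; UNION ;; Asg 46 (Minus (V 46) (N 1))) (s1(55 := s1 56)) h1 (length q + m) (\<lambda>s' h'. F s' h' m)"
        using mid[OF b1(3)] by blast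
      have "run (Asg 55 (V 56) ;; INSERT ;; UNION ;; Asg 46 (Minus (V 46) (N 1))) s1 h1 (length q + m) (\<lambda>s' h'. F s' h' m)"
        using m by simp
      then have "run (INSERT ;; Asg 55 (V 56) ;; INSERT ;; UNION ;; Asg 46 (Minus (V 46) (N 1))) s0 h0 (length r + (length q + m)) (\<lambda>s' h'. F s' h' m)"
        by (rule run_Seq_bs[OF b1(1,2)])
      then show ?thesis unfolding F_def by blast
    qed
  next
    case (4 s' h')
    obtain dn rest n' nd' k where rs: "rs = dn @ rest" and D': "dict h' s' t A S n' nd' k" and l: "s' 46 = length rest"
      and im: "wd h' ` recs t k = fst ` set dn \<union> snd ` set dn" and lab: "labels_ok h' t k (set dn)"
      and ag: "agree ?W s s'" and lw: "\<forall>a<t. h' a = h a"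
      using 4(1)[unfolded I_def] by (elim exE conjE) (rule that, assumption+)
    have "rest = []" using 4(2) l by simp
    then show ?case using rs D' im lab ag lw unfolding dict_def by (intro conjI exI[of _ k]) auto
  qed
qed

section \<open>Lengths of maximal piece suffixes and the decision procedure\<close>

lemma run_each:
  assumes T: "s y = t" "s 23 = t + 4 * k" "y \<noteq> 23" and J0: "J 0 s h"
    and bd: "\<And>j s' h'. j < k \<Longrightarrow> J j s' h' \<Longrightarrow> s' y = t + 4 * j \<Longrightarrow> s' 23 = t + 4 * k \<Longrightarrow>
      run bd s' h' (c (t + 4 * j)) (\<lambda>s'' h''. s'' y = t + 4 * j \<and> s'' 23 = t + 4 * k \<and> J (Suc j) (s''(y := t + 4 * Suc j)) h'')"
    and n: "(\<Sum>x\<in>recs t k. 1 + c x) \<le> n"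
  shows "run (Loop (Lt (V y) (V 23)) (bd ;; Asg y (Plus (V y) (N 4)))) s h n (\<lambda>s' h'. J k s' h')"
proof (rule run_Loop[where I = "\<lambda>s' h'. s' 23 = t + 4 * k \<and> (\<exists>j\<le>k. s' y = t + 4 * j \<and> J j s' h')"
      and \<phi> = "\<lambda>s' h'. \<Sum>i = (s' y - t) div 4..<k. 1 + c (t + 4 * i)"], goal_cases)
  case 1
  then show ?case using T J0 by auto
next
  case 2
  have "(\<Sum>i = 0..<k. 1 + c (t + 4 * i)) = (\<Sum>x\<in>recs t k. 1 + c x)"
    unfolding recs_def by (subst sum.reindex) (auto simp: inj_on_def lessThan_atLeast0)
  then show ?case using n T by simp
next
  case (3 s' h')
  then obtain j where j: "s' y = t + 4 * j" "J j s' h'" "s' 23 = t + 4 * k" "j < k" by (auto split: if_splits)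
  have sm: "(\<Sum>i = j..<k. 1 + c (t + 4 * i)) = 1 + c (t + 4 * j) + (\<Sum>i = Suc j..<k. 1 + c (t + 4 * i))"
    using j(4) by (simp add: sum.atLeast_Suc_lessThan)
  show ?case
  proof (rule exI[of _ "c (t + 4 * j)"], rule run_Seq'[OF bd[OF j(4,2,1,3)], where ?n2.0 = 0], goal_cases)
    case (1 s2 h2)
    have "s2 y + 4 = t + 4 * Suc j" using 1 by simp
    then have e: "s2(y := s2 y + 4) = s2(y := t + 4 * Suc j)" by (simp only:)
    have d: "(t + 4 * Suc j - t) div 4 = Suc j" "(t + 4 * j - t) div 4 = j" by simp_all
    show ?case unfolding run_Asg ev.simps e fun_upd_same d j(1)
      using 1 T(3) j(4) sm by (auto intro!: exI[of _ "Suc j"] simp del: mult_Suc_right)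
  qed simp
next
  case (4 s' h')
  then obtain j where "s' y = t + 4 * j" "J j s' h'" "s' 23 = t + 4 * k" "j \<le> k" by auto
  then show ?case using 4(2) by (cases "j = k") (auto split: if_splits)
qed

text \<open>
  The longest piece that is a suffix of a relation word is its longest common suffix with a prefix of a
  relation word other than itself.
\<close>

definition SUFFIXES :: com where
  "SUFFIXES = Loop (Lt (V 60) (Plus (N 1) (H (Plus (V 66) (N 1)))))
    (Cond (And (Eq (V 65) (V 66)) (Eq (V 60) (H (Plus (V 65) (N 1))))) (Asg 20 (N 0))
      (Asg 16 (Plus (H (V 65)) (H (Plus (V 65) (N 1)))) ;; Asg 17 (H (Plus (V 65) (N 1))) ;;
       Asg 18 (Plus (H (V 66)) (V 60)) ;; Asg 19 (V 60) ;; CSUF) ;;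
     Cond (Lt (V 59) (V 20)) (Asg 59 (V 20)) (Asg 20 (N 0)) ;;
     Asg 60 (Plus (V 60) (N 1)))"

definition LENGTHS :: com where
  "LENGTHS = Asg 65 (V 22) ;; Loop (Lt (V 65) (V 23))
    ((Asg 59 (N 0) ;; Asg 66 (V 22) ;;
      Loop (Lt (V 66) (V 23)) ((Asg 60 (N 0) ;; SUFFIXES) ;; Asg 66 (Plus (V 66) (N 4))) ;;
      Put (Plus (V 65) (N 2)) (Minus (H (Plus (V 65) (N 1))) (V 59))) ;;
     Asg 65 (Plus (V 65) (N 4)))"

section \<open>Cost of computing the lengths\<close>

context word_problem begin

lemma run_SUFFIXES:
  assumes b: "bij_betw (wd h) (recs t k) RW" and x: "s 65 \<in> recs t k" and y: "s 66 \<in> recs t k" and s60: "s 60 = 0"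
    and z: "s 59 \<le> zlen (wd h (s 65))"
    and n: "Suc (length (wd h (s 66))) * Suc (length (wd h (s 65))) \<le> n"
  shows "run SUFFIXES s h n (\<lambda>s' h'. h' = h \<and> s 59 \<le> s' 59 \<and> s' 59 \<le> zlen (wd h (s 65)) \<and>
    (\<forall>e\<le>length (wd h (s 66)). wd h (s 65) \<noteq> wd h (s 66) \<or> e \<noteq> length (wd h (s 65)) \<longrightarrow>
      (\<forall>c. common_suffix c (wd h (s 65)) (take e (wd h (s 66))) \<longrightarrow> c \<le> s' 59)) \<and>
    agree {16, 17, 18, 19, 20, 59, 60} s s')"
proof -
  let ?S = "wd h (s 65)" let ?Q = "wd h (s 66)"
  let ?W = "{16, 17, 18, 19, 20, 59, 60} :: nat set"
  have SR: "?S \<in> RW" "?Q \<in> RW" using b x y by (auto simp: bij_betw_def)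
  have inj: "s 65 = s 66 \<longleftrightarrow> ?S = ?Q" using inj_on_eq_iff[OF bij_betw_imp_inj_on[OF b] x y] by simp
  define other where "other = (\<lambda>e. ?S \<noteq> ?Q \<or> e \<noteq> length ?S)"
  define I where "I = (\<lambda>s' h'. h' = h \<and> agree ?W s s' \<and> s 59 \<le> s' 59 \<and> s' 59 \<le> zlen ?S \<and> s' 60 \<le> Suc (length ?Q) \<and>
    (\<forall>e<s' 60. other e \<longrightarrow> (\<forall>c. common_suffix c ?S (take e ?Q) \<longrightarrow> c \<le> s' 59)))"
  define K where "K = Suc (length ?S)"
  have "run SUFFIXES s h n (\<lambda>s' h'. I s' h' \<and> s' 60 = Suc (length ?Q))"
    unfolding SUFFIXES_def
  proof (rule run_Loop[where I = I and \<phi> = "\<lambda>s' h'. (Suc (length ?Q) - s' 60) * K"], goal_cases)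
    case 1
    show ?case using s60 z by (simp add: I_def)
  next
    case 2
    then show ?case using n s60 unfolding K_def by simp
  next
    case (3 s1 h1)
    then have h1: "h1 = h" and ag: "agree ?W s s1" and i: "s 59 \<le> s1 59" "s1 59 \<le> zlen ?S"
      "\<forall>e<s1 60. other e \<longrightarrow> (\<forall>c. common_suffix c ?S (take e ?Q) \<longrightarrow> c \<le> s1 59)" unfolding I_def by auto
    have f: "s1 65 = s 65" "s1 66 = s 66" using agreeD[OF ag, of 65] agreeD[OF ag, of 66] by simp_all
    define e where "e = s1 60"
    have "s1 60 < 1 + h (s 66 + 1)" using 3(2) by (simp add: h1 f split: if_splits)
    then have e: "e \<le> length ?Q" unfolding e_def length_wd by simp
    have fin: "run (Cond (Lt (V 59) (V 20)) (Asg 59 (V 20)) (Asg 20 (N 0)) ;; Asg 60 (Plus (V 60) (N 1))) s2 h 0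
        (\<lambda>s' h'. I s' h' \<and> (Suc (length ?Q) - s' 60) * K + length ?S + 1 \<le> (Suc (length ?Q) - e) * K)"
      if s2: "agree ?W s s2" "s2 59 = s1 59" "s2 60 = e" "s2 20 \<le> zlen ?S"
        "other e \<Longrightarrow> (\<forall>c. common_suffix c ?S (take e ?Q) \<longrightarrow> c \<le> s2 20)" for s2
    proof -
      have "Suc (length ?Q) - e = Suc (length ?Q - e)" using e by simp
      then have pd: "(Suc (length ?Q) - (e + 1)) * K + length ?S + 1 \<le> (Suc (length ?Q) - e) * K" by (simp add: K_def)
      show ?thesis
      proof (cases "s2 59 < s2 20")
        case True
        have "c \<le> s2 20" if "e' < e + 1" "other e'" "common_suffix c ?S (take e' ?Q)" for e' c
        proof (cases "e' = e")
          case False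
          then have "e' < s1 60" using that(1) unfolding e_def by linarith
          then have "c \<le> s1 59" using i(3) that(2,3) by blast
          then show ?thesis using True s2(2) by simp
        qed (use s2(5) that in blast)
        then have "I (s2(59 := s2 20, 60 := e + 1)) h"
          unfolding I_def using s2 i e True by simp
        then show ?thesis using True s2(3) pd by simp
      next
        case False
        have "c \<le> s1 59" if "e' < e + 1" "other e'" "common_suffix c ?S (take e' ?Q)" for e' c
        proof (cases "e' = e")
          case True
          then have "c \<le> s2 20" using s2(5) that by blast
          then show ?thesis using False s2(2) by simp
        next
          case False
          then have "e' < s1 60" using that(1) unfolding e_def by linarith
          then show ?thesis using i(3) that(2,3) by blast
        qed
        then have "I (s2(20 := 0, 60 := e + 1)) h"
          unfolding I_def using s2 i e False by simp
        then show ?thesis using False s2(3) pd by simp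
      qed
    qed
    show ?case
    proof (cases "s 65 = s 66 \<and> e = length ?S")
      case True
      then have "\<not> other e" using inj by (simp add: other_def)
      then have "run (Cond (Lt (V 59) (V 20)) (Asg 59 (V 20)) (Asg 20 (N 0)) ;; Asg 60 (Plus (V 60) (N 1))) (s1(20 := 0)) h 0
        (\<lambda>s' h'. I s' h' \<and> (Suc (length ?Q) - s' 60) * K + length ?S + 1 \<le> (Suc (length ?Q) - e) * K)"
        by (intro fin) (use ag in \<open>simp_all add: e_def\<close>)
      then have "run (Cond (Lt (V 59) (V 20)) (Asg 59 (V 20)) (Asg 20 (N 0)) ;; Asg 60 (Plus (V 60) (N 1))) (s1(20 := 0)) h (length ?S)
        (\<lambda>s' h'. I s' h' \<and> (Suc (length ?Q) - s' 60) * K + length ?S + 1 \<le> (Suc (length ?Q) - e) * K)"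
        by (rule run_mono) simp_all
      moreover have "ev (And (Eq (V 65) (V 66)) (Eq (V 60) (H (Plus (V 65) (N 1))))) s1 h \<noteq> 0"
        using True f by (simp add: e_def length_wd)
      ultimately show ?thesis
        unfolding h1 by (intro exI[of _ "length ?S"]) (simp only: run_Seq_Cond if_True exec_simps e_def)
    next
      case False
      then have oe: "other e" using inj by (auto simp: other_def)
      let ?s = "s1(16 := h (s 65) + h (s 65 + 1), 17 := h (s 65 + 1), 18 := h (s 66) + e, 19 := e)"
      have tq: "take e ?Q = seg h (h (s 66)) e" using e by (simp add: wd_def take_seg length_wd min_def)
      have R: "run CSUF ?s h (length ?S) (\<lambda>s' h'. h' = h \<and> common_suffix (s' 20) ?S (take e ?Q) \<and>
        (\<forall>c. common_suffix c ?S (take e ?Q) \<longrightarrow> c \<le> s' 20) \<and> (\<forall>z. z \<noteq> 20 \<longrightarrow> s' z = ?s z))"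
        unfolding tq by (rule run_CSUF) (simp_all add: wd_def)
      have nb: "\<not> ev (And (Eq (V 65) (V 66)) (Eq (V 60) (H (Plus (V 65) (N 1))))) s1 h \<noteq> 0"
        using False f by (simp add: e_def length_wd)
      have "run (CSUF ;; Cond (Lt (V 59) (V 20)) (Asg 59 (V 20)) (Asg 20 (N 0)) ;; Asg 60 (Plus (V 60) (N 1))) ?s h (length ?S)
        (\<lambda>s' h'. I s' h' \<and> (Suc (length ?Q) - s' 60) * K + length ?S + 1 \<le> (Suc (length ?Q) - e) * K)"
      proof (rule run_Seq'[OF R, where ?n2.0 = 0], goal_cases)
        case (1 s2 h2)
        have f2: "s2 z = ?s z" if "z \<noteq> 20" for z using 1 that by blast
        have "s2 20 \<le> zlen ?S"
          by (rule common_suffix_take_le_zlen[OF SR e]) (use oe 1 in \<open>auto simp: other_def\<close>)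
        moreover have "agree ?W s s2"
          unfolding agree_def using f2 agreeD[OF ag] by auto
        ultimately have "run (Cond (Lt (V 59) (V 20)) (Asg 59 (V 20)) (Asg 20 (N 0)) ;; Asg 60 (Plus (V 60) (N 1))) s2 h 0
          (\<lambda>s' h'. I s' h' \<and> (Suc (length ?Q) - s' 60) * K + length ?S + 1 \<le> (Suc (length ?Q) - e) * K)"
          using 1 f2[of 59] f2[of 60] by (intro fin) (auto simp: e_def)
        then show ?case using 1 by simp
      qed simp
      then show ?thesis
        unfolding h1 run_Seq_Cond if_not_P[OF nb]
        by (intro exI[of _ "length ?S"]) (simp only: exec_simps f e_def)
    qed
  next
    case (4 s1 h1)
    then have h1: "h1 = h" and ag: "agree ?W s s1" unfolding I_def by auto
    have "s1 66 = s 66" using agreeD[OF ag, of 66] by simp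
    then show ?case using 4 by (auto simp: I_def length_wd)
  qed
  then show ?thesis
    by (rule run_mono) (auto simp: I_def other_def less_Suc_eq_le)
qed

lemma run_SUFFIX_LOOP:
  assumes b: "bij_betw (wd h) (recs t k) RW" and T: "s 22 = t" "s 23 = t + 4 * k" and x: "s 65 \<in> recs t k"
    and n: "(\<Sum>y\<in>recs t k. Suc (length (wd h y))) * (2 * Suc (length (wd h (s 65)))) \<le> n" and s: "s 59 = 0" "s 66 = t"
  shows "run (Loop (Lt (V 66) (V 23)) ((Asg 60 (N 0) ;; SUFFIXES) ;; Asg 66 (Plus (V 66) (N 4)))) s h n
    (\<lambda>s' h'. h' = h \<and> s' 59 = zlen (wd h (s 65)) \<and> agree {16, 17, 18, 19, 20, 59, 60, 66} s s')"
proof -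
  let ?S = "wd h (s 65)" let ?W = "{16, 17, 18, 19, 20, 59, 60, 66} :: nat set"
  have SR: "?S \<in> RW" using b x by (auto simp: bij_betw_def)
  define J where "J = (\<lambda>j (s' :: mem) h'. h' = h \<and> agree ?W s s' \<and> s' 59 \<le> zlen ?S \<and>
    (\<forall>y\<in>recs t j. \<forall>e\<le>length (wd h y). ?S \<noteq> wd h y \<or> e \<noteq> length ?S \<longrightarrow>
      (\<forall>c. common_suffix c ?S (take e (wd h y)) \<longrightarrow> c \<le> s' 59)))"
  have "run (Loop (Lt (V 66) (V 23)) ((Asg 60 (N 0) ;; SUFFIXES) ;; Asg 66 (Plus (V 66) (N 4)))) s h n (\<lambda>s' h'. J k s' h')"
  proof (rule run_each[where J = J and c = "\<lambda>y. Suc (length (wd h y)) * Suc (length ?S)" and t = t], goal_cases)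
    case (5 j s1 h1)
    then have h1: "h1 = h" and ag: "agree ?W s s1" and i: "s1 59 \<le> zlen ?S" unfolding J_def by auto
    have f: "s1 65 = s 65" using agreeD[OF ag, of 65] by simp
    have yr: "t + 4 * j \<in> recs t k" using 5(1) by (auto simp: recs_def)
    let ?s = "s1(60 := 0)"
    have R: "run SUFFIXES ?s h (Suc (length (wd h (t + 4 * j))) * Suc (length ?S)) (\<lambda>s' h'. h' = h \<and> ?s 59 \<le> s' 59 \<and> s' 59 \<le> zlen (wd h (?s 65)) \<and>
      (\<forall>e\<le>length (wd h (?s 66)). wd h (?s 65) \<noteq> wd h (?s 66) \<or> e \<noteq> length (wd h (?s 65)) \<longrightarrow>
        (\<forall>c. common_suffix c (wd h (?s 65)) (take e (wd h (?s 66))) \<longrightarrow> c \<le> s' 59)) \<and>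
      agree {16, 17, 18, 19, 20, 59, 60} ?s s')"
      by (rule run_SUFFIXES[OF b]) (use f i x yr 5(3) in simp_all)
    have "run SUFFIXES ?s h (Suc (length (wd h (t + 4 * j))) * Suc (length ?S)) (\<lambda>s'' h''. s'' 66 = t + 4 * j \<and> s'' 23 = t + 4 * k \<and>
      J (Suc j) (s''(66 := t + 4 * Suc j)) h'')"
    proof (rule run_mono[OF R order_refl], goal_cases)
      case (1 s2 h2)
      then have ag2: "agree {16, 17, 18, 19, 20, 59, 60} ?s s2" by simp
      have "agree ?W s s2" by (rule agree_via[OF ag2]) (use ag in simp_all)
      moreover have "s2 66 = t + 4 * j" "s2 23 = t + 4 * k"
        using agreeD[OF ag2, of 66] agreeD[OF ag2, of 23] 5(3,4) by simp_all
      moreover have "s1 59 \<le> s2 59" using 1 by simp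
      ultimately show ?case using 1 5(2,3) f unfolding J_def recs_Suc
        by (simp add: h1) (meson le_trans)
    qed
    then show ?case unfolding h1 by simp
  next
    case 6
    have "(\<Sum>y\<in>recs t k. 1 + Suc (length (wd h y)) * Suc (length ?S)) \<le>
      (\<Sum>y\<in>recs t k. Suc (length (wd h y)) * (2 * Suc (length ?S)))"
      by (rule sum_mono) (simp add: algebra_simps)
    also have "\<dots> = (\<Sum>y\<in>recs t k. Suc (length (wd h y))) * (2 * Suc (length ?S))"
      by (simp add: sum_distrib_right)
    finally show ?case using n by simp
  qed (use T s in \<open>auto simp: J_def recs_def\<close>)
  then show ?thesis
  proof (rule run_mono[OF _ order_refl], goal_cases)
    case (1 s' h')
    then have j: "h' = h" "agree ?W s s'" "s' 59 \<le> zlen ?S" unfolding J_def by auto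
    have "zlen ?S \<le> s' 59"
    proof (cases "zlen ?S = 0")
      case False
      then obtain S' e where e: "S' \<in> RW" "e \<le> length S'" "?S \<noteq> S' \<or> e \<noteq> length ?S" "common_suffix (zlen ?S) ?S (take e S')"
        using zlen_attained[OF SR] by blast
      then obtain y where "y \<in> recs t k" "S' = wd h y" using b unfolding bij_betw_def by blast
      then show ?thesis using 1 e unfolding J_def by blast
    qed simp
    then show ?case using j by simp
  qed
qed

lemma run_LENGTHS:
  assumes b: "bij_betw (wd h) (recs t k) RW" and T: "s 22 = t" "s 23 = t + 4 * k"
    and low: "\<forall>x\<in>recs t k. h x + h (x + 1) \<le> t" and n: "L + 2 * (L * L) \<le> n"
  shows "run LENGTHS s h n (\<lambda>s' h'. (\<forall>x\<in>recs t k. h' (x + 2) = bl (wd h x)) \<and>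
    (\<forall>a. (\<forall>x\<in>recs t k. a \<noteq> x + 2) \<longrightarrow> h' a = h a) \<and> agree {16, 17, 18, 19, 20, 59, 60, 65, 66} s s')"
proof -
  let ?W = "{16, 17, 18, 19, 20, 59, 60, 65, 66} :: nat set"
  have sumL: "(\<Sum>x\<in>recs t k. Suc (length (wd h x))) = L"
    unfolding L_def using sum.reindex_bij_betw[OF b, of "\<lambda>w. Suc (length w)"] .
  define J where "J = (\<lambda>j (s' :: mem) h'. agree ?W s s' \<and> (\<forall>x\<in>recs t j. h' (x + 2) = bl (wd h x)) \<and>
    (\<forall>a. (\<forall>x\<in>recs t j. a \<noteq> x + 2) \<longrightarrow> h' a = h a))"
  have "run (Loop (Lt (V 65) (V 23))
    ((Asg 59 (N 0) ;; Asg 66 (V 22) ;;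
      Loop (Lt (V 66) (V 23)) ((Asg 60 (N 0) ;; SUFFIXES) ;; Asg 66 (Plus (V 66) (N 4))) ;;
      Put (Plus (V 65) (N 2)) (Minus (H (Plus (V 65) (N 1))) (V 59))) ;;
     Asg 65 (Plus (V 65) (N 4)))) (s(65 := t)) h n (\<lambda>s' h'. J k s' h')"
  proof (rule run_each[where J = J and c = "\<lambda>x. L * (2 * Suc (length (wd h x)))" and t = t], goal_cases)
    case (5 j s1 h1)
    have ag: "agree ?W s s1" and jr: "\<forall>x\<in>recs t j. h1 (x + 2) = bl (wd h x)"
      and same: "\<And>a. (\<And>x. x \<in> recs t j \<Longrightarrow> a \<noteq> x + 2) \<Longrightarrow> h1 a = h a" using 5(2) unfolding J_def by auto
    let ?x = "t + 4 * j"
    have xr: "?x \<in> recs t k" using 5(1) by (auto simp: recs_def)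
    have sub: "x \<in> recs t j \<Longrightarrow> x \<in> recs t k" for x using 5(1) by (auto simp: recs_def)
    have wd1: "wd h1 y = wd h y" if y: "y \<in> recs t k" for y
    proof (rule wd_cong)
      have "y \<noteq> x + 2" "y + 1 \<noteq> x + 2" if "x \<in> recs t j" for x
        using recs_disjoint[OF y sub[OF that], of 0 2] recs_disjoint[OF y sub[OF that], of 1 2] by auto
      then show "h1 y = h y" "h1 (y + 1) = h (y + 1)" by (auto intro!: same)
      fix a assume "a < h y + h (y + 1)"
      then have "a < t" using low y by fastforce
      then show "h1 a = h a" by (intro same) (use recs_bounds in fastforce)
    qed
    have b1: "bij_betw (wd h1) (recs t k) RW" using b wd1 bij_betw_cong[of "recs t k" "wd h1" "wd h"] by blast
    have f22: "s1 22 = t" using agreeD[OF ag, of 22] T by simp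
    let ?s = "s1(59 := 0, 66 := t)"
    have sum1: "(\<Sum>y\<in>recs t k. Suc (length (wd h1 y))) = L" using wd1 sumL by simp
    have R: "run (Loop (Lt (V 66) (V 23)) ((Asg 60 (N 0) ;; SUFFIXES) ;; Asg 66 (Plus (V 66) (N 4)))) ?s h1
      (L * (2 * Suc (length (wd h ?x)))) (\<lambda>s' h'. h' = h1 \<and> s' 59 = zlen (wd h1 (?s 65)) \<and> agree {16, 17, 18, 19, 20, 59, 60, 66} ?s s')"
      by (rule run_SUFFIX_LOOP[OF b1]) (use f22 5(3,4) xr wd1 sum1 in simp_all)
    show ?case
    proof (simp only: exec_simps f22, rule run_Seq'[OF R, where ?n2.0 = 0], goal_cases)
      case (1 s2 h2)
      then have h2: "h2 = h1" and ag2: "agree {16, 17, 18, 19, 20, 59, 60, 66} ?s s2" and s59: "s2 59 = zlen (wd h ?x)"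
        using wd1[OF xr] 5(3) by auto
      have f2: "s2 65 = ?x" "s2 23 = t + 4 * k" using agreeD[OF ag2, of 65] agreeD[OF ag2, of 23] 5(3,4) by simp_all
      have "agree ?W s s2" by (rule agree_via[OF ag2]) (use ag in simp_all)
      moreover have "h1 (?x + 1) - zlen (wd h ?x) = bl (wd h ?x)"
        using wd1[OF xr] length_wd[of h1 ?x] by (simp add: bl_def)
      moreover have "\<forall>x\<in>recs t j. ?x + 2 \<noteq> x + 2" by (auto simp: recs_def)
      ultimately show ?case using jr same s59 unfolding h2 J_def recs_Suc by (auto simp: f2)
    qed simp
  next
    case 6
    have "(\<Sum>x\<in>recs t k. 1 + L * (2 * Suc (length (wd h x)))) \<le> (\<Sum>x\<in>recs t k. Suc (length (wd h x)) * Suc (2 * L))"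
      by (rule sum_mono) (simp add: algebra_simps)
    also have "\<dots> = L * Suc (2 * L)" unfolding sum_distrib_right[symmetric] sumL ..
    finally show ?case using n by (simp add: algebra_simps)
  qed (use T in \<open>auto simp: J_def recs_def\<close>)
  then have "run LENGTHS s h n (\<lambda>s' h'. J k s' h')" using T by (simp add: LENGTHS_def)
  then show ?thesis by (rule run_mono) (auto simp: J_def)
qed

end

text \<open>
  The table of records starts behind the input, at 22, with room for two records per relation; the trie
  follows at 50. Letters are unbounded, so the stride of the trie is obtained from their sum, kept in 48;
  this costs no time as the memory is initially zero.
\<close>

definition DECIDE :: com where
  "DECIDE = Asg 26 (N 4) ;; Asg 27 (H (N 2)) ;; Asg 30 (Plus (N 4) (H (N 2))) ;; Asg 31 (H (N 3)) ;; Asg 34 (N 1) ;;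
    Asg 51 (Plus (V 30) (V 31)) ;; Asg 45 (V 51) ;; Asg 46 (Plus (H (N 1)) (H (N 1))) ;; Asg 48 (N 1) ;; SIZE ;;
    Asg 22 (Plus (Plus (V 45) (H (N 0))) (N 1)) ;; Asg 23 (V 22) ;;
    Asg 46 (Plus (H (N 1)) (H (N 1))) ;; Asg 46 (Plus (V 46) (V 46)) ;; Asg 46 (Plus (V 46) (V 46)) ;;
    Asg 50 (Plus (V 22) (V 46)) ;; Asg 49 (Plus (V 50) (Plus (V 48) (N 1))) ;;
    Asg 45 (V 51) ;; Asg 46 (H (N 1)) ;; GATHER ;; LENGTHS ;; Loop (V 34) BODY"

lemma encode_input_eq:
  "encode_input gs rs u v = [length gs, length rs, length u, length v] @ u @ v @ encs (both_sides rs) @ gs"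
proof -
  have "concat (map (\<lambda>(r, s). encode_word r @ encode_word s) rs) = encs (both_sides rs)"
    by (induction rs) (auto simp: encode_word_def)
  then show ?thesis by (simp add: encode_input_def)
qed

lemma length_both_sides: "length (both_sides rs) = length rs + length rs"
  by (induction rs) auto

lemma length_encs: "length (encs (both_sides rs)) = (\<Sum>x\<leftarrow>rs. Suc (length (fst x)) + Suc (length (snd x)))"
  by (induction rs) auto

lemma trie_singleton: "(\<And>a. A \<le> a \<Longrightarrow> h a = 0) \<Longrightarrow> trie h A S 1 (\<lambda>_. [])"
  by (auto simp: trie_def inj_on_def)

context word_problem begin

lemma card_RW_le_L: "card RW \<le> L"
  unfolding card_eq_sum L_def by (rule sum_mono) simp

text \<open>Relation words are nonempty, so the extra unit per word at most doubles the
  size.\<close>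

lemma L_le: "L \<le> 2 * relation_size R"
  unfolding L_def relation_size_def sum_distrib_left
proof (rule sum_mono)
  fix w assume "w \<in> RW"
  then have "w \<noteq> []" using Nil_notin_RW by blast
  then show "Suc (length w) \<le> 2 * length w" by (cases w) auto
qed

text \<open>The relations form a set of pairs of relation words. Summing over all pairs counts each
  word once for every partner and side, and there are at most L partners.\<close>

lemma encs_le:
  assumes "distinct rs" "set rs = R"
  shows "length (encs (both_sides rs)) \<le> 2 * (L * L)"
proof -
  let ?f = "\<lambda>w :: nat list. Suc (length w)"
  have pairs: "(\<Sum>r\<in>X. \<Sum>s\<in>X. f r + f s) = 2 * (card X * sum f X)" for f :: "nat list \<Rightarrow> nat" and X
    by (simp add: sum.distrib sum_distrib_left[symmetric] mult_2)
  have "length (encs (both_sides rs)) = (\<Sum>x\<in>R. ?f (fst x) + ?f (snd x))"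
    unfolding length_encs sum_list_distinct_conv_sum_set[OF assms(1)] assms(2) ..
  also have "\<dots> \<le> (\<Sum>x\<in>RW \<times> RW. ?f (fst x) + ?f (snd x))"
    by (rule sum_mono2) (use finite_RW in \<open>force simp: relation_words_def\<close>)+
  also have "\<dots> = (\<Sum>r\<in>RW. \<Sum>s\<in>RW. ?f r + ?f s)"
    by (simp add: sum.cartesian_product split_beta)
  also have "\<dots> = 2 * (card RW * L)"
    unfolding L_def by (rule pairs)
  also have "\<dots> \<le> 2 * (L * L)" using card_RW_le_L by simp
  finally show ?thesis .
qed

text \<open>The preprocessing terms are 2 L^2 for \<open>SIZE\<close>, 3 L^2 for
  \<open>GATHER\<close> and 2 L^2 + L for \<open>LENGTHS\<close>; the last summand is the potential
  at the start of the main loop, where nothing is prepended yet.\<close>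

lemma run_DECIDE:
  assumes rs: "distinct rs" "set rs = R"
    and n: "6 * (L * L) + L * L + L + 20 * ((L + 2) * (L + 2)) * Suc (2 * min (length u) (length v)) \<le> n"
    and xs: "xs = encode_input gs rs u v"
  shows "run DECIDE (\<lambda>_. 0) (\<lambda>a. if a < length xs then xs ! a else 0) n (\<lambda>s' h'. s' 0 = of_bool (eqv u v))"
proof -
  define h where "h = (\<lambda>a. if a < length xs then xs ! a else 0)"
  define w where "w = encs (both_sides rs)"
  define p where "p = 4 + length u + length v"
  define t where "t = p + length w + length gs + 1"
  define A where "A = t + 8 * length rs"
  define S where "S = 2 + sum_list (concat (both_sides rs))"
  define E where "E = 20 * ((L + 2) * (L + 2))"
  have w_le: "length w \<le> 2 * (L * L)" unfolding w_def by (rule encs_le[OF rs])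
  have len: "length xs < t" by (simp add: xs encode_input_eq t_def p_def w_def)
  have "holds h 0 xs" by (simp add: holds_def h_def)
  then have hd: "h 0 = length gs" "h 1 = length rs" "h 2 = length u" "h 3 = length v"
    and hu: "holds h 4 u" and hv: "holds h (4 + length u) v" and hw: "holds h p w"
    unfolding xs encode_input_eq by (simp_all add: p_def w_def add.assoc)
  have RWe: "RW = fst ` set rs \<union> snd ` set rs" by (simp add: relation_words_def rs)
  let ?s1 = "(\<lambda>_ :: nat. 0 :: nat)(26 := 4, 27 := length u, 30 := 4 + length u, 31 := length v, 34 := 1, 51 := p, 45 := p,
    46 := length rs + length rs, 48 := 1)"
  have SZ: "run SIZE ?s1 h (2 * (L * L)) (\<lambda>s' h'. h' = h \<and> s' 45 = ?s1 45 + length w \<and>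
      s' 48 = ?s1 48 + sum_list (concat (both_sides rs)) \<and> agree {45, 46, 47, 48} ?s1 s')"
    unfolding w_def by (rule run_SIZE) (use hw w_le in \<open>simp_all add: w_def length_both_sides\<close>)
  have start: "run DECIDE (\<lambda>_. 0) h n Q \<longleftrightarrow> run (SIZE ;;
    Asg 22 (Plus (Plus (V 45) (H (N 0))) (N 1)) ;; Asg 23 (V 22) ;;
    Asg 46 (Plus (H (N 1)) (H (N 1))) ;; Asg 46 (Plus (V 46) (V 46)) ;; Asg 46 (Plus (V 46) (V 46)) ;;
    Asg 50 (Plus (V 22) (V 46)) ;; Asg 49 (Plus (V 50) (Plus (V 48) (N 1))) ;;
    Asg 45 (V 51) ;; Asg 46 (H (N 1)) ;; GATHER ;; LENGTHS ;; Loop (V 34) BODY) ?s1 h n Q" for Q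
    unfolding DECIDE_def by (simp only: exec_simps hd p_def)
  show ?thesis
    unfolding h_def[symmetric] start
  proof (rule run_Seq'[OF SZ, where ?n2.0 = "n - 2 * (L * L)"], goal_cases)
    case (1 s2 h2)
    then have h2: "h2 = h" and s2: "s2 45 = p + length w" "s2 48 = S - 1" and ag2: "agree {45, 46, 47, 48} ?s1 s2"
      by (auto simp: S_def)
    let ?s = "s2(22 := t, 23 := t, 46 := 8 * length rs, 50 := A, 49 := A + S, 45 := p, 46 := length rs)"
    have D: "dict h ?s t A S 1 (\<lambda>_. []) 0"
      unfolding dict_def using s2 len
      by (auto simp: t_def A_def S_def recs_def h_def intro!: trie_singleton)
    have G: "run GATHER ?s h (3 * (L * L)) (\<lambda>s' h'. (\<forall>a<t. h' a = h a) \<and>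
      (\<exists>k. s' 22 = t \<and> s' 23 = t + 4 * k \<and> inj_on (wd h') (recs t k) \<and> wd h' ` recs t k = fst ` set rs \<union> snd ` set rs \<and>
        labels_ok h' t k (set rs) \<and> (\<forall>x\<in>recs t k. h' x + h' (x + 1) \<le> t)) \<and>
      agree {23, 45, 46, 47, 49, 52, 53, 54, 55, 56, 57, 58, 65} ?s s')"
    proof (rule run_GATHER[OF D _ _ _ _ _ HOL.refl])
      show "holds h (?s 45) (encs (both_sides rs))" using hw by (simp add: w_def)
      show "?s 45 + length (encs (both_sides rs)) \<le> t" by (simp add: t_def w_def)
      show "Suc c < S" if "c \<in> set (concat (both_sides rs))" for c
        using member_le_sum_list[OF that] by (simp add: S_def)
      have "card RW * card RW \<le> L * L" using card_RW_le_L by (rule mult_le_mono) (rule card_RW_le_L)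
      then show "length (encs (both_sides rs)) + card (fst ` set rs \<union> snd ` set rs) * card (fst ` set rs \<union> snd ` set rs) \<le> 3 * (L * L)"
        using w_le unfolding RWe w_def by linarith
    qed (simp_all add: A_def)
    have mid: "run (Asg 22 (Plus (Plus (V 45) (H (N 0))) (N 1)) ;; Asg 23 (V 22) ;;
      Asg 46 (Plus (H (N 1)) (H (N 1))) ;; Asg 46 (Plus (V 46) (V 46)) ;; Asg 46 (Plus (V 46) (V 46)) ;;
      Asg 50 (Plus (V 22) (V 46)) ;; Asg 49 (Plus (V 50) (Plus (V 48) (N 1))) ;;
      Asg 45 (V 51) ;; Asg 46 (H (N 1)) ;; GATHER ;; LENGTHS ;; Loop (V 34) BODY) s2 h m Q \<longleftrightarrow>
      run (GATHER ;; LENGTHS ;; Loop (V 34) BODY) ?s h m Q" for m Q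
    proof -
      have "s2 51 = p" using agreeD[OF ag2, of 51] by simp
      moreover have "p + length w + length gs + 1 = t" by (simp add: t_def)
      moreover have "t + (length rs + length rs + (length rs + length rs) + (length rs + length rs + (length rs + length rs))) = A"
        by (simp add: A_def)
      moreover have "S - 1 + 1 = S" by (simp add: S_def)
      moreover have "length rs + length rs + (length rs + length rs) + (length rs + length rs + (length rs + length rs)) = 8 * length rs" by simp
      ultimately show ?thesis by (simp only: exec_simps hd s2 fun_upd_upd)
    qed
    show ?case
      unfolding h2 mid
    proof (rule run_Seq'[OF G, where ?n2.0 = "n - 5 * (L * L)"], goal_cases)
      case (1 s3 h3)
      then obtain k where low: "\<forall>a<t. h3 a = h a" and k: "s3 22 = t" "s3 23 = t + 4 * k" "inj_on (wd h3) (recs t k)"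
        "wd h3 ` recs t k = RW" "labels_ok h3 t k R" "\<forall>x\<in>recs t k. h3 x + h3 (x + 1) \<le> t"
        and ag3: "agree {23, 45, 46, 47, 49, 52, 53, 54, 55, 56, 57, 58, 65} ?s s3"
        unfolding RWe unfolding rs(2)[symmetric] by blast
      have b3: "bij_betw (wd h3) (recs t k) RW" using k(3,4) by (simp add: bij_betw_def)
      have LE: "run LENGTHS s3 h3 (L + 2 * (L * L)) (\<lambda>s' h'. (\<forall>x\<in>recs t k. h' (x + 2) = bl (wd h3 x)) \<and>
        (\<forall>a. (\<forall>x\<in>recs t k. a \<noteq> x + 2) \<longrightarrow> h' a = h3 a) \<and> agree {16, 17, 18, 19, 20, 59, 60, 65, 66} s3 s')"
        by (rule run_LENGTHS[OF b3 k(1,2,6) order_refl])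
      show ?case
      proof (rule run_Seq'[OF LE, where ?n2.0 = "E * Suc (2 * min (length u) (length v))"], goal_cases)
        case (1 s4 h4)
        then have bl4: "\<forall>x\<in>recs t k. h4 (x + 2) = bl (wd h3 x)" and same: "\<And>a. (\<And>x. x \<in> recs t k \<Longrightarrow> a \<noteq> x + 2) \<Longrightarrow> h4 a = h3 a"
          and ag4: "agree {16, 17, 18, 19, 20, 59, 60, 65, 66} s3 s4" by blast+
        have below: "h4 a = h3 a" if "a < t" for a
          by (rule same) (use that recs_bounds in fastforce)
        have wd4: "wd h4 y = wd h3 y" and h4_3: "h4 (y + 3) = h3 (y + 3)" if y: "y \<in> recs t k" for y
        proof -
          have d: "y \<noteq> x + 2" "y + 1 \<noteq> x + 2" "y + 3 \<noteq> x + 2" if "x \<in> recs t k" for x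
            using recs_disjoint[OF y that, of 0 2] recs_disjoint[OF y that, of 1 2] recs_disjoint[OF y that, of 3 2] by auto
          show "h4 (y + 3) = h3 (y + 3)" using d(3) by (rule same)
          show "wd h4 y = wd h3 y"
          proof (rule wd_cong)
            show "h4 y = h3 y" "h4 (y + 1) = h3 (y + 1)" using d(1,2) by (auto intro: same)
            fix a assume "a < h3 y + h3 (y + 1)"
            then show "h4 a = h3 a" using k(6) y below by fastforce
          qed
        qed
        have reg: "s4 z = ?s1 z" if "z \<notin> {16, 17, 18, 19, 20, 22, 23, 45, 46, 47, 48, 49, 50, 52, 53, 54, 55, 56, 57, 58, 59, 60, 65, 66}" for z
          using that agreeD[OF ag4, of z] agreeD[OF ag3, of z] agreeD[OF ag2, of z] by simp
        have T: "table h4 t k" unfolding table_def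
        proof (intro conjI ballI)
          show "0 < t" by (simp add: t_def)
          show "bij_betw (wd h4) (recs t k) RW" using b3 wd4 bij_betw_cong[of "recs t k" "wd h4" "wd h3"] by blast
          show "h4 (x + 2) = bl (wd h4 x)" if "x \<in> recs t k" for x using bl4 wd4 that by simp
          show "h4 (x + 3) = h4 (y + 3) \<longleftrightarrow> cls (wd h4 x) (wd h4 y)" if "x \<in> recs t k" "y \<in> recs t k" for x y
            using k(5) wd4[OF that(1)] wd4[OF that(2)] h4_3[OF that(1)] h4_3[OF that(2)] that
            unfolding labels_ok_def closure_def rel_def[abs_def] by simp
        qed
        have "holds h4 4 u \<and> holds h4 (4 + length u) v"
          using hu hv below low by (auto simp: holds_def t_def p_def)
        then have uv: "seg h4 4 (length u) = u" "seg h4 (4 + length u) (length v) = v"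
          by (auto simp: holds_seg)
        have r: "s4 22 = t" "s4 23 = t + 4 * k" using k(1,2) agreeD[OF ag4, of 22] agreeD[OF ag4, of 23] by simp_all
        have G: "good h4 t k (eqv u v) s4"
          unfolding good_def using uv by (simp add: r reg WP_no_prefix piece_def AU_def AV_def UU_def VV_def PW_def)
        have P: "pot s4 = E + min (2 * E * length u) (2 * E * length v)"
          by (simp add: pot_def Let_def E_def reg)
        show ?case
          by (rule run_main_loop[OF T G]) (simp add: P min_def)
      qed (use n in \<open>simp add: E_def\<close>)
    qed (use n in simp)
  qed (use n in simp)
qed

end

text \<open>With l at most 2 k the quadratic preprocessing gives 28, the linear term 2, the
  additional tick 1 and the main loop 320 times 3; the sum 991 is rounded to 1000.\<close>

lemma ticks_le:
  fixes k l m :: nat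
  assumes "l \<le> 2 * k" "1 \<le> k" "1 \<le> m"
  shows "6 * (l * l) + l * l + l + 20 * ((l + 2) * (l + 2)) * Suc (2 * m) + 1 \<le> 1000 * (k\<^sup>2 * m)"
proof -
  have k: "k \<le> k\<^sup>2" using assms by (simp add: power2_eq_square)
  have m: "k\<^sup>2 \<le> k\<^sup>2 * m" using assms(3) by simp
  have "l * l \<le> (2 * k) * (2 * k)" by (rule mult_le_mono) (rule assms(1))+
  then have a: "l * l \<le> 4 * k\<^sup>2" by (simp add: power2_eq_square)
  have "(l + 2) * (l + 2) \<le> (4 * k) * (4 * k)" by (rule mult_le_mono) (use assms in simp_all)
  then have "20 * ((l + 2) * (l + 2)) \<le> 320 * k\<^sup>2" by (simp add: power2_eq_square)
  moreover have "Suc (2 * m) \<le> 3 * m" using assms(3) by simp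
  ultimately have "20 * ((l + 2) * (l + 2)) * Suc (2 * m) \<le> 320 * k\<^sup>2 * (3 * m)" by (rule mult_le_mono)
  also have "\<dots> = 960 * (k\<^sup>2 * m)" by (simp only: mult.assoc mult.left_commute)
  finally show ?thesis using a k m assms(1,2) by linarith
qed

theorem theorem2:
  "\<exists>(M :: ram) (c :: nat).
     \<forall>(A :: nat set) (R :: (nat list \<times> nat list) set) (u :: nat list) (v :: nat list)
       (gs :: nat list) (rs :: (nat list \<times> nat list) list).
       finite_presentation A R \<and> weakly_C 4 R \<and> u \<in> lists A \<and> v \<in> lists A \<and>
       distinct gs \<and> set gs = A \<and> distinct rs \<and> set rs = R \<longrightarrow>
       (\<exists>t b. ram_outputs_within M (encode_input gs rs u v) t (of_bool b) \<and>
          (b \<longleftrightarrow> monoid_element A R u = monoid_element A R v) \<and>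
          (u \<noteq> [] \<and> v \<noteq> [] \<longrightarrow>
             (b \<longleftrightarrow> semigroup_element A R u = semigroup_element A R v)) \<and>
          (relation_size R \<ge> 1 \<and> length u \<ge> 1 \<and> length v \<ge> 1 \<longrightarrow>
             t \<le> c * ((relation_size R)\<^sup>2 * min (length u) (length v))))"
proof (rule exI[of _ "machine DECIDE"], rule exI[of _ "code_length DECIDE * 1000"], intro allI impI, elim conjE)
  fix A :: "nat set" and R :: "(nat list \<times> nat list) set" and u v gs :: "nat list" and rs :: "(nat list \<times> nat list) list"
  assume fp: "finite_presentation A R" and C: "weakly_C 4 R" and uv: "u \<in> lists A" "v \<in> lists A"
    and rs: "distinct rs" "set rs = R"
  interpret word_problem R
    by unfold_locales (use fp C in \<open>auto simp: finite_presentation_def\<close>)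
  have RA: "R \<subseteq> lists A \<times> lists A" using fp by (simp add: finite_presentation_def)
  define xs where "xs = encode_input gs rs u v"
  define n where "n = 6 * (L * L) + L * L + L + 20 * ((L + 2) * (L + 2)) * Suc (2 * min (length u) (length v))"
  have "run DECIDE (\<lambda>_. 0) (\<lambda>a. if a < length xs then xs ! a else 0) n (\<lambda>s' h'. s' 0 = of_bool (eqv u v))"
    by (rule run_DECIDE[OF rs _ xs_def]) (simp add: n_def)
  then obtain s' h' j where bs: "bs DECIDE (\<lambda>_. 0) (\<lambda>a. if a < length xs then xs ! a else 0) j s' h'"
    and j: "j \<le> n" and out: "s' 0 = of_bool (eqv u v)" unfolding run_def by blast
  obtain t where t: "t \<le> code_length DECIDE * Suc j" "ram_outputs_within (machine DECIDE) xs t (of_bool (eqv u v))"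
    using machine_correct[OF bs] out by auto
  have "t \<le> code_length DECIDE * 1000 * ((relation_size R)\<^sup>2 * min (length u) (length v))"
    if "relation_size R \<ge> 1 \<and> length u \<ge> 1 \<and> length v \<ge> 1"
  proof -
    have "Suc j \<le> 1000 * ((relation_size R)\<^sup>2 * min (length u) (length v))"
      using ticks_le[OF L_le, of "min (length u) (length v)"] that j unfolding n_def by linarith
    then have "code_length DECIDE * Suc j \<le> code_length DECIDE * (1000 * ((relation_size R)\<^sup>2 * min (length u) (length v)))"
      by (rule mult_le_mono2)
    then show ?thesis using t(1) by (simp only: mult.assoc)
  qed
  moreover have "eqv u v \<longleftrightarrow> monoid_element A R u = monoid_element A R v"
    unfolding monoid_element_def using class_eq_iff_eqv[OF uv _ RA Nil_notin_RW] by simp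
  moreover have "eqv u v \<longleftrightarrow> semigroup_element A R u = semigroup_element A R v" if "u \<noteq> [] \<and> v \<noteq> []"
    unfolding semigroup_element_def using class_eq_iff_eqv[of u "lists A - {[]}" v A, OF _ _ _ RA Nil_notin_RW] uv that by simp
  ultimately show "\<exists>t b. ram_outputs_within (machine DECIDE) (encode_input gs rs u v) t (of_bool b) \<and>
      (b \<longleftrightarrow> monoid_element A R u = monoid_element A R v) \<and>
      (u \<noteq> [] \<and> v \<noteq> [] \<longrightarrow> (b \<longleftrightarrow> semigroup_element A R u = semigroup_element A R v)) \<and>
      (relation_size R \<ge> 1 \<and> length u \<ge> 1 \<and> length v \<ge> 1 \<longrightarrow>
        t \<le> code_length DECIDE * 1000 * ((relation_size R)\<^sup>2 * min (length u) (length v)))"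
    using t(2) unfolding xs_def by blast
qed

end
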